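(* Let $S$ be a Fuchsian triangle group of signature $(2,5,\infty)$ or $(5,\infty,\infty)$, and let $\Gamma=S^*<\mathrm{PSL}(2,\mathbb{R})^2$ be its modular embedding (the first factor being $S$ itself and the second factor its Galois conjugate). Then the limit cone of $\Gamma$ is $$C_\Gamma=\{(x_1:x_2)\in\mathbb{RP}^1\mid x_1\ge x_2\ge 0,\ x_1>0\},$$ and consequently the limit set $\mathcal{L}_\Gamma$ is "half" of the geometric boundary of $(\mathbb{H}^2)^2$: it consists exactly of the classes of unit speed geodesic rays $\gamma=(\gamma_1,\gamma_2)$ in $(\mathbb{H}^2)^2$ with $\|\gamma_1'\|\ge\|\gamma_2'\|$.
   Context: $\mathrm{PSL}(2,\mathbb{R})^2$ acts componentwise on $(\mathbb{H}^2)^2$. The geometric boundary $\partial((\mathbb{H}^2)^2)$ is the set of classes of asymptotic unit speed geodesic rays, with the cone topology. The speeds $\|\gamma_1'\|,\|\gamma_2'\|$ of the components of a ray $\gamma=(\gamma_1,\gamma_2)$ are constant, possibly $0$, and depend only on its class. The limit set is $\mathcal{L}_\Gamma=\overline{\Gamma(x)}\cap\partial((\mathbb{H}^2)^2)$ (independent of $x\in(\mathbb{H}^2)^2$). The translation length $\ell(g)$ of a hyperbolic $g\in\mathrm{PSL}(2,\mathbb{R})$ is the distance it translates along its axis; $\ell(g)=0$ if $g$ is elliptic, parabolic or the identity. The translation direction of $g=(g_1,g_2)$ is $L(g)=(\ell(g_1):\ell(g_2))\in\mathbb{RP}^1$ whenever some $\ell(g_i)\ne0$. An element is hyperbolic if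 both components are hyperbolic; it is mixed if its components are of different types. The limit cone $C_\Gamma$ is the closure in $\mathbb{RP}^1$ of the set of translation directions of the hyperbolic and mixed elements of $\Gamma$. The group $S^*$. A group $S$ of either signature has trace field $K=\mathbb{Q}(\sqrt5)$ and algebraic integer traces. It is contained in $\phi_1(\mathcal{O}^1)$, where $\mathcal{O}$ is an order in a quaternion algebra $A$ over $K$ (isomorphic to $M(2,K)$), $\mathcal{O}^1$ is its group of units of reduced norm 1, and $\phi_1:A\to M(2,\mathbb{R})$ extends the identity embedding of $K$. Let $\phi_2:A\to M(2,\mathbb{R})$ be an embedding extending the nontrivial Galois automorphism of $K$. Then $S^*=\{(\phi_1(\varepsilon),\phi_2(\varepsilon))\mid\phi_1(\varepsilon)\in S\}$, considered in $\mathrm{PSL}(2,\mathbb{R})^2$. It is a modular embedding, meaning that there is a holomorphic embedding $F:\mathbb{H}^2\to(\mathbb{H}^2)^2$ with $F(Tz)=T^*F(z)$ for all $T\in S$, $z\in\mathbb{H}^2$, where $T^*$ denotes the element of $S^*$ with first component $T$. *)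

theory Defs
  imports
    "HOL-Analysis.Analysis"
    "HOL-Algebra.Generated_Groups"
    "HOL-Library.Extended_Nat"
    "HOL-Computational_Algebra.Polynomial"
begin

section \<open>The group PSL(2,R) and its action on the hyperbolic plane\<close>

definition SL2R :: "(real^2^2) monoid" where
  "SL2R = \<lparr>carrier = {A. det A = 1}, mult = (**), one = mat 1\<rparr>"

definition PSL2R :: "(real^2^2) set monoid" where
  "PSL2R = SL2R Mod {mat 1, - mat 1}"

definition psl :: "real^2^2 \<Rightarrow> (real^2^2) set" where
  "psl A = {mat 1, - mat 1} #>\<^bsub>SL2R\<^esub> A"

lemma psl_eq: "psl A = {A, - A}"
proof -
  have "(- mat 1 :: real^2^2) ** A = - A"
    by (simp add: vec_eq_iff matrix_matrix_mult_def mat_def UNIV_2 forall_2)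
  then show ?thesis
    by (auto simp: psl_def r_coset_def SL2R_def)
qed

lemma group_SL2R: "group SL2R"
proof (rule groupI)
  fix A assume A: "A \<in> carrier SL2R"
  then have "invertible A"
    by (simp add: SL2R_def invertible_det_nz)
  then obtain B where eq: "B ** A = mat 1"
    by (auto simp: invertible_def)
  then have "det B * det A = 1"
    by (metis det_I det_mul)
  with A have "det B = 1"
    by (simp add: SL2R_def)
  with eq show "\<exists>B\<in>carrier SL2R. B \<otimes>\<^bsub>SL2R\<^esub> A = \<one>\<^bsub>SL2R\<^esub>"
    by (auto simp: SL2R_def)
qed (auto simp: SL2R_def det_mul det_I matrix_mul_assoc)

lemma normal_pm_one: "{mat 1, - mat 1} \<lhd> SL2R"
proof -
  interpret group SL2R by (rule group_SL2R)
  have mult_left: "(- mat 1 :: real^2^2) ** A = - A" for A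
    by (simp add: vec_eq_iff matrix_matrix_mult_def mat_def UNIV_2 forall_2)
  have mult_right: "A ** (- mat 1 :: real^2^2) = - A" for A
    by (simp add: vec_eq_iff matrix_matrix_mult_def mat_def UNIV_2 forall_2)
  have det: "det (- mat 1 :: real^2^2) = 1"
    by (simp add: det_2 mat_def)
  have inv: "inv\<^bsub>SL2R\<^esub> (- mat 1) = - mat 1"
    by (rule inv_equality) (auto simp: SL2R_def mult_left det)
  have one: "inv\<^bsub>SL2R\<^esub> (mat 1) = mat 1"
    by (rule inv_equality) (auto simp: SL2R_def det_I)
  have "subgroup {mat 1, - mat 1} SL2R"
    by (rule subgroupI) (use inv one in \<open>auto simp: SL2R_def det det_I mult_left\<close>)
  then show ?thesis
    by (rule normalI)
      (auto simp: r_coset_def l_coset_def SL2R_def mult_left mult_right)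
qed

lemma group_PSL2R: "group PSL2R"
  unfolding PSL2R_def by (rule normal.factorgroup_is_group[OF normal_pm_one])

definition H2 :: "complex set" where
  "H2 = {z. Im z > 0}"

definition hdist :: "complex \<Rightarrow> complex \<Rightarrow> real" where
  "hdist z w = arcosh (1 + (cmod (z - w))\<^sup>2 / (2 * Im z * Im w))"

definition moebius :: "real^2^2 \<Rightarrow> complex \<Rightarrow> complex" where
  "moebius A z = (of_real (A$1$1) * z + of_real (A$1$2)) / (of_real (A$2$1) * z + of_real (A$2$2))"

text \<open>The two representatives of an element of PSL(2,R) differ by a sign, so neither the action
  nor the absolute value of the trace depends on the choice below.\<close>

definition psl_act :: "(real^2^2) set \<Rightarrow> complex \<Rightarrow> complex" where
  "psl_act g = moebius (SOME A. A \<in> g)"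

definition abs_trace :: "(real^2^2) set \<Rightarrow> real" where
  "abs_trace g = \<bar>trace (SOME A. A \<in> g)\<bar>"

datatype isometry_type = Identity | Elliptic | Parabolic | Hyperbolic

definition isometry_type :: "(real^2^2) set \<Rightarrow> isometry_type" where
  "isometry_type g =
     (if g = \<one>\<^bsub>PSL2R\<^esub> then Identity
      else if abs_trace g < 2 then Elliptic
      else if abs_trace g = 2 then Parabolic
      else Hyperbolic)"

text \<open>The axis of a hyperbolic element is the geodesic line that it translates.\<close>

definition geodesic_line :: "(real \<Rightarrow> complex) \<Rightarrow> bool" where
  "geodesic_line c \<longleftrightarrow> range c \<subseteq> H2 \<and> (\<forall>s t. hdist (c s) (c t) = \<bar>s - t\<bar>)"

definition translation_length :: "(real^2^2) set \<Rightarrow> real" where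
  "translation_length g =
     (if isometry_type g = Hyperbolic
      then (THE l. l > 0 \<and> (\<exists>c. geodesic_line c \<and> (\<forall>t. psl_act g (c t) = c (t + l))))
      else 0)"


section \<open>The real projective line\<close>

definition rp_point :: "real \<Rightarrow> real \<Rightarrow> (real \<times> real) set" where
  "rp_point x y = {(t * x, t * y) | t. t \<noteq> 0}"

definition RP1 :: "(real \<times> real) set set" where
  "RP1 = {rp_point x y | x y. (x, y) \<noteq> (0, 0)}"

definition RP1_topology :: "(real \<times> real) set topology" where
  "RP1_topology =
     topology (\<lambda>U. U \<subseteq> RP1 \<and> open {(x, y). (x, y) \<noteq> (0, 0) \<and> rp_point x y \<in> U})"

lemma openin_RP1_topology:
  "openin RP1_topology U \<longleftrightarrow>
     U \<subseteq> RP1 \<and> open {(x, y). (x, y) \<noteq> (0, 0) \<and> rp_point x y \<in> U}"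
proof -
  let ?pre = "\<lambda>U. {(x, y). (x, y) \<noteq> (0, 0) \<and> rp_point x y \<in> U}"
  have inter: "?pre (U \<inter> V) = ?pre U \<inter> ?pre V" for U V by auto
  have union: "?pre (\<Union>\<U>) = (\<Union>U\<in>\<U>. ?pre U)" for \<U> by auto
  have "istopology (\<lambda>U. U \<subseteq> RP1 \<and> open (?pre U))"
    unfolding istopology_def inter union by (auto intro: open_Int open_UN)
  then show ?thesis
    by (simp add: RP1_topology_def topology_inverse')
qed


section \<open>The limit cone\<close>

type_synonym psl_pair = "(real^2^2) set \<times> (real^2^2) set"

definition hyperbolic_elt :: "psl_pair \<Rightarrow> bool" where
  "hyperbolic_elt g \<longleftrightarrow> isometry_type (fst g) = Hyperbolic \<and> isometry_type (snd g) = Hyperbolic"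

definition mixed_elt :: "psl_pair \<Rightarrow> bool" where
  "mixed_elt g \<longleftrightarrow> isometry_type (fst g) \<noteq> isometry_type (snd g)"

definition translation_direction :: "psl_pair \<Rightarrow> (real \<times> real) set" where
  "translation_direction g = rp_point (translation_length (fst g)) (translation_length (snd g))"

text \<open>A mixed element such as (parabolic, elliptic) has no translation direction; the last condition
  excludes it.\<close>

definition limit_cone :: "psl_pair set \<Rightarrow> (real \<times> real) set set" where
  "limit_cone \<Gamma> = RP1_topology closure_of
     {translation_direction g | g. g \<in> \<Gamma> \<and> (hyperbolic_elt g \<or> mixed_elt g) \<and>
        (translation_length (fst g) \<noteq> 0 \<or> translation_length (snd g) \<noteq> 0)}"


section \<open>The product of two hyperbolic planes, its geometric boundary and the limit set\<close>

definition HH :: "(complex \<times> complex) set" where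
  "HH = H2 \<times> H2"

definition HHdist :: "complex \<times> complex \<Rightarrow> complex \<times> complex \<Rightarrow> real" where
  "HHdist p q = sqrt ((hdist (fst p) (fst q))\<^sup>2 + (hdist (snd p) (snd q))\<^sup>2)"

text \<open>A ray is represented by a function on the whole real line of which only the restriction to
  \<open>{0..}\<close> matters.\<close>

definition unit_ray :: "(real \<Rightarrow> complex \<times> complex) \<Rightarrow> bool" where
  "unit_ray \<gamma> \<longleftrightarrow> \<gamma> ` {0..} \<subseteq> HH \<and> (\<forall>s\<ge>0. \<forall>t\<ge>0. HHdist (\<gamma> s) (\<gamma> t) = \<bar>s - t\<bar>)"

definition asymptotic :: "(real \<Rightarrow> complex \<times> complex) \<Rightarrow> (real \<Rightarrow> complex \<times> complex) \<Rightarrow> bool" where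
  "asymptotic \<gamma> \<delta> \<longleftrightarrow> (\<exists>C. \<forall>t\<ge>0. HHdist (\<gamma> t) (\<delta> t) \<le> C)"

definition ray_class :: "(real \<Rightarrow> complex \<times> complex) \<Rightarrow> (real \<Rightarrow> complex \<times> complex) set" where
  "ray_class \<gamma> = {\<delta>. unit_ray \<delta> \<and> asymptotic \<gamma> \<delta>}"

definition geom_boundary :: "(real \<Rightarrow> complex \<times> complex) set set" where
  "geom_boundary = ray_class ` {\<gamma>. unit_ray \<gamma>}"

text \<open>The norm of the tangent vector of a curve in the upper half-plane, for the hyperbolic metric.\<close>

definition hspeed :: "(real \<Rightarrow> complex) \<Rightarrow> real \<Rightarrow> real" where
  "hspeed c t = cmod (vector_derivative c (at t within {0..})) / Im (c t)"

type_synonym bordification_pt = "(complex \<times> complex) + (real \<Rightarrow> complex \<times> complex) set"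

text \<open>\<open>radial b r \<xi>\<close> is the point at distance \<open>r\<close> from \<open>b\<close> on the geodesic segment or ray from \<open>b\<close> to
  \<open>\<xi>\<close> (and \<open>\<xi>\<close> itself if \<open>\<xi>\<close> has distance at most \<open>r\<close> from \<open>b\<close>). The cone topology is that of the inverse
  limit of the closed balls around \<open>b\<close>, i.e. the coarsest one making all maps \<open>radial b r\<close> continuous.
  It does not depend on \<open>b\<close>.\<close>

definition radial :: "complex \<times> complex \<Rightarrow> real \<Rightarrow> bordification_pt \<Rightarrow> complex \<times> complex" where
  "radial b r \<xi> =
     (case \<xi> of
        Inl x \<Rightarrow> if HHdist b x \<le> r then x
                 else (THE p. p \<in> HH \<and> HHdist b p = r \<and> HHdist p x = HHdist b x - r)
      | Inr \<eta> \<Rightarrow> (THE p. \<exists>\<gamma>\<in>\<eta>. \<gamma> 0 = b \<and> p = \<gamma> r))"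

definition cone_topology :: "bordification_pt topology" where
  "cone_topology = topology_generated_by
     {{\<xi> \<in> HH <+> geom_boundary. radial (\<i>, \<i>) r \<xi> \<in> U} | r U. r \<ge> 0 \<and> open U}"

definition orbit :: "psl_pair set \<Rightarrow> complex \<times> complex \<Rightarrow> (complex \<times> complex) set" where
  "orbit \<Gamma> x = {(psl_act (fst g) (fst x), psl_act (snd g) (snd x)) | g. g \<in> \<Gamma>}"

definition limit_set :: "psl_pair set \<Rightarrow> complex \<times> complex \<Rightarrow> (real \<Rightarrow> complex \<times> complex) set set" where
  "limit_set \<Gamma> x = {\<eta> \<in> geom_boundary. Inr \<eta> \<in> cone_topology closure_of (Inl ` orbit \<Gamma> x)}"


section \<open>Fuchsian triangle groups\<close>

text \<open>Points of the Riemann sphere; those with nonnegative imaginary part and \<open>Infty\<close> form the closed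
  hyperbolic plane.\<close>

datatype sphere_pt = Pt complex | Infty

definition closed_H2 :: "sphere_pt set" where
  "closed_H2 = Pt ` {z. Im z \<ge> 0} \<union> {Infty}"

text \<open>A real matrix of negative determinant acts on the closed hyperbolic plane by an orientation
  reversing isometry. It is the reflection in a geodesic iff it is an involution, i.e. has trace 0;
  the geodesic is then its fixed point set.\<close>

definition anti_moebius :: "real^2^2 \<Rightarrow> sphere_pt \<Rightarrow> sphere_pt" where
  "anti_moebius R p =
     (case p of
        Pt z \<Rightarrow> if of_real (R$2$1) * cnj z + of_real (R$2$2) = 0 then Infty else Pt (moebius R (cnj z))
      | Infty \<Rightarrow> if R$2$1 = 0 then Infty else Pt (of_real (R$1$1 / R$2$1)))"

definition reflection_matrix :: "real^2^2 \<Rightarrow> bool" where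
  "reflection_matrix R \<longleftrightarrow> det R = -1 \<and> trace R = 0"

definition reflection_in_side :: "real^2^2 \<Rightarrow> sphere_pt \<Rightarrow> sphere_pt \<Rightarrow> bool" where
  "reflection_in_side R u v \<longleftrightarrow>
     reflection_matrix R \<and> anti_moebius R u = u \<and> anti_moebius R v = v"

definition hyperbolic_triangle :: "sphere_pt \<Rightarrow> sphere_pt \<Rightarrow> sphere_pt \<Rightarrow> bool" where
  "hyperbolic_triangle u v w \<longleftrightarrow>
     {u, v, w} \<subseteq> closed_H2 \<and>
     \<not> (\<exists>R. reflection_matrix R \<and> (\<forall>p\<in>{u, v, w}. anti_moebius R p = p))"

text \<open>The map \<open>\<zeta> \<mapsto> (\<zeta> - z) / (\<zeta> - cnj z)\<close> is an isometry onto the disc model that sends \<open>z\<close> to \<open>0\<close>, where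
  the geodesics through \<open>0\<close> are straight. Hence angles at \<open>z\<close> can be measured between the images.\<close>

definition disc_coord :: "complex \<Rightarrow> sphere_pt \<Rightarrow> complex" where
  "disc_coord z p = (case p of Pt \<zeta> \<Rightarrow> (\<zeta> - z) / (\<zeta> - cnj z) | Infty \<Rightarrow> 1)"

definition interior_angle :: "sphere_pt \<Rightarrow> sphere_pt \<Rightarrow> sphere_pt \<Rightarrow> real" where
  "interior_angle u v w =
     (case u of
        Pt z \<Rightarrow> if Im z > 0 then \<bar>Arg (disc_coord z v / disc_coord z w)\<bar> else 0
      | Infty \<Rightarrow> 0)"

definition signature_angle :: "enat \<Rightarrow> real" where
  "signature_angle p = (case p of enat n \<Rightarrow> pi / real n | \<infinity> \<Rightarrow> 0)"

text \<open>The orientation preserving part of the group generated by the reflections in the sides of a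
  hyperbolic triangle with the prescribed angles. It is generated by the products of two reflections,
  which are the rotations about the vertices (parabolic at an ideal vertex), and it is discrete by
  the Poincare polygon theorem, the angles being of the form \<open>pi / n\<close> or 0.\<close>

definition triangle_group :: "enat \<Rightarrow> enat \<Rightarrow> enat \<Rightarrow> (real^2^2) set set \<Rightarrow> bool" where
  "triangle_group p q r S \<longleftrightarrow>
     (\<exists>u v w R\<^sub>1 R\<^sub>2 R\<^sub>3.
        hyperbolic_triangle u v w \<and>
        interior_angle u v w = signature_angle p \<and>
        interior_angle v w u = signature_angle q \<and>
        interior_angle w u v = signature_angle r \<and>
        reflection_in_side R\<^sub>1 v w \<and> reflection_in_side R\<^sub>2 w u \<and> reflection_in_side R\<^sub>3 u v \<and>
        S = generate PSL2R {psl (R\<^sub>1 ** R\<^sub>2), psl (R\<^sub>2 ** R\<^sub>3), psl (R\<^sub>3 ** R\<^sub>1)})"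


section \<open>Quaternion algebras over the field obtained by adjoining the square root of 5\<close>

definition K :: "real set" where
  "K = {p + q * sqrt 5 | p q. p \<in> \<rat> \<and> q \<in> \<rat>}"

definition galois :: "real \<Rightarrow> real" where
  "galois x = (THE y. \<exists>p\<in>\<rat>. \<exists>q\<in>\<rat>. x = p + q * sqrt 5 \<and> y = p - q * sqrt 5)"

definition integers_K :: "real set" where
  "integers_K = {x \<in> K. algebraic_int x}"

text \<open>The tuple \<open>(x0, x1, x2, x3)\<close> stands for \<open>x0 + x1 i + x2 j + x3 ij\<close> in the quaternion algebra with
  \<open>i\<^sup>2 = a\<close>, \<open>j\<^sup>2 = b\<close>, \<open>ij = -ji\<close>; up to isomorphism every quaternion algebra over \<open>K\<close> is of this form
  with nonzero \<open>a, b\<close> in \<open>K\<close>. Addition and scalar multiplication are those of the product type.\<close>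

type_synonym quat = "real \<times> real \<times> real \<times> real"

definition quat_carrier :: "quat set" where
  "quat_carrier = K \<times> K \<times> K \<times> K"

fun qmult :: "real \<Rightarrow> real \<Rightarrow> quat \<Rightarrow> quat \<Rightarrow> quat" where
  "qmult a b (x0, x1, x2, x3) (y0, y1, y2, y3) =
     (x0 * y0 + a * x1 * y1 + b * x2 * y2 - a * b * x3 * y3,
      x0 * y1 + x1 * y0 - b * x2 * y3 + b * x3 * y2,
      x0 * y2 + x2 * y0 + a * x1 * y3 - a * x3 * y1,
      x0 * y3 + x3 * y0 + x1 * y2 - x2 * y1)"

fun reduced_norm :: "real \<Rightarrow> real \<Rightarrow> quat \<Rightarrow> real" where
  "reduced_norm a b (x0, x1, x2, x3) = x0\<^sup>2 - a * x1\<^sup>2 - b * x2\<^sup>2 + a * b * x3\<^sup>2"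

text \<open>Embeddings of the quaternion algebra into M(2,R) extending the embedding \<open>\<tau>\<close> of \<open>K\<close> into R.\<close>

definition quat_embedding :: "real \<Rightarrow> real \<Rightarrow> (real \<Rightarrow> real) \<Rightarrow> (quat \<Rightarrow> real^2^2) \<Rightarrow> bool" where
  "quat_embedding a b \<tau> \<phi> \<longleftrightarrow>
     inj_on \<phi> quat_carrier \<and>
     (\<forall>x\<in>quat_carrier. \<forall>y\<in>quat_carrier. \<phi> (x + y) = \<phi> x + \<phi> y) \<and>
     (\<forall>x\<in>quat_carrier. \<forall>y\<in>quat_carrier. \<phi> (qmult a b x y) = \<phi> x ** \<phi> y) \<and>
     (\<forall>k\<in>K. \<phi> (k, 0, 0, 0) = \<tau> k *\<^sub>R mat 1)"

definition isomorphic_M2K :: "real \<Rightarrow> real \<Rightarrow> bool" where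
  "isomorphic_M2K a b \<longleftrightarrow>
     (\<exists>\<psi>. quat_embedding a b (\<lambda>k. k) \<psi> \<and> \<psi> ` quat_carrier = {M. \<forall>i j. M$i$j \<in> K})"

definition lin_combs :: "real set \<Rightarrow> quat set \<Rightarrow> quat set" where
  "lin_combs R B = {\<Sum>x\<in>B. c x *\<^sub>R x | c. c ` B \<subseteq> R}"

text \<open>An order is a subring with 1 that is a finitely generated module over the integers of \<open>K\<close> and
  spans the algebra over \<open>K\<close>.\<close>

definition quat_order :: "real \<Rightarrow> real \<Rightarrow> quat set \<Rightarrow> bool" where
  "quat_order a b \<O> \<longleftrightarrow>
     (1, 0, 0, 0) \<in> \<O> \<and> (\<forall>x\<in>\<O>. \<forall>y\<in>\<O>. qmult a b x y \<in> \<O>) \<and>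
     (\<exists>B. finite B \<and> \<O> = lin_combs integers_K B \<and> quat_carrier = lin_combs K B)"

text \<open>An element of an order whose reduced norm is 1 is a unit of the order, its conjugate being the
  inverse.\<close>

definition norm_one_units :: "real \<Rightarrow> real \<Rightarrow> quat set \<Rightarrow> quat set" where
  "norm_one_units a b \<O> = {\<epsilon> \<in> \<O>. reduced_norm a b \<epsilon> = 1}"

definition S_star ::
    "quat set \<Rightarrow> (quat \<Rightarrow> real^2^2) \<Rightarrow> (quat \<Rightarrow> real^2^2) \<Rightarrow> (real^2^2) set set \<Rightarrow> psl_pair set" where
  "S_star U \<phi>\<^sub>1 \<phi>\<^sub>2 S = {(psl (\<phi>\<^sub>1 \<epsilon>), psl (\<phi>\<^sub>2 \<epsilon>)) | \<epsilon>. \<epsilon> \<in> U \<and> psl (\<phi>\<^sub>1 \<epsilon>) \<in> S}"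

end

(* After conjugating the two factors, Gamma has index at most 2 in the image of a Hecke group with
   parameter 2 cos w in the first factor and its Galois conjugate, with parameter 2 cos 3w, in the
   second, where w = pi/5 or pi/10. Write the elements as words in the order two generator and the
   elliptic U = T S. Powers of U have entries sin (k w) / sin w, those of the conjugate
   sin (3kw) / sin 3w, and the latter are dominated by the former, which are nonnegative. Hence
   norm B <= C norm A for all (A, B) in Gamma. This bounds the displacement, and after passing to
   powers the translation length, in the second factor by that in the first.

   Conversely Gamma contains a pair (T1, T2) of parabolics and a pair (h1, h2) with h1 hyperbolic and
   h2 elliptic of infinite order. In T^N h^g the parabolic contributes 2 ln N to the displacement in
   both factors and h^g contributes only in the first. Balancing N against g gives a dense set of
   slopes in (0, 1). The directions in the two factors are controlled independently: let e1, e2 span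
   the lines fixed by T1, T2. For K = K0 T^j h^m with j fixed and large, K1 e1 stays near the line of
   K0 e1, where K0 e1 is dense, while the irrational rotation h2 makes the line of K2 e2 dense. *)
theory Submission
  imports Defs "HOL-Analysis.Kronecker_Approximation_Theorem" "HOL-Computational_Algebra.Primes"
begin

text \<open>The second factor is never written down: it is an abstract embedding
  \<open>\<phi>\<^sub>2\<close>, accessible only through traces. It is made explicit by rigidity. A
  unit has Galois conjugate traces under the two embeddings, and a pair consisting of a parabolic
  and a matrix without real eigenvectors is determined up to conjugation by three traces. As the
  automorphism sends 2 cos (pi/5) to 2 cos (3 pi/5), the second group is of Hecke type with angle
  3w. For signature (5,\<infinity>,\<infinity>) the number 2 cos (pi/10) is not in \<open>K\<close>,
  only its square is; this is why S reaches the Hecke group only up to index 2. The obstacle is that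
  the second projection of \<Gamma> is not discrete, so there is no fundamental domain to work with.
  Entrywise domination of nonnegative matrices plays the part of the Schwarz lemma for F, and the
  nondiscreteness itself supplies the elliptic element that moves the second direction freely. Signs
  need care throughout: traces are the link between the factors, and PSL(2,R) knows them only up to
  sign. Hence the work is done with pairs of matrices.\<close>

section \<open>The hyperbolic plane in light cone coordinates\<close>

text \<open>The triple (\<open>cp z\<close>, \<open>cq z\<close>, \<open>cr z\<close>) lists the
  entries of the symmetric matrix of determinant 1 that represents z in the hyperboloid model.
  Moebius maps act on it linearly and cosh of a distance becomes a bilinear form, so that geometry
  turns into polynomial algebra.\<close>

definition cp :: "complex \<Rightarrow> real" where "cp z = (cmod z)\<^sup>2 / Im z"
definition cq :: "complex \<Rightarrow> real" where "cq z = Re z / Im z"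
definition cr :: "complex \<Rightarrow> real" where "cr z = 1 / Im z"

lemma light_cone_coords:
  assumes "z \<in> H2"
  shows "cp z * cr z - (cq z)\<^sup>2 = 1" "cp z > 0" "cr z > 0"
proof -
  have y: "Im z > 0" using assms by (simp add: H2_def)
  then have "z \<noteq> 0" by auto
  then show "cp z > 0" "cr z > 0" using y by (auto simp: cp_def cr_def)
  show "cp z * cr z - (cq z)\<^sup>2 = 1"
    using y unfolding cp_def cq_def cr_def cmod_power2 by (simp add: field_simps power2_eq_square)
qed

lemma light_cone_coords_inject:
  assumes "z \<in> H2" "w \<in> H2" "cq z = cq w" "cr z = cr w"
  shows "z = w"
  using assms by (auto simp: H2_def cq_def cr_def complex_eq_iff field_simps)

lemma hdist_arg_ge_1:
  assumes "z \<in> H2" "w \<in> H2"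
  shows "1 + (cmod (z - w))\<^sup>2 / (2 * Im z * Im w) \<ge> 1"
  using assms by (auto simp: H2_def)

lemma hdist_nonneg: "z \<in> H2 \<Longrightarrow> w \<in> H2 \<Longrightarrow> hdist z w \<ge> 0"
  unfolding hdist_def using hdist_arg_ge_1 by (intro arcosh_nonneg_real) auto

lemma hdist_refl: "z \<in> H2 \<Longrightarrow> hdist z z = 0"
  by (simp add: hdist_def)

lemma hdist_commute: "hdist z w = hdist w z"
  by (simp add: hdist_def norm_minus_commute mult_ac)

lemma cosh_hdist:
  assumes "z \<in> H2" "w \<in> H2"
  shows "cosh (hdist z w) = (cp z * cr w + cr z * cp w) / 2 - cq z * cq w"
proof -
  have pos: "Im z > 0" "Im w > 0" using assms by (auto simp: H2_def)
  have "cosh (hdist z w) = 1 + (cmod (z - w))\<^sup>2 / (2 * Im z * Im w)"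
    unfolding hdist_def using hdist_arg_ge_1[OF assms] by (rule cosh_arcosh_real)
  also have "\<dots> = (cp z * cr w + cr z * cp w) / 2 - cq z * cq w"
    using pos unfolding cp_def cq_def cr_def cmod_power2 by (simp add: field_simps power2_eq_square)
  finally show ?thesis .
qed

lemma cosh_real_inject:
  fixes x y :: real
  assumes "cosh x = cosh y" "x \<ge> 0" "y \<ge> 0"
  shows "x = y"
  using assms by (metis arcosh_cosh_real)

text \<open>The affine maps are simply transitive on the upper half-plane, and \<open>aff p\<close>
  is the one that carries \<open>\<i>\<close> to p. They reduce statements about several points to
  the base point \<open>\<i>\<close>.\<close>

definition aff :: "complex \<Rightarrow> complex \<Rightarrow> complex" where
  "aff p z = of_real (Im p) * z + of_real (Re p)"

lemma aff_sel [simp]: "Re (aff p z) = Im p * Re z + Re p" "Im (aff p z) = Im p * Im z"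
  by (simp_all add: aff_def)

lemma aff_mem: "p \<in> H2 \<Longrightarrow> z \<in> H2 \<Longrightarrow> aff p z \<in> H2"
  by (simp add: H2_def)

lemma aff_ii [simp]: "aff p \<i> = p"
  by (simp add: complex_eq_iff)

lemma aff_surj:
  assumes "p \<in> H2" "z \<in> H2"
  obtains w where "w \<in> H2" "z = aff p w"
proof
  show "Complex ((Re z - Re p) / Im p) (Im z / Im p) \<in> H2"
    "z = aff p (Complex ((Re z - Re p) / Im p) (Im z / Im p))"
    using assms by (auto simp: H2_def complex_eq_iff)
qed

lemma hdist_aff:
  assumes "p \<in> H2"
  shows "hdist (aff p z) (aff p w) = hdist z w"
proof -
  have "aff p z - aff p w = of_real (Im p) * (z - w)" by (simp add: aff_def algebra_simps)
  then have "cmod (aff p z - aff p w) = Im p * cmod (z - w)"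
    using assms by (simp add: norm_mult H2_def)
  then show ?thesis using assms by (simp add: hdist_def H2_def power2_eq_square mult.assoc)
qed

lemma ii_mem [simp]: "\<i> \<in> H2" by (simp add: H2_def)

lemma coords_ii [simp]: "cp \<i> = 1" "cq \<i> = 0" "cr \<i> = 1"
  by (simp_all add: cp_def cq_def cr_def)


section \<open>Polar coordinates\<close>

text \<open>Hyperboloid polar coordinates: the point reached from \<open>\<i>\<close> after time t
  in direction u. The unit number u also names the endpoint at infinity, with u = 1 for the upward
  vertical ray.\<close>

definition pol :: "real \<Rightarrow> complex \<Rightarrow> complex" where
  "pol t u = Complex (sinh t * Im u / (cosh t - sinh t * Re u)) (1 / (cosh t - sinh t * Re u))"

lemma abs_sinh_less_cosh: "\<bar>sinh t\<bar> < cosh (t::real)"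
  by (rule power2_less_imp_less) (auto simp: cosh_square_eq)

lemma pol_denominator_pos:
  assumes "norm u = 1"
  shows "cosh t - sinh t * Re u > 0"
proof -
  have "\<bar>Re u\<bar> \<le> 1" using assms abs_Re_le_cmod[of u] by simp
  then have "\<bar>sinh t * Re u\<bar> \<le> \<bar>sinh t\<bar>" by (simp add: abs_mult mult_left_le)
  then show ?thesis using abs_sinh_less_cosh[of t] by linarith
qed

lemma pol_mem: "norm u = 1 \<Longrightarrow> pol t u \<in> H2"
  using pol_denominator_pos[of u t] by (simp add: pol_def H2_def)

lemma norm_one_squares: "norm u = 1 \<Longrightarrow> (Re u)\<^sup>2 + (Im u)\<^sup>2 = 1"
  by (metis cmod_power2 one_power2)

lemma coords_pol:
  assumes "norm u = 1"
  shows "cp (pol t u) = cosh t + sinh t * Re u" "cq (pol t u) = sinh t * Im u"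
    "cr (pol t u) = cosh t - sinh t * Re u"
proof -
  note pos = pol_denominator_pos[OF assms, of t]
  show q: "cq (pol t u) = sinh t * Im u" and r: "cr (pol t u) = cosh t - sinh t * Re u"
    using pos by (auto simp: cq_def cr_def pol_def)
  have "1 + (sinh t * Im u)\<^sup>2 = (cosh t + sinh t * Re u) * (cosh t - sinh t * Re u)"
    using norm_one_squares[OF assms] hyperbolic_pythagoras[of t] by algebra
  moreover have "cp (pol t u) * cr (pol t u) = 1 + (cq (pol t u))\<^sup>2"
    using light_cone_coords(1)[OF pol_mem[OF assms]] by (simp add: algebra_simps)
  ultimately show "cp (pol t u) = cosh t + sinh t * Re u"
    using pos unfolding q r by simp
qed

lemma pol_0 [simp]: "pol 0 u = \<i>"
  by (simp add: pol_def complex_eq_iff)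

lemma cosh_hdist_pol:
  assumes "norm u = 1" "norm v = 1"
  shows "cosh (hdist (pol s u) (pol t v)) = cosh s * cosh t - sinh s * sinh t * Re (u * cnj v)"
  using assms by (simp add: cosh_hdist pol_mem coords_pol field_simps)

lemma hdist_pol_same:
  assumes "norm u = 1"
  shows "hdist (pol s u) (pol t u) = \<bar>s - t\<bar>"
proof -
  have "u * cnj u = 1" using assms by (simp add: complex_norm_square [symmetric])
  then have "cosh (hdist (pol s u) (pol t u)) = cosh \<bar>s - t\<bar>"
    using assms by (simp add: cosh_hdist_pol cosh_diff)
  then show ?thesis by (rule cosh_real_inject) (auto intro: hdist_nonneg pol_mem assms)
qed

lemma hdist_ii_pol:
  assumes "norm u = 1" "t \<ge> 0"
  shows "hdist \<i> (pol t u) = t"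
  using hdist_pol_same[OF assms(1), of 0 t] assms(2) by simp

lemma cosh_hdist_ii: "z \<in> H2 \<Longrightarrow> cosh (hdist \<i> z) = (cp z + cr z) / 2"
  by (simp add: cosh_hdist)

text \<open>The coordinates of \<open>pol t u\<close> contain sinh t times Re u and Im u, so u is
  found by division. The explicit quotient matters: limits of directions are later computed from
  this formula.\<close>

lemma polar_direction:
  assumes "z \<in> H2" "hdist \<i> z > 0"
  defines "u \<equiv> Complex ((cp z - cr z) / 2) (cq z) / of_real (sinh (hdist \<i> z))"
  shows "norm u = 1" "z = pol (hdist \<i> z) u"
proof -
  let ?s = "sinh (hdist \<i> z)"
  have s: "?s > 0" using assms by simp
  have "?s\<^sup>2 = (cosh (hdist \<i> z))\<^sup>2 - 1" by (simp add: sinh_square_eq)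
  also have "\<dots> = ((cp z - cr z) / 2)\<^sup>2 + (cq z)\<^sup>2"
    using light_cone_coords(1)[OF assms(1)] assms(1)
    by (simp add: cosh_hdist_ii power2_eq_square field_simps)
  finally have "cmod (Complex ((cp z - cr z) / 2) (cq z)) = ?s"
    using s by (simp add: complex_norm real_sqrt_unique)
  then show u: "norm u = 1" using s by (simp add: u_def norm_divide)
  have "Re u = (cp z - cr z) / 2 / ?s" "Im u = cq z / ?s"
    by (simp_all add: u_def Re_divide_of_real Im_divide_of_real)
  then show "z = pol (hdist \<i> z) u"
    using s assms(1) by (intro light_cone_coords_inject) (auto simp: pol_mem u coords_pol cosh_hdist_ii field_simps)
qed

lemma polar_ex:
  assumes "z \<in> H2"
  obtains u where "norm u = 1" "z = pol (hdist \<i> z) u"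
proof (cases "hdist \<i> z = 0")
  \<comment> \<open>At distance 0 the direction is undefined. It has to be shown that the point is
    \<open>\<i>\<close>; then any u will do.\<close>
  case True
  then have "cosh (hdist \<i> z) = 1" by simp
  then have "(cp z + cr z) / 2 = 1" using assms by (simp add: cosh_hdist_ii)
  then have p: "cp z = 2 - cr z" by simp
  then have "(cr z - 1)\<^sup>2 + (cq z)\<^sup>2 = 0"
    using light_cone_coords(1)[OF assms] by (simp add: p power2_eq_square algebra_simps)
  then have "cr z = 1" "cq z = 0" by (auto simp: sum_power2_eq_zero_iff)
  then have "z = \<i>" using assms by (intro light_cone_coords_inject) auto
  then show ?thesis using that[of 1] True by simp
next
  case False
  then have "hdist \<i> z > 0" using hdist_nonneg[OF ii_mem assms] by simp
  from that[OF polar_direction[OF assms this]] show ?thesis .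
qed

lemma unit_Re_mult_cnj:
  assumes "norm u = 1" "norm v = 1"
  shows "\<bar>Re (u * cnj v)\<bar> \<le> 1" "Re (u * cnj v) = 1 \<Longrightarrow> u = v"
proof -
  show "\<bar>Re (u * cnj v)\<bar> \<le> 1"
    using abs_Re_le_cmod[of "u * cnj v"] assms by (simp add: norm_mult)
  assume "Re (u * cnj v) = 1"
  then have "(Re u - Re v)\<^sup>2 + (Im u - Im v)\<^sup>2 = 0"
    using norm_one_squares[OF assms(1)] norm_one_squares[OF assms(2)]
    by (simp add: power2_eq_square algebra_simps)
  then show "u = v" by (simp add: sum_power2_eq_zero_iff complex_eq_iff)
qed

text \<open>By the hyperbolic law of cosines, with the cosine of the angle bounded below by -1, cosh
  of the distance is at most the addition formula for cosh.\<close>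

lemma hdist_triangle_ii:
  assumes "x \<in> H2" "z \<in> H2"
  shows "hdist x z \<le> hdist x \<i> + hdist \<i> z"
proof -
  obtain u where u: "norm u = 1" "x = pol (hdist \<i> x) u" using polar_ex[OF assms(1)] .
  obtain v where v: "norm v = 1" "z = pol (hdist \<i> z) v" using polar_ex[OF assms(2)] .
  have nn: "hdist \<i> x \<ge> 0" "hdist \<i> z \<ge> 0" using assms by (auto intro: hdist_nonneg)
  have "cosh (hdist x z) = cosh (hdist \<i> x) * cosh (hdist \<i> z) - sinh (hdist \<i> x) * sinh (hdist \<i> z) * Re (u * cnj v)"
    using cosh_hdist_pol[OF u(1) v(1), of "hdist \<i> x" "hdist \<i> z"] u v by simp
  also have "\<dots> \<le> cosh (hdist \<i> x) * cosh (hdist \<i> z) + sinh (hdist \<i> x) * sinh (hdist \<i> z)"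
  proof -
    have "sinh (hdist \<i> x) * sinh (hdist \<i> z) \<ge> 0" using nn by simp
    moreover have "Re (u * cnj v) \<ge> -1" using unit_Re_mult_cnj(1)[OF u(1) v(1)] by linarith
    ultimately show ?thesis
      using mult_left_mono[of "- 1" "Re (u * cnj v)" "sinh (hdist \<i> x) * sinh (hdist \<i> z)"] by linarith
  qed
  also have "\<dots> = cosh (hdist x \<i> + hdist \<i> z)" by (simp add: cosh_add hdist_commute)
  finally show ?thesis
    using nn assms by (subst (asm) cosh_real_nonneg_le_iff) (auto simp: hdist_commute intro: hdist_nonneg)
qed

lemma hdist_triangle:
  assumes "x \<in> H2" "y \<in> H2" "z \<in> H2"
  shows "hdist x z \<le> hdist x y + hdist y z"
proof -
  obtain x' where x': "x' \<in> H2" "x = aff y x'" using aff_surj assms by metis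
  obtain z' where z': "z' \<in> H2" "z = aff y z'" using aff_surj assms by metis
  have "hdist x y = hdist x' \<i>" "hdist y z = hdist \<i> z'" "hdist x z = hdist x' z'"
    using hdist_aff[OF assms(2), of x' \<i>] hdist_aff[OF assms(2), of \<i> z'] hdist_aff[OF assms(2), of x' z'] x' z'
    by auto
  then show ?thesis using hdist_triangle_ii[OF x'(1) z'(1)] by simp
qed

text \<open>Equality in the law of cosines forces the angle to be 0. This is the uniqueness of
  geodesic segments.\<close>

lemma segment_unique:
  assumes u: "norm u = 1" and p: "p \<in> H2" and \<alpha>: "hdist \<i> p \<le> d"
    and add: "hdist p (pol d u) = d - hdist \<i> p"
  shows "p = pol (hdist \<i> p) u"
proof (cases "hdist \<i> p = 0")
  case True
  then show ?thesis using p polar_ex[OF p] by (metis pol_0)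
next
  case False
  define \<alpha> where "\<alpha> = hdist \<i> p"
  have \<alpha>0: "\<alpha> > 0" using False hdist_nonneg[OF ii_mem p] by (simp add: \<alpha>_def)
  obtain v where v: "norm v = 1" "p = pol \<alpha> v" unfolding \<alpha>_def by (rule polar_ex[OF p])
  have "hdist (pol \<alpha> v) (pol d u) = d - \<alpha>"
    unfolding v(2)[symmetric] using add by (simp add: \<alpha>_def)
  then have "cosh (d - \<alpha>) = cosh \<alpha> * cosh d - sinh \<alpha> * sinh d * Re (v * cnj u)"
    using cosh_hdist_pol[OF v(1) u, of \<alpha> d] by simp
  then have "sinh \<alpha> * sinh d * (1 - Re (v * cnj u)) = 0" by (simp add: cosh_diff algebra_simps)
  moreover have "sinh \<alpha> > 0" "sinh d > 0" using \<alpha>0 \<alpha> by (auto simp: \<alpha>_def)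
  ultimately have "Re (v * cnj u) = 1" by auto
  then have "v = u" using unit_Re_mult_cnj(2)[OF v(1) u] by simp
  then show ?thesis using v(2) by (simp only: \<alpha>_def)
qed

lemma geodesic_ray_form:
  assumes mem: "\<And>t. t \<ge> 0 \<Longrightarrow> c t \<in> H2"
    and dist: "\<And>s t. s \<ge> 0 \<Longrightarrow> t \<ge> 0 \<Longrightarrow> hdist (c s) (c t) = a * \<bar>s - t\<bar>"
    and a: "a \<ge> 0"
  obtains u where "norm u = 1" "\<And>t. t \<ge> 0 \<Longrightarrow> c t = aff (c 0) (pol (a * t) u)"
proof -
  define b where "b = (\<lambda>t. SOME w. w \<in> H2 \<and> c t = aff (c 0) w)"
  have b: "b t \<in> H2 \<and> c t = aff (c 0) (b t)" if "t \<ge> 0" for t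
    unfolding b_def by (rule someI_ex) (metis aff_surj mem that order_refl)
  have b_dist: "hdist (b s) (b t) = a * \<bar>s - t\<bar>" if "s \<ge> 0" "t \<ge> 0" for s t
    using dist[OF that] b[OF that(1)] b[OF that(2)] hdist_aff[OF mem[of 0]] by (metis order_refl)
  have b0: "b 0 = \<i>"
    using b[of 0] mem[of 0] by (auto simp: complex_eq_iff H2_def)
  have bi: "hdist \<i> (b t) = a * t" if "t \<ge> 0" for t
    using b_dist[of 0 t] that b0 by simp
  obtain u where u: "norm u = 1" "b 1 = pol a u"
    using polar_ex[of "b 1"] b[of 1] bi[of 1] by auto
  have "b t = pol (a * t) u" if t: "t \<ge> 0" for t
  proof (cases "t \<le> 1")
    case True
    then have "hdist (b t) (pol a u) = a - hdist \<i> (b t)"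
      using b_dist[of t 1] t u bi[OF t] by (simp add: algebra_simps)
    moreover have "hdist \<i> (b t) \<le> a" using True a bi[OF t] by (simp add: mult_left_le)
    ultimately show ?thesis using segment_unique[OF u(1)] b[OF t] bi[OF t] by metis
  next
    case False
    obtain v where v: "norm v = 1" "b t = pol (a * t) v"
      using polar_ex[of "b t"] b[OF t] bi[OF t] by auto
    have "hdist (b 1) (pol (a * t) v) = a * t - hdist \<i> (b 1)"
      using b_dist[of 1 t] t v bi[of 1] False by (simp add: algebra_simps)
    moreover have "hdist \<i> (b 1) \<le> a * t" using False a bi[of 1] by (simp add: mult_le_cancel_left1)
    ultimately have "b 1 = pol a v" using segment_unique[OF v(1)] b[of 1] bi[of 1]
      by (metis mult.right_neutral zero_le_one)
    \<comment> \<open>For a = 0 the direction carries no information; for a > 0 equal points at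
      distance a have equal directions.\<close>
    show ?thesis
    proof (cases "a = 0")
      case True
      then show ?thesis using v by simp
    next
      case False
      then have "sinh a > 0" using a by simp
      have "cosh a * cosh a - sinh a * sinh a * Re (u * cnj v) = 1"
        using cosh_hdist_pol[OF u(1) v(1), of a a] \<open>b 1 = pol a v\<close> u(2) b[of 1] by (simp add: hdist_refl)
      then have "sinh a * sinh a * (1 - Re (u * cnj v)) = 0"
        using hyperbolic_pythagoras[of a] by (simp add: algebra_simps power2_eq_square)
      then have "u = v" using \<open>sinh a > 0\<close> unit_Re_mult_cnj(2)[OF u(1) v(1)] by auto
      then show ?thesis using v by simp
    qed
  qed
  then show ?thesis using that[OF u(1)] b by metis
qed

lemma squares_hyperbolic_aux:
  fixes x y s c :: real
  assumes "x\<^sup>2 + y\<^sup>2 = 1" "c\<^sup>2 - s\<^sup>2 = 1"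
  shows "y\<^sup>2 + (s - c * x)\<^sup>2 = (c - s * x)\<^sup>2"
proof -
  have "y\<^sup>2 = 1 - x\<^sup>2" "c\<^sup>2 = 1 + s\<^sup>2" using assms by auto
  then show ?thesis by (simp add: power2_diff power_mult_distrib algebra_simps)
qed

lemma hspeed_geodesic:
  assumes u: "norm u = 1" and p: "p \<in> H2" and a: "a \<ge> 0" and t: "t \<ge> 0"
    and c: "\<And>t. t \<ge> 0 \<Longrightarrow> c t = aff p (pol (a * t) u)"
  shows "hspeed c t = a"
proof -
  define D where "D = (\<lambda>t. cosh (a * t) - sinh (a * t) * Re u)"
  define D' where "D' = a * (sinh (a * t) - cosh (a * t) * Re u)"
  have D: "D t > 0" unfolding D_def using pol_denominator_pos[OF u] .
  have dD: "(D has_real_derivative D') (at t within {0..})"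
    unfolding D_def D'_def by (auto intro!: derivative_eq_intros simp: algebra_simps)
  have re: "((\<lambda>t. Im p * (sinh (a * t) * Im u / D t) + Re p) has_real_derivative
      Im p * (a * cosh (a * t) * Im u * D t - sinh (a * t) * Im u * D') / (D t)\<^sup>2) (at t within {0..})"
    using D by (auto intro!: derivative_eq_intros dD simp: power2_eq_square field_simps)
  have im: "((\<lambda>t. Im p * (1 / D t)) has_real_derivative Im p * (- D') / (D t)\<^sup>2) (at t within {0..})"
    using D by (auto intro!: derivative_eq_intros dD simp: power2_eq_square field_simps)
  define d where "d = Complex (Im p * (a * cosh (a * t) * Im u * D t - sinh (a * t) * Im u * D') / (D t)\<^sup>2)
      (Im p * (- D') / (D t)\<^sup>2)"
  have vd: "((\<lambda>t. Complex (Im p * (sinh (a * t) * Im u / D t) + Re p) (Im p * (1 / D t))) has_vector_derivative d) (at t within {0..})"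
    unfolding d_def has_vector_derivative_complex_iff using re im by simp
  have cs: "c s = Complex (Im p * (sinh (a * s) * Im u / D s) + Re p) (Im p * (1 / D s))" if "s \<ge> 0" for s
    using c[OF that] by (simp add: complex_eq_iff pol_def D_def)
  have "(c has_vector_derivative d) (at t within {0..})"
    by (rule has_vector_derivative_transform[OF _ _ vd]) (use t cs in auto)
  \<comment> \<open>The speed is defined by a derivative within the half-line, one-sided at time 0;
    that derivative is unique because the filter is nontrivial.\<close>
  moreover have "at t within {0..} \<noteq> bot"
  proof
    assume "at t within {0..} = bot"
    moreover have "at_right t \<le> at t within {0..}" by (rule at_le) (use t in auto)
    ultimately show False using trivial_limit_at_right_real[of t] by (simp add: bot_unique)
  qed
  ultimately have "vector_derivative c (at t within {0..}) = d"
    using vector_derivative_within by blast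
  moreover have "cmod d = Im p * a / D t"
  proof -
    have e1: "a * cosh (a * t) * Im u * D t - sinh (a * t) * Im u * D' = a * Im u"
      using hyperbolic_pythagoras[of "a * t"] unfolding D_def D'_def
      by (simp add: algebra_simps power2_eq_square)
    have "(Im u)\<^sup>2 + (sinh (a * t) - cosh (a * t) * Re u)\<^sup>2 = (D t)\<^sup>2"
      unfolding D_def by (rule squares_hyperbolic_aux) (use norm_one_squares[OF u] hyperbolic_pythagoras[of "a * t"] in auto)
    then have "(a * Im u)\<^sup>2 + (D')\<^sup>2 = (a * D t)\<^sup>2"
      unfolding D'_def power_mult_distrib by (metis distrib_left)
    then have "sqrt ((a * Im u)\<^sup>2 + (- D')\<^sup>2) = a * D t"
      using a D by (simp add: real_sqrt_unique)
    moreover have "d = of_real (Im p / (D t)\<^sup>2) * Complex (a * Im u) (- D')"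
      unfolding d_def e1 by (simp add: complex_eq_iff)
    then have "cmod d = \<bar>Im p / (D t)\<^sup>2\<bar> * sqrt ((a * Im u)\<^sup>2 + (- D')\<^sup>2)"
      by (simp only: norm_mult norm_of_real complex_norm)
    ultimately show ?thesis using p D by (simp add: H2_def power2_eq_square)
  qed
  moreover have "Im (c t) = Im p / D t" using c[OF t] by (simp add: pol_def D_def)
  ultimately show ?thesis using p D by (simp add: hspeed_def H2_def)
qed

section \<open>The product of two planes: rays, boundary points and the cone topology\<close>

section \<open>Rays in the product\<close>

text \<open>Equality case of the triangle inequality in the Euclidean plane. The sum of the vectors
  \<alpha> and \<beta>, of lengths r and q, dominates d componentwise, while d already has length r
  + q. Nothing can be lost, and equality in Cauchy-Schwarz makes \<alpha> the fraction r / (r + q)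
  of d. This gives the constant speed of the components of a geodesic and the uniqueness of segments
  in the product.\<close>

lemma additive_pair:
  fixes \<alpha>1 \<alpha>2 \<beta>1 \<beta>2 d1 d2 r q :: real
  assumes nn: "d1 \<ge> 0" "d2 \<ge> 0"
    and tri: "d1 \<le> \<alpha>1 + \<beta>1" "d2 \<le> \<alpha>2 + \<beta>2"
    and r: "r \<ge> 0" "\<alpha>1\<^sup>2 + \<alpha>2\<^sup>2 = r\<^sup>2" and q: "q \<ge> 0" "\<beta>1\<^sup>2 + \<beta>2\<^sup>2 = q\<^sup>2"
    and d: "d1\<^sup>2 + d2\<^sup>2 = (r + q)\<^sup>2"
  shows "\<alpha>1 + \<beta>1 = d1" "\<alpha>2 + \<beta>2 = d2" "(r + q) * \<alpha>1 = r * d1" "(r + q) * \<alpha>2 = r * d2"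
proof -
  have "(\<alpha>1 * \<beta>1 + \<alpha>2 * \<beta>2)\<^sup>2 + (\<alpha>1 * \<beta>2 - \<alpha>2 * \<beta>1)\<^sup>2 = (\<alpha>1\<^sup>2 + \<alpha>2\<^sup>2) * (\<beta>1\<^sup>2 + \<beta>2\<^sup>2)"
    by (simp add: power2_eq_square algebra_simps)
  then have "(\<alpha>1 * \<beta>1 + \<alpha>2 * \<beta>2)\<^sup>2 \<le> (r * q)\<^sup>2"
    unfolding r q by (simp add: power_mult_distrib) (smt (verit) zero_le_power2)
  then have cs: "\<alpha>1 * \<beta>1 + \<alpha>2 * \<beta>2 \<le> r * q"
    by (rule power2_le_imp_le) (use r q in simp)
  have m1: "d1\<^sup>2 \<le> (\<alpha>1 + \<beta>1)\<^sup>2" and m2: "d2\<^sup>2 \<le> (\<alpha>2 + \<beta>2)\<^sup>2"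
    using nn tri by (simp_all add: power_mono)
  have e: "(\<alpha>1 + \<beta>1)\<^sup>2 + (\<alpha>2 + \<beta>2)\<^sup>2 = r\<^sup>2 + q\<^sup>2 + 2 * (\<alpha>1 * \<beta>1 + \<alpha>2 * \<beta>2)"
    using r(2) q(2) by (simp add: power2_eq_square algebra_simps)
  have rq: "(r + q)\<^sup>2 = r\<^sup>2 + q\<^sup>2 + 2 * (r * q)" by (simp add: power2_eq_square algebra_simps)
  have aux: "P \<le> X \<Longrightarrow> Q \<le> Y \<Longrightarrow> X + Y = W + 2 * A \<Longrightarrow> Z = W + 2 * B \<Longrightarrow> P + Q = Z \<Longrightarrow> A \<le> B \<Longrightarrow>
      X = P \<and> Y = Q \<and> A = B" for P Q X Y W Z A B :: real
    by linarith
  have "(\<alpha>1 + \<beta>1)\<^sup>2 = d1\<^sup>2" "(\<alpha>2 + \<beta>2)\<^sup>2 = d2\<^sup>2" and cs_eq: "\<alpha>1 * \<beta>1 + \<alpha>2 * \<beta>2 = r * q"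
    using aux[OF m1 m2 e rq d cs] by auto
  then show s1: "\<alpha>1 + \<beta>1 = d1" and s2: "\<alpha>2 + \<beta>2 = d2"
    using nn tri by (smt (verit) power2_eq_iff)+
  have "(q * \<alpha>1 - r * \<beta>1)\<^sup>2 + (q * \<alpha>2 - r * \<beta>2)\<^sup>2
      = q\<^sup>2 * (\<alpha>1\<^sup>2 + \<alpha>2\<^sup>2) + r\<^sup>2 * (\<beta>1\<^sup>2 + \<beta>2\<^sup>2) - 2 * (r * q) * (\<alpha>1 * \<beta>1 + \<alpha>2 * \<beta>2)"
    by (simp add: power2_eq_square algebra_simps)
  also have "\<dots> = 0" unfolding r q cs_eq by (simp add: power2_eq_square algebra_simps)
  finally have "q * \<alpha>1 = r * \<beta>1" "q * \<alpha>2 = r * \<beta>2" by (auto simp: sum_power2_eq_zero_iff)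
  then show "(r + q) * \<alpha>1 = r * d1" "(r + q) * \<alpha>2 = r * d2"
    using s1 s2 by (auto simp: algebra_simps)
qed

lemma HHdist_square: "(HHdist p q)\<^sup>2 = (hdist (fst p) (fst q))\<^sup>2 + (hdist (snd p) (snd q))\<^sup>2"
  by (simp add: HHdist_def)

lemma HHdist_commute: "HHdist p q = HHdist q p"
  by (simp add: HHdist_def hdist_commute)

lemma HH_iff: "p \<in> HH \<longleftrightarrow> fst p \<in> H2 \<and> snd p \<in> H2"
  by (cases p) (simp add: HH_def)

lemma HHdist_triangle:
  assumes "p \<in> HH" "q \<in> HH" "s \<in> HH"
  shows "HHdist p s \<le> HHdist p q + HHdist q s"
proof -
  have "HHdist p s \<le> sqrt ((hdist (fst p) (fst q) + hdist (fst q) (fst s))\<^sup>2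
      + (hdist (snd p) (snd q) + hdist (snd q) (snd s))\<^sup>2)"
    unfolding HHdist_def using assms
    by (intro real_sqrt_le_mono add_mono power_mono hdist_triangle hdist_nonneg) (auto simp: HH_iff)
  also have "\<dots> \<le> HHdist p q + HHdist q s"
    unfolding HHdist_def by (rule real_sqrt_sum_squares_triangle_ineq)
  finally show ?thesis .
qed

lemma hdist_le_HHdist:
  "hdist (fst p) (fst q) \<le> HHdist p q" "hdist (snd p) (snd q) \<le> HHdist p q"
  unfolding HHdist_def by (rule real_sqrt_sum_squares_ge1, rule real_sqrt_sum_squares_ge2)

lemma unit_ray_mem: "unit_ray \<gamma> \<Longrightarrow> t \<ge> 0 \<Longrightarrow> \<gamma> t \<in> HH"
  by (auto simp: unit_ray_def)

lemma asymptotic_sym: "asymptotic \<gamma> \<delta> \<Longrightarrow> asymptotic \<delta> \<gamma>"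
  by (simp add: asymptotic_def HHdist_commute)

lemma asymptotic_trans:
  assumes "unit_ray \<gamma>" "unit_ray \<delta>" "unit_ray \<epsilon>" "asymptotic \<gamma> \<delta>" "asymptotic \<delta> \<epsilon>"
  shows "asymptotic \<gamma> \<epsilon>"
proof -
  obtain C C' where C: "\<forall>t\<ge>0. HHdist (\<gamma> t) (\<delta> t) \<le> C" "\<forall>t\<ge>0. HHdist (\<delta> t) (\<epsilon> t) \<le> C'"
    using assms(4,5) unfolding asymptotic_def by blast
  have "HHdist (\<gamma> t) (\<epsilon> t) \<le> C + C'" if "t \<ge> 0" for t
    using HHdist_triangle[OF unit_ray_mem[OF assms(1) that] unit_ray_mem[OF assms(2) that] unit_ray_mem[OF assms(3) that]] C that
    by (meson add_mono order_trans)
  then show ?thesis unfolding asymptotic_def by blast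
qed

lemma asymptotic_refl:
  assumes "unit_ray \<gamma>"
  shows "asymptotic \<gamma> \<gamma>"
proof -
  have "HHdist (\<gamma> t) (\<gamma> t) \<le> 0" if "t \<ge> 0" for t
    using assms that by (simp add: unit_ray_def)
  then show ?thesis unfolding asymptotic_def by blast
qed

lemma ray_class_eqI:
  assumes "unit_ray \<gamma>" "unit_ray \<delta>" "asymptotic \<gamma> \<delta>"
  shows "ray_class \<gamma> = ray_class \<delta>"
  unfolding ray_class_def using assms asymptotic_sym asymptotic_trans by blast

text \<open>Rays issuing from (\<open>\<i>\<close>, \<open>\<i>\<close>). Each class at infinity
  contains exactly one of them, so speeds and directions serve as coordinates on the
  boundary.\<close>

definition base_ray :: "real \<Rightarrow> real \<Rightarrow> complex \<Rightarrow> complex \<Rightarrow> real \<Rightarrow> complex \<times> complex" where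
  "base_ray a1 a2 u1 u2 t = (pol (a1 * t) u1, pol (a2 * t) u2)"

definition ray_params :: "real \<Rightarrow> real \<Rightarrow> complex \<Rightarrow> complex \<Rightarrow> bool" where
  "ray_params a1 a2 u1 u2 \<longleftrightarrow> a1 \<ge> 0 \<and> a2 \<ge> 0 \<and> a1\<^sup>2 + a2\<^sup>2 = 1 \<and> norm u1 = 1 \<and> norm u2 = 1"

lemma unit_ray_base_ray:
  assumes "ray_params a1 a2 u1 u2"
  shows "unit_ray (base_ray a1 a2 u1 u2)"
proof -
  have p: "a1 \<ge> 0" "a2 \<ge> 0" "a1\<^sup>2 + a2\<^sup>2 = 1" "norm u1 = 1" "norm u2 = 1"
    using assms by (auto simp: ray_params_def)
  have "HHdist (base_ray a1 a2 u1 u2 s) (base_ray a1 a2 u1 u2 t) = \<bar>s - t\<bar>" for s t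
  proof -
    have "(a1 * s - a1 * t)\<^sup>2 + (a2 * s - a2 * t)\<^sup>2 = (a1\<^sup>2 + a2\<^sup>2) * (s - t)\<^sup>2"
      by (simp add: power2_eq_square algebra_simps)
    then show ?thesis
      using p by (simp add: HHdist_def base_ray_def hdist_pol_same)
  qed
  then show ?thesis using p by (auto simp: unit_ray_def base_ray_def HH_def pol_mem)
qed

text \<open>\<open>additive_pair\<close>, applied to three successive times, shows that each
  componentwise distance is additive and proportional to elapsed time; so both components are
  geodesics of constant speed.\<close>

lemma unit_ray_form:
  assumes "unit_ray \<gamma>"
  obtains a1 a2 u1 u2 where "ray_params a1 a2 u1 u2"
    "\<And>t. t \<ge> 0 \<Longrightarrow> \<gamma> t = (aff (fst (\<gamma> 0)) (pol (a1 * t) u1), aff (snd (\<gamma> 0)) (pol (a2 * t) u2))"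
proof -
  define d1 where "d1 = (\<lambda>s t. hdist (fst (\<gamma> s)) (fst (\<gamma> t)))"
  define d2 where "d2 = (\<lambda>s t. hdist (snd (\<gamma> s)) (snd (\<gamma> t)))"
  have mem: "fst (\<gamma> t) \<in> H2" "snd (\<gamma> t) \<in> H2" if "t \<ge> 0" for t
    using unit_ray_mem[OF assms that] by (auto simp: HH_iff)
  have sq: "(d1 s t)\<^sup>2 + (d2 s t)\<^sup>2 = (t - s)\<^sup>2" if "s \<ge> 0" "t \<ge> 0" for s t
  proof -
    have "HHdist (\<gamma> s) (\<gamma> t) = \<bar>s - t\<bar>" using assms that by (simp add: unit_ray_def)
    then show ?thesis using HHdist_square[of "\<gamma> s" "\<gamma> t"]
      by (simp add: d1_def d2_def power2_commute)
  qed
  have nn: "d1 s t \<ge> 0" "d2 s t \<ge> 0" if "s \<ge> 0" "t \<ge> 0" for s t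
    using mem that by (auto simp: d1_def d2_def intro: hdist_nonneg)
  have add: "d1 s t + d1 t w = d1 s w" "d2 s t + d2 t w = d2 s w"
      "(w - s) * d1 s t = (t - s) * d1 s w" "(w - s) * d2 s t = (t - s) * d2 s w"
    if "0 \<le> s" "s \<le> t" "t \<le> w" for s t w
  proof -
    have tri: "d1 s w \<le> d1 s t + d1 t w" "d2 s w \<le> d2 s t + d2 t w"
      using mem that by (auto simp: d1_def d2_def intro!: hdist_triangle)
    have "0 \<le> t" "0 \<le> w" using that by auto
    note A = additive_pair[OF nn(1)[of s w] nn(2)[of s w] tri _ sq[of s t] _ sq[of t w]]
    show "d1 s t + d1 t w = d1 s w" "d2 s t + d2 t w = d2 s w"
      "(w - s) * d1 s t = (t - s) * d1 s w" "(w - s) * d2 s t = (t - s) * d2 s w"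
      using A that sq[of s w] by auto
  qed
  define a1 where "a1 = d1 0 1"
  define a2 where "a2 = d2 0 1"
  have lin0: "d1 0 t = a1 * t" "d2 0 t = a2 * t" if "t \<ge> 0" for t
  proof -
    have "d1 0 t = a1 * t \<and> d2 0 t = a2 * t"
    proof (cases "t \<le> 1")
      case True
      then show ?thesis using add(3,4)[of 0 t 1] that by (simp add: a1_def a2_def mult.commute)
    next
      case False
      then show ?thesis using add(3,4)[of 0 1 t] by (simp add: a1_def a2_def mult.commute)
    qed
    then show "d1 0 t = a1 * t" "d2 0 t = a2 * t" by auto
  qed
  have lin1: "d1 s t = a1 * (t - s)" "d2 s t = a2 * (t - s)" if "0 \<le> s" "s \<le> t" for s t
    using add(1,2)[of 0 s t] lin0[of s] lin0[of t] that by (auto simp: algebra_simps)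
  have sym: "d1 s t = d1 t s" "d2 s t = d2 t s" for s t
    by (simp_all add: d1_def d2_def hdist_commute)
  have lin: "d1 s t = a1 * \<bar>s - t\<bar>" "d2 s t = a2 * \<bar>s - t\<bar>" if "s \<ge> 0" "t \<ge> 0" for s t
  proof -
    have "d1 s t = a1 * \<bar>s - t\<bar> \<and> d2 s t = a2 * \<bar>s - t\<bar>"
    proof (cases "s \<le> t")
      case True
      then show ?thesis using lin1[of s t] that by simp
    next
      case False
      then show ?thesis using lin1[of t s] sym[of s t] that by simp
    qed
    then show "d1 s t = a1 * \<bar>s - t\<bar>" "d2 s t = a2 * \<bar>s - t\<bar>" by auto
  qed
  have a: "a1 \<ge> 0" "a2 \<ge> 0" "a1\<^sup>2 + a2\<^sup>2 = 1"
    using nn[of 0 1] sq[of 0 1] by (auto simp: a1_def a2_def)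
  have g1: "\<And>t. t \<ge> 0 \<Longrightarrow> (fst \<circ> \<gamma>) t \<in> H2" "\<And>s t. s \<ge> 0 \<Longrightarrow> t \<ge> 0 \<Longrightarrow> hdist ((fst \<circ> \<gamma>) s) ((fst \<circ> \<gamma>) t) = a1 * \<bar>s - t\<bar>" "a1 \<ge> 0"
    and g2: "\<And>t. t \<ge> 0 \<Longrightarrow> (snd \<circ> \<gamma>) t \<in> H2" "\<And>s t. s \<ge> 0 \<Longrightarrow> t \<ge> 0 \<Longrightarrow> hdist ((snd \<circ> \<gamma>) s) ((snd \<circ> \<gamma>) t) = a2 * \<bar>s - t\<bar>" "a2 \<ge> 0"
    using mem lin a unfolding d1_def d2_def comp_def by blast+
  have "\<exists>u. norm u = 1 \<and> (\<forall>t\<ge>0. (fst \<circ> \<gamma>) t = aff ((fst \<circ> \<gamma>) 0) (pol (a1 * t) u))"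
  proof (rule geodesic_ray_form[OF g1])
    fix u assume A1: "norm u = 1" and A2: "\<And>t. t \<ge> 0 \<Longrightarrow> (fst \<circ> \<gamma>) t = aff ((fst \<circ> \<gamma>) 0) (pol (a1 * t) u)"
    show "\<exists>u. norm u = 1 \<and> (\<forall>t\<ge>0. (fst \<circ> \<gamma>) t = aff ((fst \<circ> \<gamma>) 0) (pol (a1 * t) u))"
      by (intro exI[of _ u] conjI allI impI A1 A2)
  qed
  then obtain u1 where u1: "norm u1 = 1" "\<forall>t\<ge>0. (fst \<circ> \<gamma>) t = aff ((fst \<circ> \<gamma>) 0) (pol (a1 * t) u1)"
    by blast
  have "\<exists>u. norm u = 1 \<and> (\<forall>t\<ge>0. (snd \<circ> \<gamma>) t = aff ((snd \<circ> \<gamma>) 0) (pol (a2 * t) u))"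
  proof (rule geodesic_ray_form[OF g2])
    fix u assume A1: "norm u = 1" and A2: "\<And>t. t \<ge> 0 \<Longrightarrow> (snd \<circ> \<gamma>) t = aff ((snd \<circ> \<gamma>) 0) (pol (a2 * t) u)"
    show "\<exists>u. norm u = 1 \<and> (\<forall>t\<ge>0. (snd \<circ> \<gamma>) t = aff ((snd \<circ> \<gamma>) 0) (pol (a2 * t) u))"
      by (intro exI[of _ u] conjI allI impI A1 A2)
  qed
  then obtain u2 where u2: "norm u2 = 1" "\<forall>t\<ge>0. (snd \<circ> \<gamma>) t = aff ((snd \<circ> \<gamma>) 0) (pol (a2 * t) u2)"
    by blast
  have eq: "\<gamma> t = (aff (fst (\<gamma> 0)) (pol (a1 * t) u1), aff (snd (\<gamma> 0)) (pol (a2 * t) u2))" if "t \<ge> 0" for t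
    using u1(2)[rule_format, OF that] u2(2)[rule_format, OF that] by (simp add: prod_eq_iff)
  have "ray_params a1 a2 u1 u2" using a u1(1) u2(1) by (simp add: ray_params_def)
  from that[OF this eq] show ?thesis .
qed

lemma coords_aff:
  assumes "p \<in> H2" "z \<in> H2"
  shows "cp (aff p z) = Im p * cp z + 2 * Re p * cq z + (Re p)\<^sup>2 / Im p * cr z"
    "cq (aff p z) = cq z + Re p / Im p * cr z" "cr (aff p z) = cr z / Im p"
  using assms unfolding cp_def cq_def cr_def cmod_power2
  by (auto simp: H2_def field_simps power2_eq_square)

lemma le_two_cosh: "d \<le> 2 * cosh (d::real)"
proof -
  have "d \<le> exp d" using exp_ge_add_one_self[of d] by linarith
  also have "\<dots> \<le> 2 * cosh d" by (simp add: cosh_def)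
  finally show ?thesis .
qed

text \<open>In light cone coordinates, a ray is \<open>L e\<^sup>\<tau> + l e\<^sup>-\<^sup>\<tau>\<close> with \<open>L\<close> on the light cone, and two rays are
  asymptotic as soon as their vectors \<open>L\<close> are proportional.\<close>

lemma asymptotic_base_direction:
  assumes p: "p \<in> H2" and u: "norm u = 1"
  obtains v C where "norm v = 1" "\<And>\<tau>. \<tau> \<ge> 0 \<Longrightarrow> hdist (aff p (pol \<tau> u)) (pol \<tau> v) \<le> C"
proof -
  define b where "b = Im p"
  define c where "c = Re p"
  have b: "b > 0" using p by (simp add: b_def H2_def)
  have uu: "(Im u)\<^sup>2 = 1 - (Re u)\<^sup>2" using norm_one_squares[OF u] by simp
  \<comment> \<open>Expanding cosh and sinh in \<open>coords_aff\<close> after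
    \<open>coords_pol\<close> gives these coefficients: upper case for exp \<tau>, lower case for
    exp (- \<tau>).\<close>
  define Lp where "Lp = b * (1 + Re u) / 2 + c * Im u + c\<^sup>2 / b * (1 - Re u) / 2"
  define Lq where "Lq = Im u / 2 + c / b * (1 - Re u) / 2"
  define Lr where "Lr = (1 - Re u) / (2 * b)"
  define lp where "lp = b * (1 - Re u) / 2 - c * Im u + c\<^sup>2 / b * (1 + Re u) / 2"
  define lq where "lq = - Im u / 2 + c / b * (1 + Re u) / 2"
  define lr where "lr = (1 + Re u) / (2 * b)"
  have null: "Lp * Lr = Lq\<^sup>2"
  proof -
    have "Lp * Lr - Lq\<^sup>2 = (1 - (Re u)\<^sup>2 - (Im u)\<^sup>2) / 4"
      using b by (simp add: Lp_def Lq_def Lr_def field_simps power2_eq_square)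
    then show ?thesis using uu by simp
  qed
  have Re_u: "\<bar>Re u\<bar> \<le> 1" using abs_Re_le_cmod[of u] u by simp
  have "Lr \<ge> 0" using Re_u b by (auto simp: Lr_def)
  \<comment> \<open>If Re u = 1 the endpoint is \<infinity> and Lr vanishes, but then Lp = b; in all
    other cases Lr is positive.\<close>
  have s: "Lp + Lr > 0"
  proof (cases "Re u = 1")
    case True
    then show ?thesis using b uu by (simp add: Lp_def Lr_def)
  next
    case False
    then have "Lr > 0" using Re_u b by (auto simp: Lr_def)
    moreover from this null have "Lp \<ge> 0" by (metis zero_le_power2 zero_le_mult_iff less_eq_real_def not_less)
    ultimately show ?thesis by simp
  qed
  define s where "s = Lp + Lr"
  \<comment> \<open>Chosen so that the leading null vector of \<open>pol \<tau> v\<close> is L / s;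
    the two rays then share their point at infinity.\<close>
  define v where "v = Complex ((Lp - Lr) / s) (2 * Lq / s)"
  have s0: "s > 0" using s by (simp add: s_def)
  have "(Lp - Lr)\<^sup>2 + (2 * Lq)\<^sup>2 = s\<^sup>2"
    using null by (simp add: s_def power2_eq_square algebra_simps)
  then have "((Lp - Lr) / s)\<^sup>2 + (2 * Lq / s)\<^sup>2 = 1"
    using s0 by (simp add: power_divide add_divide_distrib[symmetric])
  then have v: "norm v = 1" by (simp add: v_def complex_norm)
  have v1: "(1 + Re v) / 2 = Lp / s" "(1 - Re v) / 2 = Lr / s" "Im v / 2 = Lq / s"
    using s0 by (auto simp: v_def s_def field_simps)
  define B where "B = (Lp * Lp / s + lp * Lr / s + Lr * Lr / s + lr * Lp / s) / 2 - (- Lq * Lq / s + lq * Lq / s)"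
  define C where "C = (lp * Lp / s + lr * Lr / s) / 2 + lq * Lq / s"
  have bound: "cosh (hdist (aff p (pol \<tau> u)) (pol \<tau> v)) = B + C * exp (- \<tau>) ^ 2" for \<tau>
  proof -
    define E where "E = exp \<tau>"
    define F where "F = exp (- \<tau>)"
    have EF: "E * F = 1" by (simp add: E_def F_def exp_minus)
    have cs: "cosh \<tau> = (E + F) / 2" "sinh \<tau> = (E - F) / 2"
      by (auto simp: cosh_def sinh_def E_def F_def scaleR_conv_of_real)
    have c1: "cp (aff p (pol \<tau> u)) = Lp * E + lp * F" "cq (aff p (pol \<tau> u)) = Lq * E + lq * F"
      "cr (aff p (pol \<tau> u)) = Lr * E + lr * F"
      using b unfolding coords_aff[OF p pol_mem[OF u]] coords_pol[OF u] cs b_def[symmetric] c_def[symmetric]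
      by (simp_all add: Lp_def Lq_def Lr_def lp_def lq_def lr_def field_simps)
    have c2: "cp (pol \<tau> v) = Lp / s * E + Lr / s * F" "cq (pol \<tau> v) = Lq / s * E - Lq / s * F"
      "cr (pol \<tau> v) = Lr / s * E + Lp / s * F"
      unfolding coords_pol[OF v] cs v1[symmetric] by (simp_all add: field_simps)
    have "cosh (hdist (aff p (pol \<tau> u)) (pol \<tau> v)) =
        ((Lp * E + lp * F) * (Lr / s * E + Lp / s * F) + (Lr * E + lr * F) * (Lp / s * E + Lr / s * F)) / 2
        - (Lq * E + lq * F) * (Lq / s * E - Lq / s * F)"
      using p u v by (simp add: cosh_hdist aff_mem pol_mem c1 c2)
    \<comment> \<open>The coefficient of the growing term E^2 is the null form of L with itself and
      vanishes, so the distance stays bounded.\<close>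
    also have "\<dots> = (Lp * Lr - Lq\<^sup>2) / s * E\<^sup>2 + B * (E * F) + C * F\<^sup>2"
      using s0 by (simp add: B_def C_def field_simps power2_eq_square)
    finally show ?thesis using null EF by (simp add: F_def)
  qed
  have "hdist (aff p (pol \<tau> u)) (pol \<tau> v) \<le> 2 * (\<bar>B\<bar> + \<bar>C\<bar>)" if "\<tau> \<ge> 0" for \<tau>
  proof -
    have "exp (- \<tau>) ^ 2 \<le> 1" using that by (simp add: power_le_one)
    then have "\<bar>C\<bar> * exp (- \<tau>) ^ 2 \<le> \<bar>C\<bar>" by (rule mult_left_le) simp
    moreover have "C * exp (- \<tau>) ^ 2 \<le> \<bar>C\<bar> * exp (- \<tau>) ^ 2" by (intro mult_right_mono) auto
    ultimately have "B + C * exp (- \<tau>) ^ 2 \<le> \<bar>B\<bar> + \<bar>C\<bar>" by linarith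
    then have "2 * (B + C * exp (- \<tau>) ^ 2) \<le> 2 * (\<bar>B\<bar> + \<bar>C\<bar>)" by (rule mult_left_mono) simp
    then show ?thesis
      using le_two_cosh[of "hdist (aff p (pol \<tau> u)) (pol \<tau> v)"] unfolding bound by (rule order_trans[rotated])
  qed
  then show ?thesis using that[OF v] by blast
qed

lemma asymptotic_base_ray:
  assumes \<gamma>: "unit_ray \<gamma>" and a: "ray_params a1 a2 u1 u2"
    and form: "\<And>t. t \<ge> 0 \<Longrightarrow> \<gamma> t = (aff (fst (\<gamma> 0)) (pol (a1 * t) u1), aff (snd (\<gamma> 0)) (pol (a2 * t) u2))"
  obtains v1 v2 where "ray_params a1 a2 v1 v2" "ray_class \<gamma> = ray_class (base_ray a1 a2 v1 v2)"
proof -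
  have p: "a1 \<ge> 0" "a2 \<ge> 0" "norm u1 = 1" "norm u2 = 1" using a by (auto simp: ray_params_def)
  have mem: "fst (\<gamma> 0) \<in> H2" "snd (\<gamma> 0) \<in> H2" using unit_ray_mem[OF \<gamma>, of 0] by (auto simp: HH_iff)
  obtain v1 C1 where v1: "norm v1 = 1" "\<And>\<tau>. \<tau> \<ge> 0 \<Longrightarrow> hdist (aff (fst (\<gamma> 0)) (pol \<tau> u1)) (pol \<tau> v1) \<le> C1"
    using asymptotic_base_direction[OF mem(1) p(3)] by blast
  obtain v2 C2 where v2: "norm v2 = 1" "\<And>\<tau>. \<tau> \<ge> 0 \<Longrightarrow> hdist (aff (snd (\<gamma> 0)) (pol \<tau> u2)) (pol \<tau> v2) \<le> C2"
    using asymptotic_base_direction[OF mem(2) p(4)] by blast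
  have v: "ray_params a1 a2 v1 v2" using a v1 v2 by (simp add: ray_params_def)
  have "HHdist (\<gamma> t) (base_ray a1 a2 v1 v2 t) \<le> C1 + C2" if t: "t \<ge> 0" for t
  proof -
    have nn: "hdist (aff (fst (\<gamma> 0)) (pol (a1 * t) u1)) (pol (a1 * t) v1) \<ge> 0"
      "hdist (aff (snd (\<gamma> 0)) (pol (a2 * t) u2)) (pol (a2 * t) v2) \<ge> 0"
      using mem p v1 v2 by (auto intro!: hdist_nonneg aff_mem pol_mem)
    have "HHdist (\<gamma> t) (base_ray a1 a2 v1 v2 t) \<le>
      hdist (aff (fst (\<gamma> 0)) (pol (a1 * t) u1)) (pol (a1 * t) v1) + hdist (aff (snd (\<gamma> 0)) (pol (a2 * t) u2)) (pol (a2 * t) v2)"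
      unfolding HHdist_def base_ray_def form[OF t] fst_conv snd_conv by (rule sqrt_sum_squares_le_sum[OF nn])
    also have "\<dots> \<le> C1 + C2" using v1(2)[of "a1 * t"] v2(2)[of "a2 * t"] p t by auto
    finally show ?thesis .
  qed
  then have "asymptotic \<gamma> (base_ray a1 a2 v1 v2)" unfolding asymptotic_def by blast
  then show ?thesis using that[OF v] ray_class_eqI[OF \<gamma> unit_ray_base_ray[OF v]] by blast
qed

lemma half_le_sinh:
  assumes "x \<ge> (0::real)"
  shows "x / 2 \<le> sinh x"
proof -
  have "exp (- x) \<le> 1" "exp x \<ge> 1 + x" using assms by auto
  then have "x \<le> exp x - exp (- x)" by linarith
  then show ?thesis by (simp add: sinh_def)
qed

text \<open>The triangle inequality forces equal speeds. Two rays of the same positive speed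
  separate like sinh^2 times 1 minus the cosine of their angle, so boundedness forces the angle
  0.\<close>

lemma hdist_pol_bounded:
  assumes u: "norm u = 1" and v: "norm v = 1" and ab: "a \<ge> 0" "b \<ge> 0"
    and bd: "\<And>t. t \<ge> 0 \<Longrightarrow> hdist (pol (a * t) u) (pol (b * t) v) \<le> C"
  shows "a = b" "pol (a * t) u = pol (b * t) v"
proof -
  have C: "C \<ge> 0" using bd[of 0] by (simp add: hdist_refl)
  have ge: "\<bar>a - b\<bar> * t \<le> C" if t: "t \<ge> 0" for t
  proof -
    let ?x = "pol (a * t) u" and ?y = "pol (b * t) v"
    have mem: "?x \<in> H2" "?y \<in> H2" using u v by (auto intro: pol_mem)
    have "hdist \<i> ?x = a * t" "hdist \<i> ?y = b * t" using u v ab t by (auto intro!: hdist_ii_pol)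
    then have "\<bar>a * t - b * t\<bar> \<le> hdist ?x ?y"
      using hdist_triangle[OF ii_mem mem] hdist_triangle[OF ii_mem mem(2) mem(1)] hdist_commute[of ?x ?y] by linarith
    moreover have "\<bar>a * t - b * t\<bar> = \<bar>a - b\<bar> * t" using t by (simp add: left_diff_distrib[symmetric] abs_mult)
    ultimately show ?thesis using bd[OF t] by linarith
  qed
  show eq: "a = b"
  proof (rule ccontr)
    assume "a \<noteq> b"
    then have "\<bar>a - b\<bar> * ((C + 1) / \<bar>a - b\<bar>) = C + 1" by simp
    moreover have "(C + 1) / \<bar>a - b\<bar> \<ge> 0" using C by simp
    ultimately show False using ge[of "(C + 1) / \<bar>a - b\<bar>"] by linarith
  qed
  show "pol (a * t) u = pol (b * t) v"
  proof (cases "a = 0")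
    case True
    then show ?thesis using eq by simp
  next
    case False
    then have a: "a > 0" using ab by simp
    define k where "k = 1 - Re (u * cnj v)"
    have k0: "k \<ge> 0" using unit_Re_mult_cnj(1)[OF u v] by (simp add: k_def abs_le_iff)
    have le: "(a * t / 2)\<^sup>2 * k \<le> cosh C" if t: "t \<ge> 0" for t
    proof -
      let ?d = "hdist (pol (a * t) u) (pol (a * t) v)"
      have "cosh ?d = 1 + (sinh (a * t))\<^sup>2 * k"
        using hyperbolic_pythagoras[of "a * t"]
        by (simp add: cosh_hdist_pol[OF u v] k_def algebra_simps power2_eq_square)
      moreover have "cosh ?d \<le> cosh C"
        using bd[OF t] eq C u v by (subst cosh_real_nonneg_le_iff) (auto intro: hdist_nonneg pol_mem)
      moreover have "(a * t / 2)\<^sup>2 * k \<le> (sinh (a * t))\<^sup>2 * k"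
        using a t k0 by (intro mult_right_mono power_mono half_le_sinh) auto
      ultimately show ?thesis by simp
    qed
    have "k = 0"
    proof (rule ccontr)
      assume "k \<noteq> 0"
      then have k: "k > 0" using k0 by simp
      \<comment> \<open>At time 2 m / a the lower bound is m^2 k, which is at least m k; this m
        makes m k exceed cosh C.\<close>
      define m where "m = (cosh C + 1) / k + 1"
      have m: "m \<ge> 1" using k by (simp add: m_def add_nonneg_nonneg)
      have "(a * (2 * m / a) / 2)\<^sup>2 * k \<le> cosh C" using m a by (intro le) simp
      then have "m\<^sup>2 * k \<le> cosh C" using a by simp
      moreover have "m * k \<le> m\<^sup>2 * k" using m k by (simp add: power2_eq_square)
      moreover have "m * k = cosh C + 1 + k" using k by (simp add: m_def field_simps)
      ultimately show False using k by linarith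
    qed
    then have "u = v" using unit_Re_mult_cnj(2)[OF u v] by (simp add: k_def)
    then show ?thesis using eq by simp
  qed
qed

lemma base_ray_asymptotic_unique:
  assumes a: "ray_params a1 a2 u1 u2" and b: "ray_params b1 b2 v1 v2"
    and as: "asymptotic (base_ray a1 a2 u1 u2) (base_ray b1 b2 v1 v2)"
  shows "base_ray a1 a2 u1 u2 t = base_ray b1 b2 v1 v2 t"
proof -
  obtain C where C: "\<And>t. t \<ge> 0 \<Longrightarrow> HHdist (base_ray a1 a2 u1 u2 t) (base_ray b1 b2 v1 v2 t) \<le> C"
    using as unfolding asymptotic_def by blast
  have "hdist (pol (a1 * t) u1) (pol (b1 * t) v1) \<le> C" "hdist (pol (a2 * t) u2) (pol (b2 * t) v2) \<le> C" if "t \<ge> 0" for t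
    using hdist_le_HHdist[of "base_ray a1 a2 u1 u2 t" "base_ray b1 b2 v1 v2 t"] C[OF that]
    by (auto simp: base_ray_def)
  then show ?thesis
    using hdist_pol_bounded(2)[of u1 v1 a1 b1 C t] hdist_pol_bounded(2)[of u2 v2 a2 b2 C t] a b
    by (auto simp: ray_params_def base_ray_def)
qed

text \<open>A class contains only one ray from the base point, so the definite description in
  \<open>radial\<close> has a unique solution.\<close>

lemma radial_boundary:
  assumes a: "ray_params a1 a2 u1 u2" and r: "r \<ge> 0"
  shows "radial (\<i>, \<i>) r (Inr (ray_class (base_ray a1 a2 u1 u2))) = base_ray a1 a2 u1 u2 r"
proof -
  let ?b = "base_ray a1 a2 u1 u2"
  have "(THE p. \<exists>\<gamma>\<in>ray_class ?b. \<gamma> 0 = (\<i>, \<i>) \<and> p = \<gamma> r) = ?b r"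
  proof (rule the_equality)
    show "\<exists>\<gamma>\<in>ray_class ?b. \<gamma> 0 = (\<i>, \<i>) \<and> ?b r = \<gamma> r"
      using unit_ray_base_ray[OF a] asymptotic_refl[OF unit_ray_base_ray[OF a]]
      by (intro bexI[of _ ?b]) (auto simp: ray_class_def base_ray_def)
  next
    fix p assume "\<exists>\<gamma>\<in>ray_class ?b. \<gamma> 0 = (\<i>, \<i>) \<and> p = \<gamma> r"
    then obtain \<gamma> where \<gamma>: "unit_ray \<gamma>" "asymptotic ?b \<gamma>" "\<gamma> 0 = (\<i>, \<i>)" "p = \<gamma> r"
      by (auto simp: ray_class_def)
    obtain b1 b2 v1 v2 where b: "ray_params b1 b2 v1 v2"
      "\<And>t. t \<ge> 0 \<Longrightarrow> \<gamma> t = (aff (fst (\<gamma> 0)) (pol (b1 * t) v1), aff (snd (\<gamma> 0)) (pol (b2 * t) v2))"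
      using unit_ray_form[OF \<gamma>(1)] by blast
    have aff_i: "aff \<i> z = z" for z by (simp add: aff_def)
    have eq: "\<gamma> t = base_ray b1 b2 v1 v2 t" if "t \<ge> 0" for t
      using b(2)[OF that] by (simp add: \<gamma>(3) aff_i base_ray_def)
    then have "asymptotic ?b (base_ray b1 b2 v1 v2)" using \<gamma>(2) by (simp add: asymptotic_def)
    from base_ray_asymptotic_unique[OF a b(1) this] show "p = ?b r" using \<gamma>(4) eq[OF r] by simp
  qed
  then show ?thesis by (simp add: radial_def)
qed

text \<open>A point that splits the distance in the product splits both components in the same
  ratio, by the equality case \<open>additive_pair\<close>. So the point on the segment is unique
  and is found by scaling both radii.\<close>

lemma radial_interior:
  assumes x: "x = (pol d1 u1, pol d2 u2)" and d: "d1 \<ge> 0" "d2 \<ge> 0" and u: "norm u1 = 1" "norm u2 = 1"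
    and D: "D = sqrt (d1\<^sup>2 + d2\<^sup>2)" and r: "0 \<le> r" "r < D"
  shows "radial (\<i>, \<i>) r (Inl x) = (pol (r * d1 / D) u1, pol (r * d2 / D) u2)"
proof -
  have HHx: "HHdist (\<i>, \<i>) x = D"
    using d u by (simp add: HHdist_def x D hdist_ii_pol)
  have Dsq: "d1\<^sup>2 + d2\<^sup>2 = D\<^sup>2" and D0: "D > 0" using r by (auto simp only: D real_sqrt_pow2 sum_power2_ge_zero)
  let ?p = "(pol (r * d1 / D) u1, pol (r * d2 / D) u2)"
  have e: "r * d1 / D - d1 = - ((D - r) / D * d1)" "r * d2 / D - d2 = - ((D - r) / D * d2)"
    using D0 by (auto simp: field_simps)
  have "(r * d1 / D)\<^sup>2 + (r * d2 / D)\<^sup>2 = (r / D)\<^sup>2 * (d1\<^sup>2 + d2\<^sup>2)"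
    by (simp add: power_mult_distrib power_divide add_divide_distrib distrib_left)
  also have "\<dots> = r\<^sup>2" unfolding Dsq using D0 by (simp add: power_divide)
  finally have n1: "sqrt ((r * d1 / D)\<^sup>2 + (r * d2 / D)\<^sup>2) = r" using r by simp
  have "((D - r) / D * d1)\<^sup>2 + ((D - r) / D * d2)\<^sup>2 = ((D - r) / D)\<^sup>2 * (d1\<^sup>2 + d2\<^sup>2)"
    by (simp add: power_mult_distrib power_divide add_divide_distrib distrib_left)
  also have "\<dots> = (D - r)\<^sup>2" unfolding Dsq using D0 by (simp add: power_divide)
  finally have n2: "sqrt (((D - r) / D * d1)\<^sup>2 + ((D - r) / D * d2)\<^sup>2) = D - r" using r by simp
  have "(THE p. p \<in> HH \<and> HHdist (\<i>, \<i>) p = r \<and> HHdist p x = D - r) = ?p"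
  proof (rule the_equality)
    have "HHdist (\<i>, \<i>) ?p = r"
      using d u r D0 n1 by (simp add: HHdist_def hdist_ii_pol)
    moreover have "HHdist ?p x = D - r"
      unfolding HHdist_def x fst_conv snd_conv hdist_pol_same[OF u(1)] hdist_pol_same[OF u(2)] e abs_minus_cancel power2_abs
      by (rule n2)
    ultimately show "?p \<in> HH \<and> HHdist (\<i>, \<i>) ?p = r \<and> HHdist ?p x = D - r"
      using u by (simp add: HH_def pol_mem)
  next
    fix p assume p: "p \<in> HH \<and> HHdist (\<i>, \<i>) p = r \<and> HHdist p x = D - r"
    then have mem: "fst p \<in> H2" "snd p \<in> H2" by (auto simp: HH_iff)
    define \<alpha>1 where "\<alpha>1 = hdist \<i> (fst p)"
    define \<alpha>2 where "\<alpha>2 = hdist \<i> (snd p)"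
    define \<beta>1 where "\<beta>1 = hdist (fst p) (pol d1 u1)"
    define \<beta>2 where "\<beta>2 = hdist (snd p) (pol d2 u2)"
    have t: "d1 \<le> \<alpha>1 + \<beta>1" "d2 \<le> \<alpha>2 + \<beta>2"
      using hdist_triangle[OF ii_mem mem(1) pol_mem[OF u(1)], of d1] hdist_triangle[OF ii_mem mem(2) pol_mem[OF u(2)], of d2]
        hdist_ii_pol u d by (auto simp: \<alpha>1_def \<alpha>2_def \<beta>1_def \<beta>2_def)
    have s: "\<alpha>1\<^sup>2 + \<alpha>2\<^sup>2 = r\<^sup>2" "\<beta>1\<^sup>2 + \<beta>2\<^sup>2 = (D - r)\<^sup>2"
      using HHdist_square[of "(\<i>, \<i>)" p] HHdist_square[of p x] p
      by (auto simp: \<alpha>1_def \<alpha>2_def \<beta>1_def \<beta>2_def x)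
    have nn: "\<beta>1 \<ge> 0" "\<beta>2 \<ge> 0" using mem u by (auto simp: \<beta>1_def \<beta>2_def intro: hdist_nonneg pol_mem)
    have Dr: "D - r \<ge> 0" "d1\<^sup>2 + d2\<^sup>2 = (r + (D - r))\<^sup>2" using r Dsq by auto
    note A = additive_pair[OF d t r(1) s(1) Dr(1) s(2) Dr(2)]
    have "\<alpha>1 = r * d1 / D" "\<alpha>2 = r * d2 / D" using A(3,4) D0 by (auto simp: field_simps)
    moreover have "fst p = pol \<alpha>1 u1"
      unfolding \<alpha>1_def by (rule segment_unique[OF u(1) mem(1), of d1]) (use A(1) nn in \<open>auto simp: \<alpha>1_def \<beta>1_def\<close>)
    moreover have "snd p = pol \<alpha>2 u2"
      unfolding \<alpha>2_def by (rule segment_unique[OF u(2) mem(2), of d2]) (use A(2) nn in \<open>auto simp: \<alpha>2_def \<beta>2_def\<close>)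
    ultimately show "p = ?p" by (simp add: prod_eq_iff)
  qed
  then show ?thesis using HHx r by (simp add: radial_def)
qed

section \<open>The cone topology\<close>

lemma tendsto_pol:
  assumes "(t \<longlongrightarrow> t0) F" "(u \<longlongrightarrow> u0) F" "norm u0 = 1"
  shows "((\<lambda>n. pol (t n) (u n)) \<longlongrightarrow> pol t0 u0) F"
proof -
  have s: "((\<lambda>n. sinh (t n)) \<longlongrightarrow> sinh t0) F" and c: "((\<lambda>n. cosh (t n)) \<longlongrightarrow> cosh t0) F"
    by (rule tendsto_sinh[OF assms(1)], rule tendsto_cosh[OF assms(1)])
  have d: "((\<lambda>n. cosh (t n) - sinh (t n) * Re (u n)) \<longlongrightarrow> cosh t0 - sinh t0 * Re u0) F"
    by (rule tendsto_diff[OF c tendsto_mult[OF s tendsto_Re[OF assms(2)]]])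
  have d0: "cosh t0 - sinh t0 * Re u0 \<noteq> 0" using pol_denominator_pos[OF assms(3), of t0] by simp
  show ?thesis
    unfolding pol_def
    by (rule tendsto_Complex[OF tendsto_divide[OF tendsto_mult[OF s tendsto_Im[OF assms(2)]] d d0] tendsto_divide[OF tendsto_const d d0]])
qed

lemma topspace_cone_topology: "topspace cone_topology = HH <+> geom_boundary"
proof -
  have "HH <+> geom_boundary \<in> {{\<xi> \<in> HH <+> geom_boundary. radial (\<i>, \<i>) r \<xi> \<in> U} | r U. r \<ge> 0 \<and> open U}"
    by (rule CollectI, rule exI[of _ 0], rule exI[of _ UNIV]) simp
  then show ?thesis unfolding cone_topology_def topology_generated_by_topspace by blast
qed

lemma base_ray_class_mem: "ray_params a1 a2 u1 u2 \<Longrightarrow> ray_class (base_ray a1 a2 u1 u2) \<in> geom_boundary"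
  by (auto simp: geom_boundary_def intro: unit_ray_base_ray)

text \<open>The cone topology is given by a subbasis, so convergence of all radial images suffices:
  eventual membership passes to finite intersections and unions by induction on the generation of
  open sets.\<close>

lemma cone_closure_sequence:
  assumes a: "ray_params a1 a2 u1 u2" and B: "B \<subseteq> HH <+> geom_boundary" and X: "\<And>n. X n \<in> B"
    and rad: "\<And>r. r \<ge> 0 \<Longrightarrow> (\<lambda>n. radial (\<i>, \<i>) r (X n)) \<longlonglongrightarrow> base_ray a1 a2 u1 u2 r"
  shows "Inr (ray_class (base_ray a1 a2 u1 u2)) \<in> cone_topology closure_of B"
proof -
  let ?\<xi> = "Inr (ray_class (base_ray a1 a2 u1 u2)) :: bordification_pt"
  define S where "S = {{\<xi> \<in> HH <+> geom_boundary. radial (\<i>, \<i>) r \<xi> \<in> U} | r U. r \<ge> 0 \<and> open U}"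
  have "\<forall>\<^sub>F n in sequentially. X n \<in> T" if "generate_topology_on S T" "?\<xi> \<in> T" for T
    using that
  proof (induction rule: generate_topology_on.induct)
    case Empty
    then show ?case by simp
  next
    case (Int a b)
    then show ?case by (auto intro: eventually_conj)
  next
    case (UN K)
    then obtain k where k: "k \<in> K" "?\<xi> \<in> k" by blast
    with UN have "\<forall>\<^sub>F n in sequentially. X n \<in> k" by blast
    then show ?case by eventually_elim (use k in blast)
  next
    case (Basis s)
    then obtain r U where s: "s = {\<xi> \<in> HH <+> geom_boundary. radial (\<i>, \<i>) r \<xi> \<in> U}" "r \<ge> 0" "open U"
      by (auto simp: S_def)
    have "base_ray a1 a2 u1 u2 r \<in> U" using Basis s radial_boundary[OF a s(2)] by auto
    from topological_tendstoD[OF rad[OF s(2)] s(3) this]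
    show ?case by eventually_elim (use s X B in auto)
  qed
  moreover have "openin cone_topology T \<Longrightarrow> generate_topology_on S T" for T
    unfolding cone_topology_def S_def by (rule openin_topology_generated_by)
  ultimately have "\<exists>y\<in>B. y \<in> T" if "openin cone_topology T" "?\<xi> \<in> T" for T
    using that X eventually_happens'[OF sequentially_bot] by metis
  moreover have "?\<xi> \<in> topspace cone_topology"
    unfolding topspace_cone_topology using base_ray_class_mem[OF a] by blast
  ultimately show ?thesis unfolding in_closure_of by blast
qed

lemma tendsto_base_ray:
  assumes "ray_params a1 a2 u1 u2"
    and "(b1 \<longlongrightarrow> a1) F" "(b2 \<longlongrightarrow> a2) F" "(v1 \<longlongrightarrow> u1) F" "(v2 \<longlongrightarrow> u2) F"
  shows "((\<lambda>n. base_ray (b1 n) (b2 n) (v1 n) (v2 n) r) \<longlongrightarrow> base_ray a1 a2 u1 u2 r) F"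
  unfolding base_ray_def using assms
  by (intro tendsto_Pair tendsto_pol tendsto_mult tendsto_const) (auto simp: ray_params_def)

lemma cone_closure_interior_limit:
  assumes a: "ray_params a1 a2 u1 u2" and B: "B \<subseteq> HH"
    and X: "\<And>n. X n \<in> B" "\<And>n. X n = (pol (d1 n) (v1 n), pol (d2 n) (v2 n))"
    and d: "\<And>n. d1 n \<ge> 0" "\<And>n. d2 n \<ge> 0" "\<And>n. norm (v1 n) = 1" "\<And>n. norm (v2 n) = 1"
    and D: "\<And>n. D n = sqrt ((d1 n)\<^sup>2 + (d2 n)\<^sup>2)" "filterlim D at_top sequentially"
    and lim: "(\<lambda>n. d1 n / D n) \<longlonglongrightarrow> a1" "(\<lambda>n. d2 n / D n) \<longlonglongrightarrow> a2" "v1 \<longlonglongrightarrow> u1" "v2 \<longlonglongrightarrow> u2"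
  shows "Inr (ray_class (base_ray a1 a2 u1 u2)) \<in> cone_topology closure_of (Inl ` B)"
proof (rule cone_closure_sequence[OF a])
  show "Inl ` B \<subseteq> HH <+> geom_boundary" using B by auto
  show "Inl (X n) \<in> Inl ` B" for n using X by blast
  fix r :: real assume r: "r \<ge> 0"
  have "\<forall>\<^sub>F n in sequentially. base_ray (d1 n / D n) (d2 n / D n) (v1 n) (v2 n) r = radial (\<i>, \<i>) r (Inl (X n))"
    using filterlim_at_top_dense[THEN iffD1, OF D(2), rule_format, of r]
  proof eventually_elim
    case (elim n)
    from radial_interior[OF X(2) d D(1) r elim] show ?case by (simp add: base_ray_def mult.commute)
  qed
  from Lim_transform_eventually[OF tendsto_base_ray[OF a lim] this]
  show "(\<lambda>n. radial (\<i>, \<i>) r (Inl (X n))) \<longlonglongrightarrow> base_ray a1 a2 u1 u2 r" .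
qed

text \<open>Idempotence of the closure replaces a diagonal choice among sequences of orbit
  points.\<close>

lemma cone_closure_boundary_limit:
  assumes a: "ray_params a1 a2 u1 u2" and b: "\<And>n. ray_params (b1 n) (b2 n) (v1 n) (v2 n)"
    and cl: "\<And>n. Inr (ray_class (base_ray (b1 n) (b2 n) (v1 n) (v2 n))) \<in> cone_topology closure_of B"
    and lim: "b1 \<longlonglongrightarrow> a1" "b2 \<longlonglongrightarrow> a2" "v1 \<longlonglongrightarrow> u1" "v2 \<longlonglongrightarrow> u2"
  shows "Inr (ray_class (base_ray a1 a2 u1 u2)) \<in> cone_topology closure_of B"
proof -
  have "Inr (ray_class (base_ray a1 a2 u1 u2)) \<in> cone_topology closure_of (cone_topology closure_of B)"
  proof (rule cone_closure_sequence[OF a _ cl])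
    show "cone_topology closure_of B \<subseteq> HH <+> geom_boundary"
      using closure_of_subset_topspace[of cone_topology B] by (simp only: topspace_cone_topology)
    fix r :: real assume "r \<ge> 0"
    then show "(\<lambda>n. radial (\<i>, \<i>) r (Inr (ray_class (base_ray (b1 n) (b2 n) (v1 n) (v2 n))))) \<longlonglongrightarrow> base_ray a1 a2 u1 u2 r"
      using tendsto_base_ray[OF a lim] by (simp add: radial_boundary[OF b])
  qed
  then show ?thesis by simp
qed

lemma open_H2: "open H2"
  unfolding H2_def by (intro open_Collect_less continuous_intros)

lemma continuous_on_hdist_ii: "continuous_on H2 (hdist \<i>)"
proof -
  have "continuous_on H2 (\<lambda>z. 1 + (cmod (\<i> - z))\<^sup>2 / (2 * Im \<i> * Im z))"
    by (intro continuous_intros) (auto simp: H2_def)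
  then show ?thesis
    unfolding hdist_def by (rule continuous_on_compose2[OF continuous_on_arcosh[OF order_refl]])
      (use hdist_arg_ge_1[OF ii_mem] in auto)
qed

text \<open>A comparison of distances with an additive error survives at infinity as a comparison of
  speeds, since a fixed error is negligible far out.\<close>

lemma cone_closure_slope:
  assumes a: "ray_params a1 a2 u1 u2" and B: "B \<subseteq> HH" and C: "C \<ge> 0"
    and bd: "\<And>x. x \<in> B \<Longrightarrow> hdist \<i> (snd x) \<le> hdist \<i> (fst x) + C"
    and cl: "Inr (ray_class (base_ray a1 a2 u1 u2)) \<in> cone_topology closure_of (Inl ` B)"
  shows "a2 \<le> a1"
proof (rule ccontr)
  assume "\<not> a2 \<le> a1"
  then have gap: "a2 - a1 > 0" by simp
  \<comment> \<open>At this radius the two components of a ray with forbidden slope have distances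
    differing by C + 1, just beyond the error C. The open set U records a difference above
    C.\<close>
  define r where "r = (C + 1) / (a2 - a1)"
  have r: "r \<ge> 0" using gap C by (simp add: r_def)
  have a': "a1 \<ge> 0" "a2 \<ge> 0" "norm u1 = 1" "norm u2 = 1" using a by (auto simp: ray_params_def)
  define U where "U = {p \<in> H2 \<times> H2. hdist \<i> (snd p) - hdist \<i> (fst p) \<in> {C<..}}"
  have "continuous_on (H2 \<times> H2) (\<lambda>p. hdist \<i> (snd p) - hdist \<i> (fst p))"
    by (intro continuous_on_diff continuous_on_compose2[OF continuous_on_hdist_ii] continuous_on_snd continuous_on_fst continuous_on_id) auto
  then have "open U"
    unfolding U_def by (rule continuous_open_preimage[unfolded vimage_def Int_def mem_Collect_eq]) (auto intro: open_Times open_H2)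
  define T where "T = {\<xi> \<in> HH <+> geom_boundary. radial (\<i>, \<i>) r \<xi> \<in> U}"
  have T: "openin cone_topology T"
    unfolding cone_topology_def T_def using r \<open>open U\<close> by (intro topology_generated_by_Basis) blast
  have "r * (a2 - a1) = C + 1" using gap by (simp add: r_def)
  then have "a2 * r - a1 * r > C" by (simp add: algebra_simps)
  then have "base_ray a1 a2 u1 u2 r \<in> U"
    using a' r by (simp add: U_def base_ray_def pol_mem hdist_ii_pol)
  then have "Inr (ray_class (base_ray a1 a2 u1 u2)) \<in> T"
    unfolding T_def using base_ray_class_mem[OF a] radial_boundary[OF a r] by auto
  then obtain x where x: "x \<in> B" "Inl x \<in> T"
    using cl T unfolding in_closure_of by blast
  then have xU: "radial (\<i>, \<i>) r (Inl x) \<in> U" by (simp add: T_def)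
  have mem: "fst x \<in> H2" "snd x \<in> H2" using x B by (auto simp: HH_iff)
  obtain v1 where v1: "norm v1 = 1" "fst x = pol (hdist \<i> (fst x)) v1" by (rule polar_ex[OF mem(1)])
  obtain v2 where v2: "norm v2 = 1" "snd x = pol (hdist \<i> (snd x)) v2" by (rule polar_ex[OF mem(2)])
  define e1 where "e1 = hdist \<i> (fst x)"
  define e2 where "e2 = hdist \<i> (snd x)"
  define D where "D = sqrt (e1\<^sup>2 + e2\<^sup>2)"
  have e: "e1 \<ge> 0" "e2 \<ge> 0" using mem by (auto simp: e1_def e2_def intro: hdist_nonneg)
  have be: "e2 \<le> e1 + C" using bd[OF x(1)] by (simp add: e1_def e2_def)
  \<comment> \<open>Moving an orbit point inwards to radius r multiplies the difference of its two
    distances by r / D, which is at most 1, so the difference cannot exceed C. A point no farther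
    than r is not moved at all.\<close>
  show False
  proof (cases "r < D")
    case True
    have "x = (pol e1 v1, pol e2 v2)" using v1(2) v2(2) by (simp add: e1_def e2_def prod_eq_iff)
    from radial_interior[OF this e v1(1) v2(1) D_def r True] xU
    have "(pol (r * e1 / D) v1, pol (r * e2 / D) v2) \<in> U" by simp
    then have "r * e2 / D - r * e1 / D > C"
      using v1 v2 e r True by (simp add: U_def hdist_ii_pol)
    moreover have "r * e2 / D - r * e1 / D = r / D * (e2 - e1)" by (simp add: diff_divide_distrib right_diff_distrib)
    moreover have "r / D * (e2 - e1) \<le> r / D * C"
      using be r True by (intro mult_left_mono) auto
    moreover have "r / D * C \<le> 1 * C" using r True C by (intro mult_right_mono) auto
    ultimately show False by linarith
  next
    case False
    then have "HHdist (\<i>, \<i>) x \<le> r" by (simp add: HHdist_def D_def e1_def e2_def)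
    then have "x \<in> U" using xU by (simp add: radial_def)
    then show False using be by (simp add: U_def e1_def e2_def)
  qed
qed

text \<open>The asymptotic ray from the base point has the same pair of speeds, so the condition on
  speeds can be tested on base rays.\<close>

lemma ray_class_speed_set:
  "{ray_class \<gamma> | \<gamma>. unit_ray \<gamma> \<and> (\<forall>t\<ge>0. hspeed (fst \<circ> \<gamma>) t \<ge> hspeed (snd \<circ> \<gamma>) t)}
   = {ray_class (base_ray a1 a2 u1 u2) | a1 a2 u1 u2. ray_params a1 a2 u1 u2 \<and> a2 \<le> a1}" (is "?L = ?R")
proof
  have speeds: "hspeed (fst \<circ> \<gamma>) t = a1" "hspeed (snd \<circ> \<gamma>) t = a2"
    if \<gamma>: "unit_ray \<gamma>" and a: "ray_params a1 a2 u1 u2" and t: "t \<ge> 0"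
      and form: "\<And>t. t \<ge> 0 \<Longrightarrow> \<gamma> t = (aff (fst (\<gamma> 0)) (pol (a1 * t) u1), aff (snd (\<gamma> 0)) (pol (a2 * t) u2))"
    for \<gamma> a1 a2 u1 u2 t
  proof -
    have mem: "fst (\<gamma> 0) \<in> H2" "snd (\<gamma> 0) \<in> H2" using unit_ray_mem[OF \<gamma>, of 0] by (auto simp: HH_iff)
    have form1: "(fst \<circ> \<gamma>) t = aff (fst (\<gamma> 0)) (pol (a1 * t) u1)"
      and form2: "(snd \<circ> \<gamma>) t = aff (snd (\<gamma> 0)) (pol (a2 * t) u2)" if "t \<ge> 0" for t
      unfolding comp_def by ((subst form[OF that]), simp)+
    show "hspeed (fst \<circ> \<gamma>) t = a1"
      by (rule hspeed_geodesic[OF _ mem(1) _ t form1]) (use a in \<open>auto simp: ray_params_def\<close>)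
    show "hspeed (snd \<circ> \<gamma>) t = a2"
      by (rule hspeed_geodesic[OF _ mem(2) _ t form2]) (use a in \<open>auto simp: ray_params_def\<close>)
  qed
  show "?L \<subseteq> ?R"
  proof
    fix \<eta> assume "\<eta> \<in> ?L"
    then obtain \<gamma> where \<gamma>: "\<eta> = ray_class \<gamma>" "unit_ray \<gamma>"
      "\<forall>t\<ge>0. hspeed (fst \<circ> \<gamma>) t \<ge> hspeed (snd \<circ> \<gamma>) t" by blast
    obtain a1 a2 u1 u2 where a: "ray_params a1 a2 u1 u2"
      "\<And>t. t \<ge> 0 \<Longrightarrow> \<gamma> t = (aff (fst (\<gamma> 0)) (pol (a1 * t) u1), aff (snd (\<gamma> 0)) (pol (a2 * t) u2))"
      using unit_ray_form[OF \<gamma>(2)] by blast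
    have "a2 \<le> a1" using \<gamma>(3)[rule_format, of 0] speeds[OF \<gamma>(2) a(1) order_refl a(2)] by simp
    moreover obtain v1 v2 where "ray_params a1 a2 v1 v2" "ray_class \<gamma> = ray_class (base_ray a1 a2 v1 v2)"
      using asymptotic_base_ray[OF \<gamma>(2) a] by blast
    ultimately show "\<eta> \<in> ?R" using \<gamma>(1) by blast
  qed
  show "?R \<subseteq> ?L"
  proof
    fix \<eta> assume "\<eta> \<in> ?R"
    then obtain a1 a2 u1 u2 where a: "\<eta> = ray_class (base_ray a1 a2 u1 u2)" "ray_params a1 a2 u1 u2" "a2 \<le> a1" by blast
    have sp: "hspeed (fst \<circ> base_ray a1 a2 u1 u2) t = a1" "hspeed (snd \<circ> base_ray a1 a2 u1 u2) t = a2" if "t \<ge> 0" for t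
      by (rule speeds[OF unit_ray_base_ray[OF a(2)] a(2) that]; simp add: base_ray_def aff_def)+
    have "\<forall>t\<ge>0. hspeed (fst \<circ> base_ray a1 a2 u1 u2) t \<ge> hspeed (snd \<circ> base_ray a1 a2 u1 u2) t"
      using a(3) by (intro allI impI) (simp only: sp)
    then show "\<eta> \<in> ?L" using a(1) unit_ray_base_ray[OF a(2)] by blast
  qed
qed

lemma geom_boundary_eq:
  "geom_boundary = {ray_class (base_ray a1 a2 u1 u2) | a1 a2 u1 u2. ray_params a1 a2 u1 u2}"
proof -
  have "\<exists>a1 a2 u1 u2. ray_class \<gamma> = ray_class (base_ray a1 a2 u1 u2) \<and> ray_params a1 a2 u1 u2" if \<gamma>: "unit_ray \<gamma>" for \<gamma>
  proof -
    obtain a1 a2 u1 u2 where a: "ray_params a1 a2 u1 u2"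
      "\<And>t. t \<ge> 0 \<Longrightarrow> \<gamma> t = (aff (fst (\<gamma> 0)) (pol (a1 * t) u1), aff (snd (\<gamma> 0)) (pol (a2 * t) u2))"
      using unit_ray_form[OF \<gamma>] by blast
    obtain v1 v2 where "ray_params a1 a2 v1 v2" "ray_class \<gamma> = ray_class (base_ray a1 a2 v1 v2)"
      using asymptotic_base_ray[OF \<gamma> a] by blast
    then show ?thesis by blast
  qed
  then have "geom_boundary \<subseteq> {ray_class (base_ray a1 a2 u1 u2) | a1 a2 u1 u2. ray_params a1 a2 u1 u2}"
    unfolding geom_boundary_def by blast
  then show ?thesis using base_ray_class_mem by blast
qed

section \<open>Linear algebra of SL(2,R): action, translation lengths, growth of powers\<close>

section \<open>Two by two matrices\<close>

lemma matrix_2_eq_iff: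
  "(A :: real^2^2) = B \<longleftrightarrow> A$1$1 = B$1$1 \<and> A$1$2 = B$1$2 \<and> A$2$1 = B$2$1 \<and> A$2$2 = B$2$2"
  by (auto simp: vec_eq_iff forall_2)

lemma vector_2_eq_iff: "(v :: real^2) = w \<longleftrightarrow> v$1 = w$1 \<and> v$2 = w$2"
  by (auto simp: vec_eq_iff forall_2)

lemma matrix_2_mult:
  "((A :: real^2^2) ** B)$i$j = A$i$1 * B$1$j + A$i$2 * B$2$j"
  by (simp add: matrix_matrix_mult_def sum_2)

lemma matrix_2_vector: "((A :: real^2^2) *v x)$i = A$i$1 * x$1 + A$i$2 * x$2"
  by (simp add: matrix_vector_mult_def sum_2)

lemma mat_2_sel [simp]:
  "(mat k :: real^2^2)$1$1 = k" "(mat k :: real^2^2)$1$2 = 0" "(mat k :: real^2^2)$2$1 = 0" "(mat k :: real^2^2)$2$2 = k"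
  by (simp_all add: mat_def)

lemma trace_2: "trace (A :: real^2^2) = A$1$1 + A$2$2"
  by (simp add: trace_def sum_2)

lemma inner_2: "(v :: real^2) \<bullet> w = v$1 * w$1 + v$2 * w$2"
  by (simp add: inner_vec_def sum_2)

lemma trace_uminus: "trace (- A :: real^2^2) = - trace A"
  by (simp add: trace_2)

lemma det_uminus_2: "det (- A :: real^2^2) = det A"
  by (simp add: det_2)

lemma cayley_hamilton_2:
  "(A :: real^2^2) ** A = trace A *\<^sub>R A - det A *\<^sub>R mat 1"
  by (simp add: matrix_2_eq_iff matrix_2_mult trace_2 det_2 algebra_simps)

definition mat2 :: "real \<Rightarrow> real \<Rightarrow> real \<Rightarrow> real \<Rightarrow> real^2^2" where
  "mat2 a b c d = vector [vector [a, b], vector [c, d]]"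

lemma mat2_sel [simp]:
  "(mat2 a b c d)$1$1 = a" "(mat2 a b c d)$1$2 = b" "(mat2 a b c d)$2$1 = c" "(mat2 a b c d)$2$2 = d"
  by (simp_all add: mat2_def)

lemma trace_mat2 [simp]: "trace (mat2 a b c d) = a + d"
  and det_mat2 [simp]: "det (mat2 a b c d) = a * d - b * c"
  by (simp_all add: trace_2 det_2)

lemma mat2_mult: "mat2 a b c d ** mat2 a' b' c' d' = mat2 (a * a' + b * c') (a * b' + b * d') (c * a' + d * c') (c * b' + d * d')"
  by (simp add: matrix_2_eq_iff matrix_2_mult)

lemma exists_eigenvector_2:
  fixes A :: "real^2^2"
  assumes "m\<^sup>2 - trace A * m + det A = 0"
  obtains v where "v \<noteq> 0" "A *v v = m *\<^sub>R v"
proof (cases "A$2$1 = 0 \<and> A$2$2 = m")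
  case True
  show ?thesis
  proof (cases "A$1$1 = m \<and> A$1$2 = 0")
    case a: True
    show ?thesis
      by (rule that[of "vector [1, 0]"]) (use True a in \<open>auto simp: vector_2_eq_iff matrix_2_vector\<close>)
  next
    case False
    show ?thesis
      by (rule that[of "vector [A$1$2, m - A$1$1]"]) (use True False in \<open>auto simp: vector_2_eq_iff matrix_2_vector algebra_simps\<close>)
  qed
next
  case False
  have "A$1$1 * (m - A$2$2) + A$1$2 * A$2$1 = m * (m - A$2$2)"
    using assms by (simp add: trace_2 det_2 algebra_simps power2_eq_square)
  then show ?thesis
    by (intro that[of "vector [m - A$2$2, A$2$1]"]) (use False in \<open>auto simp: vector_2_eq_iff matrix_2_vector algebra_simps\<close>)
qed


section \<open>Moebius transformations and translation lengths\<close>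

text \<open>On the symmetric matrix X formed by the coordinates, A acts by X -> A X A^T.\<close>

lemma coords_moebius:
  assumes A: "det A = 1" and z: "z \<in> H2"
  shows "moebius A z \<in> H2"
    "cp (moebius A z) = (A$1$1)\<^sup>2 * cp z + 2 * (A$1$1 * A$1$2) * cq z + (A$1$2)\<^sup>2 * cr z"
    "cq (moebius A z) = A$1$1 * A$2$1 * cp z + (A$1$1 * A$2$2 + A$1$2 * A$2$1) * cq z + A$1$2 * A$2$2 * cr z"
    "cr (moebius A z) = (A$2$1)\<^sup>2 * cp z + 2 * (A$2$1 * A$2$2) * cq z + (A$2$2)\<^sup>2 * cr z"
proof -
  define a b c d where "a = A$1$1" and "b = A$1$2" and "c = A$2$1" and "d = A$2$2"
  have det: "a * d - b * c = 1" using A by (simp add: det_2 a_def b_def c_def d_def)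
  have y: "Im z > 0" using z by (simp add: H2_def)
  define N where "N = (c * Re z + d)\<^sup>2 + (c * Im z)\<^sup>2"
  have N: "N > 0"
  proof (cases "c = 0")
    case True
    then show ?thesis using det by (auto simp: N_def)
  next
    case False
    then show ?thesis using y by (simp add: N_def add_nonneg_pos)
  qed
  have re: "Re (moebius A z) = ((a * Re z + b) * (c * Re z + d) + a * c * (Im z)\<^sup>2) / N"
    by (simp add: moebius_def Re_divide a_def b_def c_def d_def N_def power2_eq_square algebra_simps)
  have "Im (moebius A z) = ((a * Im z) * (c * Re z + d) - (a * Re z + b) * (c * Im z)) / N"
    by (simp add: moebius_def Im_divide a_def b_def c_def d_def N_def power2_eq_square algebra_simps)
  also have "\<dots> = (a * d - b * c) * Im z / N" by (simp add: algebra_simps)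
  finally have im: "Im (moebius A z) = Im z / N" by (simp add: det)
  have "cmod (moebius A z) = cmod (of_real a * z + of_real b) / cmod (of_real c * z + of_real d)"
    by (simp add: moebius_def norm_divide a_def b_def c_def d_def)
  then have "(cmod (moebius A z))\<^sup>2 = ((a * Re z + b)\<^sup>2 + (a * Im z)\<^sup>2) / N"
    by (simp add: power_divide cmod_power2 N_def)
  then show "cp (moebius A z) = (A$1$1)\<^sup>2 * cp z + 2 * (A$1$1 * A$1$2) * cq z + (A$1$2)\<^sup>2 * cr z"
    using y N unfolding cp_def cq_def cr_def im cmod_power2[of z]
    by (simp add: a_def[symmetric] b_def[symmetric] field_simps power2_eq_square)
  show "moebius A z \<in> H2" using im y N by (simp add: H2_def)
  show "cq (moebius A z) = A$1$1 * A$2$1 * cp z + (A$1$1 * A$2$2 + A$1$2 * A$2$1) * cq z + A$1$2 * A$2$2 * cr z"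
    using y N unfolding cp_def cq_def cr_def im re cmod_power2[of z]
    by (simp add: a_def[symmetric] b_def[symmetric] c_def[symmetric] d_def[symmetric] field_simps power2_eq_square)
  show "cr (moebius A z) = (A$2$1)\<^sup>2 * cp z + 2 * (A$2$1 * A$2$2) * cq z + (A$2$2)\<^sup>2 * cr z"
    using y N unfolding cp_def cq_def cr_def im cmod_power2[of z]
    by (simp add: N_def c_def[symmetric] d_def[symmetric] field_simps power2_eq_square)
qed

text \<open>The bilinear form is the polarised determinant, which X -> A X A^T multiplies by (det
  A)^2.\<close>

lemma hdist_moebius:
  assumes A: "det A = 1" and z: "z \<in> H2" and w: "w \<in> H2"
  shows "hdist (moebius A z) (moebius A w) = hdist z w"
proof (rule cosh_real_inject)
  have det: "A$1$1 * A$2$2 - A$1$2 * A$2$1 = 1" using A by (simp add: det_2)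
  have "(cp (moebius A z) * cr (moebius A w) + cr (moebius A z) * cp (moebius A w)) / 2 - cq (moebius A z) * cq (moebius A w)
    = (A$1$1 * A$2$2 - A$1$2 * A$2$1)\<^sup>2 * ((cp z * cr w + cr z * cp w) / 2 - cq z * cq w)"
    unfolding coords_moebius[OF A z] coords_moebius[OF A w] by (simp add: field_simps power2_eq_square)
  then show "cosh (hdist (moebius A z) (moebius A w)) = cosh (hdist z w)"
    by (simp add: cosh_hdist z w coords_moebius[OF A z] coords_moebius[OF A w] det)
qed (auto intro!: hdist_nonneg coords_moebius assms)

lemma moebius_mult:
  assumes A: "det A = 1" and B: "det B = 1" and z: "z \<in> H2"
  shows "moebius (A ** B) z = moebius A (moebius B z)"
proof -
  have AB: "det (A ** B) = 1" using A B by (simp add: det_mul)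
  note m = coords_moebius(1)[OF B z]
  show ?thesis
    by (rule light_cone_coords_inject)
      (simp_all add: coords_moebius[OF AB z] coords_moebius[OF A m] coords_moebius[OF B z] matrix_2_mult
        algebra_simps power2_eq_square)
qed

lemma moebius_uminus: "moebius (- A) z = moebius A z"
proof -
  have "of_real ((- A)$1$1) * z + of_real ((- A)$1$2) = - (of_real (A$1$1) * z + of_real (A$1$2))"
    "of_real ((- A)$2$1) * z + of_real ((- A)$2$2) = - (of_real (A$2$1) * z + of_real (A$2$2))" by simp_all
  then show ?thesis unfolding moebius_def by (simp only: minus_divide_divide)
qed

lemma some_mem_psl: "(SOME B. B \<in> psl A) \<in> {A, - A}"
  using someI[of "\<lambda>B. B \<in> psl A" A] by (simp add: psl_eq)

lemma psl_act_psl: "psl_act (psl A) z = moebius A z"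
  using some_mem_psl[of A] by (auto simp: psl_act_def moebius_uminus)

lemma abs_trace_psl: "abs_trace (psl A) = \<bar>trace A\<bar>"
  using some_mem_psl[of A] by (auto simp: abs_trace_def trace_uminus)

lemma one_PSL2R: "\<one>\<^bsub>PSL2R\<^esub> = {mat 1, - mat 1}"
  by (simp add: PSL2R_def FactGroup_def)

lemma hyperbolic_psl_iff: "isometry_type (psl A) = Hyperbolic \<longleftrightarrow> \<bar>trace A\<bar> > 2"
proof -
  have "psl A = \<one>\<^bsub>PSL2R\<^esub> \<Longrightarrow> \<bar>trace A\<bar> = 2"
    unfolding one_PSL2R psl_eq doubleton_eq_iff by (auto simp: trace_2)
  then show ?thesis by (auto simp: isometry_type_def abs_trace_psl)
qed

lemma pol_1_eq: "pol t 1 = of_real (exp t) * \<i>"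
proof -
  have "cosh t - sinh t = 1 / exp t" by (simp add: cosh_minus_sinh exp_minus inverse_eq_divide)
  then show ?thesis by (simp add: pol_def complex_eq_iff)
qed

lemma diagonalize_2:
  assumes A: "det A = 1" "trace A = m + 1 / m" and m: "m > 1"
  obtains B where "det B = 1" "A ** B = B ** mat2 m 0 0 (1 / m)"
proof -
  have "m\<^sup>2 - trace A * m + det A = 0" "(1 / m)\<^sup>2 - trace A * (1 / m) + det A = 0"
    using A m by (auto simp: field_simps power2_eq_square)
  then obtain v w where v: "v \<noteq> 0" "A *v v = m *\<^sub>R v" and w: "w \<noteq> 0" "A *v w = (1 / m) *\<^sub>R w"
    using exists_eigenvector_2 by metis
  define D where "D = v$1 * w$2 - w$1 * v$2"
  have e: "A$1$1 * v$1 + A$1$2 * v$2 = m * v$1" "A$2$1 * v$1 + A$2$2 * v$2 = m * v$2"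
    "A$1$1 * w$1 + A$1$2 * w$2 = w$1 / m" "A$2$1 * w$1 + A$2$2 * w$2 = w$2 / m"
    using v(2) w(2) by (auto simp: vector_2_eq_iff matrix_2_vector)
  have m2: "m * m > 1" using m by (simp add: less_1_mult)
  have D: "D \<noteq> 0"
  proof
    assume D0: "D = 0"
    obtain k where k: "w = k *\<^sub>R v"
    proof (cases "v$1 = 0")
      case True
      then have "v$2 \<noteq> 0" using v(1) by (auto simp: vector_2_eq_iff)
      moreover from this have "w$1 = 0" using D0 True by (simp add: D_def)
      ultimately show ?thesis using True by (intro that[of "w$2 / v$2"]) (simp add: vector_2_eq_iff)
    next
      case False
      then show ?thesis using D0 by (intro that[of "w$1 / v$1"]) (simp add: vector_2_eq_iff D_def field_simps)
    qed
    then have "k \<noteq> 0" using w(1) by auto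
    have "A *v w = k *\<^sub>R (m *\<^sub>R v)" unfolding k using v(2) by (simp add: matrix_vector_mult_scaleR)
    then have "(1 / m) *\<^sub>R w = m *\<^sub>R w" using w(2) v(1) k by (auto simp: mult.commute)
    then have "1 / m = m" using w(1) by simp
    then show False using m2 m by (simp add: field_simps)
  qed
  \<comment> \<open>Dividing only the second eigenvector by D gives determinant 1 and leaves both
    eigenvector equations intact.\<close>
  define B where "B = mat2 (v$1) (w$1 / D) (v$2) (w$2 / D)"
  have "det B = 1" unfolding B_def det_mat2 using D by (simp add: D_def[symmetric] diff_divide_distrib[symmetric])
  moreover have "A ** B = B ** mat2 m 0 0 (1 / m)"
    using e by (simp add: matrix_2_eq_iff matrix_2_mult B_def add_divide_distrib[symmetric] mult.commute)
  ultimately show ?thesis using that by blast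
qed

text \<open>Corresponding points on two lines translated by the same isometry stay at constant
  distance K, so n l is at most n l' + 2 K for every n. Used in both directions, this makes the
  definite description of the translation length well defined.\<close>

lemma translation_length_le:
  assumes A: "det A = 1" and c: "geodesic_line c" "\<And>t. moebius A (c t) = c (t + l)" and l: "l > 0"
    and c': "geodesic_line c'" "\<And>t. moebius A (c' t) = c' (t + l')" and l': "l' > 0"
  shows "l \<le> l'"
proof (rule ccontr)
  assume "\<not> l \<le> l'"
  then have gap: "l - l' > 0" by simp
  have mem: "c t \<in> H2" "c' t \<in> H2" for t using c c' by (auto simp: geodesic_line_def)
  define K where "K = hdist (c 0) (c' 0)"
  have inv: "hdist (c (real n * l)) (c' (real n * l')) = K" for n
  proof (induction n)
    case (Suc n)
    have "c (real (Suc n) * l) = moebius A (c (real n * l))" "c' (real (Suc n) * l') = moebius A (c' (real n * l'))"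
      unfolding c(2) c'(2) by (simp_all add: algebra_simps)
    then show ?case using Suc hdist_moebius[OF A mem] by simp
  qed (simp add: K_def)
  obtain n :: nat where n: "2 * K < real n * (l - l')" using reals_Archimedean3[OF gap] by blast
  have "real n * l = hdist (c 0) (c (real n * l))" using c(1) l by (simp add: geodesic_line_def)
  also have "\<dots> \<le> K + (hdist (c' 0) (c' (real n * l')) + hdist (c' (real n * l')) (c (real n * l)))"
    using hdist_triangle[OF mem(1)[of 0] mem(2)[of 0] mem(1)[of "real n * l"]]
      hdist_triangle[OF mem(2)[of 0] mem(2)[of "real n * l'"] mem(1)[of "real n * l"]] unfolding K_def by linarith
  also have "hdist (c' 0) (c' (real n * l')) = real n * l'" using c'(1) l' by (simp add: geodesic_line_def)
  finally have "real n * l \<le> K + (real n * l' + K)" using inv[of n] by (simp add: hdist_commute)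
  then show False using n by (simp add: algebra_simps)
qed

lemma translation_length_psl:
  assumes A: "det A = 1" and tr: "\<bar>trace A\<bar> > 2"
  shows "translation_length (psl A) = 2 * arcosh (\<bar>trace A\<bar> / 2)"
proof -
  have pos: "translation_length (psl A) = 2 * arcosh (trace A / 2)" if A: "det A = 1" and tr: "trace A > 2" for A
  proof -
    define l where "l = 2 * arcosh (trace A / 2)"
    define m where "m = exp (l / 2)"
    have l: "l > 0" using tr by (simp add: l_def)
    have m: "m > 1" using l by (simp add: m_def)
    have "cosh (l / 2) = trace A / 2" using tr by (simp add: l_def cosh_arcosh_real)
    then have "trace A = m + 1 / m" by (simp add: m_def cosh_def exp_minus inverse_eq_divide)
    then obtain B where B: "det B = 1" "A ** B = B ** mat2 m 0 0 (1 / m)"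
      using diagonalize_2[OF A _ m] by blast
    have D: "det (mat2 m 0 0 (1 / m)) = 1" using m by simp
    define c where "c = (\<lambda>t. moebius B (pol t 1))"
    have c: "geodesic_line c"
      using B by (auto simp: geodesic_line_def c_def hdist_moebius hdist_pol_same pol_mem coords_moebius)
    have act: "moebius A (c t) = c (t + l)" for t
    proof -
      have "moebius A (c t) = moebius (A ** B) (pol t 1)"
        unfolding c_def by (rule moebius_mult[symmetric]) (auto simp: A B pol_mem)
      also have "\<dots> = moebius B (moebius (mat2 m 0 0 (1 / m)) (pol t 1))"
        unfolding B(2) by (rule moebius_mult) (use B D in \<open>auto simp: pol_mem\<close>)
      also have "moebius (mat2 m 0 0 (1 / m)) (pol t 1) = pol (t + l) 1"
      proof -
        have "exp (t + l) = exp t * (m * m)" by (simp add: m_def exp_add[symmetric])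
        then show ?thesis using m by (simp add: moebius_def pol_1_eq)
      qed
      finally show ?thesis by (simp add: c_def)
    qed
    have "(THE l. l > 0 \<and> (\<exists>c. geodesic_line c \<and> (\<forall>t. psl_act (psl A) (c t) = c (t + l)))) = l"
    proof (rule the_equality)
      show "l > 0 \<and> (\<exists>c. geodesic_line c \<and> (\<forall>t. psl_act (psl A) (c t) = c (t + l)))"
        using l c act by (auto simp: psl_act_psl)
    next
      fix l' assume "l' > 0 \<and> (\<exists>c. geodesic_line c \<and> (\<forall>t. psl_act (psl A) (c t) = c (t + l')))"
      then obtain c' where c': "l' > 0" "geodesic_line c'" "\<And>t. moebius A (c' t) = c' (t + l')"
        by (auto simp: psl_act_psl)
      from translation_length_le[OF A c act l c'(2,3,1)] translation_length_le[OF A c'(2,3,1) c act l]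
      show "l' = l" by simp
    qed
    then show ?thesis using tr by (simp add: translation_length_def hyperbolic_psl_iff l_def)
  qed
  have psl_uminus: "psl (- A) = psl A" by (auto simp: psl_eq)
  show ?thesis
  proof (cases "trace A > 0")
    case True
    then show ?thesis using pos[OF A] tr by simp
  next
    case False
    then show ?thesis using pos[of "- A"] A tr by (simp add: det_uminus_2 trace_uminus psl_uminus)
  qed
qed

lemma translation_length_psl_0: "\<bar>trace A\<bar> \<le> 2 \<Longrightarrow> translation_length (psl A) = 0"
  using hyperbolic_psl_iff[of A] by (simp add: translation_length_def)

lemma coords_moebius_ii:
  assumes "det G = 1"
  shows "cp (moebius G \<i>) = G$1 \<bullet> G$1" "cq (moebius G \<i>) = G$1 \<bullet> G$2" "cr (moebius G \<i>) = G$2 \<bullet> G$2"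
  using coords_moebius[OF assms ii_mem] by (simp_all add: inner_2 power2_eq_square)

lemma norm_matrix_2: "(norm (A :: real^2^2))\<^sup>2 = A$1 \<bullet> A$1 + A$2 \<bullet> A$2"
  by (simp add: power2_norm_eq_inner inner_vec_def sum_2)

text \<open>The norm of matrices is the Frobenius norm, and it measures the displacement of the base
  point. A comparison of norms thus becomes a comparison of distances up to an additive
  constant.\<close>

lemma cosh_hdist_moebius_ii:
  assumes "det G = 1"
  shows "cosh (hdist \<i> (moebius G \<i>)) = (norm G)\<^sup>2 / 2"
  by (simp add: cosh_hdist_ii coords_moebius[OF assms] coords_moebius_ii[OF assms] norm_matrix_2)

lemma moebius_ii_surj:
  assumes "z \<in> H2"
  obtains k where "det k = 1" "moebius k \<i> = z"
proof
  have y: "Im z > 0" using assms by (simp add: H2_def)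
  then have s: "sqrt (Im z) > 0" "sqrt (Im z) * sqrt (Im z) = Im z" by auto
  let ?k = "mat2 (sqrt (Im z)) (Re z / sqrt (Im z)) 0 (1 / sqrt (Im z))"
  show "det ?k = 1" using s by simp
  show "moebius ?k \<i> = z" using s y by (simp add: moebius_def complex_eq_iff Re_divide Im_divide power2_eq_square field_simps)
qed

section \<open>Growth of powers\<close>

lemma norm_matrix_vector_le: "norm ((A :: real^2^2) *v x) \<le> norm A * norm x"
proof (rule power2_le_imp_le)
  have "(norm (A *v x))\<^sup>2 = (A$1 \<bullet> x)\<^sup>2 + (A$2 \<bullet> x)\<^sup>2"
    unfolding power2_norm_eq_inner inner_2 matrix_2_vector by (simp add: power2_eq_square)
  also have "\<dots> \<le> (A$1 \<bullet> A$1) * (x \<bullet> x) + (A$2 \<bullet> A$2) * (x \<bullet> x)"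
    by (intro add_mono Cauchy_Schwarz_ineq)
  also have "\<dots> = (norm A * norm x)\<^sup>2"
    by (simp add: power_mult_distrib norm_matrix_2 power2_norm_eq_inner[of x] distrib_right)
  finally show "(norm (A *v x))\<^sup>2 \<le> (norm A * norm x)\<^sup>2" .
qed simp

lemma norm_transpose_2: "norm (transpose (A :: real^2^2)) = norm A"
  by (rule power2_eq_imp_eq) (simp_all add: norm_matrix_2 inner_2 transpose_def)

lemma norm_vector_matrix_le: "norm (x v* (A :: real^2^2)) \<le> norm x * norm A"
  using norm_matrix_vector_le[of "transpose A" x] by (simp add: norm_transpose_2 mult.commute)

lemma row_matrix_mult: "((A :: real^2^2) ** (B :: real^2^2))$i = A$i v* B"
  by (simp add: vector_2_eq_iff matrix_2_mult vector_matrix_mult_def sum_2 mult.commute)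

lemma norm_matrix_mult_le: "norm ((A :: real^2^2) ** (B :: real^2^2)) \<le> norm A * norm B"
proof (rule power2_le_imp_le)
  have "(norm (A ** B))\<^sup>2 = (norm (A$1 v* B))\<^sup>2 + (norm (A$2 v* B))\<^sup>2"
    unfolding norm_matrix_2 row_matrix_mult power2_norm_eq_inner[symmetric] ..
  also have "\<dots> \<le> (norm (A$1) * norm B)\<^sup>2 + (norm (A$2) * norm B)\<^sup>2"
    by (intro add_mono power_mono norm_vector_matrix_le) auto
  also have "\<dots> = (norm A * norm B)\<^sup>2"
    unfolding power_mult_distrib norm_matrix_2[of A] power2_norm_eq_inner[symmetric] distrib_right ..
  finally show "(norm (A ** B))\<^sup>2 \<le> (norm A * norm B)\<^sup>2" .
qed simp

lemma abs_trace_le_norm: "\<bar>trace (A :: real^2^2)\<bar> \<le> 2 * norm A"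
proof -
  have "\<bar>A$1$1\<bar> \<le> norm A" "\<bar>A$2$2\<bar> \<le> norm A"
    by (meson component_le_norm_cart order_trans Finite_Cartesian_Product.norm_nth_le)+
  then show ?thesis by (simp add: trace_2)
qed

primrec mpow :: "real^2^2 \<Rightarrow> nat \<Rightarrow> real^2^2" where
  "mpow A 0 = mat 1"
| "mpow A (Suc n) = A ** mpow A n"

lemma det_mpow: "det A = 1 \<Longrightarrow> det (mpow A n) = 1"
  by (induction n) (simp_all add: det_mul)

lemma mpow_uminus: "mpow (- A) n = mpow A n \<or> mpow (- A) n = - mpow A n"
proof (induction n)
  case (Suc n)
  have "(- A) ** M = - (A ** M)" "A ** (- M) = - (A ** M)" for M :: "real^2^2"
    by (simp_all add: matrix_2_eq_iff matrix_2_mult)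
  then show ?case using Suc by auto
qed simp

text \<open>By Cayley-Hamilton the powers of A satisfy a linear recurrence, solved here once for the
  hyperbolic, elliptic and parabolic case. The factor k avoids a division, and
  \<open>b 0 = - k\<close> is the value of \<open>a\<close> continued to the index -1.\<close>

lemma mpow_quadratic:
  fixes A :: "real^2^2"
  assumes A: "det A = 1" and k: "\<And>n. a (Suc n) = trace A * a n - b n" "\<And>n. b (Suc n) = a n" "b 0 = - k" "a 0 = 0"
  shows "k *\<^sub>R mpow A n = a n *\<^sub>R A - b n *\<^sub>R mat 1"
proof (induction n)
  case 0
  then show ?case by (simp add: k)
next
  case (Suc n)
  have "k *\<^sub>R mpow A (Suc n) = A ** (k *\<^sub>R mpow A n)"
    by (simp add: matrix_2_eq_iff matrix_2_mult algebra_simps)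
  also have "\<dots> = a n *\<^sub>R (A ** A) - b n *\<^sub>R A"
    unfolding Suc by (simp add: matrix_2_eq_iff matrix_2_mult algebra_simps)
  also have "\<dots> = a (Suc n) *\<^sub>R A - b (Suc n) *\<^sub>R mat 1"
    by (simp add: cayley_hamilton_2 A k scaleR_diff_right scaleR_diff_left)
  finally show ?case .
qed

lemma mpow_sinh:
  assumes "det A = 1" "trace A = 2 * cosh \<eta>"
  shows "sinh \<eta> *\<^sub>R mpow A n = sinh (real n * \<eta>) *\<^sub>R A - sinh ((real n - 1) * \<eta>) *\<^sub>R mat 1"
proof (rule mpow_quadratic[OF assms(1)])
  fix n
  have "sinh (real n * \<eta> + \<eta>) + sinh (real n * \<eta> - \<eta>) = 2 * cosh \<eta> * sinh (real n * \<eta>)"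
    by (simp add: sinh_add sinh_diff)
  then show "sinh (real (Suc n) * \<eta>) = trace A * sinh (real n * \<eta>) - sinh ((real n - 1) * \<eta>)"
    by (simp add: assms(2) algebra_simps)
qed (simp_all add: algebra_simps)

lemma mpow_sin:
  assumes "det A = 1" "trace A = 2 * cos \<theta>"
  shows "sin \<theta> *\<^sub>R mpow A n = sin (real n * \<theta>) *\<^sub>R A - sin ((real n - 1) * \<theta>) *\<^sub>R mat 1"
proof (rule mpow_quadratic[OF assms(1)])
  fix n
  have "sin (real n * \<theta> + \<theta>) + sin (real n * \<theta> - \<theta>) = 2 * cos \<theta> * sin (real n * \<theta>)"
    by (simp add: sin_add sin_diff)
  then show "sin (real (Suc n) * \<theta>) = trace A * sin (real n * \<theta>) - sin ((real n - 1) * \<theta>)"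
    by (simp add: assms(2) algebra_simps)
qed (simp_all add: algebra_simps)

lemma mpow_parabolic:
  assumes "det A = 1" "trace A = 2"
  shows "1 *\<^sub>R mpow A n = real n *\<^sub>R A - (real n - 1) *\<^sub>R mat 1"
  by (rule mpow_quadratic[OF assms(1)]) (simp_all add: assms(2))

lemma abs_sinh_le_exp: "\<bar>sinh x\<bar> \<le> exp \<bar>x\<bar>" for x :: real
proof -
  have "exp x \<le> exp \<bar>x\<bar>" "exp (- x) \<le> exp \<bar>x\<bar>" "exp x > 0" "exp (- x) > 0" by auto
  then have "exp x - exp (- x) \<le> 2 * exp \<bar>x\<bar>" "- (exp x - exp (- x)) \<le> 2 * exp \<bar>x\<bar>" by linarith+
  then show ?thesis by (simp add: sinh_def abs_le_iff)
qed

lemma norm_mpow_hyperbolic: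
  assumes A: "det A = 1" "trace A = 2 * cosh \<eta>" and \<eta>: "\<eta> > 0"
  obtains C where "C > 0" "\<And>n. norm (mpow A n) \<le> C * exp (real n * \<eta>)"
proof
  let ?C = "(norm A + exp \<eta> * norm (mat 1 :: real^2^2) + 1) / sinh \<eta>"
  have s: "sinh \<eta> > 0" using \<eta> by simp
  show "?C > 0" using s by (simp add: add_nonneg_pos)
  fix n
  have b: "\<bar>sinh ((real n - 1) * \<eta>)\<bar> \<le> exp (real n * \<eta>) * exp \<eta>"
  proof -
    have "\<bar>(real n - 1) * \<eta>\<bar> \<le> (real n + 1) * \<eta>" using \<eta> by (simp add: abs_mult)
    then have "exp \<bar>(real n - 1) * \<eta>\<bar> \<le> exp ((real n + 1) * \<eta>)" by simp
    then show ?thesis using abs_sinh_le_exp[of "(real n - 1) * \<eta>"] by (simp add: exp_add distrib_right)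
  qed
  have a: "\<bar>sinh (real n * \<eta>)\<bar> \<le> exp (real n * \<eta>)" using abs_sinh_le_exp[of "real n * \<eta>"] \<eta> by simp
  have "sinh \<eta> * norm (mpow A n) = norm (sinh (real n * \<eta>) *\<^sub>R A - sinh ((real n - 1) * \<eta>) *\<^sub>R mat 1)"
    using mpow_sinh[OF A, of n, symmetric] s by simp
  also have "\<dots> \<le> \<bar>sinh (real n * \<eta>)\<bar> * norm A + \<bar>sinh ((real n - 1) * \<eta>)\<bar> * norm (mat 1 :: real^2^2)"
    using norm_triangle_ineq4[of "sinh (real n * \<eta>) *\<^sub>R A" "sinh ((real n - 1) * \<eta>) *\<^sub>R (mat 1 :: real^2^2)"]
    by (simp only: norm_scaleR)
  also have "\<dots> \<le> exp (real n * \<eta>) * norm A + (exp (real n * \<eta>) * exp \<eta>) * norm (mat 1 :: real^2^2)"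
    by (intro add_mono mult_right_mono a b) auto
  also have "\<dots> \<le> (norm A + exp \<eta> * norm (mat 1 :: real^2^2) + 1) * exp (real n * \<eta>)"
    by (simp add: algebra_simps)
  finally show "norm (mpow A n) \<le> ?C * exp (real n * \<eta>)"
    using s by (simp add: field_simps)
qed

lemma norm_mpow_elliptic:
  assumes A: "det A = 1" "trace A = 2 * cos \<theta>" and \<theta>: "sin \<theta> > 0"
  obtains C where "C > 0" "\<And>n. norm (mpow A n) \<le> C"
proof
  let ?C = "(norm A + norm (mat 1 :: real^2^2) + 1) / sin \<theta>"
  show "?C > 0" using \<theta> by (simp add: add_nonneg_pos)
  fix n
  have "sin \<theta> * norm (mpow A n) = norm (sin (real n * \<theta>) *\<^sub>R A - sin ((real n - 1) * \<theta>) *\<^sub>R mat 1)"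
    using mpow_sin[OF A, of n, symmetric] \<theta> by simp
  also have "\<dots> \<le> \<bar>sin (real n * \<theta>)\<bar> * norm A + \<bar>sin ((real n - 1) * \<theta>)\<bar> * norm (mat 1 :: real^2^2)"
    using norm_triangle_ineq4[of "sin (real n * \<theta>) *\<^sub>R A" "sin ((real n - 1) * \<theta>) *\<^sub>R (mat 1 :: real^2^2)"]
    by (simp only: norm_scaleR)
  also have "\<dots> \<le> 1 * norm A + 1 * norm (mat 1 :: real^2^2)"
    by (intro add_mono mult_right_mono) auto
  finally show "norm (mpow A n) \<le> ?C" using \<theta> by (simp add: field_simps)
qed

lemma trace_mpow_hyperbolic:
  assumes A: "det A = 1" "trace A = 2 * cosh \<eta>" and \<eta>: "\<eta> > 0"
  shows "trace (mpow A n) = 2 * cosh (real n * \<eta>)"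
proof -
  have "sinh \<eta> * trace (mpow A n) = trace (sinh \<eta> *\<^sub>R mpow A n)" by (simp add: trace_2 algebra_simps)
  also have "\<dots> = sinh (real n * \<eta>) * trace A - sinh ((real n - 1) * \<eta>) * 2"
    unfolding mpow_sinh[OF A] by (simp add: trace_2 algebra_simps)
  also have "\<dots> = sinh \<eta> * (2 * cosh (real n * \<eta>))"
    unfolding A(2) left_diff_distrib by (simp add: sinh_diff algebra_simps)
  finally show ?thesis using \<eta> by simp
qed

lemma arcosh_half:
  assumes "t > (2::real)"
  obtains \<eta> where "\<eta> > 0" "t = 2 * cosh \<eta>" "\<eta> = arcosh (t / 2)"
proof (rule that[OF _ _ refl])
  show "arcosh (t / 2) > 0" using assms by simp
  show "t = 2 * cosh (arcosh (t / 2))" using assms cosh_arcosh_real[of "t / 2"] by simp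
qed

text \<open>Passing to powers removes the constant C. If trace B = 2 cosh \<beta>, the norm of B^n
  is at least of order exp (n \<beta>), so A^n cannot grow at a smaller exponential rate.\<close>

lemma abs_trace_le_of_norm_mpow_le:
  assumes A: "det A = 1" and B: "det B = 1" "\<bar>trace B\<bar> > 2"
    and le: "\<And>n. norm (mpow B n) \<le> C * norm (mpow A n)" and C: "C > 0"
  shows "\<bar>trace B\<bar> \<le> \<bar>trace A\<bar>"
proof -
  have pos: "trace B \<le> trace A" if A: "det A = 1" "trace A \<ge> 0" and B: "det B = 1" "trace B > 2"
    and le: "\<And>n. norm (mpow B n) \<le> C * norm (mpow A n)" for A B
  proof (rule ccontr)
    assume "\<not> trace B \<le> trace A"
    then have lt: "trace A < trace B" by simp
    obtain \<beta> where \<beta>: "\<beta> > 0" "trace B = 2 * cosh \<beta>" using arcosh_half[OF B(2)] by blast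
    \<comment> \<open>A rate below \<beta> exists whatever the type of A: its own rate if
      hyperbolic, \<beta> / 2 to absorb linear growth if parabolic, 0 if elliptic.\<close>
    have "\<exists>D \<eta>. D > 0 \<and> 0 \<le> \<eta> \<and> \<eta> < \<beta> \<and> (\<forall>n. norm (mpow A n) \<le> D * exp (real n * \<eta>))"
    proof -
      consider "trace A > 2" | "trace A = 2" | "trace A < 2" by linarith
      then show ?thesis
      proof cases
        case 1
        obtain \<eta> where \<eta>: "\<eta> > 0" "trace A = 2 * cosh \<eta>" using arcosh_half[OF 1] by blast
        obtain D where "D > 0" "\<And>n. norm (mpow A n) \<le> D * exp (real n * \<eta>)"
          using norm_mpow_hyperbolic[OF A(1) \<eta>(2,1)] by blast
        moreover have "\<eta> < \<beta>" using lt \<eta> \<beta> by (simp add: cosh_real_nonneg_less_iff)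
        ultimately show ?thesis using \<eta>(1) by (intro exI[of _ D] exI[of _ \<eta>]) auto
      next
        case 2
        define \<eta> where "\<eta> = \<beta> / 2"
        have \<eta>: "\<eta> > 0" "\<eta> < \<beta>" using \<beta> by (auto simp: \<eta>_def)
        let ?D = "(norm A + norm (mat 1 :: real^2^2)) / \<eta> + norm (mat 1 :: real^2^2) + 1"
        have "norm (mpow A n) \<le> ?D * exp (real n * \<eta>)" for n
        proof -
          have e: "real n * \<eta> \<le> exp (real n * \<eta>)" "1 \<le> exp (real n * \<eta>)"
            using exp_ge_add_one_self[of "real n * \<eta>"] mult_nonneg_nonneg[of "real n" \<eta>] \<eta> by linarith+
          have "norm (mpow A n) = norm (real n *\<^sub>R A - (real n - 1) *\<^sub>R mat 1)"
            using mpow_parabolic[OF A(1) 2, of n] by simp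
          also have "\<dots> \<le> real n * norm A + \<bar>real n - 1\<bar> * norm (mat 1 :: real^2^2)"
            using norm_triangle_ineq4[of "real n *\<^sub>R A" "(real n - 1) *\<^sub>R (mat 1 :: real^2^2)"]
            by (simp only: norm_scaleR abs_of_nat)
          also have "\<dots> \<le> real n * norm A + (real n + 1) * norm (mat 1 :: real^2^2)"
            by (intro add_mono mult_right_mono) auto
          also have "\<dots> = (norm A + norm (mat 1 :: real^2^2)) / \<eta> * (real n * \<eta>) + norm (mat 1 :: real^2^2) * 1"
            using \<eta> by (simp add: field_simps)
          also have "\<dots> \<le> (norm A + norm (mat 1 :: real^2^2)) / \<eta> * exp (real n * \<eta>) + norm (mat 1 :: real^2^2) * exp (real n * \<eta>)"
            using \<eta> by (intro add_mono mult_left_mono e) auto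
          also have "\<dots> \<le> ?D * exp (real n * \<eta>)" by (simp add: algebra_simps)
          finally show ?thesis .
        qed
        moreover have "?D > 0" using \<eta> by (simp add: add_nonneg_pos)
        ultimately show ?thesis using \<eta> by (intro exI[of _ ?D] exI[of _ \<eta>]) auto
      next
        case 3
        define \<theta> where "\<theta> = arccos (trace A / 2)"
        have \<theta>: "trace A = 2 * cos \<theta>" "sin \<theta> > 0"
          using 3 A(2) arccos_lt_bounded[of "trace A / 2"] by (auto simp: \<theta>_def intro!: sin_gt_zero)
        obtain D where "D > 0" "\<And>n. norm (mpow A n) \<le> D"
          using norm_mpow_elliptic[OF A(1) \<theta>] by blast
        then show ?thesis using \<beta> by (intro exI[of _ D] exI[of _ 0]) auto
      qed
    qed
    then obtain D \<eta> where D: "D > 0" "0 \<le> \<eta>" "\<eta> < \<beta>" "\<And>n. norm (mpow A n) \<le> D * exp (real n * \<eta>)" by blast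
    have bd: "exp (real n * (\<beta> - \<eta>)) \<le> 2 * (C * D)" for n
    proof -
      have "exp (real n * \<beta>) \<le> 2 * cosh (real n * \<beta>)" by (simp add: cosh_def)
      also have "\<dots> \<le> 2 * norm (mpow B n)"
        using abs_trace_le_norm[of "mpow B n"] trace_mpow_hyperbolic[OF B(1) \<beta>(2,1), of n] by simp
      also have "\<dots> \<le> 2 * (C * (D * exp (real n * \<eta>)))"
      proof -
        have "C * norm (mpow A n) \<le> C * (D * exp (real n * \<eta>))" using D(4)[of n] C by (intro mult_left_mono) auto
        then show ?thesis using le[of n] by linarith
      qed
      finally show ?thesis by (simp add: right_diff_distrib exp_diff field_simps)
    qed
    obtain n :: nat where n: "2 * (C * D) < real n * (\<beta> - \<eta>)" using reals_Archimedean3[of "\<beta> - \<eta>"] D by auto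
    have "real n * (\<beta> - \<eta>) < exp (real n * (\<beta> - \<eta>))" using exp_ge_add_one_self[of "real n * (\<beta> - \<eta>)"] by linarith
    then show False using n bd[of n] by linarith
  qed
  have nu: "norm (mpow (- M) n) = norm (mpow M n)" for M n using mpow_uminus[of M n] by auto
  \<comment> \<open>Changing signs makes both traces nonnegative and leaves the norms of all powers
    unchanged.\<close>
  define A' where "A' = (if trace A \<ge> 0 then A else - A)"
  define B' where "B' = (if trace B \<ge> 0 then B else - B)"
  have tr: "trace A' = \<bar>trace A\<bar>" "trace B' = \<bar>trace B\<bar>" and det: "det A' = 1" "det B' = 1"
    using A B(1) by (simp_all add: A'_def B'_def trace_uminus det_uminus_2)
  have n: "norm (mpow A' n) = norm (mpow A n)" "norm (mpow B' n) = norm (mpow B n)" for n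
    by (simp_all add: A'_def B'_def nu)
  have "trace B' \<le> trace A'"
    by (rule pos[OF det(1) _ det(2)]) (simp_all add: tr n B(2) le)
  then show ?thesis by (simp add: tr)
qed

section \<open>Directions of lines and cuspidal sequences\<close>

text \<open>Doubling the angle identifies lines in the plane with points of the unit circle. In the
  coordinates of \<open>pol\<close> this is the boundary point v1 : v2 of the upper half-plane; the
  line of (1, 0) corresponds to \<infinity>, that is, to u = 1.\<close>

definition line_dir :: "real^2 \<Rightarrow> complex" where
  "line_dir v = Complex ((v$1)\<^sup>2 - (v$2)\<^sup>2) (2 * v$1 * v$2) / of_real ((v$1)\<^sup>2 + (v$2)\<^sup>2)"

lemma square_sum_pos_2: "v \<noteq> 0 \<Longrightarrow> (v$1)\<^sup>2 + (v$2)\<^sup>2 > (0::real)" for v :: "real^2"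
  by (auto simp: vector_2_eq_iff sum_power2_gt_zero_iff)

lemma line_dir_scaleR:
  assumes "c \<noteq> 0"
  shows "line_dir (c *\<^sub>R v) = line_dir v"
proof -
  have "Complex ((c * v$1)\<^sup>2 - (c * v$2)\<^sup>2) (2 * (c * v$1) * (c * v$2)) = of_real (c\<^sup>2) * Complex ((v$1)\<^sup>2 - (v$2)\<^sup>2) (2 * v$1 * v$2)"
    by (simp add: complex_eq_iff power2_eq_square algebra_simps)
  moreover have "(c * v$1)\<^sup>2 + (c * v$2)\<^sup>2 = c\<^sup>2 * ((v$1)\<^sup>2 + (v$2)\<^sup>2)"
    by (simp add: power2_eq_square algebra_simps)
  ultimately show ?thesis
    using assms unfolding line_dir_def vector_scaleR_component real_scaleR_def by (simp only: of_real_mult) simp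
qed

lemma norm_line_dir:
  assumes "v \<noteq> 0"
  shows "norm (line_dir v) = 1"
proof -
  have p: "(v$1)\<^sup>2 + (v$2)\<^sup>2 > 0" using assms by (rule square_sum_pos_2)
  have "((v$1)\<^sup>2 - (v$2)\<^sup>2)\<^sup>2 + (2 * v$1 * v$2)\<^sup>2 = ((v$1)\<^sup>2 + (v$2)\<^sup>2)\<^sup>2"
    by (simp add: power2_eq_square algebra_simps)
  then have "cmod (Complex ((v$1)\<^sup>2 - (v$2)\<^sup>2) (2 * v$1 * v$2)) = (v$1)\<^sup>2 + (v$2)\<^sup>2"
    using p by (simp add: complex_norm)
  then show ?thesis using p by (simp only: line_dir_def norm_divide norm_of_real) auto
qed

lemma line_dir_surj:
  assumes "norm u = 1"
  obtains v where "v \<noteq> 0" "line_dir v = u"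
proof
  define \<alpha> where "\<alpha> = Arg u / 2"
  define v :: "real^2" where "v = vector [cos \<alpha>, sin \<alpha>]"
  have v: "v$1 = cos \<alpha>" "v$2 = sin \<alpha>" by (simp_all add: v_def)
  have "u = cis (2 * \<alpha>)" using assms by (metis \<alpha>_def cis_Arg field_sum_of_halves mult_2 norm_zero sgn_eq mult_cancel_right2 of_real_1 div_by_1 zero_neq_one)
  then show "line_dir v = u"
    unfolding line_dir_def v by (simp add: complex_eq_iff cos_double sin_double)
  show "v \<noteq> 0" using v sin_zero_abs_cos_one[of \<alpha>] by (auto simp: vector_2_eq_iff)
qed

lemma tendsto_line_dir:
  assumes "(w \<longlongrightarrow> v) F" "v \<noteq> 0"
  shows "((\<lambda>l. line_dir (w l)) \<longlongrightarrow> line_dir v) F"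
proof -
  have c: "((\<lambda>l. w l $ i) \<longlongrightarrow> v $ i) F" for i using assms(1) by (rule tendsto_vec_nth)
  have p: "complex_of_real ((v$1)\<^sup>2 + (v$2)\<^sup>2) \<noteq> 0" using square_sum_pos_2[OF assms(2)] by (simp only: of_real_eq_0_iff)
  show ?thesis
    unfolding line_dir_def
    by (rule tendsto_divide[OF tendsto_Complex[OF tendsto_diff[OF tendsto_power[OF c] tendsto_power[OF c]]
          tendsto_mult[OF tendsto_mult[OF tendsto_const c] c]] tendsto_of_real[OF tendsto_add[OF tendsto_power[OF c] tendsto_power[OF c]]] p])
qed

text \<open>The rank one matrix e f^T. If f \<bullet> e = 0, then \<open>mat 1 + outer2 e f\<close>
  is unipotent and fixes e. This shape is preserved by conjugation, and its powers are linear in the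
  exponent.\<close>

definition outer2 :: "real^2 \<Rightarrow> real^2 \<Rightarrow> real^2^2" where
  "outer2 e f = (\<chi> i j. e$i * f$j)"

lemma outer2_sel [simp]: "outer2 e f $ i $ j = e$i * f$j"
  by (simp add: outer2_def)

lemma outer2_mult: "outer2 e f ** (M :: real^2^2) = outer2 e (f v* M)"
  by (simp add: matrix_2_eq_iff matrix_2_mult vector_matrix_mult_def sum_2 algebra_simps)

lemma mult_outer2: "(M :: real^2^2) ** outer2 e f = outer2 (M *v e) f"
  by (simp add: matrix_2_eq_iff matrix_2_mult matrix_2_vector algebra_simps)

lemma trace_outer2_mult: "trace (outer2 e f ** M) = f \<bullet> (M *v e)"
  by (simp add: trace_2 matrix_2_mult inner_2 matrix_2_vector algebra_simps)

lemma mpow_unipotent: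
  assumes "f \<bullet> e = 0"
  shows "mpow (mat 1 + outer2 e f) n = mat 1 + real n *\<^sub>R outer2 e f"
proof (induction n)
  case (Suc n)
  have "outer2 e f ** outer2 e f = 0"
    using assms by (simp add: matrix_2_eq_iff matrix_2_mult inner_2) (algebra)
  then have "(mat 1 + outer2 e f) ** (mat 1 + real n *\<^sub>R outer2 e f) = mat 1 + real (Suc n) *\<^sub>R outer2 e f"
    by (simp add: matrix_2_eq_iff matrix_2_mult algebra_simps) algebra
  then show ?case using Suc by simp
qed simp

text \<open>G is A X plus a rank one matrix of size N s. The norm of X is at most C s, so the rank
  one term wins as N grows, and the rescaled Gram matrix of the rows tends to v v^T with v = A e.
  Only the length of the row f X enters, so its direction need not converge.\<close>

lemma cusp_rows_tendsto:
  fixes A :: "real^2^2" and X G :: "nat \<Rightarrow> real^2^2"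
  assumes fe: "f \<bullet> e = 0" and s: "\<And>l. s l = norm (f v* X l)" "\<And>l. s l > 0"
    and X: "\<And>l. norm (X l) \<le> C * s l" and N: "filterlim (\<lambda>l. real (N l)) at_top sequentially"
    and G: "\<And>l. G l = A ** (mpow (mat 1 + outer2 e f) (N l) ** X l)"
  shows "(\<lambda>l. (G l $ i \<bullet> G l $ j) / (real (N l) * s l)\<^sup>2) \<longlonglongrightarrow> (A *v e)$i * (A *v e)$j"
proof -
  define v where "v = A *v e"
  define w where "w = (\<lambda>l. (1 / s l) *\<^sub>R (f v* X l))"
  define \<delta> where "\<delta> = (\<lambda>l. (1 / (real (N l) * s l)) *\<^sub>R (A ** X l))"
  have w: "norm (w l) = 1" for l using s(1)[of l] s(2)[of l] by (simp add: w_def)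
  have N0: "\<forall>\<^sub>F l in sequentially. real (N l) > 0"
    using filterlim_at_top_dense[THEN iffD1, OF N, rule_format, of 0] .
  have \<delta>_le: "\<forall>\<^sub>F l in sequentially. norm (\<delta> l $ i) \<le> norm A * C / real (N l)" for i
    using N0
  proof eventually_elim
    case (elim l)
    have "norm (\<delta> l $ i) \<le> norm (\<delta> l)" by (rule Finite_Cartesian_Product.norm_nth_le)
    also have "\<dots> = norm (A ** X l) / (real (N l) * s l)" using elim s(2)[of l] by (simp add: \<delta>_def)
    also have "\<dots> \<le> norm A * (C * s l) / (real (N l) * s l)"
      using elim s(2)[of l] mult_left_mono[OF X[of l] norm_ge_zero[of A]] norm_matrix_mult_le[of A "X l"]
      by (intro divide_right_mono) auto
    also have "\<dots> = norm A * C / real (N l)" using s(2)[of l] by simp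
    finally show ?case .
  qed
  have lim0: "(\<lambda>l. norm A * C / real (N l)) \<longlonglongrightarrow> 0"
    by (rule tendsto_divide_0[OF tendsto_const]) (rule filterlim_at_top_imp_at_infinity[OF N])
  have \<delta>0: "(\<lambda>l. \<delta> l $ i) \<longlonglongrightarrow> 0" for i
    by (rule Lim_null_comparison[OF \<delta>_le lim0])
  have wd: "(\<lambda>l. w l \<bullet> \<delta> l $ i) \<longlonglongrightarrow> 0" for i
  proof (rule Lim_null_comparison)
    show "\<forall>\<^sub>F l in sequentially. norm (w l \<bullet> \<delta> l $ i) \<le> norm (\<delta> l $ i)"
      using Cauchy_Schwarz_ineq2[of "w _" "\<delta> _ $ i"] w by simp
    show "(\<lambda>l. norm (\<delta> l $ i)) \<longlonglongrightarrow> 0" by (rule tendsto_norm_zero[OF \<delta>0])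
  qed
  have dd: "(\<lambda>l. \<delta> l $ i \<bullet> \<delta> l $ j) \<longlonglongrightarrow> 0" using tendsto_inner[OF \<delta>0 \<delta>0] by simp
  have "\<forall>\<^sub>F l in sequentially. v$i * v$j + v$i * (w l \<bullet> \<delta> l $ j) + v$j * (w l \<bullet> \<delta> l $ i) + \<delta> l $ i \<bullet> \<delta> l $ j
      = (G l $ i \<bullet> G l $ j) / (real (N l) * s l)\<^sup>2"
    using N0
  proof eventually_elim
    case (elim l)
    have "G l = A ** X l + real (N l) *\<^sub>R outer2 v (f v* X l)"
      unfolding G mpow_unipotent[OF fe] v_def mult_outer2[symmetric] outer2_mult[symmetric]
      by (simp add: matrix_2_eq_iff matrix_2_mult algebra_simps)
    then have row: "G l $ i = (real (N l) * s l) *\<^sub>R (\<delta> l $ i + (v$i) *\<^sub>R w l)" for i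
      using elim s(2)[of l] by (simp add: \<delta>_def w_def vec_eq_iff algebra_simps)
    have ww: "w l \<bullet> w l = 1" using w[of l] by (simp add: norm_eq_1)
    have k: "real (N l) * s l \<noteq> 0" using elim s(2)[of l] by simp
    have "(G l $ i \<bullet> G l $ j) / (real (N l) * s l)\<^sup>2 = (\<delta> l $ i + (v$i) *\<^sub>R w l) \<bullet> (\<delta> l $ j + (v$j) *\<^sub>R w l)"
      unfolding row inner_scaleR_left inner_scaleR_right power2_eq_square using k by (simp only: mult.assoc[symmetric]) simp
    then show ?case
      by (simp add: inner_add_left inner_add_right ww inner_commute algebra_simps)
  qed
  moreover have "(\<lambda>l. v$i * v$j + v$i * (w l \<bullet> \<delta> l $ j) + v$j * (w l \<bullet> \<delta> l $ i) + \<delta> l $ i \<bullet> \<delta> l $ j)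
      \<longlonglongrightarrow> v$i * v$j + v$i * 0 + v$j * 0 + 0"
    by (intro tendsto_add tendsto_mult tendsto_const wd dd)
  ultimately show ?thesis unfolding v_def[symmetric] by (simp add: tendsto_cong)
qed

lemma abs_diff_ln_cosh:
  assumes "d \<ge> (0::real)"
  shows "\<bar>d - ln (cosh d)\<bar> \<le> ln 2"
proof -
  have "cosh d \<le> exp d" using assms by (simp add: cosh_def)
  then have "ln (cosh d) \<le> d" by (metis cosh_real_pos exp_gt_zero ln_exp ln_le_cancel_iff)
  moreover have "exp d \<le> 2 * cosh d" by (simp add: cosh_def)
  then have "d \<le> ln (2 * cosh d)" by (metis cosh_real_pos exp_gt_zero ln_exp ln_le_cancel_iff mult_pos_pos zero_less_numeral)
  then have "d \<le> ln 2 + ln (cosh d)" by (simp add: ln_mult)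
  ultimately show ?thesis by (simp add: abs_le_iff)
qed

text \<open>The inner products of the rows of G are the coordinates of the image of
  \<open>\<i>\<close>. If they approach the rank one matrix v v^T after division by S^2, the image
  tends to the boundary point of v, at distance 2 ln S up to a bounded error.\<close>

lemma moebius_polar_limits:
  assumes det: "\<And>l. det (G l) = 1" and S: "filterlim S at_top sequentially" and v: "v \<noteq> 0"
    and rows: "\<And>i j. (\<lambda>l. (G l $ i \<bullet> G l $ j) / (S l)\<^sup>2) \<longlonglongrightarrow> v$i * v$j"
    and d: "\<And>l. d l = hdist \<i> (moebius (G l) \<i>)"
  shows "filterlim d at_top sequentially"
    "(\<lambda>l. Complex ((cp (moebius (G l) \<i>) - cr (moebius (G l) \<i>)) / 2) (cq (moebius (G l) \<i>)) / of_real (sinh (d l))) \<longlonglongrightarrow> line_dir v"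
    "\<exists>C. \<forall>\<^sub>F l in sequentially. \<bar>d l - 2 * ln (S l)\<bar> \<le> C"
proof -
  note co = coords_moebius_ii[OF det]
  define q where "q = ((v$1)\<^sup>2 + (v$2)\<^sup>2) / 2"
  have q: "q > 0" using square_sum_pos_2[OF v] by (simp add: q_def)
  have d0: "d l \<ge> 0" for l unfolding d by (intro hdist_nonneg ii_mem coords_moebius(1)[OF det])
  have S0: "\<forall>\<^sub>F l in sequentially. S l > 0"
    using filterlim_at_top_dense[THEN iffD1, OF S, rule_format, of 0] .
  have ceq: "cosh (d l) / (S l)\<^sup>2 = ((G l $ 1 \<bullet> G l $ 1) / (S l)\<^sup>2 + (G l $ 2 \<bullet> G l $ 2) / (S l)\<^sup>2) / 2" for l
    unfolding d by (simp add: cosh_hdist_ii coords_moebius(1)[OF det] co add_divide_distrib)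
  have c_lim: "(\<lambda>l. cosh (d l) / (S l)\<^sup>2) \<longlonglongrightarrow> q"
  proof -
    have q': "q = (v$1 * v$1 + v$2 * v$2) / 2" by (simp add: q_def power2_eq_square)
    show ?thesis unfolding ceq q' by (rule tendsto_divide[OF tendsto_add[OF rows rows] tendsto_const]) simp
  qed
  have S2: "filterlim (\<lambda>l. S l * S l) at_top sequentially" by (rule filterlim_at_top_mult_at_top[OF S S])
  have fl: "filterlim (\<lambda>l. cosh (d l) / (S l)\<^sup>2 * (S l * S l)) at_top sequentially"
    by (rule filterlim_tendsto_pos_mult_at_top[OF c_lim q S2])
  have ev: "\<forall>\<^sub>F l in sequentially. cosh (d l) / (S l)\<^sup>2 * (S l * S l) = cosh (d l)"
    using S0 by eventually_elim (simp add: power2_eq_square)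
  have c_top: "filterlim (\<lambda>l. cosh (d l)) at_top sequentially"
    by (rule filterlim_cong[OF refl refl ev, THEN iffD1, OF fl])
  have "filterlim (\<lambda>l. ln (cosh (d l))) at_top sequentially"
    by (rule filterlim_compose[OF ln_at_top c_top])
  then have "filterlim (\<lambda>l. - ln 2 + ln (cosh (d l))) at_top sequentially"
    by (rule filterlim_tendsto_add_at_top[OF tendsto_const])
  then show d_top: "filterlim d at_top sequentially"
  proof (rule filterlim_at_top_mono)
    have "- ln 2 + ln (cosh (d l)) \<le> d l" for l using abs_diff_ln_cosh[OF d0[of l]] by linarith
    then show "\<forall>\<^sub>F l in sequentially. - ln 2 + ln (cosh (d l)) \<le> d l" by simp
  qed
  have th: "(\<lambda>l. tanh (d l)) \<longlonglongrightarrow> 1" by (rule filterlim_compose[OF tanh_real_at_top d_top])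
  have dl: "(\<lambda>l. Complex (((G l $ 1 \<bullet> G l $ 1) / (S l)\<^sup>2 - (G l $ 2 \<bullet> G l $ 2) / (S l)\<^sup>2) / 2) ((G l $ 1 \<bullet> G l $ 2) / (S l)\<^sup>2)
      / of_real (tanh (d l) * (cosh (d l) / (S l)\<^sup>2))) \<longlonglongrightarrow> Complex ((v$1 * v$1 - v$2 * v$2) / 2) (v$1 * v$2) / of_real (1 * q)"
    by (intro tendsto_divide tendsto_Complex tendsto_diff rows tendsto_of_real tendsto_mult th c_lim tendsto_const) (use q in auto)
  have dv: "Complex ((v$1 * v$1 - v$2 * v$2) / 2) (v$1 * v$2) / of_real (1 * q) = line_dir v"
    unfolding line_dir_def q_def by (simp add: complex_eq_iff Re_divide_of_real Im_divide_of_real power2_eq_square mult.commute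
        del: distrib_left_numeral right_diff_distrib_numeral distrib_right_numeral left_diff_distrib_numeral)
  have de: "\<forall>\<^sub>F l in sequentially. Complex (((G l $ 1 \<bullet> G l $ 1) / (S l)\<^sup>2 - (G l $ 2 \<bullet> G l $ 2) / (S l)\<^sup>2) / 2) ((G l $ 1 \<bullet> G l $ 2) / (S l)\<^sup>2)
      / of_real (tanh (d l) * (cosh (d l) / (S l)\<^sup>2)) =
      Complex ((cp (moebius (G l) \<i>) - cr (moebius (G l) \<i>)) / 2) (cq (moebius (G l) \<i>)) / of_real (sinh (d l))"
    using S0
  proof eventually_elim
    case (elim l)
    have t: "tanh (d l) * (cosh (d l) / (S l)\<^sup>2) = sinh (d l) / (S l)\<^sup>2" by (simp add: tanh_def)
    show ?case unfolding t co using elim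
      by (simp add: complex_eq_iff Re_divide_of_real Im_divide_of_real diff_divide_distrib[symmetric])
  qed
  show "(\<lambda>l. Complex ((cp (moebius (G l) \<i>) - cr (moebius (G l) \<i>)) / 2) (cq (moebius (G l) \<i>)) / of_real (sinh (d l))) \<longlonglongrightarrow> line_dir v"
    by (rule Lim_transform_eventually[OF dl[unfolded dv] de])
  have "(\<lambda>l. ln (cosh (d l) / (S l)\<^sup>2)) \<longlonglongrightarrow> ln q" by (rule tendsto_ln[OF c_lim]) (use q in simp)
  then have "\<forall>\<^sub>F l in sequentially. dist (ln (cosh (d l) / (S l)\<^sup>2)) (ln q) < 1" by (rule tendstoD) simp
  with S0 have "\<forall>\<^sub>F l in sequentially. \<bar>d l - 2 * ln (S l)\<bar> \<le> ln 2 + \<bar>ln q\<bar> + 1"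
  proof eventually_elim
    case (elim l)
    have "ln (cosh (d l) / (S l)\<^sup>2) = ln (cosh (d l)) - 2 * ln (S l)"
      using elim by (simp add: ln_div ln_realpow)
    then show ?case using elim abs_diff_ln_cosh[OF d0[of l]] unfolding dist_real_def by linarith
  qed
  then show "\<exists>C. \<forall>\<^sub>F l in sequentially. \<bar>d l - 2 * ln (S l)\<bar> \<le> C" by blast
qed


section \<open>Linear growth\<close>

text \<open>Linear growth up to a bounded error is the scale on which distances and logarithms of
  traces are compared; multiplicative constants disappear in it.\<close>

definition lin_growth :: "(nat \<Rightarrow> real) \<Rightarrow> real \<Rightarrow> bool" where
  "lin_growth x \<kappa> \<longleftrightarrow> (\<exists>C. \<forall>\<^sub>F l in sequentially. \<bar>x l - \<kappa> * real l\<bar> \<le> C)"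

lemma lin_growth_tendsto:
  assumes "lin_growth x \<kappa>"
  shows "(\<lambda>l. x l / real l) \<longlonglongrightarrow> \<kappa>"
proof -
  obtain C where C: "\<forall>\<^sub>F l in sequentially. \<bar>x l - \<kappa> * real l\<bar> \<le> C" using assms by (auto simp: lin_growth_def)
  have "(\<lambda>l. x l / real l - \<kappa>) \<longlonglongrightarrow> 0"
  proof (rule Lim_null_comparison)
    show "\<forall>\<^sub>F l in sequentially. norm (x l / real l - \<kappa>) \<le> C / real l"
      using C eventually_gt_at_top[of 0]
    proof eventually_elim
      case (elim l)
      have "x l / real l - \<kappa> = (x l - \<kappa> * real l) / real l" using elim by (simp add: field_simps)
      then show ?case using elim by (simp add: divide_right_mono)
    qed
    show "(\<lambda>l. C / real l) \<longlonglongrightarrow> 0" by (rule lim_const_over_n)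
  qed
  then show ?thesis by (simp add: LIM_zero_iff)
qed

lemma lin_growth_add:
  assumes "lin_growth x \<kappa>" "lin_growth y \<mu>"
  shows "lin_growth (\<lambda>l. x l + y l) (\<kappa> + \<mu>)"
proof -
  obtain C D where "\<forall>\<^sub>F l in sequentially. \<bar>x l - \<kappa> * real l\<bar> \<le> C" "\<forall>\<^sub>F l in sequentially. \<bar>y l - \<mu> * real l\<bar> \<le> D"
    using assms by (auto simp: lin_growth_def)
  then have "\<forall>\<^sub>F l in sequentially. \<bar>x l + y l - (\<kappa> + \<mu>) * real l\<bar> \<le> C + D"
  proof eventually_elim
    case (elim l)
    then show ?case unfolding distrib_right by linarith
  qed
  then show ?thesis by (auto simp: lin_growth_def)
qed

lemma lin_growth_near:
  assumes "lin_growth x \<kappa>" "\<forall>\<^sub>F l in sequentially. \<bar>y l - c * x l\<bar> \<le> C"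
  shows "lin_growth y (c * \<kappa>)"
proof -
  obtain D where "\<forall>\<^sub>F l in sequentially. \<bar>x l - \<kappa> * real l\<bar> \<le> D" using assms by (auto simp: lin_growth_def)
  with assms(2) have "\<forall>\<^sub>F l in sequentially. \<bar>y l - c * \<kappa> * real l\<bar> \<le> C + \<bar>c\<bar> * D"
  proof eventually_elim
    case (elim l)
    have "\<bar>c * (x l - \<kappa> * real l)\<bar> \<le> \<bar>c\<bar> * D" unfolding abs_mult using elim by (intro mult_left_mono) auto
    then show ?case using elim by (simp add: algebra_simps)
  qed
  then show ?thesis by (auto simp: lin_growth_def)
qed

lemma lin_growth_ln:
  assumes c: "c > 0" and x: "\<forall>\<^sub>F l in sequentially. c * exp (\<kappa> * real l) \<le> x l \<and> x l \<le> C * exp (\<kappa> * real l)"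
  shows "lin_growth (\<lambda>l. ln (x l)) \<kappa>"
proof -
  have "\<forall>\<^sub>F l in sequentially. \<bar>ln (x l) - \<kappa> * real l\<bar> \<le> \<bar>ln c\<bar> + \<bar>ln C\<bar>"
    using x
  proof eventually_elim
    case (elim l)
    have lo: "c * exp (\<kappa> * real l) > 0" using c by simp
    then have x0: "x l > 0" using elim by linarith
    then have "C * exp (\<kappa> * real l) > 0" using elim by linarith
    then have C: "C > 0" by (simp add: zero_less_mult_iff)
    have "ln (c * exp (\<kappa> * real l)) \<le> ln (x l)" "ln (x l) \<le> ln (C * exp (\<kappa> * real l))"
      using elim lo x0 C by (auto simp: ln_le_cancel_iff)
    then have "ln c + \<kappa> * real l \<le> ln (x l)" "ln (x l) \<le> ln C + \<kappa> * real l"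
      using c C by (simp_all add: ln_mult)
    then show ?case by linarith
  qed
  then show ?thesis unfolding lin_growth_def by blast
qed

text \<open>The exponent of a parabolic must be an integer; rounding up exp (\<kappa> l) gives
  exponents whose logarithm grows at the prescribed rate \<kappa>.\<close>

lemma ceiling_exp_growth:
  assumes "\<kappa> > 0" and N: "\<And>l. N l = nat \<lceil>exp (\<kappa> * real l)\<rceil>"
  shows "exp (\<kappa> * real l) \<le> real (N l)" "real (N l) \<le> 2 * exp (\<kappa> * real l)"
    "filterlim (\<lambda>l. real (N l)) at_top sequentially" "lin_growth (\<lambda>l. ln (real (N l))) \<kappa>"
proof -
  have b: "exp (\<kappa> * real l) \<le> real (N l) \<and> real (N l) \<le> 2 * exp (\<kappa> * real l)" for l
  proof -
    have "1 \<le> exp (\<kappa> * real l)" using assms(1) by simp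
    then have "real (N l) = of_int \<lceil>exp (\<kappa> * real l)\<rceil>" unfolding N by (simp add: ceiling_le_zero less_imp_le)
    then show ?thesis using \<open>1 \<le> exp (\<kappa> * real l)\<close> ceiling_correct[of "exp (\<kappa> * real l)"] by linarith
  qed
  then show "exp (\<kappa> * real l) \<le> real (N l)" "real (N l) \<le> 2 * exp (\<kappa> * real l)" by auto
  have "filterlim (\<lambda>l. \<kappa> * real l) at_top sequentially"
    by (rule filterlim_tendsto_pos_mult_at_top[OF tendsto_const assms(1) filterlim_real_sequentially])
  then have "filterlim (\<lambda>l. exp (\<kappa> * real l)) at_top sequentially" by (rule filterlim_compose[OF exp_at_top])
  then show "filterlim (\<lambda>l. real (N l)) at_top sequentially"
    by (rule filterlim_at_top_mono) (use b in auto)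
  show "lin_growth (\<lambda>l. ln (real (N l))) \<kappa>"
    by (rule lin_growth_ln[of 1 _ _ 2]) (use b in auto)
qed

lemma slope_limit:
  assumes "lin_growth d1 (c * a1)" "lin_growth d2 (c * a2)" and c: "c > 0" and a: "a1\<^sup>2 + a2\<^sup>2 = 1"
    and D: "\<And>l. D l = sqrt ((d1 l)\<^sup>2 + (d2 l)\<^sup>2)"
  shows "(\<lambda>l. d1 l / D l) \<longlonglongrightarrow> a1" "(\<lambda>l. d2 l / D l) \<longlonglongrightarrow> a2"
proof -
  have l1: "(\<lambda>l. d1 l / real l) \<longlonglongrightarrow> c * a1" and l2: "(\<lambda>l. d2 l / real l) \<longlonglongrightarrow> c * a2"
    using assms by (auto intro: lin_growth_tendsto)
  have "(\<lambda>l. sqrt ((d1 l / real l)\<^sup>2 + (d2 l / real l)\<^sup>2)) \<longlonglongrightarrow> sqrt ((c * a1)\<^sup>2 + (c * a2)\<^sup>2)"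
    by (intro tendsto_intros l1 l2)
  moreover have "(c * a1)\<^sup>2 + (c * a2)\<^sup>2 = c\<^sup>2" using a by (simp add: power_mult_distrib distrib_left[symmetric])
  ultimately have lD: "(\<lambda>l. sqrt ((d1 l / real l)\<^sup>2 + (d2 l / real l)\<^sup>2)) \<longlonglongrightarrow> c" using c by simp
  have eq: "\<forall>\<^sub>F l in sequentially. x l / real l / sqrt ((d1 l / real l)\<^sup>2 + (d2 l / real l)\<^sup>2) = x l / D l" for x
    using eventually_gt_at_top[of 0]
  proof eventually_elim
    case (elim l)
    have "sqrt ((d1 l / real l)\<^sup>2 + (d2 l / real l)\<^sup>2) = D l / real l"
      unfolding D using elim by (simp add: power_divide add_divide_distrib[symmetric] real_sqrt_divide)
    then show ?case using elim by simp
  qed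
  show "(\<lambda>l. d1 l / D l) \<longlonglongrightarrow> a1"
    using Lim_transform_eventually[OF tendsto_divide[OF l1 lD] eq] c by simp
  show "(\<lambda>l. d2 l / D l) \<longlonglongrightarrow> a2"
    using Lim_transform_eventually[OF tendsto_divide[OF l2 lD] eq] c by simp
qed

section \<open>Dynamics of a group of pairs whose second component is dominated by the first\<close>

section \<open>Groups of pairs of matrices\<close>

definition adj2 :: "real^2^2 \<Rightarrow> real^2^2" where
  "adj2 M = mat2 (M$2$2) (- (M$1$2)) (- (M$2$1)) (M$1$1)"

lemma mult_adj2: "det M = 1 \<Longrightarrow> M ** adj2 M = mat 1" "det M = 1 \<Longrightarrow> adj2 M ** M = mat 1"
  by (simp_all add: adj2_def matrix_2_eq_iff matrix_2_mult det_2 algebra_simps)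

lemma norm_adj2: "norm (adj2 M) = norm M"
  by (rule power2_eq_imp_eq) (simp_all add: norm_matrix_2 inner_2 adj2_def)

lemma vector_matrix_mult_assoc_2: "(x v* (A :: real^2^2)) v* (B :: real^2^2) = x v* (A ** B)"
  by (simp add: vector_2_eq_iff vector_matrix_mult_def sum_2 matrix_2_mult algebra_simps)

text \<open>For determinant 1 the adjugate is the inverse and has the same norm, so M cannot shrink
  a row by more than the factor norm M.\<close>

lemma norm_le_norm_vector_matrix:
  assumes "det (M :: real^2^2) = 1"
  shows "norm x \<le> norm (x v* M) * norm M"
proof -
  have "x = (x v* M) v* adj2 M"
    unfolding vector_matrix_mult_assoc_2 mult_adj2(1)[OF assms] by (simp add: vector_2_eq_iff vector_matrix_mult_def sum_2)
  then show ?thesis using norm_vector_matrix_le[of "x v* M" "adj2 M"] by (simp add: norm_adj2)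
qed

lemma matrix_vector_nonzero_2:
  assumes "det (M :: real^2^2) = 1" "v \<noteq> 0"
  shows "M *v v \<noteq> 0"
proof
  assume "M *v v = 0"
  then have "adj2 M *v (M *v v) = 0" by simp
  then show False using assms mult_adj2(2)[OF assms(1)] by (simp add: matrix_vector_mul_assoc)
qed

definition pair_orbit :: "((real^2^2) \<times> (real^2^2)) set \<Rightarrow> complex \<times> complex \<Rightarrow> (complex \<times> complex) set" where
  "pair_orbit G x = {(moebius A (fst x), moebius B (snd x)) | A B. (A, B) \<in> G}"

lemma parallel_2:
  fixes v w :: "real^2"
  assumes "v \<noteq> 0" "v$1 * w$2 = v$2 * w$1"
  obtains k where "w = k *\<^sub>R v"
proof (cases "v$1 = 0")
  case True
  then have "v$2 \<noteq> 0" using assms(1) by (auto simp: vector_2_eq_iff)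
  moreover from this have "w$1 = 0" using assms(2) True by simp
  ultimately show ?thesis using True by (intro that[of "w$2 / v$2"]) (simp add: vector_2_eq_iff)
next
  case False
  then show ?thesis using assms(2) by (intro that[of "w$1 / v$1"]) (simp add: vector_2_eq_iff field_simps)
qed

lemma no_real_eigenvector:
  fixes y :: "real^2^2"
  assumes "det y = 1" "\<bar>trace y\<bar> < 2" "v \<noteq> 0"
  shows "y *v v \<noteq> m *\<^sub>R v"
proof
  assume m: "y *v v = m *\<^sub>R v"
  have "y *v (y *v v) = trace y *\<^sub>R (y *v v) - v"
    unfolding matrix_vector_mul_assoc cayley_hamilton_2 assms(1)
    by (simp add: vector_2_eq_iff matrix_2_vector algebra_simps)
  moreover have "y *v (y *v v) = m\<^sup>2 *\<^sub>R v"
    unfolding m matrix_vector_mult_scaleR by (simp add: power2_eq_square)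
  ultimately have "(m\<^sup>2 - trace y * m + 1) *\<^sub>R v = 0"
    unfolding m by (simp add: algebra_simps)
  then have "m\<^sup>2 - trace y * m + 1 = 0" using assms(3) by simp
  then have "(m - trace y / 2)\<^sup>2 = (trace y / 2)\<^sup>2 - 1" by (simp add: power2_eq_square algebra_simps)
  moreover have "(trace y / 2)\<^sup>2 < 1" using assms(2) by (simp add: abs_square_less_1)
  ultimately show False using zero_le_power2[of "m - trace y / 2"] by linarith
qed

text \<open>What the dynamics require, separated from arithmetic and triangles. The vectors e1, e2
  span the lines fixed by the parabolics and f1, f2 annihilate them;
  \<open>f1 \<bullet> (h1 *v e1) \<noteq> 0\<close> says that h1 moves the cusp. Density is demanded
  of the first factor only and is extended to pairs below.\<close>

locale pair_group =
  fixes G :: "((real^2^2) \<times> (real^2^2)) set"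
    and e1 e2 f1 f2 :: "real^2" and h1 h2 :: "real^2^2" and Cd :: real
  assumes det_G: "(A, B) \<in> G \<Longrightarrow> det A = 1 \<and> det B = 1"
    and one_G: "(mat 1, mat 1) \<in> G"
    and mult_G: "(A, B) \<in> G \<Longrightarrow> (A', B') \<in> G \<Longrightarrow> (A ** A', B ** B') \<in> G"
    and dominated: "Cd > 0" "(A, B) \<in> G \<Longrightarrow> norm B \<le> Cd * norm A"
    and nz: "e1 \<noteq> 0" "e2 \<noteq> 0" "f2 \<noteq> 0"
    and fe: "f1 \<bullet> e1 = 0" "f2 \<bullet> e2 = 0"
    and unipotent_G: "(mat 1 + outer2 e1 f1, mat 1 + outer2 e2 f2) \<in> G"
    and h_G: "(h1, h2) \<in> G"
    and trace_h: "trace h1 > 2" "\<bar>trace h2\<bar> < 2"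
    and h1_e1: "f1 \<bullet> (h1 *v e1) \<noteq> 0"
    and h2_infinite: "n > 0 \<Longrightarrow> mpow h2 n \<noteq> mat 1"
    and dense_orbit: "norm \<xi> = 1 \<Longrightarrow> \<epsilon> > 0 \<Longrightarrow> \<exists>A B. (A, B) \<in> G \<and> norm (line_dir (A *v e1) - \<xi>) < \<epsilon>"
begin

abbreviation "T1 \<equiv> mat 1 + outer2 e1 f1"
abbreviation "T2 \<equiv> mat 1 + outer2 e2 f2"

lemma mpow_G: "(A, B) \<in> G \<Longrightarrow> (mpow A n, mpow B n) \<in> G"
  by (induction n) (auto intro: one_G mult_G)

definition "\<eta> = arcosh (trace h1 / 2)"
definition "\<theta> = arccos (trace h2 / 2)"

lemma eta: "\<eta> > 0" "trace h1 = 2 * cosh \<eta>"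
  using trace_h(1) cosh_arcosh_real[of "trace h1 / 2"] by (auto simp: \<eta>_def)

lemma theta: "sin \<theta> > 0" "trace h2 = 2 * cos \<theta>"
  using trace_h(2) arccos_lt_bounded[of "trace h2 / 2"] by (auto simp: \<theta>_def abs_less_iff intro!: sin_gt_zero)

lemma det_h: "det h1 = 1" "det h2 = 1"
  using det_G[OF h_G] by auto

lemma det_T: "det T1 = 1" "det T2 = 1"
  using det_G[OF unipotent_G] by auto

text \<open>A power of h1 is a combination of h1 and the identity, and f1 kills e1, so only the
  coefficient of h1 remains.\<close>

lemma f1_h1_power: "f1 \<bullet> (mpow h1 n *v e1) = sinh (real n * \<eta>) / sinh \<eta> * (f1 \<bullet> (h1 *v e1))"
proof -
  have "sinh \<eta> * (f1 \<bullet> (mpow h1 n *v e1)) = f1 \<bullet> ((sinh \<eta> *\<^sub>R mpow h1 n) *v e1)"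
    by (simp add: inner_2 matrix_2_vector algebra_simps)
  also have "\<dots> = sinh (real n * \<eta>) * (f1 \<bullet> (h1 *v e1)) - sinh ((real n - 1) * \<eta>) * (f1 \<bullet> e1)"
    unfolding mpow_sinh[OF det_h(1) eta(2)] by (simp add: inner_2 matrix_2_vector algebra_simps)
  finally show ?thesis using eta(1) fe by (simp add: field_simps)
qed

lemma f2_h2_power: "f2 \<bullet> (mpow h2 n *v e2) = sin (real n * \<theta>) / sin \<theta> * (f2 \<bullet> (h2 *v e2))"
proof -
  have "sin \<theta> * (f2 \<bullet> (mpow h2 n *v e2)) = f2 \<bullet> ((sin \<theta> *\<^sub>R mpow h2 n) *v e2)"
    by (simp add: inner_2 matrix_2_vector algebra_simps)
  also have "\<dots> = sin (real n * \<theta>) * (f2 \<bullet> (h2 *v e2)) - sin ((real n - 1) * \<theta>) * (f2 \<bullet> e2)"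
    unfolding mpow_sin[OF det_h(2) theta(2)] by (simp add: inner_2 matrix_2_vector algebra_simps)
  finally show ?thesis using theta(1) fe by (simp add: field_simps)
qed

lemma sinh_lower: "sinh (real (Suc n) * \<eta>) \<ge> sinh \<eta> * exp (real n * \<eta>)"
proof -
  have e: "exp (real (Suc n) * \<eta>) = exp \<eta> * exp (real n * \<eta>)" by (simp add: distrib_right exp_add)
  have "exp (- \<eta>) * exp (- (real n * \<eta>)) \<le> exp (- \<eta>) * exp (real n * \<eta>)" using eta(1) by simp
  moreover have "exp (- (real (Suc n) * \<eta>)) = exp (- \<eta>) * exp (- (real n * \<eta>))" by (simp add: distrib_right exp_add[symmetric])
  ultimately show ?thesis unfolding sinh_def e by (simp add: field_simps)
qed

text \<open>The matrix k stands for a change of base point. The exponent starts at 1 because the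
  lower bound comes from sinh (n \<eta>), which vanishes for n = 0.\<close>

lemma exists_h1_bounds:
  assumes "det (k :: real^2^2) = 1"
  obtains c C where "c > 0" "\<And>l. norm (mpow h1 (Suc l) ** k) \<le> C * exp (\<eta> * real l)"
    "\<And>l. c * exp (\<eta> * real l) \<le> norm (f1 v* (mpow h1 (Suc l) ** k))"
proof -
  obtain C0 where C0: "C0 > 0" "\<And>n. norm (mpow h1 n) \<le> C0 * exp (real n * \<eta>)"
    using norm_mpow_hyperbolic[OF det_h(1) eta(2,1)] by blast
  define C where "C = C0 * exp \<eta> * norm k"
  have 1: "norm (mpow h1 (Suc l) ** k) \<le> C * exp (\<eta> * real l)" for l
  proof -
    have "norm (mpow h1 (Suc l) ** k) \<le> norm (mpow h1 (Suc l)) * norm k" by (rule norm_matrix_mult_le)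
    also have "\<dots> \<le> C0 * exp (real (Suc l) * \<eta>) * norm k" using C0(2)[of "Suc l"] by (intro mult_right_mono) auto
    also have "exp (real (Suc l) * \<eta>) = exp \<eta> * exp (\<eta> * real l)" by (simp add: exp_add[symmetric] algebra_simps)
    finally show ?thesis by (simp add: C_def mult_ac)
  qed
  define p where "p = \<bar>f1 \<bullet> (h1 *v e1)\<bar>"
  have p: "p > 0" using h1_e1 by (simp add: p_def)
  have nk: "norm k > 0" using assms by (auto simp: det_2)
  define c where "c = p / (norm e1 * norm k)"
  have c: "c > 0" using p nk nz by (simp add: c_def)
  have 2: "c * exp (\<eta> * real l) \<le> norm (f1 v* (mpow h1 (Suc l) ** k))" for l
  proof -
    let ?M = "mpow h1 (Suc l)"
    have s: "sinh \<eta> > 0" using eta by simp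
    have "exp (\<eta> * real l) * p \<le> sinh (real (Suc l) * \<eta>) / sinh \<eta> * p"
      using sinh_lower[of l] s p by (intro mult_right_mono) (auto simp: field_simps)
    also have "\<dots> = \<bar>f1 \<bullet> (?M *v e1)\<bar>"
      unfolding f1_h1_power p_def abs_mult using s eta by (simp add: abs_mult)
    also have "f1 \<bullet> (?M *v e1) = (f1 v* ?M) \<bullet> e1" 
      by (simp add: inner_2 matrix_2_vector vector_matrix_mult_def sum_2 algebra_simps)
    also have "\<bar>(f1 v* ?M) \<bullet> e1\<bar> \<le> norm (f1 v* ?M) * norm e1" by (rule Cauchy_Schwarz_ineq2)
    also have "\<dots> \<le> norm ((f1 v* ?M) v* k) * norm k * norm e1"
      using norm_le_norm_vector_matrix[OF assms, of "f1 v* ?M"] by (intro mult_right_mono) auto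
    finally have "exp (\<eta> * real l) * p \<le> norm (f1 v* (?M ** k)) * norm k * norm e1"
      by (simp only: vector_matrix_mult_assoc_2)
    then show ?thesis using nk nz(1) by (simp add: c_def field_simps)
  qed
  from that[OF c 1 2] show ?thesis .
qed

text \<open>Powers of the elliptic h2 form a bounded set of matrices of determinant 1, so their
  inverses are bounded too and rows neither grow nor shrink without limit.\<close>

lemma exists_h2_bounds:
  assumes "det (k :: real^2^2) = 1"
  obtains c C where "c > 0" "\<And>l. norm (mpow h2 l ** k) \<le> C" "\<And>l. c \<le> norm (f2 v* (mpow h2 l ** k))"
proof -
  obtain C0 where C0: "C0 > 0" "\<And>n. norm (mpow h2 n) \<le> C0"
    using norm_mpow_elliptic[OF det_h(2) theta(2,1)] by blast
  define C where "C = C0 * norm k"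
  have nk: "norm k > 0" using assms by (auto simp: det_2)
  have C: "C > 0" using C0 nk by (simp add: C_def)
  have 1: "norm (mpow h2 l ** k) \<le> C" for l
    unfolding C_def using norm_matrix_mult_le[of "mpow h2 l" k] C0(2)[of l] by (meson mult_right_mono norm_ge_zero order_trans)
  have 2: "norm f2 / C \<le> norm (f2 v* (mpow h2 l ** k))" for l
  proof -
    have "det (mpow h2 l ** k) = 1" by (simp add: det_mul det_mpow det_h assms)
    from norm_le_norm_vector_matrix[OF this, of f2]
    have "norm f2 \<le> norm (f2 v* (mpow h2 l ** k)) * norm (mpow h2 l ** k)" .
    also have "\<dots> \<le> norm (f2 v* (mpow h2 l ** k)) * C" by (intro mult_left_mono 1) auto
    finally show ?thesis using C by (simp add: field_simps)
  qed
  have "norm f2 / C > 0" using C nz by simp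
  from that[OF this 1 2] show ?thesis .
qed

lemma pair_orbit_subset: "x \<in> HH \<Longrightarrow> pair_orbit G x \<subseteq> HH"
  by (auto simp: pair_orbit_def HH_iff intro!: coords_moebius dest!: det_G)

lemma cusp_limit:
  assumes x: "x \<in> HH" and A: "(A1, A2) \<in> G" and a: "0 < a2" "a2 < a1" "a1\<^sup>2 + a2\<^sup>2 = 1"
  shows "Inr (ray_class (base_ray a1 a2 (line_dir (A1 *v e1)) (line_dir (A2 *v e2)))) \<in> cone_topology closure_of (Inl ` pair_orbit G x)"
proof -
  have xm: "fst x \<in> H2" "snd x \<in> H2" using x by (auto simp: HH_iff)
  obtain k1 where k1: "det k1 = 1" "moebius k1 \<i> = fst x" using moebius_ii_surj[OF xm(1)] .
  obtain k2 where k2: "det k2 = 1" "moebius k2 \<i> = snd x" using moebius_ii_surj[OF xm(2)] .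
  obtain c C where b1: "c > 0" "\<And>l. norm (mpow h1 (Suc l) ** k1) \<le> C * exp (\<eta> * real l)"
    "\<And>l. c * exp (\<eta> * real l) \<le> norm (f1 v* (mpow h1 (Suc l) ** k1))" using exists_h1_bounds[OF k1(1)] by blast
  obtain c' C' where b2: "c' > 0" "\<And>l. norm (mpow h2 l ** k2) \<le> C'" "\<And>l. c' \<le> norm (f2 v* (mpow h2 l ** k2))"
    using exists_h2_bounds[OF k2(1)] by blast
  have detA: "det A1 = 1" "det A2 = 1" using det_G[OF A] by auto
  \<comment> \<open>The two distances grow like 2 (\<kappa> + \<eta>) l and 2 \<kappa> l; this value
    makes their ratio a1 : a2.\<close>
  define \<kappa> where "\<kappa> = \<eta> * a2 / (a1 - a2)"
  have \<kappa>: "\<kappa> > 0" using eta a by (simp add: \<kappa>_def)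
  define N where "N = (\<lambda>l. nat \<lceil>exp (\<kappa> * real l)\<rceil>)"
  have N: "\<And>l. N l = nat \<lceil>exp (\<kappa> * real l)\<rceil>" by (simp add: N_def)
  note Ng = ceiling_exp_growth[OF \<kappa> N]
  define X1 where "X1 = (\<lambda>l. mpow h1 (Suc l) ** k1)"
  define X2 where "X2 = (\<lambda>l. mpow h2 (Suc l) ** k2)"
  define s1 where "s1 = (\<lambda>l. norm (f1 v* X1 l))"
  define s2 where "s2 = (\<lambda>l. norm (f2 v* X2 l))"
  define G1 where "G1 = (\<lambda>l. A1 ** (mpow T1 (N l) ** X1 l))"
  define G2 where "G2 = (\<lambda>l. A2 ** (mpow T2 (N l) ** X2 l))"
  define d1 where "d1 = (\<lambda>l. hdist \<i> (moebius (G1 l) \<i>))"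
  define d2 where "d2 = (\<lambda>l. hdist \<i> (moebius (G2 l) \<i>))"
  define D where "D = (\<lambda>l. sqrt ((d1 l)\<^sup>2 + (d2 l)\<^sup>2))"
  have s1_low: "c * exp (\<eta> * real l) \<le> s1 l" and s2_low: "c' \<le> s2 l" for l
    using b1(3)[of l] b2(3)[of "Suc l"] by (simp_all only: s1_def s2_def X1_def X2_def)
  have s1_up: "s1 l \<le> norm f1 * C * exp (\<eta> * real l)" for l
    unfolding s1_def X1_def mult.assoc
    by (rule order_trans[OF norm_vector_matrix_le]) (intro mult_left_mono b1(2) norm_ge_zero)
  have s2_up: "s2 l \<le> norm f2 * C'" for l
    unfolding s2_def X2_def
    by (rule order_trans[OF norm_vector_matrix_le]) (intro mult_left_mono b2(2) norm_ge_zero)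
  have s1_pos: "s1 l > 0" for l using mult_pos_pos[OF b1(1) exp_gt_zero] by (rule less_le_trans[OF _ s1_low[of l]])
  have s2_pos: "s2 l > 0" for l using s2_low[of l] b2(1) by linarith
  have X1: "norm (X1 l) \<le> C / c * s1 l" for l
  proof -
    have "C \<ge> 0" using order_trans[OF norm_ge_zero b1(2)[of 0]] by simp
    then have "C / c * (c * exp (\<eta> * real l)) \<le> C / c * s1 l" using b1(1) by (intro mult_left_mono s1_low) auto
    then show ?thesis using b1(1) b1(2)[of l] by (simp add: X1_def)
  qed
  have X2: "norm (X2 l) \<le> C' / c' * s2 l" for l
  proof -
    have "C' \<ge> 0" using b2(2)[of 0] norm_ge_zero[of "mpow h2 0 ** k2"] by linarith
    then have "C' / c' * c' \<le> C' / c' * s2 l" using b2(1) by (intro mult_left_mono s2_low) auto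
    then show ?thesis using b2(1) b2(2)[of "Suc l"] by (simp add: X2_def)
  qed
  have detG: "det (G1 l) = 1" "det (G2 l) = 1" for l
    unfolding G1_def G2_def X1_def X2_def by (simp_all only: det_mul det_mpow det_T det_h detA k1 k2 mult_1)
  have rows1: "(\<lambda>l. (G1 l $ i \<bullet> G1 l $ j) / (real (N l) * s1 l)\<^sup>2) \<longlonglongrightarrow> (A1 *v e1)$i * (A1 *v e1)$j" for i j
    by (rule cusp_rows_tendsto[OF fe(1) _ s1_pos X1 Ng(3)]) (simp_all add: s1_def G1_def)
  have rows2: "(\<lambda>l. (G2 l $ i \<bullet> G2 l $ j) / (real (N l) * s2 l)\<^sup>2) \<longlonglongrightarrow> (A2 *v e2)$i * (A2 *v e2)$j" for i j
    by (rule cusp_rows_tendsto[OF fe(2) _ s2_pos X2 Ng(3)]) (simp_all add: s2_def G2_def)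
  have expN: "exp (\<eta> * real l) \<ge> 1" for l using eta by simp
  have S1: "filterlim (\<lambda>l. real (N l) * s1 l) at_top sequentially"
  proof (rule filterlim_at_top_mono)
    show "filterlim (\<lambda>l. c * real (N l)) at_top sequentially"
      by (rule filterlim_tendsto_pos_mult_at_top[OF tendsto_const b1(1) Ng(3)])
    have "c * real (N l) \<le> real (N l) * s1 l" for l
    proof -
      have "c * 1 \<le> c * exp (\<eta> * real l)" using b1(1) expN[of l] by (intro mult_left_mono) auto
      then have "c \<le> s1 l" using s1_low[of l] by linarith
      then have "real (N l) * c \<le> real (N l) * s1 l" by (intro mult_left_mono) auto
      then show ?thesis by (simp add: mult.commute)
    qed
    then show "\<forall>\<^sub>F l in sequentially. c * real (N l) \<le> real (N l) * s1 l" by simp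
  qed
  have S2: "filterlim (\<lambda>l. real (N l) * s2 l) at_top sequentially"
  proof (rule filterlim_at_top_mono)
    show "filterlim (\<lambda>l. c' * real (N l)) at_top sequentially"
      by (rule filterlim_tendsto_pos_mult_at_top[OF tendsto_const b2(1) Ng(3)])
    have "c' * real (N l) \<le> real (N l) * s2 l" for l
      using mult_left_mono[OF s2_low[of l], of "real (N l)"] by (simp add: mult.commute)
    then show "\<forall>\<^sub>F l in sequentially. c' * real (N l) \<le> real (N l) * s2 l" by simp
  qed
  have v: "A1 *v e1 \<noteq> 0" "A2 *v e2 \<noteq> 0" using matrix_vector_nonzero_2 detA nz by auto
  have d_eq: "d1 l = hdist \<i> (moebius (G1 l) \<i>)" "d2 l = hdist \<i> (moebius (G2 l) \<i>)" for l
    by (simp_all add: d1_def d2_def)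
  note L1 = moebius_polar_limits[OF detG(1) S1 v(1) rows1 d_eq(1)]
  note L2 = moebius_polar_limits[OF detG(2) S2 v(2) rows2 d_eq(2)]
  have N0: "real (N l) > 0" for l by (rule less_le_trans[OF exp_gt_zero Ng(1)[of l]])
  have g1: "lin_growth (\<lambda>l. ln (real (N l) * s1 l)) (\<kappa> + \<eta>)"
  proof -
    have "lin_growth (\<lambda>l. ln (s1 l)) \<eta>" by (rule lin_growth_ln[OF b1(1), where C = "norm f1 * C"]) (use s1_low s1_up in auto)
    from lin_growth_add[OF Ng(4) this] show ?thesis using N0 s1_pos by (simp add: ln_mult less_imp_neq[symmetric])
  qed
  have g2: "lin_growth (\<lambda>l. ln (real (N l) * s2 l)) \<kappa>"
  proof -
    have "lin_growth (\<lambda>l. ln (s2 l)) 0" by (rule lin_growth_ln[OF b2(1), where C = "norm f2 * C'"]) (use s2_low s2_up in auto)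
    from lin_growth_add[OF Ng(4) this] show ?thesis using N0 s2_pos by (simp add: ln_mult less_imp_neq[symmetric])
  qed
  define m where "m = 2 * \<eta> / (a1 - a2)"
  have m: "m > 0" using eta a by (simp add: m_def)
  have gd1: "lin_growth d1 (m * a1)" and gd2: "lin_growth d2 (m * a2)"
  proof -
    have "lin_growth d1 (2 * (\<kappa> + \<eta>))" using L1(3) lin_growth_near[OF g1] by blast
    moreover have "2 * (\<kappa> + \<eta>) = m * a1" using a by (simp add: \<kappa>_def m_def field_simps)
    ultimately show "lin_growth d1 (m * a1)" by simp
    have "lin_growth d2 (2 * \<kappa>)" using L2(3) lin_growth_near[OF g2] by blast
    moreover have "2 * \<kappa> = m * a2" by (simp add: \<kappa>_def m_def)
    ultimately show "lin_growth d2 (m * a2)" by simp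
  qed
  have D_eq: "D l = sqrt ((d1 l)\<^sup>2 + (d2 l)\<^sup>2)" for l by (simp add: D_def)
  note sl = slope_limit[OF gd1 gd2 m a(3) D_eq]
  have D_top: "filterlim D at_top sequentially"
    by (rule filterlim_at_top_mono[OF L1(1)]) (simp add: D_def)
  have "\<forall>\<^sub>F l in sequentially. d1 l > 0 \<and> d2 l > 0"
    using filterlim_at_top_dense[THEN iffD1, OF L1(1), rule_format, of 0]
      filterlim_at_top_dense[THEN iffD1, OF L2(1), rule_format, of 0] by eventually_elim simp
  \<comment> \<open>Directions exist only away from the base point, so initial terms of the sequence
    are dropped.\<close>
  then obtain L where L: "\<And>l. l \<ge> L \<Longrightarrow> d1 l > 0 \<and> d2 l > 0" by (auto simp: eventually_sequentially)
  define u1 where "u1 = (\<lambda>l. Complex ((cp (moebius (G1 l) \<i>) - cr (moebius (G1 l) \<i>)) / 2) (cq (moebius (G1 l) \<i>)) / of_real (sinh (d1 l)))"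
  define u2 where "u2 = (\<lambda>l. Complex ((cp (moebius (G2 l) \<i>) - cr (moebius (G2 l) \<i>)) / 2) (cq (moebius (G2 l) \<i>)) / of_real (sinh (d2 l)))"
  have pol1: "norm (u1 l) = 1" "moebius (G1 l) \<i> = pol (d1 l) (u1 l)" if "l \<ge> L" for l
    using polar_direction[OF coords_moebius(1)[OF detG(1) ii_mem], of l] L[OF that] by (simp_all add: u1_def d1_def)
  have pol2: "norm (u2 l) = 1" "moebius (G2 l) \<i> = pol (d2 l) (u2 l)" if "l \<ge> L" for l
    using polar_direction[OF coords_moebius(1)[OF detG(2) ii_mem], of l] L[OF that] by (simp_all add: u2_def d2_def)
  have orb: "(moebius (G1 l) \<i>, moebius (G2 l) \<i>) \<in> pair_orbit G x" for l
  proof -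
    let ?P = "A1 ** (mpow T1 (N l) ** mpow h1 (Suc l))" and ?Q = "A2 ** (mpow T2 (N l) ** mpow h2 (Suc l))"
    have PQ: "(?P, ?Q) \<in> G" by (intro mult_G A mpow_G unipotent_G h_G)
    have "G1 l = ?P ** k1" "G2 l = ?Q ** k2" by (simp_all only: G1_def G2_def X1_def X2_def matrix_mul_assoc)
    then have "moebius (G1 l) \<i> = moebius ?P (fst x)" "moebius (G2 l) \<i> = moebius ?Q (snd x)"
      using moebius_mult[OF _ k1(1) ii_mem, of ?P] moebius_mult[OF _ k2(1) ii_mem, of ?Q] det_G[OF PQ] k1(2) k2(2) by auto
    then show ?thesis using PQ unfolding pair_orbit_def by blast
  qed
  show ?thesis
  proof (rule cone_closure_interior_limit[where X = "\<lambda>l. (moebius (G1 (l + L)) \<i>, moebius (G2 (l + L)) \<i>)" and D = "\<lambda>l. D (l + L)"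
        and ?d1.0 = "\<lambda>l. d1 (l + L)" and ?d2.0 = "\<lambda>l. d2 (l + L)" and ?v1.0 = "\<lambda>l. u1 (l + L)" and ?v2.0 = "\<lambda>l. u2 (l + L)"])
    show "ray_params a1 a2 (line_dir (A1 *v e1)) (line_dir (A2 *v e2))"
      using a v by (auto simp: ray_params_def norm_line_dir)
    show "pair_orbit G x \<subseteq> HH" by (rule pair_orbit_subset[OF x])
    show "(moebius (G1 (l + L)) \<i>, moebius (G2 (l + L)) \<i>) = (pol (d1 (l + L)) (u1 (l + L)), pol (d2 (l + L)) (u2 (l + L)))" for l
      using pol1(2)[of "l + L"] pol2(2)[of "l + L"] by simp
    show "d1 (l + L) \<ge> 0" "d2 (l + L) \<ge> 0" for l using L[of "l + L"] by auto
    show "norm (u1 (l + L)) = 1" "norm (u2 (l + L)) = 1" for l using pol1(1) pol2(1) by auto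
    show "filterlim (\<lambda>l. D (l + L)) at_top sequentially"
      by (rule filterlim_compose[OF D_top filterlim_add_const_nat_at_top])
  qed (use orb sl L1(2) L2(2) in \<open>auto simp: D_def u1_def u2_def intro!: LIMSEQ_ignore_initial_segment[of "\<lambda>l. d1 l / sqrt ((d1 l)\<^sup>2 + (d2 l)\<^sup>2)"]
      LIMSEQ_ignore_initial_segment[of "\<lambda>l. d2 l / sqrt ((d1 l)\<^sup>2 + (d2 l)\<^sup>2)"] LIMSEQ_ignore_initial_segment\<close>)
qed

text \<open>In the plane two vectors orthogonal to f2 are parallel, but h2 has no real
  eigenvector.\<close>

lemma h2_e2_independent: "f2 \<bullet> (h2 *v e2) \<noteq> 0"
proof
  assume f2: "f2 \<bullet> (h2 *v e2) = 0"
  define w where "w = h2 *v e2"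
  define d where "d = e2$1 * w$2 - e2$2 * w$1"
  have perp: "f2 \<bullet> w = 0" "f2 \<bullet> e2 = 0" using f2 fe by (simp_all add: w_def)
  have "f2$1 * d = w$2 * (f2 \<bullet> e2) - e2$2 * (f2 \<bullet> w)" "f2$2 * d = e2$1 * (f2 \<bullet> w) - w$1 * (f2 \<bullet> e2)"
    by (simp_all add: d_def inner_2 algebra_simps)
  then have "d = 0" using nz(3) unfolding perp by (auto simp: vector_2_eq_iff)
  then obtain k where "w = k *\<^sub>R e2" using parallel_2[OF nz(2), of w] unfolding d_def by auto
  then show False using no_real_eigenvector[OF det_h(2) trace_h(2) nz(2)] unfolding w_def by blast
qed

text \<open>Since \<theta> is measured against 2 pi, a rational value makes some power of h2 the
  identity itself and not its negative, contrary to infinite order.\<close>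

lemma theta_irrational: "\<theta> / (2 * pi) \<notin> \<rat>"
proof
  assume "\<theta> / (2 * pi) \<in> \<rat>"
  then obtain a b :: int where ab: "b > 0" "\<theta> / (2 * pi) = of_int a / of_int b" using Rats_cases' by metis
  define n where "n = nat b"
  have n: "n > 0" "real n = of_int b" using ab by (auto simp: n_def)
  have nt: "real n * \<theta> = 2 * pi * of_int a" using ab n by (simp add: field_simps)
  have "sin (real n * \<theta>) = 0" "sin ((real n - 1) * \<theta>) = - sin \<theta>"
    unfolding left_diff_distrib nt by (simp_all add: sin_diff sin_int_2pin cos_int_2pin)
  then have "sin \<theta> *\<^sub>R mpow h2 n = sin \<theta> *\<^sub>R mat 1"
    using mpow_sin[OF det_h(2) theta(2), of n] by simp
  then have "mpow h2 n = mat 1" using theta(1) by simp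
  then show False using h2_infinite[OF n(1)] by blast
qed

lemma elliptic_orbit_dense:
  assumes A: "det A = 1" and \<xi>: "norm \<xi> = 1" and \<epsilon>: "\<epsilon> > 0"
  obtains n where "n > 0" "norm (line_dir (A *v (mpow h2 n *v e2)) - \<xi>) < \<epsilon>"
proof -
  \<comment> \<open>The curve through all h2^n e2, up to the factor sin \<theta>, with n \<theta>
    replaced by a continuous angle. It has period 2 pi and meets every line, so Kronecker's theorem
    applies.\<close>
  define g where "g = (\<lambda>\<alpha>. sin \<alpha> *\<^sub>R (h2 *v e2) - sin (\<alpha> - \<theta>) *\<^sub>R e2)"
  have g_power: "g (real n * \<theta>) = sin \<theta> *\<^sub>R (mpow h2 n *v e2)" for n
  proof -
    have "sin \<theta> *\<^sub>R (mpow h2 n *v e2) = (sin \<theta> *\<^sub>R mpow h2 n) *v e2"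
      by (simp add: vector_2_eq_iff matrix_2_vector algebra_simps)
    also have "\<dots> = g (real n * \<theta>)"
      unfolding mpow_sin[OF det_h(2) theta(2)] g_def by (simp add: vector_2_eq_iff matrix_2_vector algebra_simps)
    finally show ?thesis by simp
  qed
  obtain y0 where y0: "y0 \<noteq> 0" "line_dir y0 = \<xi>" using line_dir_surj[OF \<xi>] .
  define y where "y = adj2 A *v y0"
  have Ay: "A *v y = y0" unfolding y_def matrix_vector_mul_assoc mult_adj2(1)[OF A] by simp
  define w where "w = h2 *v e2"
  define D where "D = w$1 * e2$2 - w$2 * e2$1"
  have D: "D \<noteq> 0"
  proof
    assume "D = 0"
    have "f2 \<bullet> w \<noteq> 0" "f2$1 * e2$1 = - (f2$2 * e2$2)" using h2_e2_independent fe(2) by (auto simp: w_def inner_2)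
    moreover have "e2$1 * (f2 \<bullet> w) = w$1 * (f2$1 * e2$1 + f2$2 * e2$2) - f2$2 * D" "e2$2 * (f2 \<bullet> w) = w$2 * (f2$1 * e2$1 + f2$2 * e2$2) + f2$1 * D"
      by (simp_all add: inner_2 D_def algebra_simps)
    ultimately have "e2$1 = 0" "e2$2 = 0" using \<open>D = 0\<close> by auto
    then show False using nz by (simp add: vector_2_eq_iff)
  qed
  define p where "p = (y$1 * e2$2 - y$2 * e2$1) / D"
  define q where "q = (w$1 * y$2 - w$2 * y$1) / D"
  have ypq: "y = p *\<^sub>R w + q *\<^sub>R e2"
  proof -
    have "D * y$1 = (y$1 * e2$2 - y$2 * e2$1) * w$1 + (w$1 * y$2 - w$2 * y$1) * e2$1"
      "D * y$2 = (y$1 * e2$2 - y$2 * e2$1) * w$2 + (w$1 * y$2 - w$2 * y$1) * e2$2"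
      by (simp_all add: D_def algebra_simps)
    then have "y$1 = ((y$1 * e2$2 - y$2 * e2$1) * w$1 + (w$1 * y$2 - w$2 * y$1) * e2$1) / D"
      "y$2 = ((y$1 * e2$2 - y$2 * e2$1) * w$2 + (w$1 * y$2 - w$2 * y$1) * e2$2) / D"
      by (simp_all only: nonzero_eq_divide_eq[OF D] mult.commute[of D])
    then show ?thesis by (simp add: vector_2_eq_iff p_def q_def add_divide_distrib)
  qed
  \<comment> \<open>Polar coordinates of z solve r g(\<alpha>) = sin \<theta> y: comparing the
    coefficients of w and e2 requires r sin \<alpha> = p sin \<theta> and r sin (\<alpha> -
    \<theta>) = - q sin \<theta>.\<close>
  define z where "z = Complex (q + p * cos \<theta>) (p * sin \<theta>)"
  have z0: "z \<noteq> 0"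
  proof
    assume "z = 0"
    then have "p = 0" "q = 0" using theta(1) by (auto simp: z_def complex_eq_iff)
    then have "y = 0" using ypq by simp
    then show False using Ay y0 by simp
  qed
  define r where "r = cmod z"
  define \<alpha> where "\<alpha> = Arg z"
  have r: "r > 0" using z0 by (simp add: r_def)
  have "z = rcis r \<alpha>" by (simp add: r_def \<alpha>_def rcis_cmod_Arg)
  then have ra: "r * cos \<alpha> = q + p * cos \<theta>" "r * sin \<alpha> = p * sin \<theta>" by (auto simp: z_def complex_eq_iff)
  have "r * sin (\<alpha> - \<theta>) = (r * sin \<alpha>) * cos \<theta> - (r * cos \<alpha>) * sin \<theta>" by (simp add: sin_diff algebra_simps)
  then have rb: "r * sin (\<alpha> - \<theta>) = - q * sin \<theta>" unfolding ra by (simp add: algebra_simps)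
  have "r *\<^sub>R g \<alpha> = (r * sin \<alpha>) *\<^sub>R w - (r * sin (\<alpha> - \<theta>)) *\<^sub>R e2" by (simp add: g_def w_def algebra_simps)
  also have "\<dots> = sin \<theta> *\<^sub>R y" unfolding ra rb ypq by (simp add: algebra_simps)
  finally have "A *v (r *\<^sub>R g \<alpha>) = sin \<theta> *\<^sub>R y0" using Ay by (simp add: matrix_vector_mult_scaleR)
  then have "r *\<^sub>R (A *v g \<alpha>) = sin \<theta> *\<^sub>R y0" by (simp add: matrix_vector_mult_scaleR)
  then have "line_dir (A *v g \<alpha>) = \<xi>"
    using line_dir_scaleR[of r "A *v g \<alpha>"] line_dir_scaleR[of "sin \<theta>" y0] r theta(1) y0(2) by simp
  moreover have "A *v g \<alpha> \<noteq> 0"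
    using \<open>r *\<^sub>R (A *v g \<alpha>) = sin \<theta> *\<^sub>R y0\<close> y0(1) theta(1) by auto
  \<comment> \<open>Kronecker's theorem approximates numbers in [0, 1] by fractional parts, so the
    angle is reduced modulo 2 pi.\<close>
  moreover define \<beta> where "\<beta> = frac (\<alpha> / (2 * pi))"
  have g_per: "g (2 * pi * frac x) = g (2 * pi * x)" for x
  proof -
    have e: "2 * pi * frac x = 2 * pi * x - 2 * pi * of_int \<lfloor>x\<rfloor>" by (simp add: frac_def algebra_simps)
    have s: "sin (t - 2 * pi * of_int k) = sin t" for t :: real and k :: int
      by (simp add: sin_diff sin_int_2pin cos_int_2pin)
    have "sin (2 * pi * x - 2 * pi * of_int \<lfloor>x\<rfloor> - \<theta>) = sin (2 * pi * x - \<theta>)"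
    proof -
      have "2 * pi * x - 2 * pi * of_int \<lfloor>x\<rfloor> - \<theta> = (2 * pi * x - \<theta>) - 2 * pi * of_int \<lfloor>x\<rfloor>" by linarith
      then show ?thesis by (simp only: s)
    qed
    then show ?thesis by (simp only: g_def e s)
  qed
  have "g (2 * pi * \<beta>) = g \<alpha>" unfolding \<beta>_def g_per by simp
  ultimately have lim0: "line_dir (A *v g (2 * pi * \<beta>)) = \<xi>" "A *v g (2 * pi * \<beta>) \<noteq> 0" by simp_all
  have "((\<lambda>t. A *v g (2 * pi * t)) \<longlongrightarrow> A *v g (2 * pi * \<beta>)) (at \<beta>)"
  proof (rule vec_tendstoI)
    fix i :: 2
    show "((\<lambda>t. (A *v g (2 * pi * t)) $ i) \<longlongrightarrow> (A *v g (2 * pi * \<beta>)) $ i) (at \<beta>)"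
      unfolding matrix_2_vector g_def by (auto intro!: tendsto_intros)
  qed
  then have "((\<lambda>t. line_dir (A *v g (2 * pi * t))) \<longlongrightarrow> \<xi>) (at \<beta>)"
    using tendsto_line_dir[OF _ lim0(2)] lim0(1) by metis
  then have "\<forall>\<^sub>F t in at \<beta>. dist (line_dir (A *v g (2 * pi * t))) \<xi> < \<epsilon>" using \<epsilon> by (rule tendstoD)
  then obtain d where d: "d > 0" "\<And>t. t \<noteq> \<beta> \<Longrightarrow> dist t \<beta> < d \<Longrightarrow> dist (line_dir (A *v g (2 * pi * t))) \<xi> < \<epsilon>"
    by (auto simp: eventually_at)
  have d': "dist (line_dir (A *v g (2 * pi * t))) \<xi> < \<epsilon>" if "dist t \<beta> < d" for t
    using d(2)[of t] that lim0(1) \<epsilon> by (cases "t = \<beta>") auto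
  have "0 \<le> \<beta>" "\<beta> \<le> 1" using frac_lt_1[of "\<alpha> / (2 * pi)"] by (auto simp: \<beta>_def)
  then obtain n where n: "n > 0" "\<bar>frac (real n * (\<theta> / (2 * pi))) - \<beta>\<bar> < d"
    using Kronecker_approx_1_explicit[OF theta_irrational _ _ d(1)] by metis
  have "2 * pi * (real n * (\<theta> / (2 * pi))) = real n * \<theta>" by simp
  then have "g (2 * pi * frac (real n * (\<theta> / (2 * pi)))) = sin \<theta> *\<^sub>R (mpow h2 n *v e2)"
    unfolding g_per by (simp only: g_power)
  then have "line_dir (A *v g (2 * pi * frac (real n * (\<theta> / (2 * pi))))) = line_dir (A *v (mpow h2 n *v e2))"
    using theta(1) line_dir_scaleR[of "sin \<theta>" "A *v (mpow h2 n *v e2)"] by (simp add: matrix_vector_mult_scaleR)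
  then show ?thesis using that[OF n(1)] d'[of "frac (real n * (\<theta> / (2 * pi)))"] n(2) by (simp add: dist_norm)
qed

text \<open>The order of choices matters: A0 for \<xi>1, then j, and n last for \<xi>2. One j serves
  all n > 0 because the vector h1^n e1 and the number f1 \<bullet> h1^n e1 grow at the same
  exponential rate.\<close>

lemma dense_pair_orbit:
  assumes \<xi>: "norm \<xi>1 = 1" "norm \<xi>2 = 1" and \<epsilon>: "\<epsilon> > 0"
  obtains A B where "(A, B) \<in> G" "norm (line_dir (A *v e1) - \<xi>1) < \<epsilon>" "norm (line_dir (B *v e2) - \<xi>2) < \<epsilon>"
proof -
  obtain A0 B0 where A0: "(A0, B0) \<in> G" "norm (line_dir (A0 *v e1) - \<xi>1) < \<epsilon>" using dense_orbit[OF \<xi>(1) \<epsilon>] by blast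
  have det0: "det A0 = 1" "det B0 = 1" using det_G[OF A0(1)] by auto
  have nz0: "A0 *v e1 \<noteq> 0" using matrix_vector_nonzero_2[OF det0(1) nz(1)] .
  define \<epsilon>' where "\<epsilon>' = \<epsilon> - norm (line_dir (A0 *v e1) - \<xi>1)"
  have \<epsilon>': "\<epsilon>' > 0" using A0 by (simp add: \<epsilon>'_def)
  have "((\<lambda>x. line_dir x) \<longlongrightarrow> line_dir (A0 *v e1)) (at (A0 *v e1))"
    by (rule tendsto_line_dir[OF tendsto_ident_at nz0])
  from tendstoD[OF this \<epsilon>'] obtain d where d: "d > 0"
    "\<And>x. x \<noteq> A0 *v e1 \<Longrightarrow> dist x (A0 *v e1) < d \<Longrightarrow> dist (line_dir x) (line_dir (A0 *v e1)) < \<epsilon>'"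
    by (auto simp: eventually_at)
  have d': "dist (line_dir x) (line_dir (A0 *v e1)) < \<epsilon>'" if "dist x (A0 *v e1) < d" for x
    using d(2)[of x] that \<epsilon>' by (cases "x = A0 *v e1") auto
  obtain c C where b: "c > 0" "\<And>l. norm (mpow h1 (Suc l) ** mat 1) \<le> C * exp (\<eta> * real l)"
    "\<And>l. c * exp (\<eta> * real l) \<le> norm (f1 v* (mpow h1 (Suc l) ** mat 1))"
    using exists_h1_bounds[OF det_I] by blast
  define p where "p = \<bar>f1 \<bullet> (h1 *v e1)\<bar>"
  have p: "p > 0" using h1_e1 by (simp add: p_def)
  \<comment> \<open>After division by j times f1 \<bullet> h1^n e1, the perturbation of A0 e1 has
    length at most Q / j, uniformly in n.\<close>
  define Q where "Q = norm A0 * (C * norm e1 / p)"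
  obtain j :: nat where j: "j > 0" "Q < d * real j"
  proof -
    obtain j0 :: nat where "Q < real j0 * d" using reals_Archimedean3[OF d(1)] by blast
    moreover have "real j0 * d \<le> d * real (Suc j0)" using d(1) by (simp add: algebra_simps)
    ultimately have "Q < d * real (Suc j0)" by linarith
    then show ?thesis using that[of "Suc j0"] by blast
  qed
  have first: "norm (line_dir (A0 *v (mpow T1 j *v (mpow h1 n *v e1))) - \<xi>1) < \<epsilon>" if n: "n > 0" for n
  proof -
    obtain l where l: "n = Suc l" using n by (cases n) auto
    define x where "x = mpow h1 n *v e1"
    define \<phi> where "\<phi> = f1 \<bullet> x"
    have "sinh \<eta> > 0" using eta by simp
    then have "exp (\<eta> * real l) * p \<le> sinh (real n * \<eta>) / sinh \<eta> * p"
      using sinh_lower[of l] p by (intro mult_right_mono) (auto simp: field_simps l)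
    also have "\<dots> = \<bar>\<phi>\<bar>"
      unfolding \<phi>_def x_def f1_h1_power p_def abs_mult using eta by (simp add: abs_mult)
    finally have \<phi>: "exp (\<eta> * real l) * p \<le> \<bar>\<phi>\<bar>" .
    have "exp (\<eta> * real l) * p > 0" using p by simp
    then have \<phi>0: "\<bar>\<phi>\<bar> > 0" using \<phi> by linarith
    have "norm x \<le> norm (mpow h1 n) * norm e1" unfolding x_def by (rule norm_matrix_vector_le)
    also have "\<dots> \<le> C * exp (\<eta> * real l) * norm e1" using b(2)[of l] by (intro mult_right_mono) (auto simp: l)
    also have "\<dots> = C * norm e1 / p * (exp (\<eta> * real l) * p)" using p by simp
    also have "\<dots> \<le> C * norm e1 / p * \<bar>\<phi>\<bar>"
    proof (rule mult_left_mono[OF \<phi>])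
      have "C \<ge> 0" using order_trans[OF norm_ge_zero b(2)[of 0]] by simp
      then show "C * norm e1 / p \<ge> 0" using p by simp
    qed
    finally have x_le: "norm x \<le> C * norm e1 / p * \<bar>\<phi>\<bar>" .
    define k where "k = 1 / (real j * \<phi>)"
    have k: "k \<noteq> 0" using j \<phi>0 by (simp add: k_def)
    have "mpow T1 j *v x = x + (real j * \<phi>) *\<^sub>R e1"
      unfolding mpow_unipotent[OF fe(1)] by (simp add: vector_2_eq_iff matrix_2_vector \<phi>_def inner_2 algebra_simps)
    then have "k *\<^sub>R (mpow T1 j *v x) = k *\<^sub>R x + e1" using j \<phi>0 by (simp add: k_def scaleR_add_right)
    then have eq: "k *\<^sub>R (A0 *v (mpow T1 j *v x)) = k *\<^sub>R (A0 *v x) + A0 *v e1"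
      by (metis matrix_vector_mult_scaleR matrix_vector_right_distrib)
    have "norm (k *\<^sub>R (A0 *v x)) \<le> \<bar>k\<bar> * (norm A0 * (C * norm e1 / p * \<bar>\<phi>\<bar>))"
      unfolding norm_scaleR
      by (intro mult_left_mono order_trans[OF norm_matrix_vector_le] x_le) auto
    also have "\<dots> = Q / real j" using \<phi>0 j by (simp add: k_def Q_def abs_mult)
    also have "\<dots> < d" using j by (simp add: field_simps)
    finally have "dist (k *\<^sub>R (A0 *v (mpow T1 j *v x))) (A0 *v e1) < d" unfolding eq by (simp add: dist_norm)
    from d'[OF this] have "dist (line_dir (A0 *v (mpow T1 j *v x))) (line_dir (A0 *v e1)) < \<epsilon>'"
      unfolding line_dir_scaleR[OF k] .
    then show ?thesis
      using norm_triangle_ineq[of "line_dir (A0 *v (mpow T1 j *v x)) - line_dir (A0 *v e1)" "line_dir (A0 *v e1) - \<xi>1"]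
      by (simp add: dist_norm \<epsilon>'_def x_def)
  qed
  have "det (B0 ** mpow T2 j) = 1" by (simp only: det_mul det0 det_mpow det_T mult_1)
  then obtain n where n: "n > 0" "norm (line_dir ((B0 ** mpow T2 j) *v (mpow h2 n *v e2)) - \<xi>2) < \<epsilon>"
    using elliptic_orbit_dense[OF _ \<xi>(2) \<epsilon>] by blast
  have "(A0 ** (mpow T1 j ** mpow h1 n), B0 ** (mpow T2 j ** mpow h2 n)) \<in> G"
    by (intro mult_G A0 mpow_G unipotent_G h_G)
  then show ?thesis
    using that first[OF n(1)] n(2) by (simp add: matrix_vector_mul_assoc matrix_mul_assoc)
qed
end

text \<open>The trace of T^N h^g in abstract form: \<tau> is the trace of h^g, and N \<phi> is
  contributed by the parabolic. As \<tau> is at most and \<phi> exactly of order exp (\<mu> l), the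
  factor N decides. The rate \<mu> is that of h, positive in the first factor and 0 in the
  second.\<close>

lemma trace_growth:
  assumes \<kappa>: "\<kappa> > 0" and N: "\<And>l. N l = nat \<lceil>exp (\<kappa> * real l)\<rceil>" and \<mu>: "\<mu> \<ge> 0" and p: "p > 0"
    and t: "\<And>l. t l = \<tau> l + real (N l) * \<phi> l" and \<tau>: "\<And>l. \<bar>\<tau> l\<bar> \<le> C * exp (\<mu> * real l)"
    and \<phi>: "\<And>l. p * exp (\<mu> * real l) \<le> \<bar>\<phi> l\<bar>" "\<And>l. \<bar>\<phi> l\<bar> \<le> C' * exp (\<mu> * real l)"
  shows "lin_growth (\<lambda>l. ln \<bar>t l\<bar>) (\<kappa> + \<mu>)" "\<forall>\<^sub>F l in sequentially. \<bar>t l\<bar> > 2"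
proof -
  note Ng = ceiling_exp_growth[OF \<kappa> N]
  have "\<forall>\<^sub>F l in sequentially. real (N l) > max (2 * C / p) (4 / p)"
    using filterlim_at_top_dense[THEN iffD1, OF Ng(3)] by blast
  then have ev: "\<forall>\<^sub>F l in sequentially. p / 2 * (real (N l) * exp (\<mu> * real l)) \<le> \<bar>t l\<bar> \<and>
      \<bar>t l\<bar> \<le> (\<bar>C\<bar> + \<bar>C'\<bar>) * (real (N l) * exp (\<mu> * real l)) \<and> real (N l) > 4 / p"
  proof eventually_elim
    case (elim l)
    define E where "E = exp (\<mu> * real l)"
    define n where "n = real (N l)"
    have E: "E > 0" by (simp add: E_def)
    have n: "n > 2 * C / p" "n > 4 / p" using elim by (auto simp: n_def)
    have n1: "n \<ge> 1" unfolding n_def by (rule order_trans[OF _ Ng(1)]) (use \<kappa> in simp)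
    have a: "\<bar>\<tau> l\<bar> \<le> C * E" "p * E \<le> \<bar>\<phi> l\<bar>" "\<bar>\<phi> l\<bar> \<le> C' * E" using \<tau> \<phi> by (auto simp: E_def)
    have "C \<le> p * n / 2" using n(1) p by (simp add: field_simps)
    then have "C * E \<le> p * n / 2 * E" using E by (intro mult_right_mono) auto
    moreover have "n * (p * E) \<le> n * \<bar>\<phi> l\<bar>" "n * \<bar>\<phi> l\<bar> \<le> n * (C' * E)" using a n1 by (auto intro!: mult_left_mono)
    moreover have "\<bar>n * \<phi> l\<bar> = n * \<bar>\<phi> l\<bar>" using n1 by (simp add: abs_mult)
    ultimately have lo: "n * (p * E) - p * n / 2 * E \<le> \<bar>t l\<bar>" and up: "\<bar>t l\<bar> \<le> C * E + n * (C' * E)"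
      using a(1) unfolding t n_def[symmetric] by linarith+
    have "C * E \<le> \<bar>C\<bar> * (n * E)"
    proof -
      have "C * E \<le> \<bar>C\<bar> * E" using E by (intro mult_right_mono) auto
      also have "\<dots> \<le> \<bar>C\<bar> * (n * E)" using n1 E by (intro mult_left_mono) auto
      finally show ?thesis .
    qed
    moreover have "n * (C' * E) \<le> \<bar>C'\<bar> * (n * E)"
    proof -
      have "C' * (n * E) \<le> \<bar>C'\<bar> * (n * E)" using n1 E by (intro mult_right_mono) auto
      then show ?thesis by (simp add: mult_ac)
    qed
    ultimately have "\<bar>t l\<bar> \<le> (\<bar>C\<bar> + \<bar>C'\<bar>) * (n * E)" using up unfolding distrib_right by linarith
    moreover have "n * (p * E) - p * n / 2 * E = p / 2 * (n * E)" by (simp add: field_simps)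
    ultimately show ?case using lo n(2) by (simp add: E_def n_def)
  qed
  then have "\<forall>\<^sub>F l in sequentially. p / 2 * exp ((\<kappa> + \<mu>) * real l) \<le> \<bar>t l\<bar> \<and>
      \<bar>t l\<bar> \<le> (\<bar>C\<bar> + \<bar>C'\<bar>) * 2 * exp ((\<kappa> + \<mu>) * real l)"
  proof eventually_elim
    case (elim l)
    have e: "exp ((\<kappa> + \<mu>) * real l) = exp (\<kappa> * real l) * exp (\<mu> * real l)" by (simp add: distrib_right exp_add)
    have "p / 2 * (exp (\<kappa> * real l) * exp (\<mu> * real l)) \<le> p / 2 * (real (N l) * exp (\<mu> * real l))"
      using p Ng(1)[of l] by (intro mult_left_mono mult_right_mono) auto
    moreover have "(\<bar>C\<bar> + \<bar>C'\<bar>) * (real (N l) * exp (\<mu> * real l)) \<le> (\<bar>C\<bar> + \<bar>C'\<bar>) * (2 * exp (\<kappa> * real l) * exp (\<mu> * real l))"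
      using Ng(2)[of l] by (intro mult_left_mono mult_right_mono) auto
    moreover have "(\<bar>C\<bar> + \<bar>C'\<bar>) * (2 * exp (\<kappa> * real l) * exp (\<mu> * real l)) = (\<bar>C\<bar> + \<bar>C'\<bar>) * 2 * (exp (\<kappa> * real l) * exp (\<mu> * real l))"
      by simp
    ultimately show ?case using elim unfolding e by linarith
  qed
  then show "lin_growth (\<lambda>l. ln \<bar>t l\<bar>) (\<kappa> + \<mu>)" using p by (intro lin_growth_ln[of "p / 2"]) auto
  show "\<forall>\<^sub>F l in sequentially. \<bar>t l\<bar> > 2"
    using ev
  proof eventually_elim
    case (elim l)
    have "p / 2 * (4 / p) < p / 2 * real (N l)" using elim p by (intro mult_strict_left_mono) auto
    also have "\<dots> \<le> p / 2 * (real (N l) * exp (\<mu> * real l))"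
      using p \<mu> by (intro mult_left_mono) (auto simp: mult_le_cancel_left1)
    finally show ?case using elim p by simp
  qed
qed

lemma arcosh_growth:
  assumes "lin_growth (\<lambda>l. ln (x l)) \<gamma>" "\<forall>\<^sub>F l in sequentially. x l > 2"
  shows "lin_growth (\<lambda>l. arcosh (x l / 2)) \<gamma>"
proof -
  have "\<forall>\<^sub>F l in sequentially. \<bar>arcosh (x l / 2) - 1 * ln (x l)\<bar> \<le> 2 * ln 2"
    using assms(2)
  proof eventually_elim
    case (elim l)
    have nn: "arcosh (x l / 2) \<ge> 0" and c: "cosh (arcosh (x l / 2)) = x l / 2" using elim cosh_arcosh_real[of "x l / 2"] by auto
    have "\<bar>arcosh (x l / 2) - ln (x l / 2)\<bar> \<le> ln 2" using abs_diff_ln_cosh[OF nn] unfolding c .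
    moreover have "ln (x l / 2) = ln (x l) - ln 2" using elim by (simp add: ln_div)
    moreover have "ln (2 :: real) > 0" by simp
    ultimately show ?case by linarith
  qed
  from lin_growth_near[OF assms(1) this] show ?thesis by simp
qed

section \<open>Limit classes and ratios of translation lengths\<close>

context pair_group
begin

lemma traces_le: 
  assumes "(A, B) \<in> G" "\<bar>trace B\<bar> > 2"
  shows "\<bar>trace B\<bar> \<le> \<bar>trace A\<bar>"
proof (rule abs_trace_le_of_norm_mpow_le)
  show "norm (mpow B n) \<le> Cd * norm (mpow A n)" for n
    by (rule dominated(2)[OF mpow_G[OF assms(1)]])
qed (use det_G[OF assms(1)] assms(2) dominated(1) in auto)

text \<open>The comparison of norms costs the factor Cd, the change of base point the norms of k1
  and k2, and the passage between cosh and exp a factor 2. All of it ends up in one additive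
  constant.\<close>

lemma orbit_distance_bound:
  assumes x: "x \<in> HH"
  obtains C where "C \<ge> 0" "\<And>y. y \<in> pair_orbit G x \<Longrightarrow> hdist \<i> (snd y) \<le> hdist \<i> (fst y) + C"
proof -
  have xm: "fst x \<in> H2" "snd x \<in> H2" using x by (auto simp: HH_iff)
  obtain k1 where k1: "det k1 = 1" "moebius k1 \<i> = fst x" using moebius_ii_surj[OF xm(1)] .
  obtain k2 where k2: "det k2 = 1" "moebius k2 \<i> = snd x" using moebius_ii_surj[OF xm(2)] .
  define M where "M = (Cd * norm k1 * norm k2)\<^sup>2"
  have "norm k1 > 0" "norm k2 > 0" using k1 k2 by (auto simp: det_2)
  then have M: "M > 0" using dominated(1) by (simp add: M_def)
  have "hdist \<i> (snd y) \<le> hdist \<i> (fst y) + \<bar>ln (2 * M)\<bar>" if y_in: "y \<in> pair_orbit G x" for y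
  proof -
    obtain A B where AB: "(A, B) \<in> G" "y = (moebius A (fst x), moebius B (snd x))" using y_in unfolding pair_orbit_def by blast
    have det: "det A = 1" "det B = 1" using det_G[OF AB(1)] by auto
    have detk: "det (A ** k1) = 1" "det (B ** k2) = 1" using det k1 k2 by (simp_all add: det_mul)
    have y: "fst y = moebius (A ** k1) \<i>" "snd y = moebius (B ** k2) \<i>"
      using AB(2) moebius_mult[OF det(1) k1(1) ii_mem] moebius_mult[OF det(2) k2(1) ii_mem] k1 k2 by auto
    define d1 where "d1 = hdist \<i> (fst y)"
    define d2 where "d2 = hdist \<i> (snd y)"
    have d: "d1 \<ge> 0" unfolding d1_def y by (intro hdist_nonneg ii_mem coords_moebius(1) detk)
    have "A = (A ** k1) ** adj2 k1" by (simp add: matrix_mul_assoc[symmetric] mult_adj2 k1)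
    then have nA: "norm A \<le> norm (A ** k1) * norm k1" using norm_matrix_mult_le[of "A ** k1" "adj2 k1"] by (simp add: norm_adj2)
    have "norm (B ** k2) \<le> norm B * norm k2" by (rule norm_matrix_mult_le)
    also have "\<dots> \<le> (Cd * norm A) * norm k2" by (intro mult_right_mono dominated(2)[OF AB(1)]) auto
    also have "\<dots> \<le> (Cd * (norm (A ** k1) * norm k1)) * norm k2"
      using dominated(1) nA by (intro mult_right_mono mult_left_mono) auto
    finally have "norm (B ** k2) \<le> (Cd * norm k1 * norm k2) * norm (A ** k1)" by (simp add: mult_ac)
    then have "(norm (B ** k2))\<^sup>2 \<le> ((Cd * norm k1 * norm k2) * norm (A ** k1))\<^sup>2" by (intro power_mono) auto
    then have "cosh d2 \<le> M * cosh d1"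
      unfolding d1_def d2_def y cosh_hdist_moebius_ii[OF detk(1)] cosh_hdist_moebius_ii[OF detk(2)] M_def
      by (simp add: power_mult_distrib)
    moreover have "exp d2 \<le> 2 * cosh d2" by (simp add: cosh_def)
    moreover have "M * cosh d1 \<le> M * exp d1" using M d by (intro mult_left_mono) (auto simp: cosh_def)
    ultimately have "exp d2 \<le> 2 * M * exp d1" by linarith
    also have "\<dots> = exp (ln (2 * M) + d1)" using M by (simp add: exp_add)
    finally have "d2 \<le> ln (2 * M) + d1" by simp
    then show ?thesis unfolding d1_def d2_def by linarith
  qed
  then show ?thesis using that[of "\<bar>ln (2 * M)\<bar>"] by simp
qed

lemma interior_slope_in_closure:
  assumes x: "x \<in> HH" and p: "ray_params a1 a2 u1 u2" and a: "0 < a2" "a2 < a1"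
  shows "Inr (ray_class (base_ray a1 a2 u1 u2)) \<in> cone_topology closure_of (Inl ` pair_orbit G x)"
proof -
  have u: "norm u1 = 1" "norm u2 = 1" "a1\<^sup>2 + a2\<^sup>2 = 1" "a1 \<ge> 0" "a2 \<ge> 0" using p by (auto simp: ray_params_def)
  have "\<exists>P. P \<in> G \<and> norm (line_dir (fst P *v e1) - u1) < 1 / real (Suc n) \<and> norm (line_dir (snd P *v e2) - u2) < 1 / real (Suc n)" for n
  proof -
    have "1 / real (Suc n) > 0" by simp
    from dense_pair_orbit[OF u(1,2) this] show ?thesis by (metis fst_conv snd_conv)
  qed
  then obtain P where P: "\<And>n. P n \<in> G" "\<And>n. norm (line_dir (fst (P n) *v e1) - u1) < 1 / real (Suc n)"
    "\<And>n. norm (line_dir (snd (P n) *v e2) - u2) < 1 / real (Suc n)" by metis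
  have P': "(fst (P n), snd (P n)) \<in> G" for n using P(1) by simp
  have lim: "w \<longlonglongrightarrow> u" if "\<And>n. norm (w n - u) < 1 / real (Suc n)" for w :: "nat \<Rightarrow> complex" and u
  proof -
    have "norm (w n - u) \<le> 1 / real (Suc n)" for n by (rule less_imp_le[OF that])
    then have "(\<lambda>n. w n - u) \<longlonglongrightarrow> 0"
      by (intro Lim_null_comparison[OF always_eventually LIMSEQ_Suc[OF lim_1_over_n]] allI)
    then show ?thesis by (simp add: LIM_zero_iff)
  qed
  have nzP: "fst (P n) *v e1 \<noteq> 0" "snd (P n) *v e2 \<noteq> 0" for n
    using det_G[OF P'] matrix_vector_nonzero_2 nz by auto
  show ?thesis
  proof (rule cone_closure_boundary_limit[OF p])
    show "ray_params a1 a2 (line_dir (fst (P n) *v e1)) (line_dir (snd (P n) *v e2))" for n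
      using u nzP by (simp add: ray_params_def norm_line_dir)
    show "Inr (ray_class (base_ray a1 a2 (line_dir (fst (P n) *v e1)) (line_dir (snd (P n) *v e2))))
        \<in> cone_topology closure_of (Inl ` pair_orbit G x)" for n
      by (rule cusp_limit[OF x P' a u(3)])
  qed (auto intro!: lim P tendsto_const)
qed

lemma slope_in_closure:
  assumes x: "x \<in> HH" and p: "ray_params a1 a2 u1 u2" and a: "a2 \<le> a1"
  shows "Inr (ray_class (base_ray a1 a2 u1 u2)) \<in> cone_topology closure_of (Inl ` pair_orbit G x)"
proof -
  have u: "norm u1 = 1" "norm u2 = 1" "a1\<^sup>2 + a2\<^sup>2 = 1" "a1 \<ge> 0" "a2 \<ge> 0" using p by (auto simp: ray_params_def)
  obtain t where t: "0 \<le> t" "t \<le> pi / 2" "a1 = cos t" "a2 = sin t" using sincos_total_pi_half[OF u(4,5,3)] by blast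
  have t4: "t \<le> pi / 4"
  proof (rule ccontr)
    assume "\<not> t \<le> pi / 4"
    then have "sin (pi / 2 - t) < sin t" using t by (intro sin_monotone_2pi) auto
    then show False using a t by (simp add: cos_sin_eq)
  qed
  \<comment> \<open>The extreme slopes 0 and 1 are reached as limits: the angle t is pulled towards
    pi / 8, the middle of [0, pi / 4], by a vanishing amount.\<close>
  define T where "T = (\<lambda>n. t + (pi / 8 - t) * (1 / real (Suc n)))"
  have T: "0 < T n" "T n < pi / 4" for n
  proof -
    define w where "w = 1 / real (Suc n)"
    have w: "0 < w" "w \<le> 1" by (auto simp: w_def)
    have e: "T n = (1 - w) * t + w * (pi / 8)" by (simp add: T_def w_def algebra_simps)
    have "(1 - w) * t \<ge> 0" "w * (pi / 8) > 0" using w t by auto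
    then show "0 < T n" unfolding e by linarith
    have "(1 - w) * t \<le> (1 - w) * (pi / 4)" using w t4 by (intro mult_left_mono) auto
    moreover have "w * (pi / 8) < w * (pi / 4)" using w by (intro mult_strict_left_mono) auto
    moreover have "(1 - w) * (pi / 4) + w * (pi / 4) = pi / 4" by (simp only: distrib_right[symmetric]) simp
    ultimately show "T n < pi / 4" unfolding e by linarith
  qed
  have "T \<longlonglongrightarrow> t + (pi / 8 - t) * 0"
    unfolding T_def by (intro tendsto_add tendsto_mult tendsto_const LIMSEQ_Suc[OF lim_1_over_n])
  then have Tl: "T \<longlonglongrightarrow> t" by simp
  have pT: "ray_params (cos (T n)) (sin (T n)) u1 u2" for n
  proof -
    have "cos (T n) \<ge> 0" "sin (T n) \<ge> 0" using T[of n] by (auto intro!: cos_ge_zero sin_ge_zero)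
    then show ?thesis using u by (simp add: ray_params_def)
  qed
  show ?thesis
  proof (rule cone_closure_boundary_limit[OF p pT])
    show "Inr (ray_class (base_ray (cos (T n)) (sin (T n)) u1 u2)) \<in> cone_topology closure_of (Inl ` pair_orbit G x)" for n
    proof (rule interior_slope_in_closure[OF x pT])
      show "0 < sin (T n)" using T[of n] by (intro sin_gt_zero) auto
      have "sin (T n) < sin (pi / 2 - T n)" using T[of n] by (intro sin_monotone_2pi) auto
      then show "sin (T n) < cos (T n)" by (simp add: cos_sin_eq)
    qed
  qed (use Tl t in \<open>auto intro!: tendsto_sin tendsto_cos\<close>)
qed

theorem limit_classes:
  assumes x: "x \<in> HH"
  shows "{\<eta> \<in> geom_boundary. Inr \<eta> \<in> cone_topology closure_of (Inl ` pair_orbit G x)} =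
    {ray_class (base_ray a1 a2 u1 u2) | a1 a2 u1 u2. ray_params a1 a2 u1 u2 \<and> a2 \<le> a1}" (is "?L = ?R")
proof
  show "?R \<subseteq> ?L" using slope_in_closure[OF x] base_ray_class_mem by blast
  obtain C where C: "C \<ge> 0" "\<And>y. y \<in> pair_orbit G x \<Longrightarrow> hdist \<i> (snd y) \<le> hdist \<i> (fst y) + C"
    using orbit_distance_bound[OF x] by blast
  show "?L \<subseteq> ?R"
  proof
    fix \<eta> assume "\<eta> \<in> ?L"
    then have "\<eta> \<in> geom_boundary" and cl: "Inr \<eta> \<in> cone_topology closure_of (Inl ` pair_orbit G x)" by auto
    then obtain a1 a2 u1 u2 where p: "\<eta> = ray_class (base_ray a1 a2 u1 u2)" "ray_params a1 a2 u1 u2"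
      unfolding geom_boundary_eq by blast
    have "a2 \<le> a1" by (rule cone_closure_slope[OF p(2) pair_orbit_subset[OF x] C cl[unfolded p(1)]])
    then show "\<eta> \<in> ?R" using p by blast
  qed
qed

theorem length_ratio_dense:
  assumes s: "0 < s" "s < 1" and \<epsilon>: "\<epsilon> > 0"
  obtains A B where "(A, B) \<in> G" "\<bar>trace A\<bar> > 2" "\<bar>trace B\<bar> > 2"
    "\<bar>arcosh (\<bar>trace B\<bar> / 2) / arcosh (\<bar>trace A\<bar> / 2) - s\<bar> < \<epsilon>"
proof -
  \<comment> \<open>The lengths in the second and first factor grow at rates proportional to
    \<kappa> and \<kappa> + \<eta>, whose ratio is s for this value.\<close>
  define \<kappa> where "\<kappa> = \<eta> * s / (1 - s)"
  have \<kappa>: "\<kappa> > 0" using eta s by (simp add: \<kappa>_def)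
  define N where "N = (\<lambda>l. nat \<lceil>exp (\<kappa> * real l)\<rceil>)"
  have N: "\<And>l. N l = nat \<lceil>exp (\<kappa> * real l)\<rceil>" by (simp add: N_def)
  \<comment> \<open>The trace in the second factor contains sin (g \<theta>), which may be close to
    0. Two consecutive values cannot both be small, because \<theta> is the difference of their
    angles; so correcting the exponent by at most 1 suffices.\<close>
  have "\<exists>g. (g = Suc l \<or> g = Suc (Suc l)) \<and> \<bar>sin (real g * \<theta>)\<bar> \<ge> sin \<theta> / 2" for l
  proof (rule ccontr)
    assume "\<not> ?thesis"
    then have lt: "\<bar>sin (real (Suc l) * \<theta>)\<bar> < sin \<theta> / 2" "\<bar>sin (real (Suc (Suc l)) * \<theta>)\<bar> < sin \<theta> / 2" by (auto simp: not_le)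
    let ?a = "real (Suc l) * \<theta>" and ?b = "real (Suc (Suc l)) * \<theta>"
    have "\<theta> = ?b - ?a" by (simp add: algebra_simps)
    then have "sin \<theta> = sin ?b * cos ?a - cos ?b * sin ?a" by (metis sin_diff)
    also have "\<dots> \<le> \<bar>sin ?b\<bar> * \<bar>cos ?a\<bar> + \<bar>cos ?b\<bar> * \<bar>sin ?a\<bar>"
      unfolding abs_mult[symmetric] by linarith
    also have "\<dots> \<le> \<bar>sin ?b\<bar> * 1 + 1 * \<bar>sin ?a\<bar>"
      by (intro add_mono mult_left_mono mult_right_mono) auto
    finally show False using lt by linarith
  qed
  then obtain g where g: "\<And>l. g l = Suc l \<or> g l = Suc (Suc l)" "\<And>l. \<bar>sin (real (g l) * \<theta>)\<bar> \<ge> sin \<theta> / 2" by metis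
  obtain C0 where C0: "C0 > 0" "\<And>n. norm (mpow h1 n) \<le> C0 * exp (real n * \<eta>)"
    using norm_mpow_hyperbolic[OF det_h(1) eta(2,1)] by blast
  obtain C2 where C2: "C2 > 0" "\<And>n. norm (mpow h2 n) \<le> C2"
    using norm_mpow_elliptic[OF det_h(2) theta(2,1)] by blast
  define C1 where "C1 = C0 * exp (2 * \<eta>)"
  have nh1: "norm (mpow h1 (g l)) \<le> C1 * exp (\<eta> * real l)" for l
  proof -
    have "real (g l) * \<eta> \<le> (2 + real l) * \<eta>" using g(1)[of l] eta by (intro mult_right_mono) auto
    then have "exp (real (g l) * \<eta>) \<le> exp (2 * \<eta>) * exp (\<eta> * real l)" by (simp add: exp_add[symmetric] algebra_simps)
    then have "C0 * exp (real (g l) * \<eta>) \<le> C0 * (exp (2 * \<eta>) * exp (\<eta> * real l))" using C0(1) by (intro mult_left_mono) auto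
    then show ?thesis using C0(2)[of "g l"] by (simp add: C1_def mult.assoc)
  qed
  define A where "A = (\<lambda>l. mpow T1 (N l) ** mpow h1 (g l))"
  define B where "B = (\<lambda>l. mpow T2 (N l) ** mpow h2 (g l))"
  have AB: "(A l, B l) \<in> G" for l unfolding A_def B_def by (intro mult_G mpow_G unipotent_G h_G)
  have tr: "trace ((mat 1 + real n *\<^sub>R outer2 e f) ** M) = trace M + real n * (f \<bullet> (M *v e))" for n e f M
    unfolding trace_outer2_mult[symmetric] by (simp add: trace_2 matrix_2_mult algebra_simps)
  have trA: "trace (A l) = trace (mpow h1 (g l)) + real (N l) * (f1 \<bullet> (mpow h1 (g l) *v e1))" for l
    unfolding A_def mpow_unipotent[OF fe(1)] by (rule tr)
  have trB: "trace (B l) = trace (mpow h2 (g l)) + real (N l) * (f2 \<bullet> (mpow h2 (g l) *v e2))" for l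
    unfolding B_def mpow_unipotent[OF fe(2)] by (rule tr)
  have in_le: "\<bar>f \<bullet> (M *v e)\<bar> \<le> norm f * norm M * norm e" for f e and M :: "real^2^2"
  proof -
    have "\<bar>f \<bullet> (M *v e)\<bar> \<le> norm f * norm (M *v e)" by (rule Cauchy_Schwarz_ineq2)
    also have "\<dots> \<le> norm f * (norm M * norm e)" by (intro mult_left_mono norm_matrix_vector_le) auto
    finally show ?thesis by (simp add: mult.assoc)
  qed
  define p1 where "p1 = \<bar>f1 \<bullet> (h1 *v e1)\<bar>"
  define p2 where "p2 = \<bar>f2 \<bullet> (h2 *v e2)\<bar> / 2"
  have p: "p1 > 0" "p2 > 0" using h1_e1 h2_e2_independent by (auto simp: p1_def p2_def)
  have low1: "p1 * exp (\<eta> * real l) \<le> \<bar>f1 \<bullet> (mpow h1 (g l) *v e1)\<bar>" for l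
  proof -
    have s0: "sinh \<eta> > 0" using eta by simp
    have "real (Suc l) * \<eta> \<le> real (g l) * \<eta>" using g(1)[of l] eta by (intro mult_right_mono) auto
    then have "sinh \<eta> * exp (real l * \<eta>) \<le> sinh (real (g l) * \<eta>)"
      using sinh_lower[of l] by (meson order_trans sinh_real_le_iff)
    then have "exp (\<eta> * real l) \<le> sinh (real (g l) * \<eta>) / sinh \<eta>" using s0 by (simp add: field_simps)
    then have "exp (\<eta> * real l) * p1 \<le> sinh (real (g l) * \<eta>) / sinh \<eta> * p1" using p by (intro mult_right_mono) auto
    also have "\<dots> = \<bar>f1 \<bullet> (mpow h1 (g l) *v e1)\<bar>"
      unfolding f1_h1_power p1_def abs_mult using eta by (simp add: abs_mult)
    finally show ?thesis by (simp add: mult.commute)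
  qed
  have low2: "p2 * exp (0 * real l) \<le> \<bar>f2 \<bullet> (mpow h2 (g l) *v e2)\<bar>" for l
  proof -
    have "1 / 2 \<le> \<bar>sin (real (g l) * \<theta>) / sin \<theta>\<bar>" using g(2)[of l] theta(1) by (simp add: field_simps)
    then have "1 / 2 * \<bar>f2 \<bullet> (h2 *v e2)\<bar> \<le> \<bar>sin (real (g l) * \<theta>) / sin \<theta>\<bar> * \<bar>f2 \<bullet> (h2 *v e2)\<bar>" by (intro mult_right_mono) auto
    then show ?thesis unfolding f2_h2_power abs_mult by (simp add: p2_def)
  qed
  have up1: "\<bar>f1 \<bullet> (mpow h1 (g l) *v e1)\<bar> \<le> norm f1 * C1 * norm e1 * exp (\<eta> * real l)" for l
  proof -
    have "norm f1 * norm (mpow h1 (g l)) * norm e1 \<le> norm f1 * (C1 * exp (\<eta> * real l)) * norm e1"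
      by (intro mult_right_mono mult_left_mono nh1) auto
    then show ?thesis using in_le[of f1 "mpow h1 (g l)" e1] by (simp add: mult_ac)
  qed
  have up2: "\<bar>f2 \<bullet> (mpow h2 (g l) *v e2)\<bar> \<le> norm f2 * C2 * norm e2 * exp (0 * real l)" for l
  proof -
    have "norm f2 * norm (mpow h2 (g l)) * norm e2 \<le> norm f2 * C2 * norm e2"
      by (intro mult_right_mono mult_left_mono C2) auto
    then show ?thesis using in_le[of f2 "mpow h2 (g l)" e2] by simp
  qed
  have t1: "\<bar>trace (mpow h1 (g l))\<bar> \<le> 2 * C1 * exp (\<eta> * real l)" for l
    using abs_trace_le_norm[of "mpow h1 (g l)"] nh1[of l] by simp
  have t2: "\<bar>trace (mpow h2 (g l))\<bar> \<le> 2 * C2 * exp (0 * real l)" for l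
    using abs_trace_le_norm[of "mpow h2 (g l)"] C2(2)[of "g l"] by simp
  note g1 = trace_growth[OF \<kappa> N less_imp_le[OF eta(1)] p(1) trA t1 low1 up1]
  note g2 = trace_growth[OF \<kappa> N order_refl p(2) trB t2 low2 up2]
  have l1: "(\<lambda>l. arcosh (\<bar>trace (A l)\<bar> / 2) / real l) \<longlonglongrightarrow> \<kappa> + \<eta>"
    by (rule lin_growth_tendsto[OF arcosh_growth[OF g1]])
  have l2: "(\<lambda>l. arcosh (\<bar>trace (B l)\<bar> / 2) / real l) \<longlonglongrightarrow> \<kappa> + 0"
    by (rule lin_growth_tendsto[OF arcosh_growth[OF g2]])
  have quot: "(\<lambda>l. (arcosh (\<bar>trace (B l)\<bar> / 2) / real l) / (arcosh (\<bar>trace (A l)\<bar> / 2) / real l)) \<longlonglongrightarrow> (\<kappa> + 0) / (\<kappa> + \<eta>)"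
    by (rule tendsto_divide[OF l2 l1]) (use \<kappa> eta in auto)
  have s_eq: "(\<kappa> + 0) / (\<kappa> + \<eta>) = s"
  proof -
    have "\<kappa> + \<eta> = \<eta> / (1 - s)" using s by (simp add: \<kappa>_def field_simps)
    then show ?thesis using s eta by (simp add: \<kappa>_def)
  qed
  have "\<forall>\<^sub>F l in sequentially. dist ((arcosh (\<bar>trace (B l)\<bar> / 2) / real l) / (arcosh (\<bar>trace (A l)\<bar> / 2) / real l)) s < \<epsilon>"
    by (rule tendstoD[OF quot[unfolded s_eq] \<epsilon>])
  with g1(2) g2(2) eventually_gt_at_top[of 0]
  have "\<forall>\<^sub>F l in sequentially. \<bar>trace (A l)\<bar> > 2 \<and> \<bar>trace (B l)\<bar> > 2 \<and> \<bar>arcosh (\<bar>trace (B l)\<bar> / 2) / arcosh (\<bar>trace (A l)\<bar> / 2) - s\<bar> < \<epsilon>"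
    by eventually_elim (simp add: dist_real_def)
  then obtain l where "\<bar>trace (A l)\<bar> > 2" "\<bar>trace (B l)\<bar> > 2" "\<bar>arcosh (\<bar>trace (B l)\<bar> / 2) / arcosh (\<bar>trace (A l)\<bar> / 2) - s\<bar> < \<epsilon>"
    using eventually_happens'[OF sequentially_bot] by blast
  then show ?thesis using that AB by blast
qed

end

section \<open>Hecke groups, their conjugates, and the domination of entries\<close>

section \<open>Hecke groups\<close>

text \<open>With U = T S, these generate the Hecke group with translation 2 cos x when x = pi / n,
  where U has order n in PSL(2,R). The same matrices with 3 x in place of x give the second
  factor.\<close>

definition hS :: "real^2^2" where "hS = mat2 0 (- 1) 1 0"
definition hU :: "real \<Rightarrow> real^2^2" where "hU x = mat2 (2 * cos x) (- 1) 1 0"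
definition hT :: "real \<Rightarrow> real^2^2" where "hT x = mat2 1 (2 * cos x) 0 1"

text \<open>The matrix \<open>hV x k\<close> is \<open>U\<^sup>k S\<^sup>-\<^sup>1\<close>.\<close>

definition hV :: "real \<Rightarrow> nat \<Rightarrow> real^2^2" where
  "hV x k = (1 / sin x) *\<^sub>R mat2 (sin (real k * x)) (sin ((real k + 1) * x)) (sin ((real k - 1) * x)) (sin (real k * x))"

lemma hV_sel:
  "hV x k $ 1 $ 1 = sin (real k * x) / sin x" "hV x k $ 1 $ 2 = sin ((real k + 1) * x) / sin x"
  "hV x k $ 2 $ 1 = sin ((real k - 1) * x) / sin x" "hV x k $ 2 $ 2 = sin (real k * x) / sin x"
  by (simp_all add: hV_def)

lemma hT_eq: "hT x = - (hU x ** hS)"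
  by (simp add: hT_def hU_def hS_def mat2_mult matrix_2_eq_iff)

lemma det_hecke: "det hS = 1" "det (hU x) = 1" "det (hT x) = 1"
  by (simp_all add: hS_def hU_def hT_def)

lemma det_hV:
  assumes "sin x \<noteq> 0"
  shows "det (hV x k) = 1"
proof -
  have "sin ((real k + 1) * x) * sin ((real k - 1) * x) = (sin (real k * x))\<^sup>2 * (cos x)\<^sup>2 - (cos (real k * x))\<^sup>2 * (sin x)\<^sup>2"
    by (simp add: distrib_right left_diff_distrib sin_add sin_diff power2_eq_square algebra_simps)
  also have "\<dots> = (sin (real k * x))\<^sup>2 - (sin x)\<^sup>2"
    unfolding cos_squared_eq by (simp add: algebra_simps)
  finally have "(sin (real k * x))\<^sup>2 - sin ((real k + 1) * x) * sin ((real k - 1) * x) = (sin x)\<^sup>2" by simp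
  then show ?thesis using assms unfolding det_2 hV_sel
    by (simp add: diff_divide_distrib[symmetric] power2_eq_square)
qed

lemma hU_hV:
  assumes "sin x \<noteq> 0"
  shows "hU x ** hV x k = hV x (Suc k)"
proof -
  have "sin ((real k + 1) * x) + sin ((real k - 1) * x) = 2 * cos x * sin (real k * x)"
    by (simp add: distrib_right left_diff_distrib sin_add sin_diff)
  moreover have "sin ((real k + 2) * x) + sin (real k * x) = 2 * cos x * sin ((real k + 1) * x)"
  proof -
    have "(real k + 2) * x = (real k + 1) * x + x" "real k * x = (real k + 1) * x - x" by (simp_all add: algebra_simps)
    then show ?thesis by (simp only: sin_add sin_diff) simp
  qed
  ultimately have "2 * cos x * sin (real k * x) - sin ((real k - 1) * x) = sin ((real k + 1) * x)"
    "2 * cos x * sin ((real k + 1) * x) - sin (real k * x) = sin ((real k + 2) * x)" by linarith+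
  then show ?thesis
    by (simp add: matrix_2_eq_iff matrix_2_mult hV_sel hU_def diff_divide_distrib[symmetric] add.commute)
qed

lemma hV_0: "sin x \<noteq> 0 \<Longrightarrow> hV x 0 = - hS"
  by (simp add: matrix_2_eq_iff hV_sel hS_def)

text \<open>This is U^n = -1 in disguise, the relation that turns an overlong power back into
  S.\<close>

lemma hV_n:
  assumes "sin x \<noteq> 0" "sin (real n * x) = 0" "cos (real n * x) = - 1"
  shows "hV x n = hS"
  using assms by (simp add: matrix_2_eq_iff hV_sel hS_def distrib_right left_diff_distrib sin_add sin_diff)

lemma hS_hS: "hS ** hS = - mat 1"
  by (simp add: hS_def mat2_mult matrix_2_eq_iff)

lemma matrix_mult_minus: "(- A) ** (B :: real^2^2) = - (A ** B)" "(A :: real^2^2) ** (- B) = - (A ** B)"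
  by (simp_all add: matrix_2_eq_iff matrix_2_mult)

text \<open>The bound puts the angle at or below pi / 4, which gives sin^2 \<omega> \<le> 1/2 and
  sin (3\<omega>) > 0; the comparison of the angles \<omega> and 3\<omega> rests on both. The values
  that occur are 5 and 10.\<close>

locale hecke =
  fixes n :: nat
  assumes n: "n \<ge> 4"
begin

definition "\<omega> = pi / real n"

lemma omega: "0 < \<omega>" "\<omega> \<le> pi / 4" "real n * \<omega> = pi"
proof -
  have "pi / real n \<le> pi / 4" by (rule divide_left_mono) (use n in auto)
  then show "0 < \<omega>" "\<omega> \<le> pi / 4" "real n * \<omega> = pi" using n by (auto simp: \<omega>_def)
qed

lemma sin_pos: "sin \<omega> > 0" "sin (3 * \<omega>) > 0"
  using omega by (auto intro!: sin_gt_zero)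

lemma hV_n_omega: "hV \<omega> n = hS" "hV (3 * \<omega>) n = hS"
proof -
  show "hV \<omega> n = hS" using sin_pos omega by (intro hV_n) auto
  have e: "real n * (3 * \<omega>) = 3 * pi" using omega(3) by simp
  have "sin (3 * pi) = 0" "cos (3 * pi) = - 1"
    using sin_npi[of 3] cos_npi[of 3] by (simp_all add: mult.commute)
  then have "sin (real n * (3 * \<omega>)) = 0" "cos (real n * (3 * \<omega>)) = - 1" unfolding e by auto
  from hV_n[OF _ this] show "hV (3 * \<omega>) n = hS" using sin_pos by auto
qed

text \<open>Products of the nonnegative matrices \<open>hV \<omega> k\<close>, carried along with
  the same products for 3\<omega>. They are the core of the normal form, once S has been split off
  at both ends.\<close>

inductive vmon :: "real^2^2 \<Rightarrow> real^2^2 \<Rightarrow> bool" where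
  one: "vmon (mat 1) (mat 1)"
| step: "vmon M M' \<Longrightarrow> 1 \<le> k \<Longrightarrow> k < n \<Longrightarrow> vmon (hV \<omega> k ** M) (hV (3 * \<omega>) k ** M')"

text \<open>Only positive powers of S and U occur. Both have finite order up to sign, so inverses
  are still words up to sign; \<open>words_adj2\<close> makes this precise.\<close>

inductive words :: "real^2^2 \<Rightarrow> real^2^2 \<Rightarrow> bool" where
  one: "words (mat 1) (mat 1)"
| S: "words A B \<Longrightarrow> words (hS ** A) (hS ** B)"
| U: "words A B \<Longrightarrow> words (hU \<omega> ** A) (hU (3 * \<omega>) ** B)"

lemma words_mult: "words A B \<Longrightarrow> words A' B' \<Longrightarrow> words (A ** A') (B ** B')"
  by (induction rule: words.induct) (auto simp: matrix_mul_assoc[symmetric] intro: words.intros)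

lemma vmon_right: "vmon M M' \<Longrightarrow> 1 \<le> k \<Longrightarrow> k < n \<Longrightarrow> vmon (M ** hV \<omega> k) (M' ** hV (3 * \<omega>) k)"
proof (induction rule: vmon.induct)
  case one
  then show ?case using vmon.step[OF vmon.one] by simp
next
  case (step M M' j)
  then show ?case using vmon.step[of "M ** hV \<omega> k" "M' ** hV (3 * \<omega>) k" j] by (simp add: matrix_mul_assoc)
qed

text \<open>Since \<open>sin 3x = sin x (3 - 4 sin\<^sup>2 x)\<close>, the matrices \<open>hV (3\<omega>) k\<close> are dominated by \<open>hV \<omega> k\<close>.\<close>

lemma sin_triple_dominated:
  assumes "k \<le> n"
  shows "\<bar>sin (real k * (3 * \<omega>)) / sin (3 * \<omega>)\<bar> \<le> sin (real k * \<omega>) / sin \<omega>" "sin (real k * \<omega>) / sin \<omega> \<ge> 0"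
    "0 < k \<Longrightarrow> k < n \<Longrightarrow> sin (real k * \<omega>) / sin \<omega> \<ge> 1"
proof -
  have kw: "real k * \<omega> \<le> pi" "real k * \<omega> \<ge> 0" using assms omega mult_right_mono[of "real k" "real n" \<omega>] by auto
  then have sk: "sin (real k * \<omega>) \<ge> 0" by (simp add: sin_ge_zero)
  then show "sin (real k * \<omega>) / sin \<omega> \<ge> 0" using sin_pos by simp
  have ge: "sin \<omega> \<le> sin (real k * \<omega>)" if k: "0 < k" "k < n"
  proof (cases "real k * \<omega> \<le> pi / 2")
    case True
    have "1 * \<omega> \<le> real k * \<omega>" using k omega by (intro mult_right_mono) auto
    then show ?thesis using True omega by (intro sin_monotone_2pi_le) auto
  next
    case False
    have "real k + 1 \<le> real n" using k by linarith
    then have "(real k + 1) * \<omega> \<le> pi" using omega mult_right_mono[of "real k + 1" "real n" \<omega>] by simp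
    then have "\<omega> \<le> pi - real k * \<omega>" by (simp add: algebra_simps)
    then have "sin \<omega> \<le> sin (pi - real k * \<omega>)" using False omega by (intro sin_monotone_2pi_le) auto
    then show ?thesis by simp
  qed
  then show "0 < k \<Longrightarrow> k < n \<Longrightarrow> sin (real k * \<omega>) / sin \<omega> \<ge> 1" using sin_pos by simp
  have triple: "sin (3 * x) = sin x * (3 - 4 * (sin x)\<^sup>2)" for x :: real
  proof -
    have "sin (3 * x) = sin (2 * x + x)" by (simp add: algebra_simps)
    also have "\<dots> = 2 * sin x * (cos x)\<^sup>2 + (2 * (cos x)\<^sup>2 - 1) * sin x"
      unfolding sin_add sin_double cos_double_cos by (simp add: power2_eq_square)
    finally show ?thesis unfolding cos_squared_eq by (simp add: power2_eq_square algebra_simps)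
  qed
  have half: "(sin \<omega>)\<^sup>2 \<le> 1 / 2"
  proof -
    have "sin \<omega> \<le> sin (pi / 4)" using omega by (intro sin_monotone_2pi_le) auto
    then have "(sin \<omega>)\<^sup>2 \<le> (sin (pi / 4))\<^sup>2" using sin_pos by (intro power_mono) auto
    then show ?thesis by (simp add: sin_45 power_divide)
  qed
  show "\<bar>sin (real k * (3 * \<omega>)) / sin (3 * \<omega>)\<bar> \<le> sin (real k * \<omega>) / sin \<omega>"
  proof (cases "0 < k \<and> k < n")
    case True
    then have "(sin \<omega>)\<^sup>2 \<le> (sin (real k * \<omega>))\<^sup>2" using ge sin_pos by (intro power_mono) auto
    moreover have "(sin (real k * \<omega>))\<^sup>2 \<le> 1" by (simp add: abs_square_le_1)
    \<comment> \<open>As sin^2 (k\<omega>) runs through [sin^2 \<omega>, 1], the factor 3 - 4 sin^2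
      lies between -1 and its value at \<omega>, and that value is at least 1 because sin^2 \<omega>
      \<le> 1/2.\<close>
    ultimately have le: "\<bar>3 - 4 * (sin (real k * \<omega>))\<^sup>2\<bar> \<le> 3 - 4 * (sin \<omega>)\<^sup>2" using half by linarith
    have pos: "3 - 4 * (sin \<omega>)\<^sup>2 > 0" using half by linarith
    have "\<bar>sin (real k * (3 * \<omega>))\<bar> = sin (real k * \<omega>) * \<bar>3 - 4 * (sin (real k * \<omega>))\<^sup>2\<bar>"
      using sk triple[of "real k * \<omega>"] by (simp add: abs_mult mult.left_commute)
    also have "\<dots> \<le> sin (real k * \<omega>) * (3 - 4 * (sin \<omega>)\<^sup>2)" using sk le by (intro mult_left_mono) auto
    finally have "\<bar>sin (real k * (3 * \<omega>))\<bar> * sin \<omega> \<le> sin (real k * \<omega>) * sin (3 * \<omega>)"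
      unfolding triple[of \<omega>] using sin_pos(1) by (simp add: mult_ac)
    then show ?thesis using sin_pos by (simp add: abs_divide divide_le_eq pos_le_divide_eq mult.commute field_simps)
  next
    case False
    then have "k = 0 \<or> k = n" using assms by auto
    then show ?thesis
    proof
      assume "k = n"
      have "real n * (3 * \<omega>) = 3 * pi" using omega(3) by simp
      moreover have "sin (3 * pi) = 0" using sin_npi[of 3] by (simp add: mult.commute)
      ultimately show ?thesis using \<open>k = n\<close> omega(3) by (simp only:) simp
    qed simp
  qed
qed

text \<open>The entries are quotients of sines with indices k - 1, k, k + 1 in the range from 0 to
  n; these vanish at the two ends and are at least 1 in between. The gap between 0 and 1 later
  yields growth by a fixed amount.\<close>

lemma hV_dominated:
  assumes "1 \<le> k" "k < n"
  shows "\<bar>hV (3 * \<omega>) k $ i $ j\<bar> \<le> hV \<omega> k $ i $ j" "hV \<omega> k $ i $ j = 0 \<or> hV \<omega> k $ i $ j \<ge> 1"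
    "hV \<omega> k $ 1 $ 1 \<ge> 1" "hV \<omega> k $ 2 $ 2 \<ge> 1" "hV \<omega> k $ 1 $ 2 \<ge> 1 \<or> hV \<omega> k $ 2 $ 1 \<ge> 1"
proof -
  have k1: "real k - 1 = real (k - 1)" "real k + 1 = real (k + 1)" using assms by auto
  have le: "k \<le> n" "k - 1 \<le> n" "k + 1 \<le> n" using assms by auto
  have ij: "i = 1 \<or> i = 2" "j = 1 \<or> j = 2" using exhaust_2 by auto
  show "\<bar>hV (3 * \<omega>) k $ i $ j\<bar> \<le> hV \<omega> k $ i $ j"
    using ij sin_triple_dominated(1)[OF le(1)] sin_triple_dominated(1)[OF le(2)] sin_triple_dominated(1)[OF le(3)]
    by (auto simp only: hV_sel k1)
  have n0: "sin (real n * \<omega>) = 0" using omega(3) by simp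
  have d: "sin (real m * \<omega>) / sin \<omega> = 0 \<or> sin (real m * \<omega>) / sin \<omega> \<ge> 1" if "m \<le> n" for m
    using sin_triple_dominated(3)[of m] that n0 by (cases "m = 0 \<or> m = n") auto
  show "hV \<omega> k $ i $ j = 0 \<or> hV \<omega> k $ i $ j \<ge> 1"
    using ij d[OF le(1)] d[OF le(2)] d[OF le(3)] by (auto simp only: hV_sel k1)
  show "hV \<omega> k $ 1 $ 1 \<ge> 1" "hV \<omega> k $ 2 $ 2 \<ge> 1"
    using sin_triple_dominated(3)[of k] assms by (simp_all only: hV_sel)
  show "hV \<omega> k $ 1 $ 2 \<ge> 1 \<or> hV \<omega> k $ 2 $ 1 \<ge> 1"
  proof (cases "k = 1")
    case True
    then have "k + 1 \<le> n" "0 < k + 1" "k + 1 < n" using n by auto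
    then show ?thesis using sin_triple_dominated(3)[of "k + 1"] by (auto simp only: hV_sel k1)
  next
    case False
    then have "k - 1 \<le> n" "0 < k - 1" "k - 1 < n" using assms by auto
    then show ?thesis using sin_triple_dominated(3)[of "k - 1"] by (auto simp only: hV_sel k1)
  qed
qed

text \<open>Domination by nonnegative entries is multiplicative: products are estimated term by
  term, and nothing cancels in the larger matrix. The alternative of 0 or at least 1 also passes to
  sums of products.\<close>

lemma vmon_dominated: "vmon M M' \<Longrightarrow> \<bar>M' $ i $ j\<bar> \<le> M $ i $ j \<and> (M $ i $ j = 0 \<or> M $ i $ j \<ge> 1)"
proof (induction arbitrary: i j rule: vmon.induct)
  case one
  have "i = 1 \<or> i = 2" "j = 1 \<or> j = 2" using exhaust_2 by auto
  then show ?case by auto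
next
  case (step M M' k)
  note V = hV_dominated(1,2)[OF step.hyps(2,3)]
  have m: "\<bar>hV (3 * \<omega>) k $ i $ l * M' $ l $ j\<bar> \<le> hV \<omega> k $ i $ l * M $ l $ j" for l
    unfolding abs_mult using V(1)[of i l] step.IH[of l j] by (intro mult_mono) auto
  have p: "hV \<omega> k $ i $ l * M $ l $ j = 0 \<or> hV \<omega> k $ i $ l * M $ l $ j \<ge> 1" for l
    using V(2)[of i l] step.IH[of l j] mult_mono[of 1 "hV \<omega> k $ i $ l" 1 "M $ l $ j"] by auto
  show ?case unfolding matrix_2_mult using m[of 1] m[of 2] p[of 1] p[of 2] by linarith
qed

lemma vmon_det: "vmon M M' \<Longrightarrow> det M = 1 \<and> det M' = 1"
proof (induction rule: vmon.induct)
  case (step M M' k)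
  then show ?case using det_hV[of \<omega> k] det_hV[of "3 * \<omega>" k] sin_pos by (simp add: det_mul)
qed simp

text \<open>The normal form of a free product, maintained under multiplication from the left. With
  V_k for \<open>hV x k\<close>: U S is -V_1, and U raises the leading factor V_k to V_(k+1), which
  collapses to S when k + 1 = n. The same rules hold for 3\<omega>, so both components keep the same
  shape and the same sign.\<close>

lemma words_normal_form:
  "words A B \<Longrightarrow> \<exists>c M M' P Q. (c = 1 \<or> c = - 1) \<and> vmon M M' \<and> (P = mat 1 \<or> P = hS) \<and> (Q = mat 1 \<or> Q = hS) \<and>
     A = c *\<^sub>R (P ** (M ** Q)) \<and> B = c *\<^sub>R (P ** (M' ** Q))"
proof (induction rule: words.induct)
  case one
  show ?case by (intro exI[of _ 1] exI[of _ "mat 1"]) (auto intro: vmon.one)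
next
  case (S A B)
  then obtain c M M' P Q where h: "c = 1 \<or> c = - 1" "vmon M M'" "P = mat 1 \<or> P = hS" "Q = mat 1 \<or> Q = hS"
    "A = c *\<^sub>R (P ** (M ** Q))" "B = c *\<^sub>R (P ** (M' ** Q))" by blast
  have sc: "hS ** (c *\<^sub>R X) = c *\<^sub>R (hS ** X)" for X :: "real^2^2" by (simp add: matrix_2_eq_iff matrix_2_mult algebra_simps)
  show ?case
  proof (cases "P = hS")
    case True
    then have "hS ** A = (- c) *\<^sub>R (mat 1 ** (M ** Q))" "hS ** B = (- c) *\<^sub>R (mat 1 ** (M' ** Q))"
      using h(5,6) by (simp_all add: sc matrix_mul_assoc hS_hS matrix_mult_minus)
    moreover have "- c = 1 \<or> - c = - 1" using h(1) by auto
    ultimately show ?thesis using h(2,4) by blast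
  next
    case False
    then have "hS ** A = c *\<^sub>R (hS ** (M ** Q))" "hS ** B = c *\<^sub>R (hS ** (M' ** Q))"
      using h(3,5,6) by (simp_all add: sc)
    then show ?thesis using h(1,2,4) by blast
  qed
next
  case (U A B)
  then obtain c M M' P Q where h: "c = 1 \<or> c = - 1" "vmon M M'" "P = mat 1 \<or> P = hS" "Q = mat 1 \<or> Q = hS"
    "A = c *\<^sub>R (P ** (M ** Q))" "B = c *\<^sub>R (P ** (M' ** Q))" by blast
  have sc: "hU x ** (c *\<^sub>R X) = c *\<^sub>R (hU x ** X)" for x and X :: "real^2^2" by (simp add: matrix_2_eq_iff matrix_2_mult algebra_simps)
  have nz: "sin \<omega> \<noteq> 0" "sin (3 * \<omega>) \<noteq> 0" using sin_pos by auto
  have US: "hU x ** hS = - hV x 1" if "sin x \<noteq> 0" for x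
    using hU_hV[OF that, of 0] hV_0[OF that] by (simp add: matrix_mult_minus matrix_2_eq_iff)
  have mc: "- c = 1 \<or> - c = - 1" using h(1) by auto
  show ?case
  proof (cases "P = hS")
    case True
    have "hU \<omega> ** A = (- c) *\<^sub>R (mat 1 ** ((hV \<omega> 1 ** M) ** Q))" "hU (3 * \<omega>) ** B = (- c) *\<^sub>R (mat 1 ** ((hV (3 * \<omega>) 1 ** M') ** Q))"
      unfolding h(5,6) True sc matrix_mul_assoc US[OF nz(1)] US[OF nz(2)] by (simp_all add: matrix_mult_minus)
    moreover have "vmon (hV \<omega> 1 ** M) (hV (3 * \<omega>) 1 ** M')" using vmon.step[OF h(2), of 1] n by simp
    ultimately show ?thesis using mc h(4) by blast
  next
    case False
    then have P: "P = mat 1" using h(3) by simp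
    show ?thesis using h(2)
    proof cases
      case one
      \<comment> \<open>With no leading factor to raise, U itself is rewritten as V_1 S.\<close>
      have e: "hU x = hV x 1 ** hS" if "sin x \<noteq> 0" for x
      proof -
        have "hV x 1 ** hS = - (hU x ** (hS ** hS))" using US[OF that] by (simp add: matrix_mul_assoc matrix_mult_minus)
        then show ?thesis by (simp add: hS_hS matrix_mult_minus)
      qed
      have v: "vmon (hV \<omega> 1) (hV (3 * \<omega>) 1)" using vmon.step[OF vmon.one, of 1] n by simp
      show ?thesis
      proof (cases "Q = hS")
        case True
        have "hU \<omega> ** A = (- c) *\<^sub>R (mat 1 ** (hV \<omega> 1 ** mat 1))" "hU (3 * \<omega>) ** B = (- c) *\<^sub>R (mat 1 ** (hV (3 * \<omega>) 1 ** mat 1))"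
          unfolding h(5,6) P True one sc by (simp_all add: US nz)
        then show ?thesis using mc v by blast
      next
        case False
        then have "Q = mat 1" using h(4) by simp
        then have "hU \<omega> ** A = c *\<^sub>R (mat 1 ** (hV \<omega> 1 ** hS))" "hU (3 * \<omega>) ** B = c *\<^sub>R (mat 1 ** (hV (3 * \<omega>) 1 ** hS))"
          unfolding h(5,6) P one sc using e[OF nz(1)] e[OF nz(2)] by simp_all
        then show ?thesis using h(1) v by blast
      qed
    next
      case (step M0 M0' k)
      have UA: "hU \<omega> ** A = c *\<^sub>R ((hV \<omega> (Suc k) ** M0) ** Q)" "hU (3 * \<omega>) ** B = c *\<^sub>R ((hV (3 * \<omega>) (Suc k) ** M0') ** Q)"
        unfolding h(5,6) P step(1,2) sc by (simp_all add: matrix_mul_assoc hU_hV nz)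
      show ?thesis
      proof (cases "Suc k < n")
        case True
        have "vmon (hV \<omega> (Suc k) ** M0) (hV (3 * \<omega>) (Suc k) ** M0')" by (rule vmon.step[OF step(3)]) (use True in auto)
        moreover have "hU \<omega> ** A = c *\<^sub>R (mat 1 ** ((hV \<omega> (Suc k) ** M0) ** Q))" "hU (3 * \<omega>) ** B = c *\<^sub>R (mat 1 ** ((hV (3 * \<omega>) (Suc k) ** M0') ** Q))"
          using UA by simp_all
        ultimately show ?thesis using h(1,4) by blast
      next
        case False
        then have "Suc k = n" using step by simp
        then have "hU \<omega> ** A = c *\<^sub>R (hS ** (M0 ** Q))" "hU (3 * \<omega>) ** B = c *\<^sub>R (hS ** (M0' ** Q))"
          using UA hV_n_omega by (simp_all add: matrix_mul_assoc)
        then show ?thesis using h(1,4) step(3) by blast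
      qed
    qed
  qed
qed

text \<open>S is orthogonal, so the outer factors and the sign leave norms alone and the entrywise
  comparison decides.\<close>

lemma words_norm_le:
  assumes "words A B"
  shows "norm B \<le> norm A"
proof -
  obtain c M M' P Q where h: "c = 1 \<or> c = - 1" "vmon M M'" "P = mat 1 \<or> P = hS" "Q = mat 1 \<or> Q = hS"
    "A = c *\<^sub>R (P ** (M ** Q))" "B = c *\<^sub>R (P ** (M' ** Q))" using words_normal_form[OF assms] by blast
  have S1: "norm (hS ** X) = norm X" and S2: "norm (X ** hS) = norm X" for X :: "real^2^2"
    by (rule power2_eq_imp_eq; simp add: norm_matrix_2 inner_2 matrix_2_mult hS_def)+
  have "norm A = norm M" "norm B = norm M'" using h S1 S2 by auto
  moreover have "norm M' \<le> norm M"
  proof (rule power2_le_imp_le)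
    have "(M' $ i $ j)\<^sup>2 \<le> (M $ i $ j)\<^sup>2" for i j using vmon_dominated[OF h(2), of i j] by (intro abs_le_square_iff[THEN iffD1]) auto
    then show "(norm M')\<^sup>2 \<le> (norm M)\<^sup>2"
      unfolding norm_matrix_2 inner_2 power2_eq_square[symmetric] by (intro add_mono) auto
  qed simp
  ultimately show ?thesis by simp
qed

lemma words_det: "words A B \<Longrightarrow> det A = 1 \<and> det B = 1"
  by (induction rule: words.induct) (auto simp: det_mul det_hecke)


lemma words_uminus: "words A B \<Longrightarrow> words (- A) (- B)"
  using words.S[OF words.S, of A B] by (simp add: matrix_mul_assoc hS_hS matrix_mult_minus)

lemma words_hV: "words (hV \<omega> k) (hV (3 * \<omega>) k)"
proof (induction k)
  case 0
  show ?case using words_uminus[OF words.S[OF words.one]] sin_pos hV_0[of \<omega>] hV_0[of "3 * \<omega>"] by simp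
next
  case (Suc k)
  then show ?case using words.U[OF Suc] sin_pos hU_hV[of \<omega> k] hU_hV[of "3 * \<omega>" k] by simp
qed

lemma vmon_words: "vmon M M' \<Longrightarrow> words M M'"
  by (induction rule: vmon.induct) (auto intro: words.one words_mult words_hV)

text \<open>One step of a continued fraction expansion: the images of the closed quadrant under
  \<open>hV \<omega> k\<close>, 0 < k < n, cover the quadrant. The least k \<ge> 1 with D k \<ge> 0
  makes the first coordinate of the preimage nonnegative, and D (k - 1) \<le> 0 does the same for
  the second.\<close>

lemma cone_step:
  fixes y :: "real^2"
  assumes y: "y$1 \<ge> 0" "y$2 \<ge> 0"
  obtains k where "1 \<le> k" "k < n" "(adj2 (hV \<omega> k) *v y)$1 \<ge> 0" "(adj2 (hV \<omega> k) *v y)$2 \<ge> 0"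
proof -
  define D where "D = (\<lambda>k. sin (real k * \<omega>) * y$1 - sin ((real k + 1) * \<omega>) * y$2)"
  have last: "D (n - 1) \<ge> 0"
  proof -
    have "(real (n - 1) + 1) * \<omega> = pi" using n omega(3) by simp
    moreover have "sin (real (n - 1) * \<omega>) \<ge> 0"
      using omega mult_right_mono[of "real (n - 1)" "real n" \<omega>] by (intro sin_ge_zero) auto
    ultimately show ?thesis using y by (simp only: D_def) simp
  qed
  define k where "k = (LEAST k. 1 \<le> k \<and> D k \<ge> 0)"
  have ex: "1 \<le> n - 1 \<and> D (n - 1) \<ge> 0" using last n by auto
  have k: "1 \<le> k \<and> D k \<ge> 0" unfolding k_def by (rule LeastI[of "\<lambda>k. 1 \<le> k \<and> D k \<ge> 0", OF ex])
  have "k \<le> n - 1" unfolding k_def by (rule Least_le[of "\<lambda>k. 1 \<le> k \<and> D k \<ge> 0", OF ex])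
  then have kn: "k < n" using n by linarith
  have "D (k - 1) \<le> 0"
  proof (cases "k = 1")
    case True
    then show ?thesis using y sin_pos by (simp add: D_def)
  next
    case False
    have "k - 1 < k" using k by simp
    then have "\<not> (1 \<le> k - 1 \<and> D (k - 1) \<ge> 0)"
      by (rule not_less_Least[of "k - 1" "\<lambda>k. 1 \<le> k \<and> D k \<ge> 0", folded k_def])
    then show ?thesis using k False by auto
  qed
  moreover have "real (k - 1) = real k - 1" using k by auto
  ultimately have D1: "sin ((real k - 1) * \<omega>) * y$1 - sin (real k * \<omega>) * y$2 \<le> 0" by (simp add: D_def)
  have "(adj2 (hV \<omega> k) *v y)$1 = D k / sin \<omega>"
    by (simp add: adj2_def matrix_2_vector hV_sel D_def diff_divide_distrib)
  moreover have "(adj2 (hV \<omega> k) *v y)$2 = - (sin ((real k - 1) * \<omega>) * y$1 - sin (real k * \<omega>) * y$2) / sin \<omega>"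
    by (simp add: adj2_def matrix_2_vector hV_sel diff_divide_distrib)
  ultimately show ?thesis using that[of k] k kn D1 sin_pos(1) by (simp add: divide_nonpos_pos)
qed

text \<open>The squared product of the column lengths. For determinant 1 it is the inverse square of
  the sine of the angle between the columns, so it measures how narrow the image of the quadrant has
  become.\<close>

definition col_prod :: "real^2^2 \<Rightarrow> real" where
  "col_prod M = ((M$1$1)\<^sup>2 + (M$2$1)\<^sup>2) * ((M$1$2)\<^sup>2 + (M$2$2)\<^sup>2)"

text \<open>Multiplication by \<open>hV \<omega> k\<close> adds to one column at least a copy of the
  other. The columns have length at least 1 and nonnegative inner product, so nothing cancels and
  the product grows by at least 1.\<close>

lemma col_prod_step:
  assumes M: "vmon M M'" and k: "1 \<le> k" "k < n"
  shows "col_prod (M ** hV \<omega> k) \<ge> col_prod M + 1"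
proof -
  define V where "V = hV \<omega> k"
  have V: "V$1$1 \<ge> 1" "V$2$2 \<ge> 1" "V$1$2 \<ge> 1 \<or> V$2$1 \<ge> 1" "V$1$2 \<ge> 0" "V$2$1 \<ge> 0"
    using hV_dominated(3,4,5)[OF k] hV_dominated(2)[OF k, of 1 2] hV_dominated(2)[OF k, of 2 1] by (auto simp: V_def)
  have m: "M$i$j \<ge> 0" "M$i$j = 0 \<or> M$i$j \<ge> 1" for i j using vmon_dominated[OF M, of i j] by auto
  have det: "M$1$1 * M$2$2 - M$1$2 * M$2$1 = 1" using vmon_det[OF M] by (simp add: det_2)
  define P where "P = (M$1$1)\<^sup>2 + (M$2$1)\<^sup>2"
  define Q where "Q = (M$1$2)\<^sup>2 + (M$2$2)\<^sup>2"
  define R where "R = M$1$1 * M$1$2 + M$2$1 * M$2$2"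
  have ge1: "x \<ge> 1 \<Longrightarrow> x\<^sup>2 \<ge> (1::real)" for x by (simp add: one_le_power)
  have P: "P \<ge> 1"
  proof (cases "M$1$1 \<ge> 1")
    case True
    then show ?thesis using ge1[OF True] by (simp add: P_def add_increasing2)
  next
    case False
    then have "M$1$1 = 0" using m(2)[of 1 1] by auto
    then have "M$2$1 \<ge> 1" using det m(2)[of 2 1] by auto
    then show ?thesis using ge1 by (simp add: P_def add_increasing)
  qed
  have Q: "Q \<ge> 1"
  proof (cases "M$2$2 \<ge> 1")
    case True
    then show ?thesis using ge1[OF True] by (simp add: Q_def add_increasing)
  next
    case False
    then have "M$2$2 = 0" using m(2)[of 2 2] by auto
    then have "M$1$2 \<ge> 1" using det m(2)[of 1 2] by auto
    then show ?thesis using ge1 by (simp add: Q_def add_increasing2)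
  qed
  have R: "R \<ge> 0" using m(1) by (simp add: R_def)
  have V2: "(V$1$1)\<^sup>2 \<ge> 1" "(V$2$2)\<^sup>2 \<ge> 1" using V ge1 by auto
  have c1: "(M ** V)$1$1 ^ 2 + (M ** V)$2$1 ^ 2 = (V$1$1)\<^sup>2 * P + (V$2$1)\<^sup>2 * Q + 2 * (V$1$1 * V$2$1 * R)"
    by (simp add: matrix_2_mult P_def Q_def R_def power2_eq_square algebra_simps)
  have c2: "(M ** V)$1$2 ^ 2 + (M ** V)$2$2 ^ 2 = (V$1$2)\<^sup>2 * P + (V$2$2)\<^sup>2 * Q + 2 * (V$1$2 * V$2$2 * R)"
    by (simp add: matrix_2_mult P_def Q_def R_def power2_eq_square algebra_simps)
  have l1: "P + (V$2$1)\<^sup>2 * Q \<le> (V$1$1)\<^sup>2 * P + (V$2$1)\<^sup>2 * Q + 2 * (V$1$1 * V$2$1 * R)"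
  proof -
    have "1 * P \<le> (V$1$1)\<^sup>2 * P" using V2 P by (intro mult_right_mono) auto
    moreover have "V$1$1 * V$2$1 * R \<ge> 0" using V R by auto
    ultimately show ?thesis by linarith
  qed
  have l2: "(V$1$2)\<^sup>2 * P + Q \<le> (V$1$2)\<^sup>2 * P + (V$2$2)\<^sup>2 * Q + 2 * (V$1$2 * V$2$2 * R)"
  proof -
    have "1 * Q \<le> (V$2$2)\<^sup>2 * Q" using V2 Q by (intro mult_right_mono) auto
    moreover have "V$1$2 * V$2$2 * R \<ge> 0" using V R by auto
    ultimately show ?thesis by linarith
  qed
  have "P * Q + 1 \<le> (P + (V$2$1)\<^sup>2 * Q) * ((V$1$2)\<^sup>2 * P + Q)"
    using V(3)
  proof
    assume "V$1$2 \<ge> 1"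
    then have "1 * P \<le> (V$1$2)\<^sup>2 * P" using ge1 P by (intro mult_right_mono) auto
    then have "P * (P + Q) \<le> (P + (V$2$1)\<^sup>2 * Q) * ((V$1$2)\<^sup>2 * P + Q)" using P Q by (intro mult_mono) auto
    moreover have "P * (P + Q) \<ge> P * Q + 1" using mult_mono[of 1 P 1 P] P by (simp add: distrib_left)
    ultimately show ?thesis by linarith
  next
    assume "V$2$1 \<ge> 1"
    then have "1 * Q \<le> (V$2$1)\<^sup>2 * Q" using ge1 Q by (intro mult_right_mono) auto
    then have "(P + Q) * Q \<le> (P + (V$2$1)\<^sup>2 * Q) * ((V$1$2)\<^sup>2 * P + Q)" using P Q by (intro mult_mono) auto
    moreover have "(P + Q) * Q \<ge> P * Q + 1" using mult_mono[of 1 Q 1 Q] Q by (simp add: distrib_right)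
    ultimately show ?thesis by linarith
  qed
  also have "\<dots> \<le> ((V$1$1)\<^sup>2 * P + (V$2$1)\<^sup>2 * Q + 2 * (V$1$1 * V$2$1 * R)) * ((V$1$2)\<^sup>2 * P + (V$2$2)\<^sup>2 * Q + 2 * (V$1$2 * V$2$2 * R))"
  proof (rule mult_mono[OF l1 l2])
    have "(V$2$1)\<^sup>2 * Q \<ge> 0" "(V$1$2)\<^sup>2 * P \<ge> 0" using P Q by auto
    then show "0 \<le> (V$1$1)\<^sup>2 * P + (V$2$1)\<^sup>2 * Q + 2 * (V$1$1 * V$2$1 * R)" "0 \<le> (V$1$2)\<^sup>2 * P + Q" using l1 P Q by linarith+
  qed
  finally show ?thesis unfolding V_def[symmetric] col_prod_def c1 c2 by (simp add: P_def Q_def)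
qed

lemma cone_expansion:
  fixes y :: "real^2"
  assumes y: "y$1 \<ge> 0" "y$2 \<ge> 0"
  shows "\<exists>M M' z. vmon M M' \<and> col_prod M \<ge> real N \<and> z$1 \<ge> 0 \<and> z$2 \<ge> 0 \<and> y = M *v z"
proof (induction N)
  case 0
  show ?case
    by (intro exI[of _ "mat 1"] exI[of _ y]) (use y in \<open>auto simp: col_prod_def intro: vmon.one\<close>)
next
  case (Suc N)
  then obtain M M' z where h: "vmon M M'" "col_prod M \<ge> real N" "z$1 \<ge> 0" "z$2 \<ge> 0" "y = M *v z" by blast
  obtain k where k: "1 \<le> k" "k < n" "(adj2 (hV \<omega> k) *v z)$1 \<ge> 0" "(adj2 (hV \<omega> k) *v z)$2 \<ge> 0"
    using cone_step[OF h(3,4)] by blast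
  have "det (hV \<omega> k) = 1" using det_hV sin_pos by simp
  then have "(M ** hV \<omega> k) *v (adj2 (hV \<omega> k) *v z) = y"
    unfolding h(5) matrix_vector_mul_assoc matrix_mul_assoc[symmetric] by (simp add: mult_adj2)
  then show ?case
    using vmon_right[OF h(1) k(1,2)] col_prod_step[OF h(1) k(1,2)] h(2) k(3,4)
    by (intro exI[of _ "M ** hV \<omega> k"] exI[of _ "M' ** hV (3 * \<omega>) k"] exI[of _ "adj2 (hV \<omega> k) *v z"]) auto
qed

end

text \<open>With v read as a complex number, \<open>line_dir v\<close> is v divided by its
  conjugate. The chord between doubled angles is twice the sine of the angle between the
  lines.\<close>

lemma norm_line_dir_diff:
  assumes "v \<noteq> 0" "w \<noteq> 0"
  shows "norm (line_dir v - line_dir w) = 2 * \<bar>v$1 * w$2 - v$2 * w$1\<bar> / (norm v * norm w)"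
proof -
  have ld: "line_dir x = Complex (x$1) (x$2) / cnj (Complex (x$1) (x$2))" and nx: "cmod (Complex (x$1) (x$2)) = norm x" if "x \<noteq> 0" for x :: "real^2"
  proof -
    have p: "(x$1)\<^sup>2 + (x$2)\<^sup>2 \<noteq> 0" by (rule less_imp_neq[OF square_sum_pos_2[OF that], symmetric])
    have a0: "Complex (x$1) (x$2) \<noteq> 0" using p by (auto simp: complex_eq_iff)
    have "cnj (Complex (x$1) (x$2)) * Complex (x$1) (x$2) = of_real ((x$1)\<^sup>2 + (x$2)\<^sup>2)"
      "Complex (x$1) (x$2) * Complex (x$1) (x$2) = Complex ((x$1)\<^sup>2 - (x$2)\<^sup>2) (2 * x$1 * x$2)"
      by (simp_all add: complex_eq_iff power2_eq_square)
    then have "line_dir x = (Complex (x$1) (x$2) * Complex (x$1) (x$2)) / (cnj (Complex (x$1) (x$2)) * Complex (x$1) (x$2))"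
      by (simp only: line_dir_def)
    then show "line_dir x = Complex (x$1) (x$2) / cnj (Complex (x$1) (x$2))" using a0 by simp
    show "cmod (Complex (x$1) (x$2)) = norm x"
      by (rule power2_eq_imp_eq) (simp_all add: cmod_power2 power2_norm_eq_inner inner_2 power2_eq_square[symmetric])
  qed
  define a where "a = Complex (v$1) (v$2)"
  define b where "b = Complex (w$1) (w$2)"
  have ab: "a \<noteq> 0" "b \<noteq> 0" using nx assms unfolding a_def b_def by (metis norm_eq_zero)+
  have "line_dir v - line_dir w = (a * cnj b - b * cnj a) / (cnj a * cnj b)"
    unfolding ld[OF assms(1)] ld[OF assms(2)] a_def[symmetric] b_def[symmetric] using ab by (simp add: field_simps)
  also have "a * cnj b - b * cnj a = of_real (2 * (v$2 * w$1 - v$1 * w$2)) * \<i>"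
    by (simp add: a_def b_def complex_eq_iff)
  finally have "norm (line_dir v - line_dir w) = 2 * \<bar>v$2 * w$1 - v$1 * w$2\<bar> / (cmod a * cmod b)"
    by (simp only: norm_divide norm_mult norm_of_real complex_mod_cnj norm_ii mult_1_right abs_mult abs_numeral)
  then show ?thesis using nx assms by (simp add: a_def b_def abs_minus_commute)
qed

text \<open>A quarter turn becomes a half turn when angles are doubled.\<close>

lemma line_dir_hS:
  "line_dir (hS *v v) = - line_dir v"
proof -
  have s: "(hS *v v)$1 = - v$2" "(hS *v v)$2 = v$1" by (simp_all add: matrix_2_vector hS_def)
  have "Complex ((- v$2)\<^sup>2 - (v$1)\<^sup>2) (2 * - v$2 * v$1) = - Complex ((v$1)\<^sup>2 - (v$2)\<^sup>2) (2 * v$1 * v$2)"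
    "(- v$2)\<^sup>2 + (v$1)\<^sup>2 = (v$1)\<^sup>2 + (v$2)\<^sup>2" by (simp_all add: complex_eq_iff)
  then show ?thesis unfolding line_dir_def s by (simp only: minus_divide_left)
qed

context hecke
begin

text \<open>y lies between the columns c1, c2 of M, whose cross product is 1, so both are within 2 /
  (|c1| |c2|) of it in direction. Both columns are recorded because of the possible index 2: W S
  sends the first basis vector to the second column of W.\<close>

lemma cone_direction_dense:
  fixes y :: "real^2"
  assumes y: "y$1 \<ge> 0" "y$2 \<ge> 0" "y \<noteq> 0" and \<epsilon>: "\<epsilon> > 0"
  obtains A B where "words A B" "norm (line_dir (A *v vector [1, 0]) - line_dir y) < \<epsilon>"
    "norm (line_dir (A *v vector [0, 1]) - line_dir y) < \<epsilon>"
proof -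
  obtain N :: nat where N: "real N > (2 / \<epsilon>)\<^sup>2" using reals_Archimedean2 by blast
  obtain M M' z where h: "vmon M M'" "col_prod M \<ge> real N" "z$1 \<ge> 0" "z$2 \<ge> 0" "y = M *v z"
    using cone_expansion[OF y(1,2), of N] by blast
  have m: "M$i$j \<ge> 0" for i j using vmon_dominated[OF h(1), of i j] by auto
  have det: "M$1$1 * M$2$2 - M$1$2 * M$2$1 = 1" using vmon_det[OF h(1)] by (simp add: det_2)
  define c1 where "c1 = M *v vector [1, 0]"
  define c2 where "c2 = M *v vector [0, 1]"
  have c: "c1$1 = M$1$1" "c1$2 = M$2$1" "c2$1 = M$1$2" "c2$2 = M$2$2"
    by (simp_all add: c1_def c2_def matrix_2_vector)
  have nz: "c1 \<noteq> 0" "c2 \<noteq> 0" using det c by (auto simp: vector_2_eq_iff)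
  have yc: "y = z$1 *\<^sub>R c1 + z$2 *\<^sub>R c2" by (simp add: h(5) vector_2_eq_iff matrix_2_vector c algebra_simps)
  have cp: "col_prod M = (norm c1 * norm c2)\<^sup>2"
    by (simp add: col_prod_def power_mult_distrib power2_norm_eq_inner inner_2 c power2_eq_square[symmetric])
  have "(2 / \<epsilon>)\<^sup>2 < (norm c1 * norm c2)\<^sup>2" using N h(2) cp by linarith
  then have "2 / \<epsilon> < norm c1 * norm c2" by (rule power2_less_imp_less) simp
  then have small: "2 / (norm c1 * norm c2) < \<epsilon>" using \<epsilon> nz by (simp add: field_simps)
  have cross: "c1 \<bullet> c2 \<ge> 0" using m by (simp add: inner_2 c)
  \<comment> \<open>The columns have nonnegative inner product, so neither summand of y is longer
    than y.\<close>
  have ny: "z$1 * norm c1 \<le> norm y" "z$2 * norm c2 \<le> norm y"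
  proof -
    have e: "(norm y)\<^sup>2 = (z$1 * norm c1)\<^sup>2 + (z$2 * norm c2)\<^sup>2 + 2 * (z$1 * z$2 * (c1 \<bullet> c2))"
      unfolding yc power2_norm_eq_inner power_mult_distrib
      by (simp add: inner_add_left inner_add_right inner_commute power2_eq_square algebra_simps)
    have "z$1 * z$2 * (c1 \<bullet> c2) \<ge> 0" using h cross by simp
    then have "(z$1 * norm c1)\<^sup>2 \<le> (norm y)\<^sup>2" "(z$2 * norm c2)\<^sup>2 \<le> (norm y)\<^sup>2"
      unfolding e using zero_le_power2[of "z$1 * norm c1"] zero_le_power2[of "z$2 * norm c2"] by linarith+
    then show "z$1 * norm c1 \<le> norm y" "z$2 * norm c2 \<le> norm y" by (auto intro: power2_le_imp_le)
  qed
  have n0: "norm c1 > 0" "norm c2 > 0" "norm y > 0" using nz y by auto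
  have "norm (line_dir c1 - line_dir y) \<le> 2 / (norm c1 * norm c2)"
  proof -
    have "c1$1 * y$2 - c1$2 * y$1 = z$2 * (M$1$1 * M$2$2 - M$1$2 * M$2$1)" by (simp add: yc c algebra_simps)
    then have "norm (line_dir c1 - line_dir y) = 2 * z$2 / (norm c1 * norm y)"
      using h(4) unfolding norm_line_dir_diff[OF nz(1) y(3)] det by simp
    moreover have "z$2 * norm c2 / norm y \<le> 1" using ny(2) n0 by simp
    then have "2 / (norm c1 * norm c2) * (z$2 * norm c2 / norm y) \<le> 2 / (norm c1 * norm c2) * 1"
      by (intro mult_left_mono) auto
    moreover have "2 * z$2 / (norm c1 * norm y) = 2 / (norm c1 * norm c2) * (z$2 * norm c2 / norm y)"
      using n0 by simp
    ultimately show ?thesis by simp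
  qed
  moreover have "norm (line_dir c2 - line_dir y) \<le> 2 / (norm c1 * norm c2)"
  proof -
    have "c2$1 * y$2 - c2$2 * y$1 = - z$1 * (M$1$1 * M$2$2 - M$1$2 * M$2$1)" by (simp add: yc c algebra_simps)
    then have "norm (line_dir c2 - line_dir y) = 2 * z$1 / (norm c2 * norm y)"
      using h(3) unfolding norm_line_dir_diff[OF nz(2) y(3)] det by simp
    moreover have "z$1 * norm c1 / norm y \<le> 1" using ny(1) n0 by simp
    then have "2 / (norm c1 * norm c2) * (z$1 * norm c1 / norm y) \<le> 2 / (norm c1 * norm c2) * 1"
      by (intro mult_left_mono) auto
    moreover have "2 * z$1 / (norm c2 * norm y) = 2 / (norm c1 * norm c2) * (z$1 * norm c1 / norm y)"
      using n0 by simp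
    ultimately show ?thesis by simp
  qed
  ultimately show ?thesis using that[OF vmon_words[OF h(1)]] small by (simp add: c1_def c2_def)
qed

text \<open>S and a change of sign bring every line into the first quadrant.\<close>

lemma words_dense:
  assumes u: "norm u = 1" and \<epsilon>: "\<epsilon> > 0"
  obtains A B where "words A B" "norm (line_dir (A *v vector [1, 0]) - u) < \<epsilon>"
    "norm (line_dir (A *v vector [0, 1]) - u) < \<epsilon>"
proof -
  obtain y where y: "y \<noteq> 0" "line_dir y = u" using line_dir_surj[OF u] .
  have neg: "line_dir (- y) = u" using line_dir_scaleR[of "- 1" y] y by simp
  consider "y$1 \<ge> 0 \<and> y$2 \<ge> 0" | "y$1 \<le> 0 \<and> y$2 \<le> 0" | "y$1 \<ge> 0 \<and> y$2 \<le> 0" | "y$1 \<le> 0 \<and> y$2 \<ge> 0" by linarith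
  then show ?thesis
  proof cases
    case 1
    then show ?thesis using cone_direction_dense[of y] y \<epsilon> that by metis
  next
    case 2
    then show ?thesis using cone_direction_dense[of "- y"] y neg \<epsilon> that
      by (metis neg_0_le_iff_le neg_equal_0_iff_equal vector_uminus_component)
  next
    case 3
    define w where "w = hS *v y"
    have w: "w$1 \<ge> 0" "w$2 \<ge> 0" "w \<noteq> 0" "line_dir w = - u"
      using 3 y line_dir_hS[of y] by (auto simp: w_def matrix_2_vector hS_def vector_2_eq_iff)
    obtain A B where AB: "words A B" "norm (line_dir (A *v vector [1, 0]) - line_dir w) < \<epsilon>" "norm (line_dir (A *v vector [0, 1]) - line_dir w) < \<epsilon>"
      using cone_direction_dense[OF w(1,2,3) \<epsilon>] by blast
    show ?thesis
      by (rule that[OF words.S[OF AB(1)]])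
        (use AB(2,3) w(4) in \<open>simp_all add: matrix_vector_mul_assoc[symmetric] line_dir_hS norm_minus_commute add.commute\<close>)
  next
    case 4
    define w where "w = hS *v (- y)"
    have w: "w$1 \<ge> 0" "w$2 \<ge> 0" "w \<noteq> 0" "line_dir w = - u"
      using 4 y neg line_dir_hS[of "- y"] by (auto simp: w_def matrix_2_vector hS_def vector_2_eq_iff)
    obtain A B where AB: "words A B" "norm (line_dir (A *v vector [1, 0]) - line_dir w) < \<epsilon>" "norm (line_dir (A *v vector [0, 1]) - line_dir w) < \<epsilon>"
      using cone_direction_dense[OF w(1,2,3) \<epsilon>] by blast
    show ?thesis
      by (rule that[OF words.S[OF AB(1)]])
        (use AB(2,3) w(4) in \<open>simp_all add: matrix_vector_mul_assoc[symmetric] line_dir_hS norm_minus_commute add.commute\<close>)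
  qed
qed

end

section \<open>Conjugated Hecke groups\<close>

lemma scaleR_matrix_2: "(c *\<^sub>R A) ** B = c *\<^sub>R (A ** B)" "A ** (c *\<^sub>R B) = c *\<^sub>R (A ** B)" for A B :: "real^2^2"
  by (simp_all add: matrix_2_eq_iff matrix_2_mult algebra_simps)

text \<open>Conjugation in GL(2,R): the change of basis that will be built from the fixed vector of
  a parabolic may have any nonzero determinant.\<close>

definition conj2 :: "real^2^2 \<Rightarrow> real^2^2 \<Rightarrow> real^2^2" where
  "conj2 P A = P ** A ** matrix_inv P"

lemma matrix_inv_2:
  assumes "det (P :: real^2^2) \<noteq> 0"
  shows "P ** matrix_inv P = mat 1" "matrix_inv P ** P = mat 1"
proof -
  have "P ** ((1 / det P) *\<^sub>R adj2 P) = mat 1 \<and> ((1 / det P) *\<^sub>R adj2 P) ** P = mat 1"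
    using assms by (simp add: adj2_def matrix_2_eq_iff matrix_2_mult det_2 diff_divide_distrib[symmetric] mult.commute)
  then have "P ** matrix_inv P = mat 1 \<and> matrix_inv P ** P = mat 1"
    unfolding matrix_inv_def by (rule someI)
  then show "P ** matrix_inv P = mat 1" "matrix_inv P ** P = mat 1" by auto
qed

lemma conj2_mult:
  assumes "det P \<noteq> 0"
  shows "conj2 P A ** conj2 P B = conj2 P (A ** B)"
proof -
  have "conj2 P A ** conj2 P B = P ** A ** (matrix_inv P ** P) ** B ** matrix_inv P"
    by (simp only: conj2_def matrix_mul_assoc)
  then show ?thesis using matrix_inv_2[OF assms] by (simp add: conj2_def matrix_mul_assoc)
qed

lemma conj2_one: "det P \<noteq> 0 \<Longrightarrow> conj2 P (mat 1) = mat 1"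
  by (simp add: conj2_def matrix_inv_2)

lemma conj2_uminus: "conj2 P (- A) = - conj2 P A"
  by (simp add: conj2_def matrix_mult_minus)

lemma conj2_add: "conj2 P (A + B) = conj2 P A + conj2 P B"
  by (simp add: conj2_def matrix_2_eq_iff matrix_2_mult algebra_simps)

lemma det_conj2:
  assumes "det P \<noteq> 0"
  shows "det (conj2 P A) = det A"
proof -
  have "det P * det (matrix_inv P) = 1" using matrix_inv_2(1)[OF assms] det_mul[of P "matrix_inv P"] by simp
  then show ?thesis by (simp add: conj2_def det_mul mult.commute mult.left_commute)
qed

lemma trace_conj2:
  assumes "det P \<noteq> 0"
  shows "trace (conj2 P A) = trace A"
proof -
  have t: "trace (X ** Y) = trace (Y ** X)" for X Y :: "real^2^2" by (simp add: trace_2 matrix_2_mult algebra_simps)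
  have "trace (conj2 P A) = trace (matrix_inv P ** P ** A)"
    unfolding conj2_def by (subst t) (simp only: matrix_mul_assoc)
  then show ?thesis using matrix_inv_2[OF assms] by simp
qed

lemma adj2_conj2:
  assumes "det P \<noteq> 0"
  shows "adj2 (conj2 P A) = conj2 P (adj2 A)"
proof -
  have "adj2 A = trace A *\<^sub>R mat 1 - A" for A :: "real^2^2" by (simp add: adj2_def matrix_2_eq_iff trace_2)
  then have a: "adj2 A + A = trace A *\<^sub>R mat 1" for A :: "real^2^2" by simp
  have "conj2 P (adj2 A) + conj2 P A = trace A *\<^sub>R mat 1"
    unfolding conj2_add[symmetric] a using matrix_inv_2[OF assms]
    by (simp add: conj2_def scaleR_matrix_2)
  moreover have "adj2 (conj2 P A) + conj2 P A = trace A *\<^sub>R mat 1" unfolding a trace_conj2[OF assms] ..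
  ultimately show ?thesis by (metis add_right_cancel)
qed

lemma norm_conj2_le: "norm (conj2 P A) \<le> norm P * norm A * norm (matrix_inv P)" for A :: "real^2^2"
  unfolding conj2_def
  by (rule order_trans[OF norm_matrix_mult_le]) (intro mult_right_mono norm_matrix_mult_le norm_ge_zero)

lemma norm_le_conj2:
  assumes "det P \<noteq> 0"
  shows "norm A \<le> norm (matrix_inv P) * norm (conj2 P A) * norm P"
proof -
  have "matrix_inv P ** conj2 P A ** P = (matrix_inv P ** P) ** A ** (matrix_inv P ** P)"
    by (simp only: conj2_def matrix_mul_assoc)
  then have "A = matrix_inv P ** conj2 P A ** P" using matrix_inv_2[OF assms] by simp
  moreover have "norm (matrix_inv P ** conj2 P A ** P) \<le> norm (matrix_inv P) * norm (conj2 P A) * norm P"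
    by (rule order_trans[OF norm_matrix_mult_le]) (intro mult_right_mono norm_matrix_mult_le norm_ge_zero)
  ultimately show ?thesis by simp
qed

text \<open>P multiplies cross products by det P, and it shortens a vector at most by the norm of
  its inverse.\<close>

lemma line_dir_lipschitz:
  assumes P: "det P \<noteq> 0" and v: "v \<noteq> 0" and w: "w \<noteq> 0"
  shows "norm (line_dir (P *v v) - line_dir (P *v w)) \<le> \<bar>det P\<bar> * (norm (matrix_inv P))\<^sup>2 * norm (line_dir v - line_dir w)"
proof -
  let ?I = "matrix_inv P"
  have inv: "?I *v (P *v x) = x" for x using matrix_inv_2[OF P] by (simp add: matrix_vector_mul_assoc)
  have nx: "P *v x \<noteq> 0 \<and> norm x \<le> norm ?I * norm (P *v x)" if "x \<noteq> 0" for x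
    using inv[of x] norm_matrix_vector_le[of ?I "P *v x"] that by auto
  have Pv: "P *v v \<noteq> 0" "norm v \<le> norm ?I * norm (P *v v)" and Pw: "P *v w \<noteq> 0" "norm w \<le> norm ?I * norm (P *v w)"
    using nx v w by auto
  define c where "c = \<bar>v$1 * w$2 - v$2 * w$1\<bar>"
  have "(P *v v)$1 * (P *v w)$2 - (P *v v)$2 * (P *v w)$1 = det P * (v$1 * w$2 - v$2 * w$1)"
    by (simp add: matrix_2_vector det_2 algebra_simps)
  then have l: "norm (line_dir (P *v v) - line_dir (P *v w)) = 2 * (\<bar>det P\<bar> * c) / (norm (P *v v) * norm (P *v w))"
    unfolding norm_line_dir_diff[OF Pv(1) Pw(1)] c_def by (simp add: abs_mult)
  have "norm v * norm w \<le> (norm ?I * norm (P *v v)) * (norm ?I * norm (P *v w))"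
    by (intro mult_mono Pv Pw) auto
  then have m: "norm v * norm w \<le> (norm ?I)\<^sup>2 * (norm (P *v v) * norm (P *v w))" by (simp add: power2_eq_square mult_ac)
  have n0: "norm v * norm w > 0" "norm (P *v v) * norm (P *v w) > 0" using v w Pv Pw by auto
  have "1 / (norm (P *v v) * norm (P *v w)) \<le> (norm ?I)\<^sup>2 / (norm v * norm w)"
    using m n0 by (simp add: divide_le_eq le_divide_eq mult.commute)
  then have "2 * (\<bar>det P\<bar> * c) * (1 / (norm (P *v v) * norm (P *v w))) \<le> 2 * (\<bar>det P\<bar> * c) * ((norm ?I)\<^sup>2 / (norm v * norm w))"
    by (rule mult_left_mono) (simp add: c_def)
  then show ?thesis unfolding l norm_line_dir_diff[OF v w] c_def[symmetric] by (simp add: mult_ac)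
qed

context hecke
begin

text \<open>Transport of the Hecke data to arbitrary conjugates. \<open>coset\<close> expresses
  index at most 2, which still gives density. Infinite order in the second component is forced by
  \<open>faithful\<close>: a power that is trivial there would have a first component equal to the
  identity up to sign, impossible for a hyperbolic element.\<close>

lemma pair_group_of_conjugate:
  assumes P: "det P \<noteq> 0" "det P' \<noteq> 0" and cos: "cos \<omega> \<noteq> 0" "cos (3 * \<omega>) \<noteq> 0"
    and G: "\<And>A B. (A, B) \<in> G \<Longrightarrow> \<exists>W W'. words W W' \<and> (A = conj2 P W \<or> A = - conj2 P W) \<and> (B = conj2 P' W' \<or> B = - conj2 P' W')"
    and one: "(mat 1, mat 1) \<in> G" and mult: "\<And>A B A' B'. (A, B) \<in> G \<Longrightarrow> (A', B') \<in> G \<Longrightarrow> (A ** A', B ** B') \<in> G"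
    and T: "(conj2 P (hT \<omega>), conj2 P' (hT (3 * \<omega>))) \<in> G"
    and coset: "\<And>W W'. words W W' \<Longrightarrow> (conj2 P W, conj2 P' W') \<in> G \<or> (conj2 P (W ** hS), conj2 P' (W' ** hS)) \<in> G"
    and h: "(conj2 P H, conj2 P' H') \<in> G" "trace H > 2" "\<bar>trace H'\<bar> < 2" "H$2$1 \<noteq> 0"
    and faithful: "\<And>A. (A, mat 1) \<in> G \<Longrightarrow> A = mat 1 \<or> A = - mat 1"
  shows "\<exists>e1 e2 f1 f2 h1 h2 Cd. pair_group G e1 e2 f1 f2 h1 h2 Cd"
proof -
  define e1 where "e1 = P *v vector [1, 0]"
  define e2 where "e2 = P' *v vector [1, 0]"
  define f1 where "f1 = (2 * cos \<omega>) *\<^sub>R (vector [0, 1] v* matrix_inv P)"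
  define f2 where "f2 = (2 * cos (3 * \<omega>)) *\<^sub>R (vector [0, 1] v* matrix_inv P')"
  define Cd where "Cd = norm P' * norm (matrix_inv P') * norm (matrix_inv P) * norm P + 1"
  have inv: "matrix_inv Q *v (Q *v x) = x" "(x v* matrix_inv Q) v* Q = x" "Q *v (matrix_inv Q *v x) = x"
    if "det Q \<noteq> 0" for Q :: "real^2^2" and x
    using matrix_inv_2[OF that]
    by (simp_all add: matrix_vector_mul_assoc vector_matrix_mult_assoc_2)
  have unit: "(vector [1, 0] :: real^2) \<noteq> 0" "(vector [0, 1] :: real^2) \<noteq> 0" by (auto simp: vector_2_eq_iff)
  have vm: "(x v* M) \<bullet> y = x \<bullet> (M *v y)" for x y and M :: "real^2^2"
    by (simp add: inner_2 matrix_2_vector vector_matrix_mult_def sum_2 algebra_simps)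
  have Teq: "conj2 Q (hT x) = mat 1 + outer2 (Q *v vector [1, 0]) ((2 * cos x) *\<^sub>R (vector [0, 1] v* matrix_inv Q))" if "det Q \<noteq> 0" for Q x
  proof -
    have "hT x = mat 1 + outer2 (vector [1, 0]) ((2 * cos x) *\<^sub>R vector [0, 1])"
      by (simp add: hT_def matrix_2_eq_iff)
    then have "conj2 Q (hT x) = mat 1 + Q ** outer2 (vector [1, 0]) ((2 * cos x) *\<^sub>R vector [0, 1]) ** matrix_inv Q"
      using conj2_one[OF that] by (simp only: conj2_add) (simp add: conj2_def)
    also have "Q ** outer2 (vector [1, 0]) ((2 * cos x) *\<^sub>R vector [0, 1]) ** matrix_inv Q =
        outer2 (Q *v vector [1, 0]) ((2 * cos x) *\<^sub>R (vector [0, 1] v* matrix_inv Q))"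
      unfolding mult_outer2 outer2_mult
      by (simp add: matrix_2_eq_iff vector_matrix_mult_def sum_2)
    finally show ?thesis .
  qed
  have det: "det A = 1 \<and> det B = 1" if "(A, B) \<in> G" for A B
    using G[OF that] words_det P by (auto simp: det_conj2 det_uminus_2)
  have dom: "norm B \<le> Cd * norm A" if AB: "(A, B) \<in> G" for A B
  proof -
    obtain W W' where W: "words W W'" "A = conj2 P W \<or> A = - conj2 P W" "B = conj2 P' W' \<or> B = - conj2 P' W'"
      using G[OF AB] by blast
    have "norm B = norm (conj2 P' W')" using W(3) by auto
    also have "\<dots> \<le> norm P' * norm W' * norm (matrix_inv P')" by (rule norm_conj2_le)
    also have "\<dots> \<le> norm P' * (norm (matrix_inv P) * norm (conj2 P W) * norm P) * norm (matrix_inv P')"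
      using words_norm_le[OF W(1)] norm_le_conj2[OF P(1), of W] by (intro mult_right_mono mult_left_mono) auto
    also have "norm (conj2 P W) = norm A" using W(2) by auto
    also have "norm P' * (norm (matrix_inv P) * norm A * norm P) * norm (matrix_inv P') \<le> Cd * norm A"
      by (simp add: Cd_def algebra_simps)
    finally show ?thesis .
  qed
  have act: "conj2 Q M *v (Q *v x) = Q *v (M *v x)" if "det Q \<noteq> 0" for Q M x
  proof -
    have "conj2 Q M *v (Q *v x) = Q *v (M *v (matrix_inv Q *v (Q *v x)))"
      by (simp only: conj2_def matrix_vector_mul_assoc[symmetric])
    then show ?thesis using inv(1)[OF that] by simp
  qed
  have nz: "e1 \<noteq> 0" "e2 \<noteq> 0" "f2 \<noteq> 0"
  proof -
    show "e1 \<noteq> 0" using inv(1)[OF P(1), of "vector [1, 0]"] unit by (auto simp: e1_def)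
    show "e2 \<noteq> 0" using inv(1)[OF P(2), of "vector [1, 0]"] unit by (auto simp: e2_def)
    have "vector [0, 1] v* matrix_inv P' \<noteq> 0"
      using inv(2)[OF P(2), of "vector [0, 1]"] unit by (auto simp: vector_matrix_mult_def sum_2 vector_2_eq_iff)
    then show "f2 \<noteq> 0" using cos by (simp add: f2_def)
  qed
  have fe: "f1 \<bullet> e1 = 0" "f2 \<bullet> e2 = 0"
    by (simp_all add: f1_def f2_def e1_def e2_def vm inv P) (simp_all add: inner_2)
  have he: "f1 \<bullet> (conj2 P H *v e1) \<noteq> 0"
    using cos h(4) unfolding e1_def act[OF P(1)]
    by (simp add: f1_def vm inv P) (simp add: inner_2 matrix_2_vector)
  have deth: "det (conj2 P H) = 1" using det[OF h(1)] by simp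
  have trh: "trace (conj2 P H) > 2" using h P by (simp add: trace_conj2)
  have inf: "mpow (conj2 P' H') m \<noteq> mat 1" if m: "m > 0" for m
  proof
    assume "mpow (conj2 P' H') m = mat 1"
    moreover have "(mpow (conj2 P H) k, mpow (conj2 P' H') k) \<in> G" for k
      by (induction k) (auto intro: one mult h(1))
    ultimately have "mpow (conj2 P H) m = mat 1 \<or> mpow (conj2 P H) m = - mat 1" using faithful by metis
    then have tr2: "\<bar>trace (mpow (conj2 P H) m)\<bar> = 2" by (auto simp: trace_2)
    obtain \<eta> where \<eta>: "\<eta> > 0" "trace (conj2 P H) = 2 * cosh \<eta>" "\<eta> = arcosh (trace (conj2 P H) / 2)"
      using arcosh_half[OF trh] by blast
    have "cosh 0 < cosh (real m * \<eta>)" using m \<eta>(1) by (subst cosh_real_nonneg_less_iff) auto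
    then show False
      using trace_mpow_hyperbolic[OF deth \<eta>(2,1), of m] tr2 abs_ge_self[of "trace (mpow (conj2 P H) m)"]
      unfolding cosh_0 by linarith
  qed
  have dense: "\<exists>A B. (A, B) \<in> G \<and> norm (line_dir (A *v e1) - \<xi>) < \<epsilon>" if \<xi>: "norm \<xi> = 1" and \<epsilon>: "\<epsilon> > 0" for \<xi> \<epsilon>
  proof -
    obtain y0 where y0: "y0 \<noteq> 0" "line_dir y0 = \<xi>" using line_dir_surj[OF \<xi>] .
    define y where "y = matrix_inv P *v y0"
    have Py: "P *v y = y0" using inv(3)[OF P(1)] by (simp add: y_def)
    then have y: "y \<noteq> 0" using y0 by auto
    define L where "L = \<bar>det P\<bar> * (norm (matrix_inv P))\<^sup>2"
    have L: "L \<ge> 0" by (simp add: L_def)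
    have "\<epsilon> / (L + 1) > 0" using L \<epsilon> by simp
    then obtain W W' where W: "words W W'" "norm (line_dir (W *v vector [1, 0]) - line_dir y) < \<epsilon> / (L + 1)"
      "norm (line_dir (W *v vector [0, 1]) - line_dir y) < \<epsilon> / (L + 1)"
      using words_dense[OF norm_line_dir[OF y]] by blast
    have close: "norm (line_dir (P *v w) - \<xi>) < \<epsilon>" if "norm (line_dir w - line_dir y) < \<epsilon> / (L + 1)" "w \<noteq> 0" for w
    proof -
      have "norm (line_dir (P *v w) - \<xi>) \<le> L * norm (line_dir w - line_dir y)"
        using line_dir_lipschitz[OF P(1) that(2) y] unfolding Py y0(2) L_def .
      also have "\<dots> \<le> L * (\<epsilon> / (L + 1))" using that L by (intro mult_left_mono) auto
      also have "\<dots> < \<epsilon>" using L \<epsilon> by (simp add: field_simps)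
      finally show ?thesis .
    qed
    have Wnz: "W *v x \<noteq> 0" if "x \<noteq> 0" for x
      using matrix_vector_nonzero_2[of W x] words_det[OF W(1)] that by blast
    have S1: "hS *v vector [1, 0] = vector [0, 1]" by (simp add: hS_def vector_2_eq_iff matrix_2_vector)
    from coset[OF W(1)] show ?thesis
    proof
      assume "(conj2 P W, conj2 P' W') \<in> G"
      moreover have "conj2 P W *v e1 = P *v (W *v vector [1, 0])" unfolding e1_def by (rule act[OF P(1)])
      ultimately show ?thesis using close[OF W(2) Wnz[OF unit(1)]] by metis
    next
      assume "(conj2 P (W ** hS), conj2 P' (W' ** hS)) \<in> G"
      moreover have "conj2 P (W ** hS) *v e1 = P *v (W *v vector [0, 1])"
        unfolding e1_def act[OF P(1)] by (simp add: matrix_vector_mul_assoc[symmetric] S1)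
      ultimately show ?thesis using close[OF W(3) Wnz[OF unit(2)]] by metis
    qed
  qed
  have "pair_group G e1 e2 f1 f2 (conj2 P H) (conj2 P' H') Cd"
  proof
    fix A B A' B' :: "real^2^2" and k :: nat and \<xi> :: complex and \<epsilon> :: real
    show "(A, B) \<in> G \<Longrightarrow> det A = 1 \<and> det B = 1" by (rule det)
    show "(mat 1, mat 1) \<in> G" by (rule one)
    show "(A, B) \<in> G \<Longrightarrow> (A', B') \<in> G \<Longrightarrow> (A ** A', B ** B') \<in> G" by (rule mult)
    show "Cd > 0" by (simp add: Cd_def add_nonneg_pos)
    show "(A, B) \<in> G \<Longrightarrow> norm B \<le> Cd * norm A" by (rule dom)
    show "e1 \<noteq> 0" "e2 \<noteq> 0" "f2 \<noteq> 0" by (rule nz)+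
    show "f1 \<bullet> e1 = 0" "f2 \<bullet> e2 = 0" by (rule fe)+
    show "(mat 1 + outer2 e1 f1, mat 1 + outer2 e2 f2) \<in> G"
      using T unfolding Teq[OF P(1)] Teq[OF P(2)] e1_def e2_def f1_def f2_def .
    show "(conj2 P H, conj2 P' H') \<in> G" by (rule h(1))
    show "trace (conj2 P H) > 2" by (rule trh)
    show "\<bar>trace (conj2 P' H')\<bar> < 2" using h(3) P by (simp add: trace_conj2)
    show "f1 \<bullet> (conj2 P H *v e1) \<noteq> 0" by (rule he)
    show "k > 0 \<Longrightarrow> mpow (conj2 P' H') k \<noteq> mat 1" by (rule inf)
    show "norm \<xi> = 1 \<Longrightarrow> \<epsilon> > 0 \<Longrightarrow> \<exists>A B. (A, B) \<in> G \<and> norm (line_dir (A *v e1) - \<xi>) < \<epsilon>" by (rule dense)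
  qed
  then show ?thesis by blast
qed

end

section \<open>Arithmetic: units of the order, their two embeddings and the resulting pairs\<close>

section \<open>The field, its conjugation and quaternion embeddings\<close>

lemma sqrt5_irrational: "sqrt 5 \<notin> \<rat>"
proof
  assume "sqrt 5 \<in> \<rat>"
  then obtain m n :: nat where mn: "n \<noteq> 0" "\<bar>sqrt 5\<bar> = real m / real n" "coprime m n" by (rule Rats_abs_nat_div_natE)
  have "(real m)\<^sup>2 = 5 * (real n)\<^sup>2"
  proof -
    have "real m = sqrt 5 * real n" using mn(1,2) by (simp add: field_simps)
    then show ?thesis by (simp add: power_mult_distrib)
  qed
  then have eq: "m\<^sup>2 = 5 * n\<^sup>2" by (metis of_nat_eq_iff of_nat_mult of_nat_numeral of_nat_power)
  have p: "prime (5 :: nat)" by simp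
  have "5 dvd m\<^sup>2" using eq by simp
  then have "5 dvd m" using p prime_dvd_power by blast
  then obtain k where "m = 5 * k" by blast
  then have "n\<^sup>2 = 5 * k\<^sup>2" using eq by (simp add: power2_eq_square)
  then have "5 dvd n\<^sup>2" by simp
  then have "5 dvd n" using p prime_dvd_power by blast
  with \<open>5 dvd m\<close> mn(3) have "5 dvd (1::nat)" using coprime_common_divisor by blast
  then show False by simp
qed

lemma K_rep_unique:
  assumes "p \<in> \<rat>" "q \<in> \<rat>" "p' \<in> \<rat>" "q' \<in> \<rat>" "p + q * sqrt 5 = p' + q' * sqrt 5"
  shows "p = p'" "q = q'"
proof -
  show "q = q'"
  proof (rule ccontr)
    assume "q \<noteq> q'"
    then have "sqrt 5 = (p' - p) / (q - q')" using assms(5) by (simp add: field_simps)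
    then show False using sqrt5_irrational assms by auto
  qed
  then show "p = p'" using assms(5) by simp
qed

lemma galois_eq:
  assumes "p \<in> \<rat>" "q \<in> \<rat>"
  shows "galois (p + q * sqrt 5) = p - q * sqrt 5"
  unfolding galois_def
proof (rule the_equality)
  show "\<exists>p'\<in>\<rat>. \<exists>q'\<in>\<rat>. p + q * sqrt 5 = p' + q' * sqrt 5 \<and> p - q * sqrt 5 = p' - q' * sqrt 5" using assms by blast
next
  fix y assume "\<exists>p'\<in>\<rat>. \<exists>q'\<in>\<rat>. p + q * sqrt 5 = p' + q' * sqrt 5 \<and> y = p' - q' * sqrt 5"
  then show "y = p - q * sqrt 5" using K_rep_unique[OF assms] by metis
qed

lemma K_I: "p \<in> \<rat> \<Longrightarrow> q \<in> \<rat> \<Longrightarrow> p + q * sqrt 5 \<in> K"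
  by (auto simp: K_def)

lemma K_cases:
  assumes "x \<in> K"
  obtains p q where "p \<in> \<rat>" "q \<in> \<rat>" "x = p + q * sqrt 5"
  using assms by (auto simp: K_def)

lemma Rats_K: "p \<in> \<rat> \<Longrightarrow> p \<in> K"
  using K_I[of p 0] by simp

lemma K_add: assumes "x \<in> K" "y \<in> K" shows "x + y \<in> K"
proof -
  obtain p q p' q' where h: "p \<in> \<rat>" "q \<in> \<rat>" "x = p + q * sqrt 5" "p' \<in> \<rat>" "q' \<in> \<rat>" "y = p' + q' * sqrt 5"
    using assms K_cases by metis
  have "x + y = (p + p') + (q + q') * sqrt 5" by (simp add: h algebra_simps)
  then show ?thesis by (simp only:) (rule K_I; use h in auto)
qed

lemma K_mult: assumes "x \<in> K" "y \<in> K" shows "x * y \<in> K"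
proof -
  obtain p q p' q' where h: "p \<in> \<rat>" "q \<in> \<rat>" "x = p + q * sqrt 5" "p' \<in> \<rat>" "q' \<in> \<rat>" "y = p' + q' * sqrt 5"
    using assms K_cases by metis
  have "x * y = (p * p' + 5 * (q * q')) + (p * q' + q * p') * sqrt 5" by (simp add: h algebra_simps)
  then show ?thesis by (simp only:) (rule K_I; use h in auto)
qed

lemma K_uminus: "x \<in> K \<Longrightarrow> - x \<in> K"
  using K_mult[OF Rats_K[of "- 1"]] by simp

lemma K_diff: "x \<in> K \<Longrightarrow> y \<in> K \<Longrightarrow> x - y \<in> K"
  using K_add[of x "- y"] K_uminus by simp

lemma K_01 [simp]: "0 \<in> K" "1 \<in> K"
  by (auto intro: Rats_K)

lemma galois_rat: "p \<in> \<rat> \<Longrightarrow> galois p = p"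
  using galois_eq[of p 0] by simp

lemma galois_double: "x \<in> K \<Longrightarrow> galois (2 * x) = 2 * galois x"
proof -
  assume "x \<in> K"
  then obtain p q where h: "p \<in> \<rat>" "q \<in> \<rat>" "x = p + q * sqrt 5" by (rule K_cases)
  have e: "2 * x = 2 * p + (2 * q) * sqrt 5" by (simp add: h)
  have "galois (2 * x) = 2 * p - (2 * q) * sqrt 5" unfolding e by (rule galois_eq) (use h in auto)
  moreover have "galois x = p - q * sqrt 5" unfolding h(3) by (rule galois_eq[OF h(1,2)])
  ultimately show ?thesis by simp
qed

lemma quat_carrier_qmult:
  assumes "a \<in> K" "b \<in> K" "x \<in> quat_carrier" "y \<in> quat_carrier"
  shows "qmult a b x y \<in> quat_carrier"
  using assms by (cases x; cases y) (auto simp: quat_carrier_def intro!: K_add K_diff K_mult)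

lemma reduced_norm_qmult: "reduced_norm a b (qmult a b x y) = reduced_norm a b x * reduced_norm a b y"
  by (cases x; cases y) (simp add: power2_eq_square algebra_simps)

lemma matrix_scalar_neq_E:
  fixes M :: "real^2^2"
  assumes "k *\<^sub>R M = l *\<^sub>R mat 1" "k \<noteq> 0"
  obtains m where "M = m *\<^sub>R mat 1"
proof
  have "M = (1 / k) *\<^sub>R (k *\<^sub>R M)" using assms(2) by simp
  then show "M = (l / k) *\<^sub>R mat 1" unfolding assms(1) by simp
qed

text \<open>With the quaternion conjugate y of x, both x + y and x y are scalars, so
  \<open>\<phi> x\<close> satisfies a monic quadratic besides its characteristic equation. If the
  linear coefficients differed, \<open>\<phi> x\<close> would be a scalar matrix, so x would be
  central by injectivity and therefore in \<open>K\<close>, where the traces agree after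
  all.\<close>

lemma trace_det_quat_embedding:
  assumes ab: "a \<in> K" "a \<noteq> 0" "b \<in> K" "b \<noteq> 0" and \<phi>: "quat_embedding a b \<tau> \<phi>"
    and \<tau>: "\<And>k. k \<in> K \<Longrightarrow> \<tau> (2 * k) = 2 * \<tau> k" and x: "x \<in> quat_carrier"
  shows "trace (\<phi> x) = 2 * \<tau> (fst x)" "det (\<phi> x) = \<tau> (reduced_norm a b x)"
proof -
  obtain x0 x1 x2 x3 where xx: "x = (x0, x1, x2, x3)" by (cases x)
  have xK: "x0 \<in> K" "x1 \<in> K" "x2 \<in> K" "x3 \<in> K" using x by (auto simp: xx quat_carrier_def)
  have inj: "inj_on \<phi> quat_carrier"
    and add: "\<And>x y. x \<in> quat_carrier \<Longrightarrow> y \<in> quat_carrier \<Longrightarrow> \<phi> (x + y) = \<phi> x + \<phi> y"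
    and mult: "\<And>x y. x \<in> quat_carrier \<Longrightarrow> y \<in> quat_carrier \<Longrightarrow> \<phi> (qmult a b x y) = \<phi> x ** \<phi> y"
    and scal: "\<And>k. k \<in> K \<Longrightarrow> \<phi> (k, 0, 0, 0) = \<tau> k *\<^sub>R mat 1"
    using \<phi> by (auto simp: quat_embedding_def)
  define y where "y = (x0, - x1, - x2, - x3)"
  have y: "y \<in> quat_carrier" using xK by (auto simp: y_def quat_carrier_def intro: K_uminus)
  have nrdK: "reduced_norm a b x \<in> K"
    using xK ab by (simp add: xx power2_eq_square) (intro K_add K_diff K_mult; simp)
  have "x + y = (2 * x0, 0, 0, 0)" by (simp add: xx y_def)
  then have s: "\<phi> x + \<phi> y = (2 * \<tau> x0) *\<^sub>R mat 1"
    using add[OF x y] scal[OF K_mult[OF Rats_K[of 2] xK(1)]] \<tau>[OF xK(1)] by simp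
  have "qmult a b x y = (reduced_norm a b x, 0, 0, 0)" by (simp add: xx y_def power2_eq_square)
  then have p: "\<phi> x ** \<phi> y = \<tau> (reduced_norm a b x) *\<^sub>R mat 1"
    using mult[OF x y] scal[OF nrdK] by simp
  have "\<phi> x ** \<phi> x + \<phi> x ** \<phi> y = \<phi> x ** (\<phi> x + \<phi> y)" by (simp add: matrix_2_eq_iff matrix_2_mult algebra_simps)
  also have "\<dots> = (2 * \<tau> x0) *\<^sub>R \<phi> x" unfolding s by (simp add: scaleR_matrix_2)
  finally have q: "(trace (\<phi> x) - 2 * \<tau> x0) *\<^sub>R \<phi> x = (det (\<phi> x) - \<tau> (reduced_norm a b x)) *\<^sub>R mat 1"
    unfolding p cayley_hamilton_2 by (simp add: algebra_simps)
  show tr: "trace (\<phi> x) = 2 * \<tau> (fst x)"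
  proof (rule ccontr)
    assume "trace (\<phi> x) \<noteq> 2 * \<tau> (fst x)"
    then have "trace (\<phi> x) - 2 * \<tau> x0 \<noteq> 0" by (simp add: xx)
    then obtain m where m: "\<phi> x = m *\<^sub>R mat 1" using matrix_scalar_neq_E[OF q] by blast
    have central: "qmult a b x z = qmult a b z x" if z: "z \<in> quat_carrier" for z
    proof (rule inj_onD[OF inj])
      show "\<phi> (qmult a b x z) = \<phi> (qmult a b z x)"
        unfolding mult[OF x z] mult[OF z x] m by (simp add: scaleR_matrix_2)
    qed (intro quat_carrier_qmult ab x z)+
    have "qmult a b x (0, 1, 0, 0) = qmult a b (0, 1, 0, 0) x" "qmult a b x (0, 0, 1, 0) = qmult a b (0, 0, 1, 0) x"
      by (intro central; simp add: quat_carrier_def)+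
    then have "x1 = 0" "x2 = 0" "x3 = 0" using ab by (auto simp: xx)
    then have "\<phi> x = \<tau> x0 *\<^sub>R mat 1" using scal[OF xK(1)] by (simp add: xx)
    then show False using \<open>trace (\<phi> x) \<noteq> 2 * \<tau> (fst x)\<close> by (simp add: xx trace_2)
  qed
  then have "(det (\<phi> x) - \<tau> (reduced_norm a b x)) *\<^sub>R (mat 1 :: real^2^2) = 0" using q by (simp add: xx)
  then show "det (\<phi> x) = \<tau> (reduced_norm a b x)" by (simp add: matrix_2_eq_iff)
qed

lemma quat_order_subset:
  assumes "quat_order a b \<O>"
  shows "\<O> \<subseteq> quat_carrier"
proof -
  obtain B where B: "\<O> = lin_combs integers_K B" "quat_carrier = lin_combs K B" using assms by (auto simp: quat_order_def)
  have "integers_K \<subseteq> K" by (auto simp: integers_K_def)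
  then show ?thesis unfolding B lin_combs_def by blast
qed


section \<open>Elements of PSL(2,R)\<close>

lemma psl_uminus: "psl (- A) = psl A"
  by (auto simp: psl_eq)

lemma psl_eq_iff: "psl A = psl B \<longleftrightarrow> A = B \<or> A = - B"
  unfolding psl_eq doubleton_eq_iff by (metis minus_minus)

lemma mem_psl_iff: "A \<in> psl B \<longleftrightarrow> A = B \<or> A = - B"
  by (auto simp: psl_eq)

lemma psl_mult:
  assumes "det A = 1" "det B = 1"
  shows "psl A \<otimes>\<^bsub>PSL2R\<^esub> psl B = psl (A ** B)"
proof -
  have "A \<in> carrier SL2R" "B \<in> carrier SL2R" using assms by (auto simp: SL2R_def)
  from normal.rcos_sum[OF normal_pm_one this] show ?thesis
    by (simp add: psl_def PSL2R_def FactGroup_def SL2R_def)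
qed

lemma psl_carrier: "det A = 1 \<Longrightarrow> psl A \<in> carrier PSL2R"
  by (auto simp: PSL2R_def FactGroup_def psl_def RCOSETS_def SL2R_def)

lemma psl_one: "\<one>\<^bsub>PSL2R\<^esub> = psl (mat 1)"
  by (simp add: one_PSL2R psl_eq)

lemma det_adj2: "det (adj2 A) = det A"
  by (simp add: adj2_def det_2)

lemma psl_inv:
  assumes "det A = 1"
  shows "inv\<^bsub>PSL2R\<^esub> (psl A) = psl (adj2 A)"
proof (rule group.inv_equality[OF group_PSL2R])
  show "psl (adj2 A) \<otimes>\<^bsub>PSL2R\<^esub> psl A = \<one>\<^bsub>PSL2R\<^esub>"
    using assms by (simp add: psl_mult det_adj2 mult_adj2 psl_one)
qed (use assms in \<open>auto intro: psl_carrier simp: det_adj2\<close>)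

lemma adj2_mult: "adj2 (A ** B) = adj2 B ** adj2 A"
  by (simp add: adj2_def matrix_2_eq_iff matrix_2_mult)

lemma adj2_uminus: "adj2 (- A) = - adj2 A"
  by (simp add: adj2_def matrix_2_eq_iff)


section \<open>The group of pairs\<close>

text \<open>The preimage of the group in pairs of matrices, with the signs of the two components
  chosen independently. Traces and norms are available here without a choice of
  representatives.\<close>

definition unit_pairs :: "quat set \<Rightarrow> (quat \<Rightarrow> real^2^2) \<Rightarrow> (quat \<Rightarrow> real^2^2) \<Rightarrow> (real^2^2) set set \<Rightarrow> ((real^2^2) \<times> (real^2^2)) set" where
  "unit_pairs U \<phi> \<phi>' S = {(A, B). \<exists>\<epsilon>\<in>U. psl (\<phi> \<epsilon>) \<in> S \<and> A \<in> psl (\<phi> \<epsilon>) \<and> B \<in> psl (\<phi>' \<epsilon>)}"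

lemma S_star_eq: "S_star U \<phi> \<phi>' S = {(psl A, psl B) | A B. (A, B) \<in> unit_pairs U \<phi> \<phi>' S}"
proof -
  have "psl A = psl B" if "A \<in> psl B" for A B using that by (auto simp: mem_psl_iff psl_uminus)
  moreover have "A \<in> psl A" for A by (simp add: mem_psl_iff)
  ultimately show ?thesis unfolding S_star_def unit_pairs_def by (auto; metis)
qed

locale conjugate_embeddings =
  fixes a b :: real and \<O> :: "quat set" and \<phi> \<phi>' :: "quat \<Rightarrow> real^2^2"
  assumes ab: "a \<in> K" "a \<noteq> 0" "b \<in> K" "b \<noteq> 0" and order: "quat_order a b \<O>"
    and emb: "quat_embedding a b (\<lambda>k. k) \<phi>" "quat_embedding a b galois \<phi>'"
begin

definition "U = norm_one_units a b \<O>"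

lemma U_carrier: "\<epsilon> \<in> U \<Longrightarrow> \<epsilon> \<in> quat_carrier"
  using quat_order_subset[OF order] by (auto simp: U_def norm_one_units_def)

lemma U_mult: "\<epsilon> \<in> U \<Longrightarrow> \<delta> \<in> U \<Longrightarrow> qmult a b \<epsilon> \<delta> \<in> U"
  using order by (auto simp: U_def norm_one_units_def quat_order_def reduced_norm_qmult)

lemma det_U: "\<epsilon> \<in> U \<Longrightarrow> det (\<phi> \<epsilon>) = 1" "\<epsilon> \<in> U \<Longrightarrow> det (\<phi>' \<epsilon>) = 1"
  using trace_det_quat_embedding(2)[OF ab emb(1) _ U_carrier] trace_det_quat_embedding(2)[OF ab emb(2) galois_double U_carrier]
  by (auto simp: U_def norm_one_units_def galois_rat)

lemma trace_U: "\<epsilon> \<in> U \<Longrightarrow> trace (\<phi> \<epsilon>) = 2 * fst \<epsilon>" "\<epsilon> \<in> U \<Longrightarrow> trace (\<phi>' \<epsilon>) = 2 * galois (fst \<epsilon>)"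
  using trace_det_quat_embedding(1)[OF ab emb(1) _ U_carrier] trace_det_quat_embedding(1)[OF ab emb(2) galois_double U_carrier]
  by auto

text \<open>The sign c is common to both components; only then are the traces exactly conjugate, not
  merely up to sign.\<close>

lemma galois_trace:
  assumes e: "\<epsilon> \<in> U" and A: "A = c *\<^sub>R \<phi> \<epsilon>" and B: "B = c *\<^sub>R \<phi>' \<epsilon>" and c: "c = 1 \<or> c = - 1"
    and tr: "trace A = p + q * sqrt 5" and pq: "p \<in> \<rat>" "q \<in> \<rat>"
  shows "trace B = p - q * sqrt 5"
proof -
  have tc: "trace (c *\<^sub>R M) = c * trace M" for M :: "real^2^2" by (simp add: trace_2 algebra_simps)
  have "c * (2 * fst \<epsilon>) = p + q * sqrt 5" using tr trace_U(1)[OF e] unfolding A tc by simp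
  then have fe: "fst \<epsilon> = c * p / 2 + c * q / 2 * sqrt 5" using c by auto
  have "c * p / 2 \<in> \<rat>" "c * q / 2 \<in> \<rat>" using c pq by auto
  then have "galois (fst \<epsilon>) = c * p / 2 - c * q / 2 * sqrt 5" unfolding fe by (rule galois_eq)
  then show ?thesis using c trace_U(2)[OF e] unfolding B tc by auto
qed

lemma phi_mult:
  "\<epsilon> \<in> U \<Longrightarrow> \<delta> \<in> U \<Longrightarrow> \<phi> (qmult a b \<epsilon> \<delta>) = \<phi> \<epsilon> ** \<phi> \<delta>"
  "\<epsilon> \<in> U \<Longrightarrow> \<delta> \<in> U \<Longrightarrow> \<phi>' (qmult a b \<epsilon> \<delta>) = \<phi>' \<epsilon> ** \<phi>' \<delta>"
  using emb U_carrier by (auto simp: quat_embedding_def)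

lemma phi_uminus:
  assumes "x \<in> quat_carrier"
  shows "\<phi> (- x) = - \<phi> x" "\<phi>' (- x) = - \<phi>' x"
proof -
  have mx: "- x \<in> quat_carrier" using assms by (auto simp: quat_carrier_def intro: K_uminus)
  have z: "0 = ((0 :: real), (0 :: real), (0 :: real), (0 :: real))" by (simp add: zero_prod_def)
  have g0: "galois 0 = 0" by (simp add: galois_rat)
  have "\<phi> (x + - x) = \<phi> x + \<phi> (- x)" "\<phi>' (x + - x) = \<phi>' x + \<phi>' (- x)"
    using emb assms mx unfolding quat_embedding_def by blast+
  moreover have "\<phi> 0 = 0" "\<phi>' 0 = 0"
    using emb g0 unfolding quat_embedding_def z by auto
  ultimately show "\<phi> (- x) = - \<phi> x" "\<phi>' (- x) = - \<phi>' x" by (simp_all add: eq_neg_iff_add_eq_0 add.commute)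
qed

lemma phi_inj: "x \<in> quat_carrier \<Longrightarrow> y \<in> quat_carrier \<Longrightarrow> \<phi> x = \<phi> y \<Longrightarrow> x = y"
  "x \<in> quat_carrier \<Longrightarrow> y \<in> quat_carrier \<Longrightarrow> \<phi>' x = \<phi>' y \<Longrightarrow> x = y"
  using emb by (auto simp: quat_embedding_def inj_on_def)

lemma uminus_carrier: "x \<in> quat_carrier \<Longrightarrow> - x \<in> quat_carrier"
  by (auto simp: quat_carrier_def intro: K_uminus)

text \<open>Both embeddings are injective and odd, so either component says of two units that they
  agree up to sign. Thus the first component in PSL(2,R) determines the second, and
  conversely.\<close>

lemma psl_phi_cong:
  assumes "\<epsilon> \<in> quat_carrier" "\<delta> \<in> quat_carrier"
  shows "psl (\<phi> \<epsilon>) = psl (\<phi> \<delta>) \<longleftrightarrow> psl (\<phi>' \<epsilon>) = psl (\<phi>' \<delta>)"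
  unfolding psl_eq_iff
  using phi_inj[OF assms] phi_inj[OF assms(1) uminus_carrier[OF assms(2)]] phi_uminus[OF assms(2)] by metis

lemma one_carrier: "(1, 0, 0, 0) \<in> quat_carrier" "\<phi> (1, 0, 0, 0) = mat 1" "\<phi>' (1, 0, 0, 0) = mat 1"
  using emb by (auto simp: quat_carrier_def quat_embedding_def galois_rat)

lemma psl_phi_one:
  assumes "\<epsilon> \<in> quat_carrier"
  shows "psl (\<phi> \<epsilon>) = psl (mat 1) \<longleftrightarrow> psl (\<phi>' \<epsilon>) = psl (mat 1)"
  using psl_phi_cong[OF assms one_carrier(1)] one_carrier by simp

section \<open>The group of pairs over a subgroup covered by units\<close>

context
  fixes S :: "(real^2^2) set set"
  assumes sub: "subgroup S PSL2R" and cover: "S \<subseteq> (\<lambda>\<epsilon>. psl (\<phi> \<epsilon>)) ` U"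
begin

abbreviation "G \<equiv> unit_pairs U \<phi> \<phi>' S"

lemma G_I: "\<epsilon> \<in> U \<Longrightarrow> psl (\<phi> \<epsilon>) \<in> S \<Longrightarrow> A = \<phi> \<epsilon> \<or> A = - \<phi> \<epsilon> \<Longrightarrow> B = \<phi>' \<epsilon> \<or> B = - \<phi>' \<epsilon> \<Longrightarrow> (A, B) \<in> G"
  unfolding unit_pairs_def mem_psl_iff by blast

lemma G_E:
  assumes "(A, B) \<in> G"
  obtains \<epsilon> where "\<epsilon> \<in> U" "psl (\<phi> \<epsilon>) \<in> S" "A = \<phi> \<epsilon> \<or> A = - \<phi> \<epsilon>" "B = \<phi>' \<epsilon> \<or> B = - \<phi>' \<epsilon>"
  using assms unfolding unit_pairs_def mem_psl_iff by blast

lemma G_uminus: "(A, B) \<in> G \<Longrightarrow> (- A, B) \<in> G" "(A, B) \<in> G \<Longrightarrow> (A, - B) \<in> G"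
  by (erule G_E, erule (1) G_I; auto)+

lemma G_mult:
  assumes "(A, B) \<in> G" "(A', B') \<in> G"
  shows "(A ** A', B ** B') \<in> G"
proof -
  obtain \<epsilon> where e: "\<epsilon> \<in> U" "psl (\<phi> \<epsilon>) \<in> S" "A = \<phi> \<epsilon> \<or> A = - \<phi> \<epsilon>" "B = \<phi>' \<epsilon> \<or> B = - \<phi>' \<epsilon>" using G_E[OF assms(1)] .
  obtain \<delta> where d: "\<delta> \<in> U" "psl (\<phi> \<delta>) \<in> S" "A' = \<phi> \<delta> \<or> A' = - \<phi> \<delta>" "B' = \<phi>' \<delta> \<or> B' = - \<phi>' \<delta>" using G_E[OF assms(2)] .
  have "psl (\<phi> (qmult a b \<epsilon> \<delta>)) \<in> S"
    using subgroup.m_closed[OF sub e(2) d(2)] e(1) d(1) by (simp add: psl_mult det_U phi_mult)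
  then show ?thesis
    by (rule G_I[OF U_mult[OF e(1) d(1)]]) (use e d in \<open>auto simp: phi_mult matrix_mult_minus\<close>)
qed

lemma G_one: "(mat 1, mat 1) \<in> G"
proof -
  have "psl (mat 1) \<in> S" using subgroup.one_closed[OF sub] by (simp add: psl_one)
  then obtain \<epsilon> where e: "\<epsilon> \<in> U" "psl (\<phi> \<epsilon>) = psl (mat 1)" using cover by (metis (no_types, lifting) imageE subsetD)
  then have "psl (\<phi>' \<epsilon>) = psl (mat 1)" using psl_phi_one[OF U_carrier[OF e(1)]] by simp
  moreover have mem: "psl (\<phi> \<epsilon>) \<in> S" using e(2) \<open>psl (mat 1) \<in> S\<close> by simp
  ultimately show ?thesis using e(2) by (intro G_I[OF e(1) mem]) (auto simp: psl_eq_iff)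
qed

text \<open>The inverse is taken inside S: a unit above the inverse of the first component exists by
  \<open>cover\<close>, and since the product of the two units is trivial up to sign in the first
  component it is so in the second.\<close>

lemma G_inverse:
  assumes "(A, B) \<in> G"
  shows "(adj2 A, adj2 B) \<in> G"
proof -
  obtain \<epsilon> where e: "\<epsilon> \<in> U" "psl (\<phi> \<epsilon>) \<in> S" "A = \<phi> \<epsilon> \<or> A = - \<phi> \<epsilon>" "B = \<phi>' \<epsilon> \<or> B = - \<phi>' \<epsilon>" using G_E[OF assms] .
  have "psl (adj2 (\<phi> \<epsilon>)) \<in> S" using subgroup.m_inv_closed[OF sub e(2)] by (simp add: psl_inv det_U e(1))
  then obtain \<delta> where d: "\<delta> \<in> U" "psl (\<phi> \<delta>) = psl (adj2 (\<phi> \<epsilon>))" "psl (\<phi> \<delta>) \<in> S" using cover by (metis (no_types, lifting) imageE subsetD)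
  have "psl (\<phi> (qmult a b \<epsilon> \<delta>)) = psl (mat 1)"
    using d(2) e(1) d(1) unfolding phi_mult(1)[OF e(1) d(1)] psl_eq_iff
    by (auto simp: mult_adj2 det_U matrix_mult_minus)
  then have "psl (\<phi>' (qmult a b \<epsilon> \<delta>)) = psl (mat 1)" using psl_phi_one[OF U_carrier[OF U_mult[OF e(1) d(1)]]] by simp
  then have "\<phi>' \<epsilon> ** \<phi>' \<delta> = mat 1 \<or> \<phi>' \<epsilon> ** \<phi>' \<delta> = - mat 1" by (simp add: phi_mult e d psl_eq_iff)
  then have "adj2 (\<phi>' \<epsilon>) ** (\<phi>' \<epsilon> ** \<phi>' \<delta>) = adj2 (\<phi>' \<epsilon>) \<or> adj2 (\<phi>' \<epsilon>) ** (\<phi>' \<epsilon> ** \<phi>' \<delta>) = - adj2 (\<phi>' \<epsilon>)"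
    by (auto simp: matrix_mult_minus)
  then have "\<phi>' \<delta> = adj2 (\<phi>' \<epsilon>) \<or> \<phi>' \<delta> = - adj2 (\<phi>' \<epsilon>)" by (simp add: matrix_mul_assoc mult_adj2 det_U e(1))
  moreover have "\<phi> \<delta> = adj2 (\<phi> \<epsilon>) \<or> \<phi> \<delta> = - adj2 (\<phi> \<epsilon>)" using d(2) by (simp add: psl_eq_iff)
  ultimately show ?thesis
    using e(3,4) by (intro G_I[OF d(1,3)]) (auto simp: adj2_uminus)
qed

lemma G_faithful:
  assumes "(A, mat 1) \<in> G"
  shows "A = mat 1 \<or> A = - mat 1"
proof -
  obtain \<epsilon> where e: "\<epsilon> \<in> U" "A = \<phi> \<epsilon> \<or> A = - \<phi> \<epsilon>" "mat 1 = \<phi>' \<epsilon> \<or> mat 1 = - \<phi>' \<epsilon>" using G_E[OF assms] by blast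
  then have "psl (\<phi>' \<epsilon>) = psl (mat 1)" by (metis psl_uminus)
  then have "psl (\<phi> \<epsilon>) = psl (mat 1)" using psl_phi_one[OF U_carrier[OF e(1)]] by simp
  then show ?thesis using e(2) by (auto simp: psl_eq_iff)
qed

text \<open>Generators are known for the first component only. The induction therefore runs over S
  and claims R for every unit above an element; different units above it agree up to sign in both
  components, and R ignores signs.\<close>

lemma G_induct:
  assumes S: "S = generate PSL2R gens" and gens: "\<And>g. g \<in> gens \<Longrightarrow> \<exists>\<epsilon>\<in>U. psl (\<phi> \<epsilon>) = g \<and> R (\<phi> \<epsilon>) (\<phi>' \<epsilon>)"
    and R: "\<And>A B. R A B \<Longrightarrow> R (- A) B" "\<And>A B. R A B \<Longrightarrow> R A (- B)" "\<And>A B. R A B \<Longrightarrow> R (adj2 A) (adj2 B)"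
      "\<And>A B A' B'. R A B \<Longrightarrow> R A' B' \<Longrightarrow> R (A ** A') (B ** B')" "R (mat 1) (mat 1)"
    and AB: "(A, B) \<in> G"
  shows "R A B"
proof -
  have Rpsl: "R A B" if "R A' B'" "psl A = psl A'" "psl B = psl B'" for A B A' B'
    using that(2,3) that(1) R(1)[OF that(1)] R(2)[OF that(1)] R(2)[OF R(1)[OF that(1)]] unfolding psl_eq_iff by auto
  have all: "R (\<phi> \<epsilon>) (\<phi>' \<epsilon>)" if "g \<in> S" "\<epsilon> \<in> U" "psl (\<phi> \<epsilon>) = g" for g \<epsilon>
    using that unfolding S
  proof (induction arbitrary: \<epsilon> rule: generate.induct)
    case one
    have p: "psl (\<phi> \<epsilon>) = psl (mat 1)" using one(2) by (simp add: psl_one)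
    then have "psl (\<phi>' \<epsilon>) = psl (mat 1)" using psl_phi_one[OF U_carrier[OF one(1)]] by simp
    from Rpsl[OF R(5) p this] show ?case .
  next
    case (incl g)
    obtain \<delta> where d: "\<delta> \<in> U" "psl (\<phi> \<delta>) = g" "R (\<phi> \<delta>) (\<phi>' \<delta>)" using gens[OF incl(1)] by blast
    have p: "psl (\<phi> \<epsilon>) = psl (\<phi> \<delta>)" using incl(3) d(2) by simp
    then have "psl (\<phi>' \<epsilon>) = psl (\<phi>' \<delta>)" using psl_phi_cong[OF U_carrier[OF incl(2)] U_carrier[OF d(1)]] by simp
    from Rpsl[OF d(3) p this] show ?case .
  next
    case (inv g)
    obtain \<delta> where d: "\<delta> \<in> U" "psl (\<phi> \<delta>) = g" "R (\<phi> \<delta>) (\<phi>' \<delta>)" using gens[OF inv(1)] by blast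
    have "psl (\<phi> \<delta>) \<in> S" unfolding S d(2) by (rule generate.incl[OF inv(1)])
    then have "(\<phi> \<delta>, \<phi>' \<delta>) \<in> G" by (intro G_I[OF d(1)]) auto
    from G_inverse[OF this] obtain \<delta>' where d': "\<delta>' \<in> U" "adj2 (\<phi> \<delta>) = \<phi> \<delta>' \<or> adj2 (\<phi> \<delta>) = - \<phi> \<delta>'"
      "adj2 (\<phi>' \<delta>) = \<phi>' \<delta>' \<or> adj2 (\<phi>' \<delta>) = - \<phi>' \<delta>'" by (rule G_E)
    have eq1: "psl (\<phi> \<delta>') = psl (adj2 (\<phi> \<delta>))" "psl (\<phi>' \<delta>') = psl (adj2 (\<phi>' \<delta>))" unfolding psl_eq_iff using d'(2,3) by auto
    have "psl (\<phi> \<epsilon>) = psl (\<phi> \<delta>')" using inv(3) d(2) eq1 psl_inv[OF det_U(1)[OF d(1)]] by simp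
    then have "psl (\<phi>' \<epsilon>) = psl (\<phi>' \<delta>')" using psl_phi_cong[OF U_carrier[OF inv(2)] U_carrier[OF d'(1)]] by simp
    then show ?case using Rpsl[OF R(3)[OF d(3)]] eq1 \<open>psl (\<phi> \<epsilon>) = psl (\<phi> \<delta>')\<close> by simp
  next
    case (eng g h)
    have "g \<in> S" "h \<in> S" using eng(1,2) S by auto
    then have "\<exists>\<delta>\<in>U. psl (\<phi> \<delta>) = g" "\<exists>\<delta>\<in>U. psl (\<phi> \<delta>) = h" using cover by auto
    then obtain \<delta>1 \<delta>2 where d: "\<delta>1 \<in> U" "psl (\<phi> \<delta>1) = g" "\<delta>2 \<in> U" "psl (\<phi> \<delta>2) = h" by blast
    let ?\<delta> = "qmult a b \<delta>1 \<delta>2"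
    have r: "R (\<phi> ?\<delta>) (\<phi>' ?\<delta>)"
      unfolding phi_mult[OF d(1,3)] by (rule R(4)[OF eng.IH(1)[OF d(1,2)] eng.IH(2)[OF d(3,4)]])
    have p: "psl (\<phi> \<epsilon>) = psl (\<phi> ?\<delta>)" using eng.prems d by (simp add: phi_mult psl_mult[symmetric] det_U)
    then have "psl (\<phi>' \<epsilon>) = psl (\<phi>' ?\<delta>)"
      using psl_phi_cong[OF U_carrier[OF eng.prems(1)] U_carrier[OF U_mult[OF d(1,3)]]] by simp
    from Rpsl[OF r p this] show ?case .
  qed
  obtain \<epsilon> where e: "\<epsilon> \<in> U" "psl (\<phi> \<epsilon>) \<in> S" "A = \<phi> \<epsilon> \<or> A = - \<phi> \<epsilon>" "B = \<phi>' \<epsilon> \<or> B = - \<phi>' \<epsilon>" using G_E[OF AB] .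
  show ?thesis
    by (rule Rpsl[OF all[OF e(2,1) refl]]) (use e in \<open>auto simp: psl_eq_iff\<close>)
qed

end
end

section \<open>From angles of a triangle to traces of generators\<close>

section \<open>Triangles\<close>

text \<open>The points of the closed half-plane are represented by the vectors \<open>(|z|\<^sup>2, Re z, 1)\<close> and \<open>(1, 0, 0)\<close>,
  on which a reflection acts as the linear form vanishing on its axis.\<close>

definition sv0 :: "sphere_pt \<Rightarrow> real" where "sv0 p = (case p of Pt z \<Rightarrow> (cmod z)\<^sup>2 | Infty \<Rightarrow> 1)"
definition sv1 :: "sphere_pt \<Rightarrow> real" where "sv1 p = (case p of Pt z \<Rightarrow> Re z | Infty \<Rightarrow> 0)"
definition sv2 :: "sphere_pt \<Rightarrow> real" where "sv2 p = (case p of Pt z \<Rightarrow> 1 | Infty \<Rightarrow> 0)"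

definition side_form :: "real^2^2 \<Rightarrow> sphere_pt \<Rightarrow> real" where
  "side_form R p = R$2$1 * sv0 p - 2 * R$1$1 * sv1 p - R$1$2 * sv2 p"

lemma reflection_matrixD:
  assumes "reflection_matrix R"
  shows "R$2$2 = - R$1$1" "(R$1$1)\<^sup>2 + R$1$2 * R$2$1 = 1"
proof -
  have "R$1$1 + R$2$2 = 0" and d: "R$1$1 * R$2$2 - R$1$2 * R$2$1 = - 1"
    using assms by (simp_all add: reflection_matrix_def trace_2 det_2)
  then show e: "R$2$2 = - R$1$1" by linarith
  show "(R$1$1)\<^sup>2 + R$1$2 * R$2$1 = 1" using d unfolding e by (simp add: power2_eq_square)
qed

text \<open>After clearing the denominator the fixed point equation is real, because trace 0
  combines the linear terms into a multiple of z plus its conjugate.\<close>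

lemma anti_moebius_fixed_iff:
  assumes R: "reflection_matrix R" and p: "p \<in> closed_H2"
  shows "anti_moebius R p = p \<longleftrightarrow> side_form R p = 0"
proof (cases p)
  case Infty
  then show ?thesis by (simp add: anti_moebius_def side_form_def sv0_def sv1_def sv2_def)
next
  case (Pt z)
  define a b c where "a = R$1$1" and "b = R$1$2" and "c = R$2$1"
  have d: "R$2$2 = - a" "a\<^sup>2 + b * c = 1" using reflection_matrixD[OF R] by (auto simp: a_def b_def c_def)
  have form: "side_form R p = c * (cmod z)\<^sup>2 - 2 * a * Re z - b"
    by (simp add: Pt side_form_def sv0_def sv1_def sv2_def a_def b_def c_def)
  have zz: "z * cnj z = of_real ((cmod z)\<^sup>2)" by (simp only: complex_norm_square)
  show ?thesis
  proof (cases "of_real c * cnj z - of_real a = 0")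
    case True
    \<comment> \<open>Here z is the real pole a / c, which is sent to \<open>Infty\<close>; the form
      takes the value -1 / c there and does not vanish.\<close>
    then have im: "c * Im z = 0" and re: "c * Re z = a" by (auto simp: complex_eq_iff)
    have "c \<noteq> 0" using re d by (auto simp: power2_eq_square)
    then have "Im z = 0" using im by simp
    then have "c * side_form R p = (c * Re z)\<^sup>2 - 2 * a * (c * Re z) - b * c"
      unfolding form cmod_power2 by (simp add: power2_eq_square algebra_simps)
    also have "\<dots> = - 1" unfolding re using d(2) by (simp add: power2_eq_square)
    finally have "side_form R p \<noteq> 0" by auto
    moreover have "anti_moebius R p = Infty" using True by (simp add: anti_moebius_def Pt d c_def)
    ultimately show ?thesis using Pt by simp
  next
    case False
    then have "anti_moebius R p = Pt ((of_real a * cnj z + of_real b) / (of_real c * cnj z - of_real a))"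
      by (simp add: anti_moebius_def Pt d moebius_def a_def b_def c_def)
    then have "anti_moebius R p = p \<longleftrightarrow> of_real a * cnj z + of_real b = z * (of_real c * cnj z - of_real a)"
      using False Pt by (simp add: divide_eq_eq)
    also have "\<dots> \<longleftrightarrow> of_real c * (z * cnj z) - of_real a * (z + cnj z) - of_real b = 0"
      by (auto simp: algebra_simps)
    also have "of_real c * (z * cnj z) - of_real a * (z + cnj z) - of_real b = complex_of_real (side_form R p)"
      unfolding zz form by (simp add: complex_add_cnj complex_eq_iff)
    finally show ?thesis by simp
  qed
qed

text \<open>k and l are unit normals of two lines through 0, the first containing n and the second
  m. Up to scaling they are n and m turned by a right angle; the positivity conditions settle the
  signs so that the normals enclose the supplementary angle.\<close>

lemma planar_perpendiculars:
  fixes k1 k2 l1 l2 m1 m2 n1 n2 :: real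
  assumes k: "k1\<^sup>2 + k2\<^sup>2 = 1" and l: "l1\<^sup>2 + l2\<^sup>2 = 1"
    and kn: "k1 * n1 + k2 * n2 = 0" and lm: "l1 * m1 + l2 * m2 = 0"
    and pos: "k1 * m1 + k2 * m2 > 0" "l1 * n1 + l2 * n2 > 0"
  shows "(k1 * l1 + k2 * l2) * (sqrt (m1\<^sup>2 + m2\<^sup>2) * sqrt (n1\<^sup>2 + n2\<^sup>2)) = - (m1 * n1 + m2 * n2)"
proof -
  define c where "c = n2 * k1 - n1 * k2"
  define d where "d = m2 * l1 - m1 * l2"
  have kk: "k1 * k1 + k2 * k2 = 1" and ll: "l1 * l1 + l2 * l2 = 1" using k l by (auto simp: power2_eq_square)
  have "n1 = n1 * (k1 * k1 + k2 * k2)" "n2 = n2 * (k1 * k1 + k2 * k2)" by (simp_all add: kk)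
  moreover have "n1 * (k1 * k1 + k2 * k2) = k1 * (k1 * n1 + k2 * n2) - c * k2" "n2 * (k1 * k1 + k2 * k2) = k2 * (k1 * n1 + k2 * n2) + c * k1"
    by (simp_all add: c_def algebra_simps)
  ultimately have n: "n1 = - c * k2" "n2 = c * k1" using kn by auto
  have "m1 = m1 * (l1 * l1 + l2 * l2)" "m2 = m2 * (l1 * l1 + l2 * l2)" by (simp_all add: ll)
  moreover have "m1 * (l1 * l1 + l2 * l2) = l1 * (l1 * m1 + l2 * m2) - d * l2" "m2 * (l1 * l1 + l2 * l2) = l2 * (l1 * m1 + l2 * m2) + d * l1"
    by (simp_all add: d_def algebra_simps)
  ultimately have m: "m1 = - d * l2" "m2 = d * l1" using lm by auto
  have "m1\<^sup>2 + m2\<^sup>2 = d\<^sup>2 * (l1\<^sup>2 + l2\<^sup>2)" "n1\<^sup>2 + n2\<^sup>2 = c\<^sup>2 * (k1\<^sup>2 + k2\<^sup>2)"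
    by (simp_all add: m n power2_eq_square algebra_simps)
  then have s: "sqrt (m1\<^sup>2 + m2\<^sup>2) = \<bar>d\<bar>" "sqrt (n1\<^sup>2 + n2\<^sup>2) = \<bar>c\<bar>" using k l by simp_all
  have "(k1 * m1 + k2 * m2) * (l1 * n1 + l2 * n2) = - (c * d) * (k2 * l1 - k1 * l2)\<^sup>2"
    by (simp add: m n power2_eq_square algebra_simps)
  then have "- (c * d) * (k2 * l1 - k1 * l2)\<^sup>2 > 0" using mult_pos_pos[OF pos] by simp
  then have "c * d < 0" by (simp add: mult_less_0_iff zero_less_mult_iff)
  then have "\<bar>d\<bar> * \<bar>c\<bar> = - (c * d)" by (simp add: abs_mult[symmetric] mult.commute)
  then show ?thesis unfolding s by (simp add: m n algebra_simps)
qed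

text \<open>The numerator of \<open>disc_coord z p\<close> after multiplication by the conjugate
  denominator. It has the same argument, but is linear in the vector that represents p.\<close>

definition vertex_coord :: "complex \<Rightarrow> sphere_pt \<Rightarrow> complex" where
  "vertex_coord z p = of_real (sv0 p) - 2 * z * of_real (sv1 p) + z\<^sup>2 * of_real (sv2 p)"

lemma disc_coord_eq:
  assumes z: "Im z > 0" and p: "p \<in> closed_H2"
  obtains r where "r > 0" "disc_coord z p = of_real r * vertex_coord z p"
proof (cases p)
  case Infty
  then show ?thesis by (intro that[of 1]) (simp_all add: disc_coord_def vertex_coord_def sv0_def sv1_def sv2_def)
next
  case (Pt \<zeta>)
  have "Im \<zeta> \<ge> 0" using p Pt by (auto simp: closed_H2_def)
  then have ne: "\<zeta> - cnj z \<noteq> 0" using z by (auto simp: complex_eq_iff)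
  have "(\<zeta> - z) / (\<zeta> - cnj z) = (\<zeta> - z) * cnj (\<zeta> - cnj z) / of_real ((cmod (\<zeta> - cnj z))\<^sup>2)"
    by (rule complex_div_cnj)
  moreover have "(\<zeta> - z) * cnj (\<zeta> - cnj z) = vertex_coord z p"
  proof -
    have "(\<zeta> - z) * cnj (\<zeta> - cnj z) = \<zeta> * cnj \<zeta> - z * (\<zeta> + cnj \<zeta>) + z\<^sup>2" by (simp add: algebra_simps power2_eq_square)
    then show ?thesis
      unfolding vertex_coord_def Pt sv0_def sv1_def sv2_def sphere_pt.case complex_add_cnj complex_norm_square[symmetric] by simp
  qed
  ultimately show ?thesis using ne
    by (intro that[of "1 / (cmod (\<zeta> - cnj z))\<^sup>2"]) (simp_all add: disc_coord_def Pt)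
qed

lemma trace_mult_2: "trace ((A :: real^2^2) ** B) = A$1$1 * B$1$1 + A$1$2 * B$2$1 + A$2$1 * B$1$2 + A$2$2 * B$2$2"
  by (simp add: trace_2 matrix_2_mult)

text \<open>In terms of \<open>vertex_coord\<close> a side through z becomes a line through 0 with
  unit normal (k1, k2). The trace of a product of two reflections is twice the inner product of the
  normals, so the planar statement applies.\<close>

lemma trace_interior_vertex:
  assumes z: "Im z > 0" and vw: "v \<in> closed_H2" "w \<in> closed_H2"
    and R: "reflection_matrix R" "reflection_matrix R'"
    and fix_R: "side_form R (Pt z) = 0" "side_form R w = 0" "side_form R' (Pt z) = 0" "side_form R' v = 0"
    and pos: "side_form R v > 0" "side_form R' w > 0"
  shows "trace (R ** R') = - 2 * cos (interior_angle (Pt z) v w)"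
proof -
  define x where "x = Re z"
  define y where "y = Im z"
  have y: "y > 0" using z by (simp add: y_def)
  define k1 where "k1 = (\<lambda>R :: real^2^2. R$2$1 * y)"
  define k2 where "k2 = (\<lambda>R :: real^2^2. - (R$2$1 * x - R$1$1))"
  define N where "N = vertex_coord z"
  have b_eq: "Q$1$2 = Q$2$1 * (x\<^sup>2 + y\<^sup>2) - 2 * Q$1$1 * x" if "side_form Q (Pt z) = 0" for Q
    using that by (simp add: side_form_def sv0_def sv1_def sv2_def cmod_power2 x_def y_def)
  have form: "y * side_form Q p = k1 Q * Re (N p) + k2 Q * Im (N p)" if "side_form Q (Pt z) = 0" for Q p
    unfolding side_form_def b_eq[OF that] N_def vertex_coord_def k1_def k2_def
    by (simp add: x_def[symmetric] y_def[symmetric] power2_eq_square algebra_simps)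
  have unit: "(k1 Q)\<^sup>2 + (k2 Q)\<^sup>2 = 1" if "side_form Q (Pt z) = 0" "reflection_matrix Q" for Q
  proof -
    have "(k1 Q)\<^sup>2 + (k2 Q)\<^sup>2 = (Q$1$1)\<^sup>2 + Q$1$2 * Q$2$1"
      unfolding b_eq[OF that(1)] k1_def k2_def by (simp add: power2_eq_square algebra_simps)
    then show ?thesis using reflection_matrixD(2)[OF that(2)] by simp
  qed
  have tr: "trace (R ** R') = 2 * (k1 R * k1 R' + k2 R * k2 R')"
    unfolding trace_mult_2 b_eq[OF fix_R(1)] b_eq[OF fix_R(3)] reflection_matrixD(1)[OF R(1)] reflection_matrixD(1)[OF R(2)] k1_def k2_def
    by (simp add: power2_eq_square algebra_simps)
  have perp: "k1 R * Re (N w) + k2 R * Im (N w) = 0" "k1 R' * Re (N v) + k2 R' * Im (N v) = 0"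
    using form[OF fix_R(1), of w] form[OF fix_R(3), of v] fix_R by auto
  have P: "k1 R * Re (N v) + k2 R * Im (N v) > 0" "k1 R' * Re (N w) + k2 R' * Im (N w) > 0"
    using form[OF fix_R(1), of v] form[OF fix_R(3), of w] pos y mult_pos_pos[OF y pos(1)] mult_pos_pos[OF y pos(2)] by auto
  have main: "(k1 R * k1 R' + k2 R * k2 R') * (cmod (N v) * cmod (N w)) = - Re (N v * cnj (N w))"
    using planar_perpendiculars[OF unit[OF fix_R(1) R(1)] unit[OF fix_R(3) R(2)] perp P]
    by (simp add: cmod_def)
  have nz: "N v \<noteq> 0" "N w \<noteq> 0" using P by auto
  obtain r where r: "r > 0" "disc_coord z v = of_real r * N v" using disc_coord_eq[OF z vw(1)] unfolding N_def by blast
  obtain s where s: "s > 0" "disc_coord z w = of_real s * N w" using disc_coord_eq[OF z vw(2)] unfolding N_def by blast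
  define q where "q = disc_coord z v / disc_coord z w"
  have q: "q = of_real (r / s / (cmod (N w))\<^sup>2) * (N v * cnj (N w))"
  proof -
    have "N v / N w = N v * cnj (N w) / of_real ((cmod (N w))\<^sup>2)" by (rule complex_div_cnj)
    moreover have "q = of_real (r / s) * (N v / N w)" unfolding q_def r(2) s(2) by simp
    ultimately show ?thesis by simp
  qed
  define t where "t = r / s / (cmod (N w))\<^sup>2"
  have t: "t > 0" using r s nz by (simp add: t_def)
  have "q \<noteq> 0" using q r s nz by simp
  have "cos (interior_angle (Pt z) v w) = cos (Arg q)"
    using z by (simp add: interior_angle_def q_def)
  also have "\<dots> = Re q / cmod q"
    using \<open>q \<noteq> 0\<close> cos_Arg[of q] by simp
  also have "\<dots> = Re (N v * cnj (N w)) / (cmod (N v) * cmod (N w))"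
  proof -
    have "Re q = t * Re (N v * cnj (N w))" unfolding q t_def[symmetric] by simp
    moreover have "cmod q = t * (cmod (N v) * cmod (N w))" unfolding q t_def[symmetric] norm_mult using t by simp
    ultimately show ?thesis using t by simp
  qed
  finally have c: "cos (interior_angle (Pt z) v w) = Re (N v * cnj (N w)) / (cmod (N v) * cmod (N w))" .
  have "k1 R * k1 R' + k2 R * k2 R' = - (Re (N v * cnj (N w)) / (cmod (N v) * cmod (N w)))"
    using main nz by (simp add: nonzero_eq_divide_eq minus_divide_left)
  then have "k1 R * k1 R' + k2 R * k2 R' = - cos (interior_angle (Pt z) v w)" unfolding c .
  then show ?thesis unfolding tr by (simp only: mult_minus_left mult_minus_right)
qed

lemma square_one_cases: "(s::real)\<^sup>2 = 1 \<Longrightarrow> s = 1 \<or> s = - 1"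
  by (simp add: power2_eq_1_iff)

text \<open>A reflection whose axis ends at the vertex carries a sign s, which is 1 or -1, and the
  trace of a product is 2 s s'. Each form is positive at the opposite vertex; this puts u and v in
  opposite order for the two reflections and forces opposite signs.\<close>

lemma trace_ideal_vertex:
  assumes ideal: "w = Infty \<or> (\<exists>x. w = Pt (of_real x))" and uv: "u \<in> closed_H2" "v \<in> closed_H2"
    and R: "reflection_matrix R" "reflection_matrix R'"
    and fix_R: "side_form R w = 0" "side_form R v = 0" "side_form R' w = 0" "side_form R' u = 0"
    and pos: "side_form R u > 0" "side_form R' v > 0"
  shows "trace (R ** R') = - 2"
  using ideal
proof
  assume w: "w = Infty"
  then have r0: "R$2$1 = 0" "R'$2$1 = 0" using fix_R by (auto simp: side_form_def sv0_def sv1_def sv2_def)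
  have sq: "R$1$1 = 1 \<or> R$1$1 = - 1" "R'$1$1 = 1 \<or> R'$1$1 = - 1"
    using reflection_matrixD(2)[OF R(1)] reflection_matrixD(2)[OF R(2)] r0 square_one_cases by auto
  obtain z where z: "u = Pt z" using pos(1) r0 by (cases u) (auto simp: side_form_def sv0_def sv1_def sv2_def)
  obtain z' where z': "v = Pt z'" using pos(2) r0 by (cases v) (auto simp: side_form_def sv0_def sv1_def sv2_def)
  have "- 2 * R$1$1 * (Re z - Re z') > 0" "- 2 * R'$1$1 * (Re z' - Re z) > 0"
    using pos fix_R r0 by (auto simp: z z' side_form_def sv0_def sv1_def sv2_def algebra_simps)
  then have "R$1$1 * R'$1$1 = - 1" using sq by auto
  then show ?thesis unfolding trace_mult_2 reflection_matrixD(1)[OF R(1)] reflection_matrixD(1)[OF R(2)] by (simp add: r0)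
next
  assume "\<exists>x. w = Pt (of_real x)"
  then obtain x where w: "w = Pt (of_real x)" by blast
  define s where "s = (\<lambda>Q :: real^2^2. Q$2$1 * x - Q$1$1)"
  define A where "A = (\<lambda>p. sv0 p - 2 * x * sv1 p + x\<^sup>2 * sv2 p)"
  define B where "B = (\<lambda>p. sv1 p - x * sv2 p)"
  have b_eq: "Q$1$2 = Q$2$1 * x\<^sup>2 - 2 * Q$1$1 * x" if "side_form Q w = 0" for Q
    using that by (simp add: w side_form_def sv0_def sv1_def sv2_def)
  have form: "side_form Q p = Q$2$1 * A p + 2 * s Q * B p" if "side_form Q w = 0" for Q p
    unfolding side_form_def b_eq[OF that] A_def B_def s_def by (simp add: power2_eq_square algebra_simps)
  have s1: "s Q = 1 \<or> s Q = - 1" if "side_form Q w = 0" "reflection_matrix Q" for Q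
  proof (rule square_one_cases)
    have "(s Q)\<^sup>2 = (Q$1$1)\<^sup>2 + Q$1$2 * Q$2$1" unfolding b_eq[OF that(1)] s_def by (simp add: power2_eq_square algebra_simps)
    then show "(s Q)\<^sup>2 = 1" using reflection_matrixD(2)[OF that(2)] by simp
  qed
  have A_pos: "A p > 0 \<or> B p = 0 \<and> A p = 0" if p: "p \<in> closed_H2" for p
  proof (cases p)
    case Infty
    then show ?thesis by (simp add: A_def sv0_def sv1_def sv2_def)
  next
    case (Pt z)
    have "A p = (Re z - x)\<^sup>2 + (Im z)\<^sup>2"
      unfolding A_def Pt sv0_def sv1_def sv2_def sphere_pt.case cmod_power2 by (simp add: power2_eq_square algebra_simps)
    moreover have "B p = Re z - x" by (simp add: B_def Pt sv1_def sv2_def)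
    ultimately show ?thesis by (cases "Re z = x \<and> Im z = 0") (auto simp: sum_power2_gt_zero_iff)
  qed
  have Au: "A u > 0" using A_pos[OF uv(1)] pos(1) form[OF fix_R(1), of u] by auto
  have Av: "A v > 0" using A_pos[OF uv(2)] pos(2) form[OF fix_R(3), of v] by auto
  \<comment> \<open>B / A is the real part of the point after x has been sent to \<infinity> by
    inversion, so the sign of X compares u and v in that picture.\<close>
  define X where "X = B u * A v - B v * A u"
  have e1: "R$2$1 * A v = - (2 * s R * B v)" "R'$2$1 * A u = - (2 * s R' * B u)"
    using form[OF fix_R(1), of v] form[OF fix_R(3), of u] fix_R by auto
  have "A v * side_form R u = (R$2$1 * A v) * A u + 2 * s R * B u * A v" unfolding form[OF fix_R(1)] by (simp add: algebra_simps)
  also have "\<dots> = 2 * s R * X" unfolding e1 X_def by (simp add: algebra_simps)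
  finally have p1: "2 * s R * X > 0" using mult_pos_pos[OF Av pos(1)] by simp
  have "A u * side_form R' v = (R'$2$1 * A u) * A v + 2 * s R' * B v * A u" unfolding form[OF fix_R(3)] by (simp add: algebra_simps)
  also have "\<dots> = - 2 * s R' * X" unfolding e1 X_def by (simp add: algebra_simps)
  finally have p2: "- 2 * s R' * X > 0" using mult_pos_pos[OF Au pos(2)] by simp
  have "s R * s R' = - 1" using p1 p2 s1[OF fix_R(1) R(1)] s1[OF fix_R(3) R(2)] by auto
  moreover have "trace (R ** R') = 2 * (s R * s R')"
    unfolding trace_mult_2 b_eq[OF fix_R(1)] b_eq[OF fix_R(3)] reflection_matrixD(1)[OF R(1)] reflection_matrixD(1)[OF R(2)] s_def
    by (simp add: power2_eq_square algebra_simps)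
  ultimately show ?thesis by simp
qed

lemma trace_vertex:
  assumes uvw: "u \<in> closed_H2" "v \<in> closed_H2" "w \<in> closed_H2"
    and R: "reflection_matrix R" "reflection_matrix R'"
    and fix_R: "side_form R u = 0" "side_form R w = 0" "side_form R' u = 0" "side_form R' v = 0"
    and pos: "side_form R v > 0" "side_form R' w > 0"
  shows "trace (R ** R') = - 2 * cos (interior_angle u v w)"
proof (cases "\<exists>z. u = Pt z \<and> Im z > 0")
  case True
  then show ?thesis using trace_interior_vertex[OF _ uvw(2,3) R] fix_R pos by blast
next
  case False
  have ang: "interior_angle u v w = 0" using False by (auto simp: interior_angle_def split: sphere_pt.splits)
  have "u = Infty \<or> (\<exists>x. u = Pt (of_real x))"
  proof (cases u)
    case (Pt z)
    then have "Im z = 0" using False uvw(1) by (auto simp: closed_H2_def)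
    then have "z = of_real (Re z)" by (simp add: complex_eq_iff)
    then show ?thesis using Pt by blast
  qed simp
  from trace_ideal_vertex[OF this uvw(2,3) R fix_R pos] show ?thesis unfolding ang by simp
qed

lemma reflection_matrix_uminus: "reflection_matrix R \<Longrightarrow> reflection_matrix (- R)"
  by (simp add: reflection_matrix_def det_uminus_2 trace_uminus)

lemma side_form_uminus: "side_form (- R) p = - side_form R p"
  by (simp add: side_form_def)

text \<open>A side determines its reflection matrix up to sign. Making each matrix positive at the
  opposite vertex fixes all three traces with their signs at once, and the products in PSL(2,R) do
  not change.\<close>

lemma triangle_group_traces:
  assumes "triangle_group p q r S"
  obtains R\<^sub>1 R\<^sub>2 R\<^sub>3 where "reflection_matrix R\<^sub>1" "reflection_matrix R\<^sub>2" "reflection_matrix R\<^sub>3"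
    "trace (R\<^sub>2 ** R\<^sub>3) = - 2 * cos (signature_angle p)" "trace (R\<^sub>3 ** R\<^sub>1) = - 2 * cos (signature_angle q)"
    "trace (R\<^sub>1 ** R\<^sub>2) = - 2 * cos (signature_angle r)"
    "S = generate PSL2R {psl (R\<^sub>1 ** R\<^sub>2), psl (R\<^sub>2 ** R\<^sub>3), psl (R\<^sub>3 ** R\<^sub>1)}"
proof -
  obtain u v w R\<^sub>1 R\<^sub>2 R\<^sub>3 where tri: "hyperbolic_triangle u v w"
    and ang: "interior_angle u v w = signature_angle p" "interior_angle v w u = signature_angle q" "interior_angle w u v = signature_angle r"
    and side: "reflection_in_side R\<^sub>1 v w" "reflection_in_side R\<^sub>2 w u" "reflection_in_side R\<^sub>3 u v"
    and S: "S = generate PSL2R {psl (R\<^sub>1 ** R\<^sub>2), psl (R\<^sub>2 ** R\<^sub>3), psl (R\<^sub>3 ** R\<^sub>1)}"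
    using assms unfolding triangle_group_def by blast
  have mem: "u \<in> closed_H2" "v \<in> closed_H2" "w \<in> closed_H2" using tri by (auto simp: hyperbolic_triangle_def)
  have refl: "reflection_matrix R\<^sub>1" "reflection_matrix R\<^sub>2" "reflection_matrix R\<^sub>3" using side by (auto simp: reflection_in_side_def)
  have z: "side_form R\<^sub>1 v = 0" "side_form R\<^sub>1 w = 0" "side_form R\<^sub>2 w = 0" "side_form R\<^sub>2 u = 0" "side_form R\<^sub>3 u = 0" "side_form R\<^sub>3 v = 0"
    using side anti_moebius_fixed_iff mem by (auto simp: reflection_in_side_def)
  have collinear: False if "reflection_matrix R" "side_form R u = 0" "side_form R v = 0" "side_form R w = 0" for R
  proof -
    have "\<forall>p\<in>{u, v, w}. anti_moebius R p = p" using that anti_moebius_fixed_iff[OF that(1)] mem by auto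
    then show False using tri that(1) unfolding hyperbolic_triangle_def by blast
  qed
  have nz: "side_form R\<^sub>1 u \<noteq> 0" "side_form R\<^sub>2 v \<noteq> 0" "side_form R\<^sub>3 w \<noteq> 0"
    using collinear[OF refl(1)] collinear[OF refl(2)] collinear[OF refl(3)] z by blast+
  define Q1 where "Q1 = (if side_form R\<^sub>1 u > 0 then R\<^sub>1 else - R\<^sub>1)"
  define Q2 where "Q2 = (if side_form R\<^sub>2 v > 0 then R\<^sub>2 else - R\<^sub>2)"
  define Q3 where "Q3 = (if side_form R\<^sub>3 w > 0 then R\<^sub>3 else - R\<^sub>3)"
  have reflQ: "reflection_matrix Q1" "reflection_matrix Q2" "reflection_matrix Q3"
    using refl reflection_matrix_uminus by (auto simp: Q1_def Q2_def Q3_def)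
  have zQ: "side_form Q1 v = 0" "side_form Q1 w = 0" "side_form Q2 w = 0" "side_form Q2 u = 0" "side_form Q3 u = 0" "side_form Q3 v = 0"
    using z by (auto simp: Q1_def Q2_def Q3_def side_form_uminus)
  have pos: "side_form Q1 u > 0" "side_form Q2 v > 0" "side_form Q3 w > 0"
    using nz by (auto simp: Q1_def Q2_def Q3_def side_form_uminus)
  have pslQ: "psl (Q1 ** Q2) = psl (R\<^sub>1 ** R\<^sub>2)" "psl (Q2 ** Q3) = psl (R\<^sub>2 ** R\<^sub>3)" "psl (Q3 ** Q1) = psl (R\<^sub>3 ** R\<^sub>1)"
    by (auto simp: Q1_def Q2_def Q3_def matrix_mult_minus psl_uminus)
  show ?thesis
  proof (rule that[OF reflQ])
    show "trace (Q2 ** Q3) = - 2 * cos (signature_angle p)"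
      using trace_vertex[OF mem(1,2,3) reflQ(2,3) zQ(4,3,5,6) pos(2,3)] ang by simp
    show "trace (Q3 ** Q1) = - 2 * cos (signature_angle q)"
      using trace_vertex[OF mem(2,3,1) reflQ(3,1) zQ(6,5,1,2) pos(3,1)] ang by simp
    show "trace (Q1 ** Q2) = - 2 * cos (signature_angle r)"
      using trace_vertex[OF mem(3,1,2) reflQ(1,2) zQ(2,1,3,4) pos(1,2)] ang by simp
    show "S = generate PSL2R {psl (Q1 ** Q2), psl (Q2 ** Q3), psl (Q3 ** Q1)}" unfolding pslQ by (rule S)
  qed
qed

section \<open>Normal forms of the generators\<close>

text \<open>With x = cos (pi/5), the relation cos (3 pi/5) = - cos (2 pi/5) becomes a cubic with the
  factor x + 1, and the remaining quadratic has discriminant a multiple of 5. So tripling the angle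
  realises the Galois automorphism.\<close>

lemma cos_pi_fifths:
  "2 * cos (pi / 5) = 1 / 2 + 1 / 2 * sqrt 5" "2 * cos (3 * (pi / 5)) = 1 / 2 - 1 / 2 * sqrt 5"
proof -
  define x where "x = cos (pi / 5)"
  have x: "x > 0" unfolding x_def by (intro cos_gt_zero) auto
  have c2: "cos (2 * (pi / 5)) = 2 * x\<^sup>2 - 1" unfolding x_def by (rule cos_double_cos)
  have "cos (3 * (pi / 5)) = 4 * x ^ 3 - 3 * x" unfolding x_def by (rule cos_treble_cos)
  moreover have c3: "cos (3 * (pi / 5)) = - cos (2 * (pi / 5))"
  proof -
    have "3 * (pi / 5) = pi - 2 * (pi / 5)" by simp
    then show ?thesis by (simp only: cos_pi_minus)
  qed
  ultimately have "(x + 1) * (4 * x\<^sup>2 - 2 * x - 1) = 0"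
    unfolding c2 by (simp add: power2_eq_square power3_eq_cube algebra_simps)
  then have q: "4 * x\<^sup>2 - 2 * x - 1 = 0" using x by simp
  then have sq: "(4 * x - 1)\<^sup>2 = 5" by (simp add: power2_eq_square algebra_simps)
  from sq have "sqrt 5 = \<bar>4 * x - 1\<bar>" by (metis real_sqrt_abs)
  \<comment> \<open>As x > 0, a negative value would lie between -1 and 0 and could not have square
    5.\<close>
  moreover have "4 * x - 1 \<ge> 0"
  proof (rule ccontr)
    assume "\<not> 4 * x - 1 \<ge> 0"
    then have "\<bar>4 * x - 1\<bar> < 1" using x by simp
    then have "(4 * x - 1)\<^sup>2 < 1" by (simp only: abs_square_less_1)
    then show False using sq by simp
  qed
  ultimately have s: "sqrt 5 = 4 * x - 1" by simp
  show "2 * cos (pi / 5) = 1 / 2 + 1 / 2 * sqrt 5" unfolding s x_def[symmetric] by (simp add: field_simps)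
  show "2 * cos (3 * (pi / 5)) = 1 / 2 - 1 / 2 * sqrt 5" unfolding s c3 c2 using q by (simp add: field_simps)
qed

lemma sqrt5_bounds: "2 < sqrt 5" "sqrt 5 < 3"
proof -
  show "2 < sqrt 5" by (rule real_less_rsqrt) simp
  have "sqrt 5 < sqrt (3\<^sup>2)" by (subst real_sqrt_less_iff) simp
  then show "sqrt 5 < 3" by simp
qed

text \<open>In a basis v, w with v fixed by x, the vector w is chosen so that y gets the first
  column of Q. The determinant and trace of each matrix and the trace of x y fill in the other
  entries. That v and w are independent is where y must have no real eigenvector.\<close>

lemma conjugate_to_normal_form:
  assumes x: "det x = 1" "trace x = 2" and y: "det y = 1" "\<bar>trace y\<bar> < 2"
    and Q: "det Q = 1" "trace Q = trace y" "Q$2$1 \<noteq> 0" "trace (mat2 1 t 0 1 ** Q) = trace (x ** y)"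
  obtains P where "det P \<noteq> 0" "x = conj2 P (mat2 1 t 0 1)" "y = conj2 P Q"
proof -
  have "1\<^sup>2 - trace x * 1 + det x = 0" using x by simp
  then obtain v where v: "v \<noteq> 0" "x *v v = 1 *\<^sub>R v" using exists_eigenvector_2 by blast
  define w where "w = (1 / Q$2$1) *\<^sub>R (y *v v - Q$1$1 *\<^sub>R v)"
  have yv: "y *v v = Q$1$1 *\<^sub>R v + Q$2$1 *\<^sub>R w" using Q(3) by (simp add: w_def)
  define P where "P = mat2 (v$1) (w$1) (v$2) (w$2)"
  have Pe: "P *v vector [1, 0] = v" "P *v vector [0, 1] = w" by (simp_all add: P_def vector_2_eq_iff matrix_2_vector)
  have P: "det P \<noteq> 0"
  proof
    assume "det P = 0"
    then have "v$1 * w$2 = v$2 * w$1" by (simp add: P_def mult.commute)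
    then obtain k where "w = k *\<^sub>R v" using parallel_2[OF v(1)] by blast
    then have "y *v v = (Q$1$1 + Q$2$1 * k) *\<^sub>R v" unfolding yv by (simp add: algebra_simps)
    then show False using no_real_eigenvector[OF y v(1)] by blast
  qed
  note inv = matrix_inv_2[OF P]
  define X where "X = matrix_inv P ** x ** P"
  define Y where "Y = matrix_inv P ** y ** P"
  have conj_back: "conj2 P (matrix_inv P ** M ** P) = M" for M
  proof -
    have "conj2 P (matrix_inv P ** M ** P) = (P ** matrix_inv P) ** M ** (P ** matrix_inv P)"
      by (simp only: conj2_def matrix_mul_assoc)
    then show ?thesis by (simp add: inv)
  qed
  have xX: "x = conj2 P X" and yY: "y = conj2 P Y" unfolding X_def Y_def conj_back by simp_all
  have iP: "matrix_inv P *v v = vector [1, 0]" "matrix_inv P *v w = vector [0, 1]"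
    unfolding Pe[symmetric] matrix_vector_mul_assoc inv by simp_all
  have "X *v vector [1, 0] = vector [1, 0]"
    unfolding X_def by (simp only: matrix_vector_mul_assoc[symmetric] Pe v(2) scaleR_one iP)
  then have X1: "X$1$1 = 1" "X$2$1 = 0" by (auto simp: vector_2_eq_iff matrix_2_vector)
  have "Y *v vector [1, 0] = Q$1$1 *\<^sub>R vector [1, 0] + Q$2$1 *\<^sub>R vector [0, 1]"
    unfolding Y_def
    by (simp only: matrix_vector_mul_assoc[symmetric] Pe yv matrix_vector_right_distrib matrix_vector_mult_scaleR iP)
  then have Y1: "Y$1$1 = Q$1$1" "Y$2$1 = Q$2$1" by (auto simp: vector_2_eq_iff matrix_2_vector)
  have trX: "trace X = 2" and trY: "trace Y = trace y" and detY: "det Y = 1" and trXY: "trace (X ** Y) = trace (x ** y)"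
    using x y xX yY P by (metis trace_conj2, metis trace_conj2, metis det_conj2, metis conj2_mult trace_conj2)
  have X2: "X$2$2 = 1" using trX X1 by (simp add: trace_2)
  have Y2: "Y$2$2 = Q$2$2" using trY Q(2) Y1 by (simp add: trace_2)
  have "Q$2$1 * Y$1$2 = Q$2$1 * Q$1$2" using detY Q(1) unfolding det_2 Y1 Y2 by (simp only: mult.commute)
  then have Y3: "Y$1$2 = Q$1$2" using Q(3) by simp
  have "Q$1$1 + X$1$2 * Q$2$1 + Q$2$2 = trace (x ** y)" using trXY by (simp add: trace_mult_2[of X Y] X1 X2 Y1 Y2)
  moreover have "Q$1$1 + t * Q$2$1 + Q$2$2 = trace (x ** y)" using Q(4) by (simp add: trace_mult_2[of _ Q])
  ultimately have "X$1$2 * Q$2$1 = t * Q$2$1" by linarith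
  then have X3: "X$1$2 = t" using Q(3) by simp
  have "X = mat2 1 t 0 1" "Y = Q" using X1 X2 X3 Y1 Y2 Y3 by (auto simp: matrix_2_eq_iff)
  then show ?thesis using that[OF P] xX yY by simp
qed

context hecke
begin

text \<open>U V_(n-1) = S expresses the inverse of U as a word up to sign, and S is its own inverse
  up to sign.\<close>

lemma words_adj2: "words A B \<Longrightarrow> words (adj2 A) (adj2 B)"
proof (induction rule: words.induct)
  case one
  have "adj2 (mat 1) = mat 1" by (simp add: adj2_def matrix_2_eq_iff)
  then show ?case by (simp add: words.one)
next
  case (S A B)
  have "adj2 hS = - hS" by (simp add: adj2_def hS_def matrix_2_eq_iff)
  moreover have "words (- hS) (- hS)" using words_uminus[OF words.S[OF words.one]] by simp
  ultimately show ?case using words_mult[OF S.IH] by (simp add: adj2_mult)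
next
  case (U A B)
  have inv: "adj2 (hU x) = - (hV x (n - 1) ** hS)" if "sin x \<noteq> 0" "hV x n = hS" for x
  proof -
    have e: "hU x ** hV x (n - 1) = hS" using hU_hV[OF that(1), of "n - 1"] n that(2) by simp
    have "adj2 (hU x) ** (hU x ** hV x (n - 1)) ** hS = hV x (n - 1) ** hS"
      using mult_adj2(2)[of "hU x"] by (simp add: matrix_mul_assoc det_hecke)
    then show ?thesis unfolding e by (simp add: matrix_mul_assoc[symmetric] hS_hS matrix_mult_minus eq_neg_iff_add_eq_0 neg_eq_iff_add_eq_0)
  qed
  have "words (- (hV \<omega> (n - 1) ** hS)) (- (hV (3 * \<omega>) (n - 1) ** hS))"
    using words_uminus[OF words_mult[OF words_hV words.S[OF words.one]], of "n - 1"] by simp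
  then have "words (adj2 (hU \<omega>)) (adj2 (hU (3 * \<omega>)))"
    using inv[OF _ hV_n_omega(1)] inv[OF _ hV_n_omega(2)] sin_pos by auto
  then show ?case using words_mult[OF U.IH] by (simp add: adj2_mult)
qed

text \<open>Words are built on the left, but cosets have to be followed under multiplication on the
  right; the accumulators X and Y stay general in the induction.\<close>

lemma words_right_closed:
  assumes "words A B" and "\<And>A B. R A B \<Longrightarrow> R (A ** hS) (B ** hS)" "\<And>A B. R A B \<Longrightarrow> R (A ** hU \<omega>) (B ** hU (3 * \<omega>))"
    and "R X Y"
  shows "R (X ** A) (Y ** B)"
  using assms(1,4) by (induction arbitrary: X Y rule: words.induct) (auto simp: matrix_mul_assoc intro: assms(2,3))

lemma words_hT: "words (hT \<omega>) (hT (3 * \<omega>))"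
  using words_uminus[OF words.U[OF words.S[OF words.one]]] by (simp add: hT_eq)

end

lemma hU_square: "hU x ** hU x = mat2 (4 * (cos x)\<^sup>2 - 1) (- 2 * cos x) (2 * cos x) (- 1)"
  by (simp add: hU_def mat2_mult power2_eq_square)

lemma hU_inverse_square: "adj2 (hU x ** hU x) = mat2 (- 1) (2 * cos x) (- 2 * cos x) (4 * (cos x)\<^sup>2 - 1)"
  unfolding hU_square by (simp add: adj2_def)

lemma hU_eq: "hU x = hT x ** hS"
  by (simp add: hU_def hT_def hS_def mat2_mult)

section \<open>From generators with prescribed traces to pairs of Hecke words\<close>

context conjugate_embeddings
begin

text \<open>x' and y' are lifted with the same signs as x and y, so all three traces, also that of
  the product, are exactly conjugate. These numbers are all that is needed to recognise the second
  factor.\<close>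

lemma generators_in_pairs:
  assumes x: "det x = 1" and y: "det y = 1" and S: "S = generate PSL2R {psl x, psl y, psl (adj2 (x ** y))}"
    and cover: "S \<subseteq> (\<lambda>\<epsilon>. psl (\<phi> \<epsilon>)) ` U"
  obtains x' y' where "subgroup S PSL2R" "(x, x') \<in> unit_pairs U \<phi> \<phi>' S" "(y, y') \<in> unit_pairs U \<phi> \<phi>' S"
    "\<And>p q. p \<in> \<rat> \<Longrightarrow> q \<in> \<rat> \<Longrightarrow> trace x = p + q * sqrt 5 \<Longrightarrow> trace x' = p - q * sqrt 5"
    "\<And>p q. p \<in> \<rat> \<Longrightarrow> q \<in> \<rat> \<Longrightarrow> trace y = p + q * sqrt 5 \<Longrightarrow> trace y' = p - q * sqrt 5"
    "\<And>p q. p \<in> \<rat> \<Longrightarrow> q \<in> \<rat> \<Longrightarrow> trace (x ** y) = p + q * sqrt 5 \<Longrightarrow> trace (x' ** y') = p - q * sqrt 5"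
proof -
  have carr: "{psl x, psl y, psl (adj2 (x ** y))} \<subseteq> carrier PSL2R"
    using x y by (auto intro!: psl_carrier simp: det_adj2 det_mul)
  have sub: "subgroup S PSL2R" unfolding S by (rule group.generate_is_subgroup[OF group_PSL2R carr])
  have lift: "\<exists>\<epsilon>\<in>U. \<exists>c. (c = 1 \<or> c = - 1) \<and> z = c *\<^sub>R \<phi> \<epsilon> \<and> psl (\<phi> \<epsilon>) = psl z" if "psl z \<in> S" for z
  proof -
    have "psl z \<in> (\<lambda>\<epsilon>. psl (\<phi> \<epsilon>)) ` U" using that cover by (rule subsetD[rotated])
    then obtain \<epsilon> where e: "psl z = psl (\<phi> \<epsilon>)" "\<epsilon> \<in> U" by (rule imageE)
    note e = e(2) e(1)[symmetric]
    then have "z = \<phi> \<epsilon> \<or> z = - \<phi> \<epsilon>" unfolding psl_eq_iff by auto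
    then have "\<exists>c. (c = 1 \<or> c = - 1) \<and> z = c *\<^sub>R \<phi> \<epsilon>"
    proof
      assume "z = \<phi> \<epsilon>"
      then show ?thesis by (intro exI[of _ 1]) simp
    next
      assume "z = - \<phi> \<epsilon>"
      then show ?thesis by (intro exI[of _ "- 1"]) simp
    qed
    then show ?thesis using e by blast
  qed
  have xS: "psl x \<in> S" and yS: "psl y \<in> S" unfolding S by (auto intro: generate.incl)
  obtain \<epsilon> c where e: "\<epsilon> \<in> U" "c = 1 \<or> c = - 1" "x = c *\<^sub>R \<phi> \<epsilon>" "psl (\<phi> \<epsilon>) = psl x" using lift[OF xS] by blast
  obtain \<delta> d where d: "\<delta> \<in> U" "d = 1 \<or> d = - 1" "y = d *\<^sub>R \<phi> \<delta>" "psl (\<phi> \<delta>) = psl y" using lift[OF yS] by blast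
  define x' where "x' = c *\<^sub>R \<phi>' \<epsilon>"
  define y' where "y' = d *\<^sub>R \<phi>' \<delta>"
  have cd: "c * d = 1 \<or> c * d = - 1" using e(2) d(2) by auto
  have xy: "x ** y = (c * d) *\<^sub>R \<phi> (qmult a b \<epsilon> \<delta>)" "x' ** y' = (c * d) *\<^sub>R \<phi>' (qmult a b \<epsilon> \<delta>)"
    unfolding e(3) d(3) x'_def y'_def phi_mult[OF e(1) d(1)] by (simp_all add: scaleR_matrix_2)
  have xG: "(x, x') \<in> unit_pairs U \<phi> \<phi>' S"
  proof -
    have "psl (\<phi> \<epsilon>) \<in> S" using e(4) xS by simp
    then show ?thesis unfolding unit_pairs_def mem_psl_iff using e(1,2) by (auto simp: e(3) x'_def)
  qed
  have yG: "(y, y') \<in> unit_pairs U \<phi> \<phi>' S"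
  proof -
    have "psl (\<phi> \<delta>) \<in> S" using d(4) yS by simp
    then show ?thesis unfolding unit_pairs_def mem_psl_iff using d(1,2) by (auto simp: d(3) y'_def)
  qed
  show ?thesis
  proof (rule that[OF sub xG yG])
    fix p q :: real assume pq: "p \<in> \<rat>" "q \<in> \<rat>"
    show "trace x = p + q * sqrt 5 \<Longrightarrow> trace x' = p - q * sqrt 5"
      using galois_trace[OF e(1,3) x'_def e(2) _ pq] .
    show "trace y = p + q * sqrt 5 \<Longrightarrow> trace y' = p - q * sqrt 5"
      using galois_trace[OF d(1,3) y'_def d(2) _ pq] .
    show "trace (x ** y) = p + q * sqrt 5 \<Longrightarrow> trace (x' ** y') = p - q * sqrt 5"
      using galois_trace[OF U_mult[OF e(1) d(1)] xy cd _ pq] .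
  qed
qed

text \<open>The hypothesis \<open>coset\<close> speaks of every relation closed under the group
  operations. This keeps the computations with Hecke words, which differ between the signatures,
  apart from conjugation and quaternions.\<close>

lemma pair_group_of_normal_form:
  assumes gen: "S = generate PSL2R {psl x, psl y, psl (adj2 (x ** y))}"
    and cover: "S \<subseteq> (\<lambda>\<epsilon>. psl (\<phi> \<epsilon>)) ` U" and sub: "subgroup S PSL2R"
    and G: "(x, x') \<in> unit_pairs U \<phi> \<phi>' S" "(y, y') \<in> unit_pairs U \<phi> \<phi>' S"
    and hk: "hecke n" and w: "w = hecke.\<omega> n"
    and P: "det P \<noteq> 0" "x = conj2 P (hT w)" "y = conj2 P Q" and P': "det P' \<noteq> 0" "x' = conj2 P' (hT (3 * w))" "y' = conj2 P' Q'"
    and Q: "hecke.words n Q Q'" and cos: "cos w \<noteq> 0" "cos (3 * w) \<noteq> 0"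
    and coset: "\<And>R. R (mat 1) (mat 1) \<Longrightarrow> R (hT w) (hT (3 * w)) \<Longrightarrow> R Q Q' \<Longrightarrow> (\<And>A B. R A B \<Longrightarrow> R (- A) (- B)) \<Longrightarrow>
        (\<And>A B. R A B \<Longrightarrow> R (adj2 A) (adj2 B)) \<Longrightarrow> (\<And>A B A' B'. R A B \<Longrightarrow> R A' B' \<Longrightarrow> R (A ** A') (B ** B')) \<Longrightarrow>
        (\<forall>W W'. hecke.words n W W' \<longrightarrow> R W W' \<or> R (W ** hS) (W' ** hS)) \<and> R H H'"
    and H: "trace H > 2" "\<bar>trace H'\<bar> < 2" "H$2$1 \<noteq> 0"
  shows "\<exists>e1 e2 f1 f2 h1 h2 Cd. pair_group (unit_pairs U \<phi> \<phi>' S) e1 e2 f1 f2 h1 h2 Cd"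
proof -
  interpret hecke n by (rule hk)
  let ?G = "unit_pairs U \<phi> \<phi>' S"
  \<comment> \<open>One inclusion: every pair is a conjugated pair of words up to independent signs.
    It holds for the generators and is carried to all pairs by \<open>G_induct\<close>.\<close>
  define R where "R = (\<lambda>A B. \<exists>W W'. words W W' \<and> (A = conj2 P W \<or> A = - conj2 P W) \<and> (B = conj2 P' W' \<or> B = - conj2 P' W'))"
  have RI: "R A B" if "words W W'" "A = conj2 P W \<or> A = - conj2 P W" "B = conj2 P' W' \<or> B = - conj2 P' W'" for A B W W'
    using that unfolding R_def by blast
  have Rneg: "R (- A) B" "R A (- B)" if AB: "R A B" for A B
  proof -
    obtain W W' where h: "words W W'" "A = conj2 P W \<or> A = - conj2 P W" "B = conj2 P' W' \<or> B = - conj2 P' W'"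
      using AB unfolding R_def by blast
    show "R (- A) B" by (rule RI[OF h(1)]) (use h in auto)
    show "R A (- B)" by (rule RI[OF h(1)]) (use h in auto)
  qed
  have Radj: "R (adj2 A) (adj2 B)" if AB: "R A B" for A B
  proof -
    obtain W W' where h: "words W W'" "A = conj2 P W \<or> A = - conj2 P W" "B = conj2 P' W' \<or> B = - conj2 P' W'"
      using AB unfolding R_def by blast
    show ?thesis by (rule RI[OF words_adj2[OF h(1)]]) (use h in \<open>auto simp: adj2_uminus adj2_conj2 P P'\<close>)
  qed
  have Rmult: "R (A ** A') (B ** B')" if AB: "R A B" and AB': "R A' B'" for A B A' B'
  proof -
    obtain W W' where h: "words W W'" "A = conj2 P W \<or> A = - conj2 P W" "B = conj2 P' W' \<or> B = - conj2 P' W'"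
      using AB unfolding R_def by blast
    obtain V V' where h': "words V V'" "A' = conj2 P V \<or> A' = - conj2 P V" "B' = conj2 P' V' \<or> B' = - conj2 P' V'"
      using AB' unfolding R_def by blast
    have "A ** A' = conj2 P (W ** V) \<or> A ** A' = - conj2 P (W ** V)"
      using h(2) h'(2) by (auto simp: matrix_mult_minus conj2_mult[OF P(1)])
    moreover have "B ** B' = conj2 P' (W' ** V') \<or> B ** B' = - conj2 P' (W' ** V')"
      using h(3) h'(3) by (auto simp: matrix_mult_minus conj2_mult[OF P'(1)])
    ultimately show ?thesis using RI[OF words_mult[OF h(1) h'(1)]] by blast
  qed
  have Rone: "R (mat 1) (mat 1)" by (rule RI[OF words.one]) (auto simp: conj2_one P P')
  have Rx: "R x x'" by (rule RI[OF words_hT]) (auto simp: P P' w)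
  have Ry: "R y y'" by (rule RI[OF Q]) (auto simp: P(3) P'(3))
  have from_G: "\<exists>\<epsilon>\<in>U. psl (\<phi> \<epsilon>) = psl A \<and> R (\<phi> \<epsilon>) (\<phi>' \<epsilon>)" if AB: "(A, B) \<in> ?G" "R A B" for A B
  proof -
    obtain \<epsilon> where e: "\<epsilon> \<in> U" "psl (\<phi> \<epsilon>) \<in> S" "A = \<phi> \<epsilon> \<or> A = - \<phi> \<epsilon>" "B = \<phi>' \<epsilon> \<or> B = - \<phi>' \<epsilon>"
      using G_E[OF sub cover AB(1)] .
    have "R (\<phi> \<epsilon>) (\<phi>' \<epsilon>)" using e(3,4) AB(2) Rneg(1)[OF AB(2)] Rneg(2)[OF AB(2)] Rneg(2)[OF Rneg(1)[OF AB(2)]] by auto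
    moreover have "psl (\<phi> \<epsilon>) = psl A" using e(3) by (auto simp: psl_uminus)
    ultimately show ?thesis using e(1) by blast
  qed
  have xyG: "(adj2 (x ** y), adj2 (x' ** y')) \<in> ?G"
    by (intro G_inverse[OF sub cover] G_mult[OF sub cover] G)
  have gens: "\<exists>\<epsilon>\<in>U. psl (\<phi> \<epsilon>) = g \<and> R (\<phi> \<epsilon>) (\<phi>' \<epsilon>)" if "g \<in> {psl x, psl y, psl (adj2 (x ** y))}" for g
    using that from_G[OF G(1) Rx] from_G[OF G(2) Ry] from_G[OF xyG Radj[OF Rmult[OF Rx Ry]]] by auto
  have GR: "R A B" if "(A, B) \<in> ?G" for A B
    by (rule G_induct[OF sub cover gen gens Rneg Radj Rmult Rone that])
  \<comment> \<open>The other inclusion: this is membership in the group after conjugation, the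
    relation to which \<open>coset\<close> is applied.\<close>
  define W where "W = (\<lambda>A B. (conj2 P A, conj2 P' B) \<in> ?G)"
  have cs: "(\<forall>V V'. words V V' \<longrightarrow> W V V' \<or> W (V ** hS) (V' ** hS)) \<and> W H H'"
  proof (rule coset)
    show "W (mat 1) (mat 1)" using G_one[OF sub cover] by (simp add: W_def conj2_one P P')
    show "W (hT w) (hT (3 * w))" using G(1) by (simp add: W_def P(2) P'(2))
    show "W Q Q'" using G(2) by (simp add: W_def P(3) P'(3))
    show "W (- A) (- B)" if "W A B" for A B
      using G_uminus(1)[OF sub cover G_uminus(2)[OF sub cover that[unfolded W_def]]] by (simp add: W_def conj2_uminus)
    show "W (adj2 A) (adj2 B)" if "W A B" for A B
      using G_inverse[OF sub cover that[unfolded W_def]] by (simp add: W_def adj2_conj2 P P')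
    show "W (A ** A') (B ** B')" if "W A B" "W A' B'" for A B A' B'
      using G_mult[OF sub cover that[unfolded W_def]] by (simp add: W_def conj2_mult P P')
  qed
  show ?thesis
  proof (rule pair_group_of_conjugate[OF P(1) P'(1)])
    show "cos \<omega> \<noteq> 0" "cos (3 * \<omega>) \<noteq> 0" using cos by (simp_all add: w)
    show "\<exists>W W'. words W W' \<and> (A = conj2 P W \<or> A = - conj2 P W) \<and> (B = conj2 P' W' \<or> B = - conj2 P' W')" if "(A, B) \<in> ?G" for A B
      using GR[OF that] by (simp add: R_def)
    show "(mat 1, mat 1) \<in> ?G" by (rule G_one[OF sub cover])
    show "(A ** A', B ** B') \<in> ?G" if "(A, B) \<in> ?G" "(A', B') \<in> ?G" for A B A' B' by (rule G_mult[OF sub cover that])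
    show "(conj2 P (hT \<omega>), conj2 P' (hT (3 * \<omega>))) \<in> ?G" using G(1) by (simp add: P(2) P'(2) w)
    show "(conj2 P V, conj2 P' V') \<in> ?G \<or> (conj2 P (V ** hS), conj2 P' (V' ** hS)) \<in> ?G" if "words V V'" for V V'
      using cs that by (simp add: W_def)
    show "(conj2 P H, conj2 P' H') \<in> ?G" using cs by (simp add: W_def)
    show "trace H > 2" "\<bar>trace H'\<bar> < 2" "H$2$1 \<noteq> 0" by (rule H)+
    show "A = mat 1 \<or> A = - mat 1" if "(A, mat 1) \<in> ?G" for A by (rule G_faithful[OF sub cover that])
  qed
qed

end

section \<open>The two signatures\<close>

context conjugate_embeddings
begin

lemma det_unit_pairs:
  assumes "(A, B) \<in> unit_pairs U \<phi> \<phi>' S"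
  shows "det A = 1" "det B = 1"
proof -
  obtain \<epsilon> where "\<epsilon> \<in> U" "A = \<phi> \<epsilon> \<or> A = - \<phi> \<epsilon>" "B = \<phi>' \<epsilon> \<or> B = - \<phi>' \<epsilon>"
    using assms unfolding unit_pairs_def mem_psl_iff by blast
  then show "det A = 1" "det B = 1" using det_U[of \<epsilon>] by (auto simp: det_2)
qed

text \<open>After conjugation S is the whole Hecke group for n = 5, since U = T S is a product of
  the generators.\<close>

lemma pair_group_2_5_infinity:
  assumes x: "det x = 1" "trace x = 2" and y: "det y = 1" "trace y = 0" and xy: "trace (x ** y) = 2 * cos (pi / 5)"
    and gen: "S = generate PSL2R {psl x, psl y, psl (adj2 (x ** y))}"
    and cover: "S \<subseteq> (\<lambda>\<epsilon>. psl (\<phi> \<epsilon>)) ` U"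
  shows "\<exists>e1 e2 f1 f2 h1 h2 Cd. pair_group (unit_pairs U \<phi> \<phi>' S) e1 e2 f1 f2 h1 h2 Cd"
proof -
  obtain x' y' where sub: "subgroup S PSL2R"
    and G: "(x, x') \<in> unit_pairs U \<phi> \<phi>' S" "(y, y') \<in> unit_pairs U \<phi> \<phi>' S"
    and tr: "\<And>p q. p \<in> \<rat> \<Longrightarrow> q \<in> \<rat> \<Longrightarrow> trace x = p + q * sqrt 5 \<Longrightarrow> trace x' = p - q * sqrt 5"
      "\<And>p q. p \<in> \<rat> \<Longrightarrow> q \<in> \<rat> \<Longrightarrow> trace y = p + q * sqrt 5 \<Longrightarrow> trace y' = p - q * sqrt 5"
      "\<And>p q. p \<in> \<rat> \<Longrightarrow> q \<in> \<rat> \<Longrightarrow> trace (x ** y) = p + q * sqrt 5 \<Longrightarrow> trace (x' ** y') = p - q * sqrt 5"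
    by (rule generators_in_pairs[OF x(1) y(1) gen cover]) blast
  define w where "w = pi / 5"
  have hk: "hecke 5" by unfold_locales simp
  have w: "w = hecke.\<omega> 5" by (simp add: w_def hecke.\<omega>_def[OF hk])
  note c = cos_pi_fifths[folded w_def]
  have x': "trace x' = 2" using tr(1)[of 2 0] x by simp
  have y': "trace y' = 0" using tr(2)[of 0 0] y by simp
  have xy': "trace (x' ** y') = 2 * cos (3 * w)" using tr(3)[of "1 / 2" "1 / 2"] xy c by (simp add: w_def)
  obtain P where P: "det P \<noteq> 0" "x = conj2 P (hT w)" "y = conj2 P hS"
  proof (rule conjugate_to_normal_form[OF x y(1)])
    show "trace (mat2 1 (2 * cos w) 0 1 ** hS) = trace (x ** y)"
      by (simp add: hS_def mat2_mult xy w_def)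
  qed (use y in \<open>auto simp: hS_def hT_def\<close>)
  obtain P' where P': "det P' \<noteq> 0" "x' = conj2 P' (hT (3 * w))" "y' = conj2 P' hS"
  proof (rule conjugate_to_normal_form[OF det_unit_pairs(2)[OF G(1)] x' det_unit_pairs(2)[OF G(2)]])
    show "trace (mat2 1 (2 * cos (3 * w)) 0 1 ** hS) = trace (x' ** y')"
      by (simp add: hS_def mat2_mult xy')
  qed (use y' in \<open>auto simp: hS_def hT_def\<close>)
  \<comment> \<open>T T S will serve as h: its trace 4 cos w is 1 + sqrt 5 > 2, while the conjugate
    1 - sqrt 5 has absolute value below 2.\<close>
  have mid: "hT z ** (hT z ** hS) = mat2 (4 * cos z) (- 1) 1 0" for z
    by (simp add: hT_def hS_def mat2_mult)
  show ?thesis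
  proof (rule pair_group_of_normal_form[OF gen cover sub G hk w P P'])
    show "hecke.words 5 hS hS"
      using hecke.words.S[OF hk hecke.words.one[OF hk]] by simp
    show "cos w \<noteq> 0" "cos (3 * w) \<noteq> 0" using c sqrt5_bounds by auto
    show "trace (hT w ** (hT w ** hS)) > 2" "\<bar>trace (hT (3 * w) ** (hT (3 * w) ** hS))\<bar> < 2"
      "(hT w ** (hT w ** hS))$2$1 \<noteq> 0"
      unfolding mid using c sqrt5_bounds by (auto simp: abs_less_iff)
  next
    fix R :: "real^2^2 \<Rightarrow> real^2^2 \<Rightarrow> bool"
    assume R: "R (mat 1) (mat 1)" "R (hT w) (hT (3 * w))" "R hS hS"
      "\<And>A B A' B'. R A B \<Longrightarrow> R A' B' \<Longrightarrow> R (A ** A') (B ** B')"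
    have RU: "R (hU w) (hU (3 * w))" unfolding hU_eq by (rule R(4)[OF R(2,3)])
    have "R (mat 1 ** W) (mat 1 ** W')" if W: "hecke.words 5 W W'" for W W'
      by (rule hecke.words_right_closed[OF hk W])
        (simp_all add: w[symmetric] R(1) R(4)[OF _ RU] R(4)[OF _ R(3)])
    then show "(\<forall>W W'. hecke.words 5 W W' \<longrightarrow> R W W' \<or> R (W ** hS) (W' ** hS)) \<and>
        R (hT w ** (hT w ** hS)) (hT (3 * w) ** (hT (3 * w) ** hS))"
      using R by simp
  qed
qed

text \<open>The rotation of order 5 is the inverse square of U for n = 10. Its trace involves only 4
  cos^2 w, which lies in \<open>K\<close> although 2 cos w does not.\<close>

lemma pair_group_5_infinity_infinity:
  assumes x: "det x = 1" "trace x = 2" and y: "det y = 1" "trace y = 2 * cos (pi / 5)" and xy: "trace (x ** y) = - 2"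
    and gen: "S = generate PSL2R {psl x, psl y, psl (adj2 (x ** y))}"
    and cover: "S \<subseteq> (\<lambda>\<epsilon>. psl (\<phi> \<epsilon>)) ` U"
  shows "\<exists>e1 e2 f1 f2 h1 h2 Cd. pair_group (unit_pairs U \<phi> \<phi>' S) e1 e2 f1 f2 h1 h2 Cd"
proof -
  obtain x' y' where sub: "subgroup S PSL2R"
    and G: "(x, x') \<in> unit_pairs U \<phi> \<phi>' S" "(y, y') \<in> unit_pairs U \<phi> \<phi>' S"
    and tr: "\<And>p q. p \<in> \<rat> \<Longrightarrow> q \<in> \<rat> \<Longrightarrow> trace x = p + q * sqrt 5 \<Longrightarrow> trace x' = p - q * sqrt 5"
      "\<And>p q. p \<in> \<rat> \<Longrightarrow> q \<in> \<rat> \<Longrightarrow> trace y = p + q * sqrt 5 \<Longrightarrow> trace y' = p - q * sqrt 5"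
      "\<And>p q. p \<in> \<rat> \<Longrightarrow> q \<in> \<rat> \<Longrightarrow> trace (x ** y) = p + q * sqrt 5 \<Longrightarrow> trace (x' ** y') = p - q * sqrt 5"
    by (rule generators_in_pairs[OF x(1) y(1) gen cover]) blast
  define w where "w = pi / 10"
  have hk: "hecke 10" by unfold_locales simp
  have w: "w = hecke.\<omega> 10" by (simp add: w_def hecke.\<omega>_def[OF hk])
  have double: "4 * (cos z)\<^sup>2 = 2 + 2 * cos (2 * z)" for z :: real
    by (simp add: cos_double_cos)
  have c: "4 * (cos w)\<^sup>2 = 5 / 2 + 1 / 2 * sqrt 5" "4 * (cos (3 * w))\<^sup>2 = 5 / 2 - 1 / 2 * sqrt 5"
  proof -
    have e: "2 * w = pi / 5" "2 * (3 * w) = 3 * (pi / 5)" by (simp_all add: w_def)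
    show "4 * (cos w)\<^sup>2 = 5 / 2 + 1 / 2 * sqrt 5" "4 * (cos (3 * w))\<^sup>2 = 5 / 2 - 1 / 2 * sqrt 5"
      unfolding double e cos_pi_fifths by simp_all
  qed
  have nz: "cos w \<noteq> 0" "cos (3 * w) \<noteq> 0" using c sqrt5_bounds by auto
  have yt: "trace y = 1 / 2 + 1 / 2 * sqrt 5" using y(2) cos_pi_fifths(1) by simp
  have x': "trace x' = 2" using tr(1)[of 2 0] x by simp
  have y': "trace y' = 1 / 2 - 1 / 2 * sqrt 5" using tr(2)[of "1 / 2" "1 / 2"] yt by simp
  have xy': "trace (x' ** y') = - 2" using tr(3)[of "- 2" 0] xy by simp
  define Q where "Q = (\<lambda>z. adj2 (hU z ** hU z))"
  note Q = hU_inverse_square[folded Q_def]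
  have Q_eq: "Q = (\<lambda>x. mat2 (- 1) (2 * cos x) (- 2 * cos x) (4 * (cos x)\<^sup>2 - 1))"
    unfolding Q_def hU_inverse_square ..
  have Q_tr: "det (Q z) = 1" "trace (mat2 1 (2 * cos z) 0 1 ** Q z) = - 2" for z
    unfolding Q_eq mat2_mult by (simp_all add: power2_eq_square algebra_simps)
  obtain P where P: "det P \<noteq> 0" "x = conj2 P (hT w)" "y = conj2 P (Q w)"
  proof (rule conjugate_to_normal_form[OF x y(1)])
    show "\<bar>trace y\<bar> < 2" using yt sqrt5_bounds by simp
    show "trace (Q w) = trace y" unfolding yt Q_eq trace_mat2 c by simp
    show "Q w $2$1 \<noteq> 0" using nz by (simp add: Q_eq)
    show "trace (mat2 1 (2 * cos w) 0 1 ** Q w) = trace (x ** y)" by (simp only: Q_tr xy)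
  qed (auto simp: Q_tr hT_def)
  obtain P' where P': "det P' \<noteq> 0" "x' = conj2 P' (hT (3 * w))" "y' = conj2 P' (Q (3 * w))"
  proof (rule conjugate_to_normal_form[OF det_unit_pairs(2)[OF G(1)] x' det_unit_pairs(2)[OF G(2)]])
    show "\<bar>trace y'\<bar> < 2" using y' sqrt5_bounds by (simp add: abs_less_iff)
    show "trace (Q (3 * w)) = trace y'" unfolding y' Q_eq trace_mat2 c by simp
    show "Q (3 * w) $2$1 \<noteq> 0" using nz by (simp add: Q_eq)
    show "trace (mat2 1 (2 * cos (3 * w)) 0 1 ** Q (3 * w)) = trace (x' ** y')" by (simp only: Q_tr xy')
  qed (auto simp: Q_tr hT_def)
  \<comment> \<open>T U^2 will serve as h: its traces in the two factors are 3 + sqrt 5 and 3 - sqrt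
    5.\<close>
  have H_eq: "hT z ** adj2 (Q z) = mat2 (8 * (cos z)\<^sup>2 - 1) (- 4 * cos z) (2 * cos z) (- 1)" for z
    by (simp add: Q_eq adj2_def hT_def mat2_mult power2_eq_square)
  have SU: "hS ** hU z = adj2 (hT z) ** adj2 (Q z)" for z
    by (simp add: Q_eq adj2_def hT_def hS_def hU_def mat2_mult power2_eq_square)
  show ?thesis
  proof (rule pair_group_of_normal_form[OF gen cover sub G hk w P P'])
    show "hecke.words 10 (Q w) (Q (3 * w))"
      unfolding Q_def w
      using hecke.words_adj2[OF hk hecke.words_mult[OF hk hecke.words.U[OF hk hecke.words.one[OF hk]] hecke.words.U[OF hk hecke.words.one[OF hk]]]]
      by simp
    show "cos w \<noteq> 0" "cos (3 * w) \<noteq> 0" by (rule nz)+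
    show "trace (hT w ** adj2 (Q w)) > 2" "\<bar>trace (hT (3 * w) ** adj2 (Q (3 * w)))\<bar> < 2"
      "(hT w ** adj2 (Q w))$2$1 \<noteq> 0"
      unfolding H_eq using c sqrt5_bounds nz by (auto simp: abs_less_iff)
  next
    fix R :: "real^2^2 \<Rightarrow> real^2^2 \<Rightarrow> bool"
    assume R: "R (mat 1) (mat 1)" "R (hT w) (hT (3 * w))" "R (Q w) (Q (3 * w))"
      "\<And>A B. R A B \<Longrightarrow> R (- A) (- B)" "\<And>A B. R A B \<Longrightarrow> R (adj2 A) (adj2 B)"
      "\<And>A B A' B'. R A B \<Longrightarrow> R A' B' \<Longrightarrow> R (A ** A') (B ** B')"
    \<comment> \<open>Membership in the group or in its coset by S. It is preserved under right
      multiplication by S, and by U because U S = -T and S U = T^-1 U^2 belong to the group.\<close>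
    define D where "D = (\<lambda>A B. R A B \<or> R (A ** hS) (B ** hS))"
    have SS: "A ** hS ** hS = - A" for A :: "real^2^2"
      by (simp add: matrix_mul_assoc[symmetric] hS_hS matrix_mult_minus)
    have DS: "D (A ** hS) (B ** hS)" if D: "D A B" for A B
      using D R(4) unfolding D_def SS by blast
    have DU: "D (A ** hU w) (B ** hU (3 * w))" if D: "D A B" for A B
    proof -
      have "A ** hU z ** hS = - (A ** hT z)" for A :: "real^2^2" and z
        unfolding hU_eq matrix_mul_assoc SS ..
      moreover have "R (- (A ** hT w)) (- (B ** hT (3 * w)))" if "R A B" by (rule R(4)[OF R(6)[OF that R(2)]])
      moreover have "A ** hU z = - (A ** hS ** (adj2 (hT z) ** adj2 (Q z)))" for A :: "real^2^2" and z
        unfolding SU[symmetric] matrix_mul_assoc SS by (simp add: matrix_mult_minus)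
      moreover have "R (- (A ** hS ** (adj2 (hT w) ** adj2 (Q w)))) (- (B ** hS ** (adj2 (hT (3 * w)) ** adj2 (Q (3 * w)))))"
        if "R (A ** hS) (B ** hS)"
        by (rule R(4)[OF R(6)[OF that R(6)[OF R(5)[OF R(2)] R(5)[OF R(3)]]]])
      ultimately show ?thesis using D unfolding D_def by metis
    qed
    have "D (mat 1 ** W) (mat 1 ** W')" if W: "hecke.words 10 W W'" for W W'
      by (rule hecke.words_right_closed[OF hk W]) (use DS DU R(1) in \<open>auto simp: w D_def\<close>)
    moreover have "R (hT w ** adj2 (Q w)) (hT (3 * w) ** adj2 (Q (3 * w)))" by (rule R(6)[OF R(2) R(5)[OF R(3)]])
    ultimately show "(\<forall>W W'. hecke.words 10 W W' \<longrightarrow> R W W' \<or> R (W ** hS) (W' ** hS)) \<and>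
        R (hT w ** adj2 (Q w)) (hT (3 * w) ** adj2 (Q (3 * w)))"
      by (simp add: D_def)
  qed
qed

lemma pair_group_triangle:
  assumes tri: "triangle_group 2 5 \<infinity> S \<or> triangle_group 5 \<infinity> \<infinity> S"
    and cover: "S \<subseteq> (\<lambda>\<epsilon>. psl (\<phi> \<epsilon>)) ` U"
  shows "\<exists>e1 e2 f1 f2 h1 h2 Cd. pair_group (unit_pairs U \<phi> \<phi>' S) e1 e2 f1 f2 h1 h2 Cd"
proof -
  have sig: "signature_angle 2 = pi / 2" "signature_angle 5 = pi / 5" "signature_angle \<infinity> = 0"
    by (simp_all add: signature_angle_def numeral_eq_enat)
  have involution: "R ** R = mat 1" "adj2 R = - R" "det R = - 1" if R: "reflection_matrix R" for R
    using reflection_matrixD[OF R] R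
    by (auto simp: matrix_2_eq_iff matrix_2_mult adj2_def power2_eq_square algebra_simps reflection_matrix_def)
  have adj: "psl (adj2 (R ** R')) = psl (R' ** R)" if "reflection_matrix R" "reflection_matrix R'" for R R'
    using that by (simp add: adj2_mult involution matrix_mult_minus)
  \<comment> \<open>Consecutive rotations telescope because R' is an involution. The minus sign is
    there since R R' at the ideal vertex has trace -2, while the normal form asks for a parabolic of
    trace 2.\<close>
  have middle: "(- (R ** R')) ** (R' ** R'') = - (R ** R'')" if "reflection_matrix R'" for R R' R'' :: "real^2^2"
  proof -
    have "R ** R' ** (R' ** R'') = R ** (R' ** R') ** R''" by (simp only: matrix_mul_assoc)
    then show ?thesis by (simp add: matrix_mult_minus involution[OF that])
  qed
  have det_uminus: "det (- A) = det A" for A :: "real^2^2" by (simp add: det_2)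
  from tri show ?thesis
  proof
    assume "triangle_group 2 5 \<infinity> S"
    then obtain R1 R2 R3 where R: "reflection_matrix R1" "reflection_matrix R2" "reflection_matrix R3"
      and tr: "trace (R2 ** R3) = 0" "trace (R3 ** R1) = - 2 * cos (pi / 5)" "trace (R1 ** R2) = - 2"
      and gen: "S = generate PSL2R {psl (R1 ** R2), psl (R2 ** R3), psl (R3 ** R1)}"
      using triangle_group_traces[of 2 5 \<infinity> S] unfolding sig by auto
    show ?thesis
    proof (rule pair_group_2_5_infinity[OF _ _ _ _ _ _ cover])
      show "trace (- (R1 ** R2) ** (R2 ** R3)) = 2 * cos (pi / 5)"
        using tr(2) unfolding middle[OF R(2)] trace_uminus trace_mul_sym[of R1] by simp
      show "S = generate PSL2R {psl (- (R1 ** R2)), psl (R2 ** R3), psl (adj2 (- (R1 ** R2) ** (R2 ** R3)))}"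
        unfolding gen middle[OF R(2)] psl_uminus adj2_uminus adj[OF R(1,3)] ..
    qed (use tr R in \<open>simp_all add: det_uminus det_mul involution trace_uminus\<close>)
  next
    assume "triangle_group 5 \<infinity> \<infinity> S"
    then obtain R1 R2 R3 where R: "reflection_matrix R1" "reflection_matrix R2" "reflection_matrix R3"
      and tr: "trace (R2 ** R3) = - 2 * cos (pi / 5)" "trace (R3 ** R1) = - 2" "trace (R1 ** R2) = - 2"
      and gen: "S = generate PSL2R {psl (R1 ** R2), psl (R2 ** R3), psl (R3 ** R1)}"
      using triangle_group_traces[of 5 \<infinity> \<infinity> S] unfolding sig by auto
    have xy: "- (R1 ** R2) ** - (R2 ** R3) = R1 ** R3"
      using middle[OF R(2), of R1 R3] by (simp add: matrix_mult_minus)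
    show ?thesis
    proof (rule pair_group_5_infinity_infinity[OF _ _ _ _ _ _ cover])
      show "trace (- (R1 ** R2) ** - (R2 ** R3)) = - 2"
        using tr(2) unfolding xy trace_mul_sym[of R1] .
      show "S = generate PSL2R {psl (- (R1 ** R2)), psl (- (R2 ** R3)), psl (adj2 (- (R1 ** R2) ** - (R2 ** R3)))}"
        unfolding gen xy psl_uminus adj[OF R(1,3)] ..
    qed (use tr R in \<open>simp_all add: det_uminus det_mul involution trace_uminus\<close>)
  qed
qed

end

section \<open>The limit cone\<close>

lemma rp_point_scale: "t \<noteq> 0 \<Longrightarrow> rp_point (t * x) (t * y) = rp_point x y"
proof -
  have sub: "rp_point (s * u) (s * v) \<subseteq> rp_point u v" if "s \<noteq> 0" for s u v
  proof
    fix p assume "p \<in> rp_point (s * u) (s * v)"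
    then obtain r where "p = (r * (s * u), r * (s * v))" "r \<noteq> 0" unfolding rp_point_def by blast
    then have "p = ((r * s) * u, (r * s) * v)" "r * s \<noteq> 0" using that by auto
    then show "p \<in> rp_point u v" unfolding rp_point_def by blast
  qed
  assume t: "t \<noteq> 0"
  then show ?thesis using sub[of t x y] sub[of "1 / t" "t * x" "t * y"] by auto
qed

definition half_cone :: "(real \<times> real) set set" where
  "half_cone = {rp_point x\<^sub>1 x\<^sub>2 | x\<^sub>1 x\<^sub>2. x\<^sub>1 \<ge> x\<^sub>2 \<and> x\<^sub>2 \<ge> 0 \<and> x\<^sub>1 > 0}"

text \<open>The condition is invariant under all nonzero scalings, negative ones included, and its
  negation is visibly open.\<close>

lemma rp_point_half_cone_iff:
  assumes "(x, y) \<noteq> (0, 0)"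
  shows "rp_point x y \<in> half_cone \<longleftrightarrow> 0 \<le> x * y \<and> \<bar>y\<bar> \<le> \<bar>x\<bar>"
proof
  assume "rp_point x y \<in> half_cone"
  then obtain x1 x2 where h: "rp_point x y = rp_point x1 x2" "x1 \<ge> x2" "x2 \<ge> 0" "x1 > 0" unfolding half_cone_def by blast
  have "(x, y) \<in> rp_point x y" unfolding rp_point_def by (auto intro!: exI[of _ 1])
  then have "(x, y) \<in> rp_point x1 x2" by (simp only: h(1))
  then obtain t where "(x, y) = (t * x1, t * x2)" unfolding rp_point_def by blast
  then have "x = t * x1" "y = t * x2" by auto
  moreover have "0 \<le> t\<^sup>2 * (x1 * x2)" using h by simp
  then have "0 \<le> (t * x1) * (t * x2)" by (simp only: power2_eq_square mult.assoc mult.left_commute)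
  ultimately show "0 \<le> x * y \<and> \<bar>y\<bar> \<le> \<bar>x\<bar>" using h(2-4) by (auto simp: abs_mult intro: mult_left_mono)
next
  assume h: "0 \<le> x * y \<and> \<bar>y\<bar> \<le> \<bar>x\<bar>"
  then have nz: "x \<noteq> 0" using assms by auto
  have "rp_point (sgn x * x) (sgn x * y) = rp_point x y" using nz by (intro rp_point_scale) (simp add: sgn_zero_iff)
  moreover have "sgn x * x = \<bar>x\<bar>" "0 \<le> sgn x * y" "sgn x * y \<le> \<bar>x\<bar>"
    using h nz by (auto simp: sgn_if zero_le_mult_iff)
  ultimately show "rp_point x y \<in> half_cone" unfolding half_cone_def using nz by (smt (verit) mem_Collect_eq)
qed

lemma topspace_RP1: "topspace RP1_topology = RP1"
proof -
  have "{(x, y). (x, y) \<noteq> (0, 0) \<and> rp_point x y \<in> RP1} = - {(0, 0)}" by (auto simp: RP1_def)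
  then have "openin RP1_topology RP1" unfolding openin_RP1_topology by (simp add: open_Compl)
  moreover have "topspace RP1_topology \<subseteq> RP1" using openin_topspace[of RP1_topology] unfolding openin_RP1_topology by simp
  ultimately show ?thesis by (simp add: openin_subset subset_antisym)
qed

lemma closedin_half_cone: "closedin RP1_topology half_cone"
  unfolding closedin_def topspace_RP1 openin_RP1_topology
proof (intro conjI)
  show "half_cone \<subseteq> RP1" unfolding half_cone_def RP1_def by auto
  have "{(x, y). (x, y) \<noteq> (0, 0) \<and> rp_point x y \<in> RP1 - half_cone} =
    {p. fst p * snd p < 0} \<union> {p. \<bar>fst p\<bar> < \<bar>snd p\<bar>}" (is "?A = ?B")
  proof (rule Set.set_eqI)
    fix p :: "real \<times> real"
    obtain x y where p: "p = (x, y)" by (cases p)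
    show "p \<in> ?A \<longleftrightarrow> p \<in> ?B"
    proof (cases "(x, y) = (0, 0)")
      case False
      then have "rp_point x y \<in> RP1" unfolding RP1_def by blast
      then show ?thesis using rp_point_half_cone_iff[OF False] False by (auto simp: p)
    qed (simp add: p)
  qed
  moreover have "open ?B" by (intro open_Un open_Collect_less continuous_intros)
  ultimately show "open {(x, y). (x, y) \<noteq> (0, 0) \<and> rp_point x y \<in> RP1 - half_cone}" by simp
qed auto

context pair_group
begin

text \<open>A second component that is not hyperbolic has length 0, and a hyperbolic one forces the
  first to be hyperbolic and at least as long; so all directions lie in the closed half cone.
  Conversely the hyperbolic pairs of \<open>length_ratio_dense\<close> already have dense
  directions.\<close>

lemma limit_cone_eq: "limit_cone {(psl A, psl B) | A B. (A, B) \<in> G} = half_cone"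
proof -
  define D where "D = {translation_direction g | g. g \<in> {(psl A, psl B) | A B. (A, B) \<in> G} \<and> (hyperbolic_elt g \<or> mixed_elt g) \<and>
        (translation_length (fst g) \<noteq> 0 \<or> translation_length (snd g) \<noteq> 0)}"
  have "D \<subseteq> half_cone"
  proof
    fix d assume "d \<in> D"
    then obtain A B where AB: "(A, B) \<in> G" "d = rp_point (translation_length (psl A)) (translation_length (psl B))"
      "translation_length (psl A) \<noteq> 0 \<or> translation_length (psl B) \<noteq> 0"
      unfolding D_def translation_direction_def by auto
    note dets = conjunct1[OF det_G[OF AB(1)]] conjunct2[OF det_G[OF AB(1)]]
    note len = translation_length_psl[OF dets(1)] translation_length_psl[OF dets(2)]
    have A0: "translation_length (psl A) \<ge> 0"
      using len(1) translation_length_psl_0[of A] by (cases "\<bar>trace A\<bar> > 2") auto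
    have B: "0 \<le> translation_length (psl B)" "translation_length (psl B) \<le> translation_length (psl A)"
    proof -
      have "0 \<le> translation_length (psl B) \<and> translation_length (psl B) \<le> translation_length (psl A)"
      proof (cases "\<bar>trace B\<bar> > 2")
        case True
        have "\<bar>trace B\<bar> \<le> \<bar>trace A\<bar>" by (rule traces_le[OF AB(1) True])
        then have "\<not> arcosh (\<bar>trace A\<bar> / 2) < arcosh (\<bar>trace B\<bar> / 2)" "0 \<le> arcosh (\<bar>trace B\<bar> / 2)"
          using True by simp_all
        moreover have "\<bar>trace A\<bar> > 2" using True \<open>\<bar>trace B\<bar> \<le> \<bar>trace A\<bar>\<close> by linarith
        ultimately show ?thesis unfolding len(1)[OF \<open>\<bar>trace A\<bar> > 2\<close>] len(2)[OF True] by linarith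
      next
        case False
        then show ?thesis using translation_length_psl_0[of B] A0 by simp
      qed
      then show "0 \<le> translation_length (psl B)" "translation_length (psl B) \<le> translation_length (psl A)" by auto
    qed
    then show "d \<in> half_cone" unfolding half_cone_def AB(2) using AB(3) by (smt (verit) mem_Collect_eq)
  qed
  then have "RP1_topology closure_of D \<subseteq> half_cone" by (rule closure_of_minimal[OF _ closedin_half_cone])
  moreover have "half_cone \<subseteq> RP1_topology closure_of D"
  proof
    fix d assume d: "d \<in> half_cone"
    then obtain x1 x2 where x: "d = rp_point x1 x2" "x1 \<ge> x2" "x2 \<ge> 0" "x1 > 0" unfolding half_cone_def by blast
    define s where "s = x2 / x1"
    have s: "0 \<le> s" "s \<le> 1" using x by (auto simp: s_def)
    have ds: "d = rp_point 1 s" using rp_point_scale[of x1 1 s] x by (simp add: s_def)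
    show "d \<in> RP1_topology closure_of D"
      unfolding in_closure_of topspace_RP1
    proof (intro conjI allI impI)
      show "d \<in> RP1" using x(4) unfolding x(1) RP1_def by auto
      fix T assume T: "d \<in> T \<and> openin RP1_topology T"
      define O' where "O' = {(x, y). (x, y) \<noteq> (0, 0) \<and> rp_point x y \<in> T}"
      have "open O'" using T unfolding O'_def openin_RP1_topology by blast
      moreover have "(1, s) \<in> O'" using T by (simp add: O'_def ds)
      ultimately obtain e where e: "e > 0" "\<And>q. dist q (1, s) < e \<Longrightarrow> q \<in> O'" unfolding open_dist by blast
      define m where "m = min e 1"
      have m: "0 < m" "m \<le> 1" "m \<le> e" using e by (auto simp: m_def)
      \<comment> \<open>Pulls s from the closed into the open unit interval and moves it by at most
        m / 2: the term m / 8 lifts the end 0, and s m / 2 lowers the end 1.\<close>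
      define s' where "s' = s + m / 8 - s * (m / 2)"
      have sm: "0 \<le> s * (m / 2)" "s * (m / 2) \<le> m / 2" using s m by (auto intro: mult_left_le_one_le)
      have "s * (m / 2) \<le> s * (1 / 2)" using s m by (intro mult_left_mono) auto
      then have s'_pos: "0 < s'" using s m unfolding s'_def by linarith
      have "(1 - s) * (1 - m / 2) \<ge> 0" using s m by simp
      then have "s' \<le> 1 - m / 2 + m / 8" unfolding s'_def by (simp add: field_simps)
      then have s'_less: "s' < 1" using m by linarith
      have close: "\<bar>s' - s\<bar> \<le> m / 2" using sm m unfolding s'_def by linarith
      obtain A B where AB: "(A, B) \<in> G" "\<bar>trace A\<bar> > 2" "\<bar>trace B\<bar> > 2"
        "\<bar>arcosh (\<bar>trace B\<bar> / 2) / arcosh (\<bar>trace A\<bar> / 2) - s'\<bar> < m / 2"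
        using length_ratio_dense[OF s'_pos s'_less, of "m / 2"] m by auto
      define r where "r = arcosh (\<bar>trace B\<bar> / 2) / arcosh (\<bar>trace A\<bar> / 2)"
      have lA: "arcosh (\<bar>trace A\<bar> / 2) > 0" using AB(2) by simp
      have len: "translation_length (psl A) = 2 * arcosh (\<bar>trace A\<bar> / 2)" "translation_length (psl B) = 2 * arcosh (\<bar>trace B\<bar> / 2)"
        by (rule translation_length_psl[OF conjunct1[OF det_G[OF AB(1)]] AB(2)], rule translation_length_psl[OF conjunct2[OF det_G[OF AB(1)]] AB(3)])
      have "\<bar>r - s\<bar> < e" using close AB(4) m unfolding r_def by linarith
      then have "dist (1, r) (1, s) < e" by (simp add: dist_prod_def dist_real_def)
      then have "(1, r) \<in> O'" by (rule e(2))
      then have "rp_point 1 r \<in> T" by (simp add: O'_def)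
      moreover have "rp_point 1 r = translation_direction (psl A, psl B)"
        using rp_point_scale[of "2 * arcosh (\<bar>trace A\<bar> / 2)" 1 r] lA unfolding translation_direction_def fst_conv snd_conv len r_def by simp
      moreover have "translation_direction (psl A, psl B) \<in> D"
      proof -
        have "hyperbolic_elt (psl A, psl B)" unfolding hyperbolic_elt_def fst_conv snd_conv hyperbolic_psl_iff using AB by simp
        moreover have "translation_length (psl A) \<noteq> 0" using lA unfolding len by linarith
        ultimately show ?thesis unfolding D_def using AB(1) by force
      qed
      ultimately show "\<exists>y. y \<in> D \<and> y \<in> T" by auto
    qed
  qed
  ultimately show ?thesis unfolding limit_cone_def D_def by (rule subset_antisym)
qed

lemma orbit_eq: "orbit {(psl A, psl B) | A B. (A, B) \<in> G} x = pair_orbit G x"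
proof -
  have "{(psl_act (fst g) (fst x), psl_act (snd g) (snd x)) | g. g \<in> {(psl A, psl B) | A B. (A, B) \<in> G}} =
      {(psl_act (psl A) (fst x), psl_act (psl B) (snd x)) | A B. (A, B) \<in> G}" by force
  then show ?thesis unfolding orbit_def pair_orbit_def psl_act_psl .
qed

end

theorem mainTheorem3:
  fixes S :: "(real^2^2) set set"
    and a b :: real
    and \<O> :: "quat set"
    and \<phi>\<^sub>1 \<phi>\<^sub>2 :: "quat \<Rightarrow> real^2^2"
  assumes "triangle_group 2 5 \<infinity> S \<or> triangle_group 5 \<infinity> \<infinity> S"
    and "a \<in> K" "a \<noteq> 0" "b \<in> K" "b \<noteq> 0" "isomorphic_M2K a b"
    and "quat_order a b \<O>"
    and "quat_embedding a b (\<lambda>k. k) \<phi>\<^sub>1"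
    and "quat_embedding a b galois \<phi>\<^sub>2"
    and "S \<subseteq> (\<lambda>\<epsilon>. psl (\<phi>\<^sub>1 \<epsilon>)) ` norm_one_units a b \<O>"
  shows "limit_cone (S_star (norm_one_units a b \<O>) \<phi>\<^sub>1 \<phi>\<^sub>2 S) =
           {rp_point x\<^sub>1 x\<^sub>2 | x\<^sub>1 x\<^sub>2. x\<^sub>1 \<ge> x\<^sub>2 \<and> x\<^sub>2 \<ge> 0 \<and> x\<^sub>1 > 0} \<and>
         (\<forall>x\<in>HH. limit_set (S_star (norm_one_units a b \<O>) \<phi>\<^sub>1 \<phi>\<^sub>2 S) x =
           {ray_class \<gamma> | \<gamma>. unit_ray \<gamma> \<and>
              (\<forall>t\<ge>0. hspeed (fst \<circ> \<gamma>) t \<ge> hspeed (snd \<circ> \<gamma>) t)})"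
proof -
  interpret conjugate_embeddings a b \<O> \<phi>\<^sub>1 \<phi>\<^sub>2 by unfold_locales (use assms in auto)
  let ?G = "unit_pairs (norm_one_units a b \<O>) \<phi>\<^sub>1 \<phi>\<^sub>2 S"
  obtain e1 e2 f1 f2 h1 h2 Cd where "pair_group ?G e1 e2 f1 f2 h1 h2 Cd"
    using pair_group_triangle[OF assms(1)] assms(10) unfolding U_def by blast
  then interpret pair_group ?G e1 e2 f1 f2 h1 h2 Cd .
  have "limit_cone (S_star (norm_one_units a b \<O>) \<phi>\<^sub>1 \<phi>\<^sub>2 S) = half_cone"
    unfolding S_star_eq by (rule limit_cone_eq)
  moreover have "limit_set (S_star (norm_one_units a b \<O>) \<phi>\<^sub>1 \<phi>\<^sub>2 S) x =
      {ray_class \<gamma> | \<gamma>. unit_ray \<gamma> \<and> (\<forall>t\<ge>0. hspeed (fst \<circ> \<gamma>) t \<ge> hspeed (snd \<circ> \<gamma>) t)}" if x: "x \<in> HH" for x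
    unfolding limit_set_def S_star_eq orbit_eq limit_classes[OF x] ray_class_speed_set ..
  ultimately show ?thesis unfolding half_cone_def by blast
qed

end
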